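(* Assume that there is $\gamma>0$ such that $x\cdot n_G\ge\gamma$ on $\partial G$ and $x\cdot n_\Omega\ge0$ on $\partial\Omega$, where $n_G,n_\Omega$ are the outer unit normals of $G$ and $\Omega$. Assume moreover that $a_{\mathrm{eff}}|_{G\setminus\overline\Omega}-a_{\mathrm{eff}}|_\Omega$ (i.e. $I-a_{\mathrm{eff}}|_\Omega$) is negative semi-definite. Let $f\in L^2(G)$, $g\in H^{1/2}(\partial G)$ and let $u\in H^1(G)$ solve \[\int_G a_{\mathrm{eff}}\nabla u\cdot\nabla\psi^*-k^2\mu_{\mathrm{eff}}u\psi^*\,dx-ik\int_{\partial G}u\psi^*\,d\sigma=\int_Gf\psi^*\,dx+\int_{\partial G}g\psi^*\,d\sigma\quad\forall\psi\in H^1(G).\] Then there is $C_{\mathrm{stab},0}>0$ depending only on the geometry, the parameters and $k_0$ (not on $k$) such that \[\|u\|_{1,k,G}\le C_{\mathrm{stab},0}\bigl(k^3\|f\|_{L^2(G\setminus\overline\Omega)}+k^2\|f\|_{L^2(\Omega)}+k^{3/2}\|g\|_{L^2(\partial G)}+k^{-1}\|g\|_{H^{1/2}(\partial G)}\bigr).\]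
   Context: $\Omega\subset\subset G\subset\mathbb R^2$ bounded domains, $\partial\Omega$ of class $C^2$, $G$ convex with polygonal Lipschitz boundary; $x$ denotes the position vector. $Y=[-\frac12,\frac12)^2$, $D\subset\subset Y$ connected with $C^2$ boundary, $Y^*=Y\setminus\overline D$ (connected), $\chi_D$ the indicator of $D$, $\mathbf e_j$ unit vectors. $\varepsilon_e>0$, $\varepsilon_i\in\mathbb C$ with $\Re\varepsilon_i>0,\Im\varepsilon_i>0$; $k\ge k_0>0$, $k_0$ fixed. $v^*$ is the complex conjugate; $\|v\|^2_{1,k,G}:=\|\nabla v\|^2_{L^2(G)}+k^2\|v\|^2_{L^2(G)}$. Effective parameters: $a_{\mathrm{eff}}=I$, $\mu_{\mathrm{eff}}=1$ on $G\setminus\overline\Omega$; on $\Omega$ they are the constants $(a_{\mathrm{eff}})_{jl}=\int_{Y^*}\varepsilon_e^{-1}(\mathbf e_j+\nabla_yw_j)\cdot(\mathbf e_l+\nabla_yw_l^* )\,dy$ and $\mu_{\mathrm{eff}}=\int_Y(1+k^2w\chi_D)\,dy$, where $w_j$ ($j=1,2$) is the $Y$-periodic zero-mean $H^1$ function on $Y^*$ solving $\int_{Y^*}\varepsilon_e^{-1}(\mathbf e_j+\nabla_yw_j)\cdot\nabla_y\psi^*\,dy=0$ for all such $\psi$, and $w\in H^1_0(D)$ solves $\int_D\varepsilon_i^{-1}\nabla_yw\cdot\nabla_y\psi^*-k^2w\psi^*\,dy=\int_D\psi^*\,dy$ for all $\psi\in H^1_0(D)$ (extended by zero to $Y$). 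*)

theory Defs
  imports "HOL-Analysis.Analysis"
begin

type_synonym R2 = "real^2"

definition pd :: "(R2 \<Rightarrow> 'a::real_normed_vector) \<Rightarrow> 2 \<Rightarrow> R2 \<Rightarrow> 'a" where
  "pd \<phi> j x = vector_derivative (\<lambda>t. \<phi> (x + t *\<^sub>R axis j 1)) (at 0)"

fun pds :: "2 list \<Rightarrow> (R2 \<Rightarrow> 'a::real_normed_vector) \<Rightarrow> R2 \<Rightarrow> 'a" where
  "pds [] \<phi> = \<phi>"
| "pds (j # js) \<phi> = pd (pds js \<phi>) j"

definition Ck_on :: "nat \<Rightarrow> R2 set \<Rightarrow> (R2 \<Rightarrow> 'a::real_normed_vector) \<Rightarrow> bool" where
  "Ck_on k V \<phi> \<longleftrightarrow>
     (\<forall>js. length js \<le> k \<longrightarrow> continuous_on V (pds js \<phi>)) \<and>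
     (\<forall>js. length js < k \<longrightarrow> (\<forall>j. \<forall>x\<in>V.
        ((\<lambda>t. pds js \<phi> (x + t *\<^sub>R axis j 1)) has_vector_derivative pds (j # js) \<phi> x) (at 0)))"

definition smooth :: "(R2 \<Rightarrow> 'a::real_normed_vector) \<Rightarrow> bool" where
  "smooth \<phi> \<longleftrightarrow> (\<forall>k. Ck_on k UNIV \<phi>)"

definition tsupp :: "(R2 \<Rightarrow> complex) \<Rightarrow> R2 set" where
  "tsupp \<phi> = closure {x. \<phi> x \<noteq> 0}"

definition test_fn :: "R2 set \<Rightarrow> (R2 \<Rightarrow> complex) \<Rightarrow> bool" where
  "test_fn U \<phi> \<longleftrightarrow> smooth \<phi> \<and> compact (tsupp \<phi>) \<and> tsupp \<phi> \<subseteq> U"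

definition L2 :: "R2 set \<Rightarrow> (R2 \<Rightarrow> complex) \<Rightarrow> bool" where
  "L2 U f \<longleftrightarrow> f \<in> borel_measurable (lebesgue_on U) \<and>
               integrable (lebesgue_on U) (\<lambda>x. (cmod (f x))\<^sup>2)"

definition L2norm :: "R2 set \<Rightarrow> (R2 \<Rightarrow> complex) \<Rightarrow> real" where
  "L2norm U f = sqrt (LINT x|lebesgue_on U. (cmod (f x))\<^sup>2)"

definition weak_grad :: "R2 set \<Rightarrow> (R2 \<Rightarrow> complex) \<Rightarrow> (2 \<Rightarrow> R2 \<Rightarrow> complex) \<Rightarrow> bool" where
  "weak_grad U u v \<longleftrightarrow> (\<forall>j. L2 U (v j)) \<and>
     (\<forall>\<phi> j. test_fn U \<phi> \<longrightarrow>
        (LINT x|lebesgue_on U. u x * pd \<phi> j x) = - (LINT x|lebesgue_on U. v j x * \<phi> x))"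

definition H1 :: "R2 set \<Rightarrow> (R2 \<Rightarrow> complex) \<Rightarrow> bool" where
  "H1 U u \<longleftrightarrow> L2 U u \<and> (\<exists>v. weak_grad U u v)"

definition grad :: "R2 set \<Rightarrow> (R2 \<Rightarrow> complex) \<Rightarrow> 2 \<Rightarrow> R2 \<Rightarrow> complex" where
  "grad U u = (SOME v. weak_grad U u v)"

definition H1dist :: "R2 set \<Rightarrow> (R2 \<Rightarrow> complex) \<Rightarrow> (R2 \<Rightarrow> complex) \<Rightarrow> real" where
  "H1dist U u v = sqrt ((L2norm U (\<lambda>x. u x - v x))\<^sup>2 +
      (\<Sum>j\<in>UNIV. (L2norm U (\<lambda>x. grad U u j x - grad U v j x))\<^sup>2))"

definition H10 :: "R2 set \<Rightarrow> (R2 \<Rightarrow> complex) \<Rightarrow> bool" where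
  "H10 U u \<longleftrightarrow> H1 U u \<and>
     (\<exists>\<phi>s. (\<forall>n. test_fn U (\<phi>s n)) \<and> (\<lambda>n. H1dist U u (\<phi>s n)) \<longlonglongrightarrow> 0)"

definition norm1k :: "R2 set \<Rightarrow> real \<Rightarrow> (R2 \<Rightarrow> complex) \<Rightarrow> real" where
  "norm1k U k u = sqrt ((\<Sum>j\<in>UNIV. (L2norm U (grad U u j))\<^sup>2) + k\<^sup>2 * (L2norm U u)\<^sup>2)"

definition vtx :: "R2 list \<Rightarrow> nat \<Rightarrow> R2" where
  "vtx vs i = vs ! (i mod length vs)"

definition edge :: "R2 list \<Rightarrow> nat \<Rightarrow> real \<Rightarrow> R2" where
  "edge vs i t = vtx vs i + t *\<^sub>R (vtx vs (Suc i) - vtx vs i)"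

definition elen :: "R2 list \<Rightarrow> nat \<Rightarrow> real" where
  "elen vs i = dist (vtx vs i) (vtx vs (Suc i))"

definition convex_polygon :: "R2 set \<Rightarrow> R2 list \<Rightarrow> bool" where
  "convex_polygon G vs \<longleftrightarrow> length vs \<ge> 3 \<and> distinct vs \<and>
     G = interior (convex hull (set vs)) \<and>
     (\<forall>v\<in>set vs. v extreme_point_of (convex hull (set vs))) \<and>
     frontier G = (\<Union>i<length vs. closed_segment (vtx vs i) (vtx vs (Suc i)))"

definition bL2 :: "R2 list \<Rightarrow> (R2 \<Rightarrow> complex) \<Rightarrow> bool" where
  "bL2 vs h \<longleftrightarrow> (\<forall>i<length vs.
      (\<lambda>t. h (edge vs i t)) \<in> borel_measurable (lebesgue_on {0..1}) \<and>
      integrable (lebesgue_on {0..1}) (\<lambda>t. (cmod (h (edge vs i t)))\<^sup>2))"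

definition bint :: "R2 list \<Rightarrow> (R2 \<Rightarrow> complex) \<Rightarrow> complex" where
  "bint vs h = (\<Sum>i<length vs. elen vs i *\<^sub>R (LINT t|lebesgue_on {0..1}. h (edge vs i t)))"

definition bL2norm :: "R2 list \<Rightarrow> (R2 \<Rightarrow> complex) \<Rightarrow> real" where
  "bL2norm vs h = sqrt (\<Sum>i<length vs.
      elen vs i * (LINT t|lebesgue_on {0..1}. (cmod (h (edge vs i t)))\<^sup>2))"

text \<open>Slobodeckij (Gagliardo) seminorm squared of H^{1/2} on the 1-dimensional boundary.\<close>
definition semi12 :: "R2 list \<Rightarrow> (R2 \<Rightarrow> complex) \<Rightarrow> ennreal" where
  "semi12 vs h = (\<Sum>i<length vs. \<Sum>j<length vs. ennreal (elen vs i * elen vs j) *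
     (\<integral>\<^sup>+ p\<in>{0..1}\<times>{0..1}.
        ennreal ((cmod (h (edge vs i (fst p)) - h (edge vs j (snd p))))\<^sup>2
                 / (norm (edge vs i (fst p) - edge vs j (snd p)))\<^sup>2)
      \<partial>(lborel \<Otimes>\<^sub>M lborel)))"

definition H12 :: "R2 list \<Rightarrow> (R2 \<Rightarrow> complex) \<Rightarrow> bool" where
  "H12 vs h \<longleftrightarrow> bL2 vs h \<and> semi12 vs h < \<infinity>"

definition H12norm :: "R2 list \<Rightarrow> (R2 \<Rightarrow> complex) \<Rightarrow> real" where
  "H12norm vs h = sqrt ((bL2norm vs h)\<^sup>2 + enn2real (semi12 vs h))"

definition is_trace :: "R2 set \<Rightarrow> R2 list \<Rightarrow> (R2 \<Rightarrow> complex) \<Rightarrow> (R2 \<Rightarrow> complex) \<Rightarrow> bool" where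
  "is_trace G vs u h \<longleftrightarrow> H1 G u \<and> bL2 vs h \<and>
     (\<exists>un. (\<forall>n. smooth (un n)) \<and> (\<lambda>n. H1dist G u (un n)) \<longlonglongrightarrow> 0 \<and>
            (\<lambda>n. bL2norm vs (\<lambda>x. un n x - h x)) \<longlonglongrightarrow> 0)"

definition rgrad :: "(R2 \<Rightarrow> real) \<Rightarrow> R2 \<Rightarrow> R2" where
  "rgrad \<phi> x = (\<chi> j. pd \<phi> j x)"

definition C2_boundary :: "R2 set \<Rightarrow> bool" where
  "C2_boundary U \<longleftrightarrow> (\<forall>p\<in>frontier U. \<exists>r>0. \<exists>\<phi>::R2 \<Rightarrow> real.
     Ck_on 2 (ball p r) \<phi> \<and> (\<forall>x\<in>ball p r. rgrad \<phi> x \<noteq> 0) \<and>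
     U \<inter> ball p r = {x\<in>ball p r. \<phi> x < 0})"

definition outer_normal :: "R2 set \<Rightarrow> R2 \<Rightarrow> R2 \<Rightarrow> bool" where
  "outer_normal U p n \<longleftrightarrow> p \<in> frontier U \<and> (\<exists>r>0. \<exists>\<phi>::R2 \<Rightarrow> real.
     Ck_on 1 (ball p r) \<phi> \<and> rgrad \<phi> p \<noteq> 0 \<and>
     U \<inter> ball p r = {x\<in>ball p r. \<phi> x < 0} \<and>
     n = (1 / norm (rgrad \<phi> p)) *\<^sub>R rgrad \<phi> p)"

definition Ycell :: "R2 set" where
  "Ycell = {x. \<forall>j. -(1/2) \<le> x $ j \<and> x $ j < 1/2}"

definition Zlat :: "R2 set" where
  "Zlat = {z. \<forall>j. z $ j \<in> \<int>}"

definition Ystar :: "R2 set \<Rightarrow> R2 set" where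
  "Ystar D = Ycell - closure D"

definition Yper :: "R2 set \<Rightarrow> R2 set" where
  "Yper D = - (\<Union>z\<in>Zlat. (\<lambda>y. z + y) ` closure D)"

definition Hper :: "R2 set \<Rightarrow> (R2 \<Rightarrow> complex) \<Rightarrow> bool" where
  "Hper D w \<longleftrightarrow> (\<forall>x. \<forall>z\<in>Zlat. w (x + z) = w x) \<and> (\<forall>r>0. H1 (Yper D \<inter> ball 0 r) w)"

definition gradY :: "R2 set \<Rightarrow> (R2 \<Rightarrow> complex) \<Rightarrow> 2 \<Rightarrow> R2 \<Rightarrow> complex" where
  "gradY D w = grad (Yper D \<inter> ball 0 1) w"

definition kd :: "2 \<Rightarrow> 2 \<Rightarrow> complex" where
  "kd j l = (if j = l then 1 else 0)"

definition cell_corrector :: "R2 set \<Rightarrow> real \<Rightarrow> 2 \<Rightarrow> (R2 \<Rightarrow> complex) \<Rightarrow> bool" where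
  "cell_corrector D \<epsilon>e j wj \<longleftrightarrow> Hper D wj \<and> (LINT y|lebesgue_on (Ystar D). wj y) = 0 \<and>
     (\<forall>\<psi>. Hper D \<psi> \<and> (LINT y|lebesgue_on (Ystar D). \<psi> y) = 0 \<longrightarrow>
        (LINT y|lebesgue_on (Ystar D). complex_of_real (1 / \<epsilon>e) *
            (\<Sum>l\<in>UNIV. (kd j l + gradY D wj l y) * cnj (gradY D \<psi> l y))) = 0)"

definition cell_w :: "R2 set \<Rightarrow> complex \<Rightarrow> real \<Rightarrow> (R2 \<Rightarrow> complex) \<Rightarrow> bool" where
  "cell_w D \<epsilon>i k w \<longleftrightarrow> H10 D w \<and>
     (\<forall>\<psi>. H10 D \<psi> \<longrightarrow>
        (LINT y|lebesgue_on D. (1 / \<epsilon>i) * (\<Sum>l\<in>UNIV. grad D w l y * cnj (grad D \<psi> l y))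
                              - complex_of_real (k\<^sup>2) * w y * cnj (\<psi> y))
        = (LINT y|lebesgue_on D. cnj (\<psi> y)))"

definition a_eff :: "R2 set \<Rightarrow> real \<Rightarrow> (2 \<Rightarrow> R2 \<Rightarrow> complex) \<Rightarrow> 2 \<Rightarrow> 2 \<Rightarrow> complex" where
  "a_eff D \<epsilon>e wc j l = (LINT y|lebesgue_on (Ystar D). complex_of_real (1 / \<epsilon>e) *
      (\<Sum>m\<in>UNIV. (kd j m + gradY D (wc j) m y) * (kd l m + cnj (gradY D (wc l) m y))))"

text \<open>w is extended by zero outside D, hence the indicator.\<close>
definition mu_eff :: "R2 set \<Rightarrow> real \<Rightarrow> (R2 \<Rightarrow> complex) \<Rightarrow> complex" where
  "mu_eff D k w = (LINT y|lebesgue_on Ycell. 1 + complex_of_real (k\<^sup>2) * w y * indicator D y)"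

text \<open>Negative semi-definiteness of a (real symmetric) 2x2 matrix.\<close>
definition neg_semidef :: "(2 \<Rightarrow> 2 \<Rightarrow> complex) \<Rightarrow> bool" where
  "neg_semidef M \<longleftrightarrow> (\<forall>\<xi>::R2. Re (\<Sum>j\<in>UNIV. \<Sum>l\<in>UNIV.
       complex_of_real (\<xi> $ j) * M j l * complex_of_real (\<xi> $ l)) \<le> 0)"

definition Acoef :: "R2 set \<Rightarrow> (2 \<Rightarrow> 2 \<Rightarrow> complex) \<Rightarrow> R2 \<Rightarrow> 2 \<Rightarrow> 2 \<Rightarrow> complex" where
  "Acoef \<Omega> a x = (if x \<in> \<Omega> then a else kd)"

definition mucoef :: "R2 set \<Rightarrow> complex \<Rightarrow> R2 \<Rightarrow> complex" where
  "mucoef \<Omega> \<mu> x = (if x \<in> \<Omega> then \<mu> else 1)"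

definition weak_sol :: "R2 set \<Rightarrow> R2 list \<Rightarrow> R2 set \<Rightarrow> (2 \<Rightarrow> 2 \<Rightarrow> complex) \<Rightarrow> complex \<Rightarrow> real
     \<Rightarrow> (R2 \<Rightarrow> complex) \<Rightarrow> (R2 \<Rightarrow> complex) \<Rightarrow> (R2 \<Rightarrow> complex) \<Rightarrow> bool" where
  "weak_sol G vs \<Omega> a \<mu> k f g u \<longleftrightarrow> H1 G u \<and>
     (\<forall>\<psi> tu t\<psi>. H1 G \<psi> \<longrightarrow> is_trace G vs u tu \<longrightarrow> is_trace G vs \<psi> t\<psi> \<longrightarrow>
        (LINT x|lebesgue_on G.
            (\<Sum>j\<in>UNIV. (\<Sum>l\<in>UNIV. Acoef \<Omega> a x j l * grad G u l x) * cnj (grad G \<psi> j x))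
            - complex_of_real (k\<^sup>2) * mucoef \<Omega> \<mu> x * u x * cnj (\<psi> x))
        - \<i> * complex_of_real k * bint vs (\<lambda>x. tu x * cnj (t\<psi> x))
        = (LINT x|lebesgue_on G. f x * cnj (\<psi> x)) + bint vs (\<lambda>x. g x * cnj (t\<psi> x)))"

end

theory Submission
  imports Defs
begin

text \<open>Rellich's identity is obtained without any regularity of the solution: instead of \<open>x \<bullet> \<nabla>u\<close> one tests
  with \<open>u - u\<^sub>t\<close>, \<open>u\<^sub>t x = u (t x)\<close>, divides by \<open>1 - t\<close> and lets \<open>t\<close> tend to \<open>1\<close>. Since \<open>\<Omega>\<close> is star-shaped
  and \<open>a\<^sub>e\<^sub>f\<^sub>f \<ge> I\<close> there, the energy density decreases along rays when the inclusion is left, so the interface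
  contributes with the good sign, and the flux through \<open>\<partial>G\<close> is absorbed thanks to \<open>x \<bullet> n \<ge> \<gamma>\<close>. This bounds \<open>u\<close> outside
  \<open>\<Omega>\<close> by the trace, the gradient and \<open>u\<close> inside \<open>\<Omega>\<close>. The imaginary part of the energy identity bounds the
  trace and \<open>u\<close> inside \<open>\<Omega>\<close>, because \<open>Im \<mu>\<^sub>e\<^sub>f\<^sub>f \<ge> c / k\<^sup>2\<close>; the real part bounds the gradient.\<close>

section \<open>Square-integrable functions\<close>

text \<open>Without regularity there is no boundary integral of the gradient. Its substitute is the
  energy \<open>E t\<close> in the shell \<open>G - t G\<close>, for which no rate in
  \<open>1 - t\<close> is known: half of it stands on the good side, the squared boundary values of
  the test function are O(1 - t) times it, and so it can be absorbed before dividing by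
  \<open>1 - t\<close>. The powers of \<open>k\<close> stem from the weak damping. The imaginary
  part of the energy identity controls the norm of \<open>u\<close> in \<Omega> without a power of
  \<open>k\<close>, whereas the Rellich estimate contains its product with \<open>k\<^sup>2\<close>
  and the gradient. Hence \<open>k ^ 4\<close> times the squared inner norm must be bounded, which
  costs \<open>k ^ 4\<close> for \<open>f\<close> in \<Omega>, \<open>k ^ 3\<close> for
  \<open>g\<close>, and \<open>k ^ 4\<close> for the product of \<open>f\<close> and
  \<open>u\<close> outside; absorbing the outer \<open>u\<close> turns the latter into
  \<open>k ^ 6\<close> times the square of \<open>f\<close>. Square roots give the exponents of the
  theorem. The weak formulation is quantified over traces, so it has no content before some trace of
  \<open>u\<close> is known to exist.\<close>

definition sqi :: "'a measure \<Rightarrow> ('a \<Rightarrow> complex) \<Rightarrow> bool" where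
  "sqi M f \<longleftrightarrow> f \<in> borel_measurable M \<and> integrable M (\<lambda>x. (cmod (f x))\<^sup>2)"

text \<open>An arbitrary measure, because the same calculus is applied to
  \<open>lebesgue_on U\<close>, to \<open>lborel\<close> (where Tonelli and substitution live) and
  to the parameter interval of an edge.\<close>

definition nrm2 :: "'a measure \<Rightarrow> ('a \<Rightarrow> complex) \<Rightarrow> real" where
  "nrm2 M f = sqrt (LINT x|M. (cmod (f x))\<^sup>2)"

lemma L2_sqi: "L2 U f \<longleftrightarrow> sqi (lebesgue_on U) f"
  by (simp add: L2_def sqi_def)

lemma L2norm_nrm2: "L2norm U f = nrm2 (lebesgue_on U) f"
  by (simp add: L2norm_def nrm2_def)

lemma sqi_measurable: "sqi M f \<Longrightarrow> f \<in> borel_measurable M"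
  by (simp add: sqi_def)

lemma sqi_integrable_sq: "sqi M f \<Longrightarrow> integrable M (\<lambda>x. (cmod (f x))\<^sup>2)"
  by (simp add: sqi_def)

lemma nrm2_nonneg [simp]: "nrm2 M f \<ge> 0"
  by (simp add: nrm2_def)

lemma nrm2_sq: "(nrm2 M f)\<^sup>2 = (LINT x|M. (cmod (f x))\<^sup>2)"
  by (simp add: nrm2_def)

lemma two_mult_le: "2 * (a * b) \<le> a\<^sup>2 + (b::real)\<^sup>2"
  using sum_squares_bound[of a b] by (simp add: power2_eq_square mult.assoc)

lemma cmod_add_sq_le: "(cmod (a + b))\<^sup>2 \<le> 2 * (cmod a)\<^sup>2 + 2 * (cmod b)\<^sup>2"
proof -
  have "(cmod (a + b))\<^sup>2 \<le> (cmod a + cmod b)\<^sup>2"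
    by (intro power_mono norm_triangle_ineq) auto
  then show ?thesis using two_mult_le[of "cmod a" "cmod b"] by (simp add: power2_sum)
qed

lemma sqi_add:
  assumes "sqi M f" "sqi M g" shows "sqi M (\<lambda>x. f x + g x)"
proof -
  have [measurable]: "f \<in> borel_measurable M" "g \<in> borel_measurable M"
    using assms by (auto simp: sqi_def)
  have "integrable M (\<lambda>x. (cmod (f x + g x))\<^sup>2)"
    by (rule Bochner_Integration.integrable_bound[where f="\<lambda>x. 2 * (cmod (f x))\<^sup>2 + 2 * (cmod (g x))\<^sup>2"])
       (use assms in \<open>auto simp: sqi_def cmod_add_sq_le\<close>)
  then show ?thesis by (simp add: sqi_def)
qed

lemma sqi_cmult: "sqi M f \<Longrightarrow> sqi M (\<lambda>x. c * f x)"
  by (auto simp: sqi_def norm_mult power_mult_distrib)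

lemma sqi_uminus: "sqi M f \<Longrightarrow> sqi M (\<lambda>x. - f x)"
  by (auto simp: sqi_def)

lemma sqi_diff: "sqi M f \<Longrightarrow> sqi M g \<Longrightarrow> sqi M (\<lambda>x. f x - g x)"
  using sqi_add[of M f "\<lambda>x. - g x"] sqi_uminus[of M g] by simp

lemma borel_measurable_cnj [measurable]:
  "f \<in> borel_measurable M \<Longrightarrow> (\<lambda>x. cnj (f x)) \<in> borel_measurable M"
  by (rule measurable_compose[of f M borel cnj]) (auto intro!: borel_measurable_continuous_onI continuous_intros)

lemma sqi_cnj: "sqi M f \<Longrightarrow> sqi M (\<lambda>x. cnj (f x))"
  by (auto simp: sqi_def)

lemma sqi_AE: "AE x in M. f x = g x \<Longrightarrow> f \<in> borel_measurable M \<Longrightarrow> sqi M g \<Longrightarrow> sqi M f"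
  unfolding sqi_def
  by (intro conjI; (rule integrable_cong_AE_imp)?) auto

lemma nrm2_AE: "AE x in M. f x = g x \<Longrightarrow> f \<in> borel_measurable M \<Longrightarrow> g \<in> borel_measurable M \<Longrightarrow> nrm2 M f = nrm2 M g"
  unfolding nrm2_def by (intro arg_cong[where f=sqrt] integral_cong_AE) auto

lemma sqi_mult_integrable:
  assumes "sqi M f" "sqi M g" shows "integrable M (\<lambda>x. f x * g x)"
proof -
  have [measurable]: "f \<in> borel_measurable M" "g \<in> borel_measurable M"
    using assms by (auto simp: sqi_def)
  show ?thesis
  proof (rule Bochner_Integration.integrable_bound[where f="\<lambda>x. (cmod (f x))\<^sup>2 + (cmod (g x))\<^sup>2"])
    show "AE x in M. norm (f x * g x) \<le> norm ((cmod (f x))\<^sup>2 + (cmod (g x))\<^sup>2)"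
    proof (rule AE_I2)
      fix x
      have "0 \<le> cmod (f x) * cmod (g x)" by simp
      then have "norm (f x * g x) \<le> (cmod (f x))\<^sup>2 + (cmod (g x))\<^sup>2"
        using two_mult_le[of "cmod (f x)" "cmod (g x)"] unfolding norm_mult by linarith
      then show "norm (f x * g x) \<le> norm ((cmod (f x))\<^sup>2 + (cmod (g x))\<^sup>2)" by simp
    qed
  qed (use assms in \<open>auto simp: sqi_def\<close>)
qed

lemma sqi_mult_cnj_integrable:
  assumes "sqi M f" "sqi M g" shows "integrable M (\<lambda>x. f x * cnj (g x))"
  using sqi_mult_integrable[OF assms(1) sqi_cnj[OF assms(2)]] .

text \<open>Integrate the Young inequality with a free weight \<open>c\<close>. The choice
  \<open>c = I / A\<close> gives \<open>I\<^sup>2 \<le> A * B\<close>; if \<open>A = 0\<close>, then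
  \<open>2 * I * c \<le> B\<close> for every \<open>c\<close>, which forces
  \<open>I = 0\<close>.\<close>

lemma cauchy_schwarz_norm:
  assumes "sqi M f" "sqi M g" shows "(LINT x|M. cmod (f x) * cmod (g x)) \<le> nrm2 M f * nrm2 M g"
proof -
  define A where "A = (LINT x|M. (cmod (f x))\<^sup>2)"
  define B where "B = (LINT x|M. (cmod (g x))\<^sup>2)"
  define I where "I = (LINT x|M. cmod (f x) * cmod (g x))"
  have intfg: "integrable M (\<lambda>x. cmod (f x) * cmod (g x))"
    using integrable_norm[OF sqi_mult_integrable[OF assms]] by (simp add: norm_mult)
  have AB: "A \<ge> 0" "B \<ge> 0" by (auto simp: A_def B_def)
  have I0: "I \<ge> 0" by (auto simp: I_def)
  have key: "2 * I \<le> c * A + B / c" if "c > 0" for c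
  proof -
    have "2 * I = (LINT x|M. 2 * (cmod (f x) * cmod (g x)))" by (simp add: I_def)
    also have "\<dots> \<le> (LINT x|M. c * (cmod (f x))\<^sup>2 + (cmod (g x))\<^sup>2 / c)"
    proof (rule integral_mono)
      fix x
      have "2 * (sqrt c * cmod (f x) * (cmod (g x) / sqrt c)) \<le> (sqrt c * cmod (f x))\<^sup>2 + (cmod (g x) / sqrt c)\<^sup>2"
        by (rule two_mult_le)
      then show "2 * (cmod (f x) * cmod (g x)) \<le> c * (cmod (f x))\<^sup>2 + (cmod (g x))\<^sup>2 / c"
        using that by (simp add: power_mult_distrib power_divide)
    qed (use assms intfg in \<open>auto simp: sqi_def\<close>)
    also have "\<dots> = c * A + B / c" using assms by (simp add: A_def B_def sqi_def)
    finally show ?thesis .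
  qed
  have "I\<^sup>2 \<le> A * B"
  proof (cases "A = 0")
    case True
    have "2 * I * c \<le> B" if "c > 0" for c
      using key[OF that] True that by (simp add: field_simps)
    from this[of "(B+1) / (2 * I)"] have "I = 0 \<or> False"
      using I0 AB by (cases "I = 0") (auto simp: field_simps)
    then show ?thesis using True by simp
  next
    case False
    then have Ap: "A > 0" using AB by simp
    show ?thesis
    proof (cases "I = 0")
      case True then show ?thesis using AB by simp
    next
      case False
      then have Ip: "I > 0" using I0 by simp
      then have "2 * I \<le> I / A * A + B / (I / A)" using key[of "I / A"] Ap by simp
      then have "I \<le> B * A / I" using Ap by simp
      then show ?thesis using Ip by (simp add: field_simps power2_eq_square)
    qed
  qed
  then have "I \<le> sqrt (A * B)" by (simp add: real_le_rsqrt)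
  then show ?thesis by (simp add: I_def A_def B_def nrm2_def real_sqrt_mult)
qed

lemma cauchy_schwarz:
  assumes "sqi M f" "sqi M g" shows "cmod (LINT x|M. f x * g x) \<le> nrm2 M f * nrm2 M g"
proof -
  have "cmod (LINT x|M. f x * g x) \<le> (LINT x|M. cmod (f x * g x))" by (rule integral_norm_bound)
  then show ?thesis using cauchy_schwarz_norm[OF assms] by (simp add: norm_mult)
qed

lemma nrm2_cnj [simp]: "nrm2 M (\<lambda>x. cnj (f x)) = nrm2 M f"
  by (simp add: nrm2_def)

lemma nrm2_uminus [simp]: "nrm2 M (\<lambda>x. - f x) = nrm2 M f"
  by (simp add: nrm2_def)

lemma nrm2_minus_commute: "nrm2 M (\<lambda>x. f x - g x) = nrm2 M (\<lambda>x. g x - f x)"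
  by (simp add: nrm2_def norm_minus_commute)

lemma nrm2_cmult: "nrm2 M (\<lambda>x. c * f x) = cmod c * nrm2 M f"
  by (simp add: nrm2_def norm_mult power_mult_distrib real_sqrt_mult)

lemma cauchy_schwarz_cnj:
  assumes "sqi M f" "sqi M g" shows "cmod (LINT x|M. f x * cnj (g x)) \<le> nrm2 M f * nrm2 M g"
  using cauchy_schwarz[OF assms(1) sqi_cnj[OF assms(2)]] by simp

lemma nrm2_triangle:
  assumes "sqi M f" "sqi M g" shows "nrm2 M (\<lambda>x. f x + g x) \<le> nrm2 M f + nrm2 M g"
proof -
  have intfg: "integrable M (\<lambda>x. cmod (f x) * cmod (g x))"
    using integrable_norm[OF sqi_mult_integrable[OF assms]] by (simp add: norm_mult)
  have "(nrm2 M (\<lambda>x. f x + g x))\<^sup>2 = (LINT x|M. (cmod (f x + g x))\<^sup>2)" by (rule nrm2_sq)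
  also have "\<dots> \<le> (LINT x|M. (cmod (f x))\<^sup>2 + (cmod (g x))\<^sup>2 + 2 * (cmod (f x) * cmod (g x)))"
  proof (rule integral_mono)
    fix x
    have "(cmod (f x + g x))\<^sup>2 \<le> (cmod (f x) + cmod (g x))\<^sup>2"
      by (intro power_mono norm_triangle_ineq) auto
    then show "(cmod (f x + g x))\<^sup>2 \<le> (cmod (f x))\<^sup>2 + (cmod (g x))\<^sup>2 + 2 * (cmod (f x) * cmod (g x))"
      by (simp add: power2_sum mult.assoc)
  qed (use assms intfg sqi_add[OF assms] in \<open>auto simp: sqi_def\<close>)
  also have "\<dots> = (nrm2 M f)\<^sup>2 + (nrm2 M g)\<^sup>2 + 2 * (LINT x|M. cmod (f x) * cmod (g x))"
    using assms intfg by (simp add: sqi_def nrm2_sq)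
  also have "\<dots> \<le> (nrm2 M f + nrm2 M g)\<^sup>2"
    using cauchy_schwarz_norm[OF assms] by (simp add: power2_sum)
  finally show ?thesis by (rule power2_le_imp_le) simp
qed

lemma nrm2_triangle_diff:
  assumes "sqi M f" "sqi M g" shows "nrm2 M (\<lambda>x. f x - g x) \<le> nrm2 M f + nrm2 M g"
  using nrm2_triangle[OF assms(1) sqi_uminus[OF assms(2)]] by simp

lemma nrm2_triangle_via:
  assumes "sqi M f" "sqi M g" "sqi M h"
  shows "nrm2 M (\<lambda>x. f x - h x) \<le> nrm2 M (\<lambda>x. f x - g x) + nrm2 M (\<lambda>x. g x - h x)"
  using nrm2_triangle[OF sqi_diff[OF assms(1,2)] sqi_diff[OF assms(2,3)]] by simp

lemma nrm2_diff_abs: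
  assumes "sqi M f" "sqi M g" shows "\<bar>nrm2 M f - nrm2 M g\<bar> \<le> nrm2 M (\<lambda>x. f x - g x)"
  using nrm2_triangle[OF sqi_diff[OF assms] assms(2)] nrm2_triangle[OF sqi_diff[OF assms(2,1)] assms(1)]
    nrm2_minus_commute[of M f g] by auto

lemma nrm2_tendsto:
  assumes "\<And>n. sqi M (fn n)" "sqi M f" "(\<lambda>n. nrm2 M (\<lambda>x. fn n x - f x)) \<longlonglongrightarrow> 0"
  shows "(\<lambda>n. nrm2 M (fn n)) \<longlonglongrightarrow> nrm2 M f"
proof (rule LIM_zero_cancel, rule Lim_null_comparison[OF _ assms(3)])
  show "\<forall>\<^sub>F n in sequentially. norm (nrm2 M (fn n) - nrm2 M f) \<le> nrm2 M (\<lambda>x. fn n x - f x)"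
    using nrm2_diff_abs[OF assms(1,2)] by simp
qed

lemma inner_tendsto:
  assumes "\<And>n. sqi M (fn n)" "sqi M f" "sqi M g" "(\<lambda>n. nrm2 M (\<lambda>x. fn n x - f x)) \<longlonglongrightarrow> 0"
  shows "(\<lambda>n. LINT x|M. g x * cnj (fn n x)) \<longlonglongrightarrow> (LINT x|M. g x * cnj (f x))"
proof (rule LIM_zero_cancel, rule Lim_null_comparison[where g="\<lambda>n. nrm2 M g * nrm2 M (\<lambda>x. fn n x - f x)"])
  have "norm ((LINT x|M. g x * cnj (fn n x)) - (LINT x|M. g x * cnj (f x))) \<le> nrm2 M g * nrm2 M (\<lambda>x. fn n x - f x)" for n
  proof -
    have "(LINT x|M. g x * cnj (fn n x)) - (LINT x|M. g x * cnj (f x)) = (LINT x|M. g x * cnj (fn n x - f x))"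
      using sqi_mult_cnj_integrable[OF assms(3) assms(1)] sqi_mult_cnj_integrable[OF assms(3) assms(2)]
      by (subst Bochner_Integration.integral_diff[symmetric]) (auto simp: algebra_simps)
    then show ?thesis using cauchy_schwarz_cnj[OF assms(3) sqi_diff[OF assms(1,2)]] by simp
  qed
  then show "\<forall>\<^sub>F n in sequentially. norm ((LINT x|M. g x * cnj (fn n x)) - (LINT x|M. g x * cnj (f x))) \<le> nrm2 M g * nrm2 M (\<lambda>x. fn n x - f x)"
    by simp
  show "(\<lambda>n. nrm2 M g * nrm2 M (\<lambda>x. fn n x - f x)) \<longlonglongrightarrow> 0"
    using tendsto_mult[OF tendsto_const assms(4), of "nrm2 M g"] by simp
qed

lemma sqi_nn_integral:
  assumes "f \<in> borel_measurable M"
  shows "sqi M f \<longleftrightarrow> (\<integral>\<^sup>+x. ennreal ((cmod (f x))\<^sup>2) \<partial>M) < \<infinity>"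
  using assms by (auto simp: sqi_def integrable_iff_bounded)

lemma nrm2_nn_integral:
  assumes "sqi M f"
  shows "(\<integral>\<^sup>+x. ennreal ((cmod (f x))\<^sup>2) \<partial>M) = ennreal ((nrm2 M f)\<^sup>2)"
  using assms by (simp add: nrm2_sq sqi_def nn_integral_eq_integral)

text \<open>The usual way into L2 below: an upper bound for an extended nonnegative integral
  presupposes no integrability and yields membership and norm bound together. This is what makes the
  Tonelli arguments usable.\<close>

lemma nrm2_le_nn_integral:
  assumes "f \<in> borel_measurable M" "(\<integral>\<^sup>+x. ennreal ((cmod (f x))\<^sup>2) \<partial>M) \<le> ennreal (c\<^sup>2)" "c \<ge> 0"
  shows "sqi M f" "nrm2 M f \<le> c"
proof -
  show s: "sqi M f" using assms by (subst sqi_nn_integral) (auto simp: less_top[symmetric] top_unique)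
  have "ennreal ((nrm2 M f)\<^sup>2) \<le> ennreal (c\<^sup>2)" using assms nrm2_nn_integral[OF s] by simp
  then have "(nrm2 M f)\<^sup>2 \<le> c\<^sup>2" by (simp add: ennreal_le_iff)
  then show "nrm2 M f \<le> c" using assms(3) by (rule power2_le_imp_le)
qed

lemma sqi_subset:
  assumes "sqi (lebesgue_on V) f" "U \<subseteq> V" "U \<in> sets lebesgue" "V \<in> sets lebesgue"
  shows "sqi (lebesgue_on U) f" "nrm2 (lebesgue_on U) f \<le> nrm2 (lebesgue_on V) f"
proof -
  have m: "f \<in> borel_measurable (lebesgue_on V)" using assms by (simp add: sqi_def)
  have mU: "f \<in> borel_measurable (lebesgue_on U)"
    by (rule measurable_restrict_mono[OF m assms(2)])
  have "(\<integral>\<^sup>+x. ennreal ((cmod (f x))\<^sup>2) \<partial>lebesgue_on U) \<le> (\<integral>\<^sup>+x. ennreal ((cmod (f x))\<^sup>2) \<partial>lebesgue_on V)"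
    using assms by (simp add: nn_integral_restrict_space) (intro nn_integral_mono, auto simp: indicator_def)
  also have "\<dots> = ennreal ((nrm2 (lebesgue_on V) f)\<^sup>2)" by (rule nrm2_nn_integral) fact
  finally show "sqi (lebesgue_on U) f" "nrm2 (lebesgue_on U) f \<le> nrm2 (lebesgue_on V) f"
    using nrm2_le_nn_integral[OF mU] by auto
qed

lemma sqi_bounded:
  assumes "finite_measure M" "f \<in> borel_measurable M" "\<And>x. x \<in> space M \<Longrightarrow> cmod (f x) \<le> B"
  shows "sqi M f"
proof -
  interpret finite_measure M by fact
  have "integrable M (\<lambda>x. (cmod (f x))\<^sup>2)"
    by (rule integrable_const_bound[where B="B\<^sup>2"]) (use assms in \<open>auto intro!: AE_I2 power_mono\<close>)
  then show ?thesis using assms by (simp add: sqi_def)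
qed

lemma sqi_mult_bounded:
  assumes "sqi M f" "g \<in> borel_measurable M" "\<And>x. x \<in> space M \<Longrightarrow> cmod (g x) \<le> B" "B \<ge> 0"
  shows "sqi M (\<lambda>x. g x * f x)" "nrm2 M (\<lambda>x. g x * f x) \<le> B * nrm2 M f"
proof -
  have m: "(\<lambda>x. g x * f x) \<in> borel_measurable M" using assms by (auto simp: sqi_def)
  have "(\<integral>\<^sup>+x. ennreal ((cmod (g x * f x))\<^sup>2) \<partial>M) \<le> (\<integral>\<^sup>+x. ennreal (B\<^sup>2) * ennreal ((cmod (f x))\<^sup>2) \<partial>M)"
    using assms by (intro nn_integral_mono)
       (auto simp: norm_mult power_mult_distrib simp flip: ennreal_mult intro!: ennreal_leI mult_right_mono power_mono)
  also have "\<dots> = ennreal (B\<^sup>2) * ennreal ((nrm2 M f)\<^sup>2)"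
    using assms nrm2_nn_integral[OF assms(1)] by (subst nn_integral_cmult) (auto simp: sqi_def)
  also have "\<dots> = ennreal ((B * nrm2 M f)\<^sup>2)" by (simp add: ennreal_mult power_mult_distrib)
  finally show "sqi M (\<lambda>x. g x * f x)" "nrm2 M (\<lambda>x. g x * f x) \<le> B * nrm2 M f"
    using nrm2_le_nn_integral[OF m] assms by auto
qed

section \<open>Smooth functions\<close>

text \<open>A coinduction principle: \<open>smooth\<close> speaks about all iterated partial
  derivatives, and a class \<open>S\<close> of continuous functions that contains the partial
  derivatives of its members contains the iterated ones as well. Each closure property below only
  has to exhibit a suitable \<open>S\<close>.\<close>

lemma smoothI:
  fixes \<phi> :: "R2 \<Rightarrow> 'a::real_normed_vector"
  assumes "\<phi> \<in> S" and c: "\<And>\<psi>. \<psi> \<in> S \<Longrightarrow> continuous_on UNIV \<psi>"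
    and d: "\<And>\<psi> j. \<psi> \<in> S \<Longrightarrow> \<exists>\<psi>'\<in>S. \<forall>x. ((\<lambda>t. \<psi> (x + t *\<^sub>R axis j 1)) has_vector_derivative \<psi>' x) (at 0)"
  shows "smooth \<phi>"
proof -
  have pdS: "pd \<psi> j \<in> S \<and> (\<forall>x. ((\<lambda>t. \<psi> (x + t *\<^sub>R axis j 1)) has_vector_derivative pd \<psi> j x) (at 0))" if psi: "\<psi> \<in> S" for \<psi> j
  proof -
    obtain \<psi>' where p: "\<psi>' \<in> S" "\<And>x. ((\<lambda>t. \<psi> (x + t *\<^sub>R axis j 1)) has_vector_derivative \<psi>' x) (at 0)"
      using d[OF psi, of j] by blast
    have "pd \<psi> j = \<psi>'" using vector_derivative_at[OF p(2)] by (auto simp: pd_def fun_eq_iff)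
    then show ?thesis using p by simp
  qed
  have "pds js \<phi> \<in> S" for js by (induction js) (use assms(1) pdS in auto)
  then show ?thesis unfolding smooth_def Ck_on_def using c pdS by auto
qed

lemma smooth_pds_continuous: "smooth \<phi> \<Longrightarrow> continuous_on UNIV (pds js \<phi>)"
  unfolding smooth_def Ck_on_def by blast

lemma smooth_pds_has: "smooth \<phi> \<Longrightarrow>
    ((\<lambda>t. pds js \<phi> (x + t *\<^sub>R axis j 1)) has_vector_derivative pds (j # js) \<phi> x) (at 0)"
  unfolding smooth_def Ck_on_def by blast

lemma smooth_continuous: "smooth \<phi> \<Longrightarrow> continuous_on UNIV \<phi>"
  using smooth_pds_continuous[of \<phi> "[]"] by simp

lemma smooth_pd_has: "smooth \<phi> \<Longrightarrow> ((\<lambda>t. \<phi> (x + t *\<^sub>R axis j 1)) has_vector_derivative pd \<phi> j x) (at 0)"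
  using smooth_pds_has[of \<phi> "[]" x j] by simp

lemma pds_append: "pds (js @ [j]) \<phi> = pds js (pd \<phi> j)"
  by (induction js) auto

lemma smooth_pd:
  assumes "smooth \<phi>" shows "smooth (pd \<phi> j)"
  using smooth_pds_continuous[OF assms, of "_ @ [j]"] smooth_pds_has[OF assms, of "_ @ [j]"]
  unfolding smooth_def Ck_on_def pds_append append_Cons[symmetric] by simp

lemma smooth_borel [measurable_dest]: "smooth \<phi> \<Longrightarrow> \<phi> \<in> borel_measurable borel"
  by (intro borel_measurable_continuous_onI smooth_continuous)

lemma pd_eqI: "((\<lambda>t. \<phi> (x + t *\<^sub>R axis j 1)) has_vector_derivative d) (at 0) \<Longrightarrow> pd \<phi> j x = d"
  unfolding pd_def by (rule vector_derivative_at)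

lemma smooth_const: "smooth (\<lambda>x. c)"
  by (rule smoothI[of _ "{\<lambda>x. c, \<lambda>x. 0}"]) (auto intro!: derivative_eq_intros)

lemma smooth_add:
  assumes "smooth f" "smooth g" shows "smooth (\<lambda>x. f x + g x)"
proof (rule smoothI[of _ "{h. \<exists>f g. smooth f \<and> smooth g \<and> h = (\<lambda>x. f x + g x)}"])
  show "(\<lambda>x. f x + g x) \<in> {h. \<exists>f g. smooth f \<and> smooth g \<and> h = (\<lambda>x. f x + g x)}" using assms by blast
  fix \<psi> assume "\<psi> \<in> {h. \<exists>f g :: R2 \<Rightarrow> 'a. smooth f \<and> smooth g \<and> h = (\<lambda>x. f x + g x)}"
  then obtain f g :: "R2 \<Rightarrow> 'a" where fg: "smooth f" "smooth g" "\<psi> = (\<lambda>x. f x + g x)" by blast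
  show "continuous_on UNIV \<psi>" unfolding fg(3) by (intro continuous_on_add smooth_continuous fg)
  fix j
  have "((\<lambda>t. \<psi> (x + t *\<^sub>R axis j 1)) has_vector_derivative (pd f j x + pd g j x)) (at 0)" for x
    unfolding fg(3) by (intro has_vector_derivative_add smooth_pd_has fg)
  then show "\<exists>\<psi>'\<in>{h. \<exists>f g. smooth f \<and> smooth g \<and> h = (\<lambda>x. f x + g x)}.
       \<forall>x. ((\<lambda>t. \<psi> (x + t *\<^sub>R axis j 1)) has_vector_derivative \<psi>' x) (at 0)"
    using smooth_pd[OF fg(1), of j] smooth_pd[OF fg(2), of j]
    by (intro bexI[of _ "\<lambda>x. pd f j x + pd g j x"]) blast+
qed

text \<open>Sums of products of smooth functions: stable under partial derivatives, which is what \<open>smoothI\<close> needs.\<close>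

inductive_set leibniz_sums :: "(R2 \<Rightarrow> complex) set" where
  base: "smooth f \<Longrightarrow> smooth g \<Longrightarrow> (\<lambda>x. f x * g x) \<in> leibniz_sums"
| plus: "f \<in> leibniz_sums \<Longrightarrow> g \<in> leibniz_sums \<Longrightarrow> (\<lambda>x. f x + g x) \<in> leibniz_sums"

lemma smooth_mult:
  fixes f g :: "R2 \<Rightarrow> complex"
  assumes "smooth f" "smooth g" shows "smooth (\<lambda>x. f x * g x)"
proof (rule smoothI[of _ leibniz_sums])
  show "(\<lambda>x. f x * g x) \<in> leibniz_sums" using assms by (rule leibniz_sums.base)
  show "continuous_on UNIV \<psi>" if "\<psi> \<in> leibniz_sums" for \<psi>
    using that by induction (auto intro!: continuous_on_mult continuous_on_add dest: smooth_continuous)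
  show "\<exists>\<psi>'\<in>leibniz_sums. \<forall>x. ((\<lambda>t. \<psi> (x + t *\<^sub>R axis j 1)) has_vector_derivative \<psi>' x) (at 0)"
    if "\<psi> \<in> leibniz_sums" for \<psi> j
    using that
  proof induction
    case (base f g)
    have "(\<lambda>x. f x * pd g j x + pd f j x * g x) \<in> leibniz_sums"
      by (rule leibniz_sums.plus; rule leibniz_sums.base) (use base smooth_pd in auto)
    moreover have "((\<lambda>t. f (x + t *\<^sub>R axis j 1) * g (x + t *\<^sub>R axis j 1)) has_vector_derivative
        (f x * pd g j x + pd f j x * g x)) (at 0)" for x
      using has_vector_derivative_mult[OF smooth_pd_has[OF base(1)] smooth_pd_has[OF base(2)], of x j x j] by simp
    ultimately show ?case by (intro bexI[of _ "\<lambda>x. f x * pd g j x + pd f j x * g x"]) auto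
  next
    case (plus f g)
    then obtain f' g' where "f' \<in> leibniz_sums" "g' \<in> leibniz_sums"
      "\<And>x. ((\<lambda>t. f (x + t *\<^sub>R axis j 1)) has_vector_derivative f' x) (at 0)"
      "\<And>x. ((\<lambda>t. g (x + t *\<^sub>R axis j 1)) has_vector_derivative g' x) (at 0)" by blast
    then show ?case
      by (intro bexI[of _ "\<lambda>x. f' x + g' x"]) (auto intro: has_vector_derivative_add leibniz_sums.plus)
  qed
qed

lemma pd_mult: "smooth f \<Longrightarrow> smooth g \<Longrightarrow> pd (\<lambda>x. f x * g x :: complex) j x = f x * pd g j x + pd f j x * g x"
  using has_vector_derivative_mult[OF smooth_pd_has smooth_pd_has, of f g x j x j] by (intro pd_eqI) simp

lemma smooth_cmult: "smooth f \<Longrightarrow> smooth (\<lambda>x. c * f x :: complex)"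
  by (rule smooth_mult[OF smooth_const])

lemma smooth_diff: "smooth f \<Longrightarrow> smooth g \<Longrightarrow> smooth (\<lambda>x. f x - g x :: complex)"
  using smooth_add[of f "\<lambda>x. (-1) * g x"] smooth_cmult[of g "-1"] by simp

lemma pd_diff: "smooth f \<Longrightarrow> smooth g \<Longrightarrow> pd (\<lambda>x. f x - g x :: complex) j x = pd f j x - pd g j x"
  by (rule pd_eqI) (auto intro: has_vector_derivative_diff smooth_pd_has)

lemma has_cnj:
  "(f has_vector_derivative d) F \<Longrightarrow> ((\<lambda>t. cnj (f t)) has_vector_derivative cnj d) F"
  by (rule bounded_linear.has_vector_derivative[OF bounded_linear_cnj])

lemma smooth_cnj:
  assumes "smooth f" shows "smooth (\<lambda>x. cnj (f x))"
proof (rule smoothI[of _ "{h. \<exists>f. smooth f \<and> h = (\<lambda>x. cnj (f x))}"])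
  show "(\<lambda>x. cnj (f x)) \<in> {h. \<exists>f. smooth f \<and> h = (\<lambda>x. cnj (f x))}" using assms by blast
  fix \<psi> assume "\<psi> \<in> {h. \<exists>f. smooth f \<and> h = (\<lambda>x. cnj (f x))}"
  then obtain f where fg: "smooth f" "\<psi> = (\<lambda>x. cnj (f x))" by blast
  show "continuous_on UNIV \<psi>" unfolding fg(2) by (intro continuous_on_cnj smooth_continuous fg)
  fix j
  have "((\<lambda>t. \<psi> (x + t *\<^sub>R axis j 1)) has_vector_derivative (cnj (pd f j x))) (at 0)" for x
    unfolding fg(2) by (intro has_cnj smooth_pd_has fg)
  then show "\<exists>\<psi>'\<in>{h. \<exists>f. smooth f \<and> h = (\<lambda>x. cnj (f x))}.
       \<forall>x. ((\<lambda>t. \<psi> (x + t *\<^sub>R axis j 1)) has_vector_derivative \<psi>' x) (at 0)"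
    using smooth_pd[OF fg(1), of j]
    by (intro bexI[of _ "\<lambda>x. cnj (pd f j x)"]) blast+
qed

lemma pd_cnj: "smooth f \<Longrightarrow> pd (\<lambda>x. cnj (f x)) j x = cnj (pd f j x)"
  by (rule pd_eqI) (auto intro: has_cnj smooth_pd_has)

lemma has_affine:
  fixes f :: "R2 \<Rightarrow> complex"
  assumes "smooth f"
  shows "((\<lambda>t. f (a + c *\<^sub>R (x + t *\<^sub>R axis j 1))) has_vector_derivative (of_real c * pd f j (a + c *\<^sub>R x))) (at 0)"
proof -
  have 1: "((\<lambda>t. c * t) has_vector_derivative c) (at 0)" by (auto intro!: derivative_eq_intros)
  have 2: "((\<lambda>t. f ((a + c *\<^sub>R x) + t *\<^sub>R axis j 1)) has_vector_derivative pd f j (a + c *\<^sub>R x)) (at (c * 0))"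
    using smooth_pd_has[OF assms] by simp
  show ?thesis using vector_diff_chain_at[OF 1 2]
    by (simp add: o_def algebra_simps scaleR_conv_of_real)
qed

lemma smooth_affine:
  fixes f :: "R2 \<Rightarrow> complex"
  assumes "smooth f" shows "smooth (\<lambda>x. f (a + c *\<^sub>R x))"
proof (rule smoothI[of _ "{h. \<exists>k f. smooth f \<and> h = (\<lambda>x. k * f (a + c *\<^sub>R x))}"])
  show "(\<lambda>x. f (a + c *\<^sub>R x)) \<in> {h. \<exists>k f. smooth f \<and> h = (\<lambda>x. k * f (a + c *\<^sub>R x))}"
    using assms by (auto intro!: exI[of _ 1] exI[of _ f])
next
  fix \<psi> :: "R2 \<Rightarrow> complex" assume "\<psi> \<in> {h. \<exists>k f. smooth f \<and> h = (\<lambda>x. k * f (a + c *\<^sub>R x))}"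
  then obtain k and f :: "R2 \<Rightarrow> complex" where f: "smooth f" "\<psi> = (\<lambda>x. k * f (a + c *\<^sub>R x))" by blast
  show "continuous_on UNIV \<psi>" unfolding f(2)
    by (intro continuous_intros continuous_on_compose2[OF smooth_continuous[OF f(1)]]) auto
  fix j
  have "(\<lambda>x. (k * of_real c) * pd f j (a + c *\<^sub>R x)) \<in> {h. \<exists>k f. smooth f \<and> h = (\<lambda>x. k * f (a + c *\<^sub>R x))}"
    using smooth_pd[OF f(1)] by blast
  moreover have "((\<lambda>t. \<psi> (x + t *\<^sub>R axis j 1)) has_vector_derivative ((k * of_real c) * pd f j (a + c *\<^sub>R x))) (at 0)" for x
    unfolding f(2) using has_vector_derivative_mult_right[OF has_affine[OF f(1)], of k a c x j] by (simp add: mult.assoc)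
  ultimately show "\<exists>\<psi>'\<in>{h. \<exists>k f. smooth f \<and> h = (\<lambda>x. k * f (a + c *\<^sub>R x))}.
       \<forall>x. ((\<lambda>t. \<psi> (x + t *\<^sub>R axis j 1)) has_vector_derivative \<psi>' x) (at 0)"
    by (intro bexI[of _ "\<lambda>x. (k * of_real c) * pd f j (a + c *\<^sub>R x)"]) auto
qed

lemma pd_affine:
  fixes f :: "R2 \<Rightarrow> complex"
  assumes "smooth f"
  shows "pd (\<lambda>x. f (a + c *\<^sub>R x)) j x = of_real c * pd f j (a + c *\<^sub>R x)"
  by (rule pd_eqI[OF has_affine[OF assms]])

lemma axis_nth: "(axis j (1::real) :: R2) $ i = (if i = j then 1 else 0)"
  by (simp add: axis_def)

lemma R2_axis: "(h::R2) = h $ 1 *\<^sub>R axis 1 1 + h $ 2 *\<^sub>R axis 2 1"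
  by (simp add: vec_eq_iff forall_2 axis_nth)

lemma coord_has: "((\<lambda>t. complex_of_real ((x + t *\<^sub>R axis j 1 :: R2) $ i)) has_vector_derivative (if i = j then 1 else 0)) (at 0)"
  by (auto simp: axis_nth intro!: derivative_eq_intros has_vector_derivative_of_real)

lemma smooth_coord: "smooth (\<lambda>x. complex_of_real (x $ i))"
proof (rule smoothI[of _ "insert (\<lambda>x. complex_of_real (x $ i)) (range (\<lambda>c x. c))"])
  fix \<psi> j assume "\<psi> \<in> insert (\<lambda>x::R2. complex_of_real (x $ i)) (range (\<lambda>c x. c))"
  then consider "\<psi> = (\<lambda>x. complex_of_real (x $ i))" | c where "\<psi> = (\<lambda>x. c)" by blast
  then show "\<exists>\<psi>'\<in>insert (\<lambda>x. complex_of_real (x $ i)) (range (\<lambda>c x. c)).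
        \<forall>x. ((\<lambda>t. \<psi> (x + t *\<^sub>R axis j 1)) has_vector_derivative \<psi>' x) (at 0)"
  proof cases
    case 1
    have "(\<lambda>x::R2. (if i = j then 1 else 0) :: complex) \<in> range (\<lambda>c x. c)" by blast
    then show ?thesis unfolding 1 using coord_has[of _ j i]
      by (intro bexI[of _ "\<lambda>x. if i = j then 1 else 0"]) auto
  next
    case 2
    have "(\<lambda>x::R2. 0 :: complex) \<in> range (\<lambda>c x. c)" by blast
    then show ?thesis unfolding 2
      by (intro bexI[of _ "\<lambda>x. 0"]) auto
  qed
qed (auto intro!: continuous_intros)

lemma pd_coord: "pd (\<lambda>x. complex_of_real (x $ i)) j x = (if i = j then 1 else 0)"
  by (rule pd_eqI[OF coord_has])

section \<open>Differentiability from continuous partial derivatives\<close>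

lemma line_vd:
  assumes "((\<lambda>t. \<phi> ((y + s *\<^sub>R axis j 1) + t *\<^sub>R axis j 1)) has_vector_derivative d) (at 0)"
  shows "((\<lambda>t. \<phi> (y + t *\<^sub>R axis j 1)) has_vector_derivative d) (at s)"
proof -
  have 1: "((\<lambda>t. t - s) has_vector_derivative 1) (at s)" by (auto intro!: derivative_eq_intros)
  have 2: "((\<lambda>t. \<phi> ((y + s *\<^sub>R axis j 1) + t *\<^sub>R axis j 1)) has_vector_derivative d) (at (s - s))"
    using assms by simp
  show ?thesis using vector_diff_chain_at[OF 1 2] by (simp add: o_def algebra_simps)
qed

text \<open>Mean value estimate along one coordinate line. It serves total differentiability as well
  as the uniform control of difference quotients under an integral.\<close>

lemma axis_increment:
  fixes \<phi> :: "R2 \<Rightarrow> 'a::real_normed_vector"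
  assumes "\<And>s. s \<in> closed_segment 0 h \<Longrightarrow>
      ((\<lambda>t. \<phi> ((y + s *\<^sub>R axis j 1) + t *\<^sub>R axis j 1)) has_vector_derivative g (y + s *\<^sub>R axis j 1)) (at 0)"
    and "\<And>s. s \<in> closed_segment 0 h \<Longrightarrow> norm (g (y + s *\<^sub>R axis j 1) - g y) \<le> B"
  shows "norm (\<phi> (y + h *\<^sub>R axis j 1) - \<phi> y - h *\<^sub>R g y) \<le> \<bar>h\<bar> * B"
proof -
  define F where "F t = \<phi> (y + t *\<^sub>R axis j 1)" for t
  define F' where "F' t = g (y + t *\<^sub>R axis j 1)" for t
  have 1: "(F has_vector_derivative F' s) (at s within closed_segment 0 h)" if s: "s \<in> closed_segment 0 h" for s
    unfolding F_def F'_def by (rule has_vector_derivative_at_within[OF line_vd[OF assms(1)[OF s]]])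
  have 2: "norm (F' s - F' 0) \<le> B" if "s \<in> closed_segment 0 h" for s
    using assms(2)[OF that] by (simp add: F'_def)
  have "norm (F h - F 0 - (h - 0) *\<^sub>R F' 0) \<le> norm (h - 0) * B"
    by (rule vector_differentiable_bound_linearization[OF 1 _ 2]) auto
  then show ?thesis by (simp add: F_def F'_def)
qed

text \<open>Walk from \<open>x\<close> to \<open>y\<close> parallel to the axes, with one corner
  \<open>z\<close>; each leg is controlled by \<open>axis_increment\<close>, and moving the second
  partial derivative from \<open>z\<close> back to \<open>x\<close> costs one more small
  term.\<close>

lemma has_derivative_of_partials:
  fixes \<phi> :: "R2 \<Rightarrow> 'a::real_normed_vector"
  assumes V: "open V" "x \<in> V"
    and d: "\<And>y j. y \<in> V \<Longrightarrow> ((\<lambda>t. \<phi> (y + t *\<^sub>R axis j 1)) has_vector_derivative g j y) (at 0)"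
    and c: "\<And>j. continuous_on V (g j)"
  shows "(\<phi> has_derivative (\<lambda>h. \<Sum>j\<in>UNIV. h $ j *\<^sub>R g j x)) (at x)"
  unfolding has_derivative_at_alt
proof (intro conjI allI impI)
  show "bounded_linear (\<lambda>h. \<Sum>j\<in>UNIV. h $ j *\<^sub>R g j x)"
    by (intro bounded_linear_sum bounded_linear_scaleR_const bounded_linear_vec_nth)
  fix e :: real assume e: "e > 0"
  \<comment> \<open>The three errors below add up to \<open>4 * e'\<close> times the length of the
    increment, so a sixth of \<open>e\<close> leaves room.\<close>
  define e' where "e' = e / 6"
  have e': "e' > 0" using e by (simp add: e'_def)
  have "\<exists>\<delta>>0. ball x \<delta> \<subseteq> V \<and> (\<forall>y\<in>ball x \<delta>. norm (g j y - g j x) < e')" for j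
  proof -
    obtain d1 where d1: "d1 > 0" "ball x d1 \<subseteq> V" using V openE by blast
    have "continuous (at x) (g j)" using c[of j] V by (simp add: continuous_on_eq_continuous_at)
    then obtain d2 where d2: "d2 > 0" "\<And>y. dist y x < d2 \<Longrightarrow> dist (g j y) (g j x) < e'"
      using e' unfolding continuous_at_eps_delta by blast
    show ?thesis
      by (rule exI[of _ "min d1 d2"]) (use d1 d2 in \<open>auto simp: dist_commute dist_norm\<close>)
  qed
  then obtain \<delta>f where \<delta>f: "\<And>j. \<delta>f j > 0" "\<And>j. ball x (\<delta>f j) \<subseteq> V" "\<And>j y. y \<in> ball x (\<delta>f j) \<Longrightarrow> norm (g j y - g j x) < e'"
    by metis
  define \<delta> where "\<delta> = min (\<delta>f 1) (\<delta>f 2)"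
  have dl: "\<delta> > 0" "ball x \<delta> \<subseteq> V" "\<And>j y. y \<in> ball x \<delta> \<Longrightarrow> norm (g j y - g j x) < e'"
    using \<delta>f unfolding \<delta>_def by (auto simp: subset_iff) (metis exhaust_2)
  show "\<exists>d>0. \<forall>y. norm (y - x) < d \<longrightarrow>
       norm (\<phi> y - \<phi> x - (\<Sum>j\<in>UNIV. (y - x) $ j *\<^sub>R g j x)) \<le> e * norm (y - x)"
  proof (intro exI[of _ "\<delta> / 2"] conjI allI impI)
    show "\<delta> / 2 > 0" using dl by simp
    fix y assume y: "norm (y - x) < \<delta> / 2"
    define h where "h = y - x"
    have hb: "\<bar>h $ j\<bar> \<le> norm h" for j using component_le_norm_cart by blast
    have na: "norm (axis j (1::real) :: R2) = 1" for j by (simp add: norm_axis_1)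
    have seg: "\<bar>s\<bar> \<le> \<bar>a\<bar>" if "s \<in> closed_segment 0 a" for s a :: real
      using that by (auto simp: closed_segment_eq_real_ivl split: if_splits)
    have in1: "x + s *\<^sub>R axis 1 1 \<in> ball x \<delta>" if "s \<in> closed_segment 0 (h $ 1)" for s
      using seg[OF that] hb[of 1] y by (simp add: dist_norm na h_def)
    have in2: "(x + h $ 1 *\<^sub>R axis 1 1) + s *\<^sub>R axis 2 1 \<in> ball x \<delta>" if "s \<in> closed_segment 0 (h $ 2)" for s
    proof -
      have "norm ((h $ 1) *\<^sub>R axis 1 1 + s *\<^sub>R (axis 2 1 :: R2)) \<le> \<bar>h $ 1\<bar> + \<bar>s\<bar>"
        using norm_triangle_ineq[of "(h $ 1) *\<^sub>R axis 1 1" "s *\<^sub>R (axis 2 1 :: R2)"] by (simp add: na)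
      also have "\<dots> < \<delta>" using seg[OF that] hb[of 1] hb[of 2] y by (simp add: h_def)
      finally have "norm ((h $ 1) *\<^sub>R axis 1 1 + s *\<^sub>R (axis 2 1 :: R2)) < \<delta>" .
      moreover have "norm (x - (x + h $ 1 *\<^sub>R axis 1 1 + s *\<^sub>R axis 2 1)) = norm ((h $ 1) *\<^sub>R axis 1 1 + s *\<^sub>R (axis 2 1 :: R2))"
        by (subst norm_minus_commute) simp
      ultimately show ?thesis by (simp only: mem_ball dist_norm)
    qed
    define z where "z = x + h $ 1 *\<^sub>R axis 1 1"
    have zin: "z \<in> ball x \<delta>" using in1[of "h $ 1"] by (simp add: z_def)
    have yz: "z + h $ 2 *\<^sub>R axis 2 1 = y" using R2_axis[of h] by (simp add: z_def h_def algebra_simps)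
    have 1: "norm (\<phi> z - \<phi> x - h $ 1 *\<^sub>R g 1 x) \<le> \<bar>h $ 1\<bar> * e'"
      unfolding z_def
      by (rule axis_increment) (use d dl in1 in \<open>auto simp: less_imp_le subset_iff\<close>)
    have 2: "norm (\<phi> y - \<phi> z - h $ 2 *\<^sub>R g 2 z) \<le> \<bar>h $ 2\<bar> * (2 * e')"
      unfolding yz[symmetric]
    proof (rule axis_increment)
      fix s assume s: "s \<in> closed_segment 0 (h $ 2)"
      note i = in2[OF s, folded z_def]
      show "((\<lambda>t. \<phi> (z + s *\<^sub>R axis 2 1 + t *\<^sub>R axis 2 1)) has_vector_derivative g 2 (z + s *\<^sub>R axis 2 1)) (at 0)"
        using d dl i by blast
      show "norm (g 2 (z + s *\<^sub>R axis 2 1) - g 2 z) \<le> 2 * e'"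
        using dl(3)[OF i, of 2] dl(3)[OF zin, of 2] norm_triangle_ineq4[of "g 2 (z + s *\<^sub>R axis 2 1) - g 2 x" "g 2 z - g 2 x"]
        by simp
    qed
    have 3: "norm (h $ 2 *\<^sub>R (g 2 z - g 2 x)) \<le> \<bar>h $ 2\<bar> * e'"
      using dl(3)[OF zin, of 2] by (simp add: mult_left_mono)
    have "\<phi> y - \<phi> x - (\<Sum>j\<in>UNIV. h $ j *\<^sub>R g j x) =
        (\<phi> z - \<phi> x - h $ 1 *\<^sub>R g 1 x) + (\<phi> y - \<phi> z - h $ 2 *\<^sub>R g 2 z) + h $ 2 *\<^sub>R (g 2 z - g 2 x)"
      by (simp add: sum_2 algebra_simps)
    also have "norm \<dots> \<le> \<bar>h $ 1\<bar> * e' + \<bar>h $ 2\<bar> * (2 * e') + \<bar>h $ 2\<bar> * e'"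
      using 1 2 3 by (intro order_trans[OF norm_triangle_ineq] add_mono) auto
    also have "\<dots> \<le> norm h * e' + norm h * (2 * e') + norm h * e'"
      using hb e' by (intro add_mono mult_right_mono) auto
    also have "\<dots> \<le> e * norm h" using e by (simp add: e'_def field_simps)
    finally show "norm (\<phi> y - \<phi> x - (\<Sum>j\<in>UNIV. (y - x) $ j *\<^sub>R g j x)) \<le> e * norm (y - x)"
      by (simp add: h_def)
  qed
qed

lemma smooth_has_derivative:
  "smooth \<phi> \<Longrightarrow> (\<phi> has_derivative (\<lambda>h. \<Sum>j\<in>UNIV. h $ j *\<^sub>R pd \<phi> j x)) (at x)"
  by (rule has_derivative_of_partials[of UNIV]) (auto intro: smooth_pd_has smooth_continuous smooth_pd)

lemma C1_has_derivative:
  assumes "Ck_on (Suc k) (ball p r) \<phi>" "x \<in> ball p r"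
  shows "(\<phi> has_derivative (\<lambda>h. \<Sum>j\<in>UNIV. h $ j *\<^sub>R pd \<phi> j x)) (at x)"
proof (rule has_derivative_of_partials[of "ball p r"])
  have *: "length js \<le> Suc k \<Longrightarrow> continuous_on (ball p r) (pds js \<phi>)" for js
    using assms unfolding Ck_on_def by blast
  show "continuous_on (ball p r) (pd \<phi> j)" for j using *[of "[j]"] by simp
  have *: "length js < Suc k \<Longrightarrow> y \<in> ball p r \<Longrightarrow> ((\<lambda>t. pds js \<phi> (y + t *\<^sub>R axis j 1)) has_vector_derivative pds (j # js) \<phi> y) (at 0)" for y j js
    using assms unfolding Ck_on_def by blast
  show "((\<lambda>t. \<phi> (y + t *\<^sub>R axis j 1)) has_vector_derivative pd \<phi> j y) (at 0)" if "y \<in> ball p r" for y j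
    using *[of "[]" y j] that by simp
qed (use assms in auto)

text \<open>\<open>hexp 0\<close> is the flat function; the derivative of \<open>hexp n\<close> is a combination of two later \<open>hexp\<close>s.\<close>

definition hexp :: "nat \<Rightarrow> real \<Rightarrow> real" where
  "hexp n s = (if s > 0 then exp (- inverse s) * inverse s ^ n else 0)"

lemma hexp_tendsto_right: "(hexp n \<longlongrightarrow> 0) (at_right 0)"
proof -
  have "((\<lambda>s. (inverse s) ^ n / exp (inverse s)) \<longlongrightarrow> (0::real)) (at_right 0)"
    by (rule filterlim_compose[OF tendsto_power_div_exp_0 filterlim_inverse_at_top_right])
  moreover have "\<forall>\<^sub>F s in at_right 0. (inverse s) ^ n / exp (inverse s) = hexp n s"
    by (rule eventually_at_rightI[of 0 1]) (auto simp: hexp_def exp_minus divide_inverse mult.commute)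
  ultimately show ?thesis by (rule Lim_transform_eventually)
qed

lemma hexp_tendsto: "(hexp n \<longlongrightarrow> 0) (at 0)"
proof (rule filterlim_split_at_real)
  show "(hexp n \<longlongrightarrow> 0) (at_left 0)"
    by (rule tendsto_eventually) (auto intro!: eventually_at_leftI[of "-1"] simp: hexp_def)
qed (rule hexp_tendsto_right)

lemma hexp_deriv:
  "(hexp n has_real_derivative (hexp (n + 2) s - real n * hexp (n + 1) s)) (at s)"
proof -
  consider "s > 0" | "s < 0" | "s = 0" by linarith
  then show ?thesis
  proof cases
    case 1
    have "((\<lambda>s. exp (- inverse s) * inverse s ^ n) has_real_derivative (hexp (n + 2) s - real n * hexp (n + 1) s)) (at s)"
    proof -
      have d: "(inverse has_real_derivative - (inverse s)\<^sup>2) (at s)"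
        using 1 DERIV_inverse[of s UNIV] by (simp add: numeral_2_eq_2)
      have d1: "((\<lambda>s. exp (- inverse s)) has_real_derivative exp (- inverse s) * (inverse s)\<^sup>2) (at s)"
        using DERIV_fun_exp[OF DERIV_minus[OF d]] by simp
      have "((\<lambda>s. exp (- inverse s) * inverse s ^ n) has_real_derivative
          exp (- inverse s) * (inverse s)\<^sup>2 * inverse s ^ n + real n * (- (inverse s)\<^sup>2 * inverse s ^ (n - Suc 0)) * exp (- inverse s)) (at s)"
        by (rule DERIV_mult[OF d1 DERIV_power[OF d]])
      moreover have "exp (- inverse s) * (inverse s)\<^sup>2 * inverse s ^ n + real n * (- (inverse s)\<^sup>2 * inverse s ^ (n - Suc 0)) * exp (- inverse s)
          = hexp (n + 2) s - real n * hexp (n + 1) s"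
        using 1 by (cases n) (simp_all add: hexp_def power2_eq_square algebra_simps)
      ultimately show ?thesis by simp
    qed
    then show ?thesis
      by (rule has_field_derivative_transform_within_open[of _ _ _ "{0<..}"]) (use 1 in \<open>auto simp: hexp_def\<close>)
  next
    case 2
    have "((\<lambda>s. 0) has_real_derivative 0) (at s)" by simp
    then have "(hexp n has_real_derivative 0) (at s)"
      by (rule has_field_derivative_transform_within_open[of _ _ _ "{..<0}"]) (use 2 in \<open>auto simp: hexp_def\<close>)
    then show ?thesis using 2 by (simp add: hexp_def)
  next
    case 3
    \<comment> \<open>The difference quotient at \<open>0\<close> is itself the next function of the
      family, whose limit is already known.\<close>
    have "(\<lambda>y. (hexp n y - hexp n 0) / (y - 0)) = hexp (n + 1)"
      by (auto simp: hexp_def fun_eq_iff divide_inverse)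
    then have "(hexp n has_real_derivative 0) (at 0)"
      using hexp_tendsto[of "n + 1"] by (simp add: has_field_derivative_iff)
    then show ?thesis unfolding 3 by (simp add: hexp_def)
  qed
qed

text \<open>The invariant class for \<open>smoothI\<close>: sums are needed because one derivative
  of \<open>hexp n\<close> produces two members of the family.\<close>

inductive_set hexp_sums :: "2 \<Rightarrow> real \<Rightarrow> real \<Rightarrow> (R2 \<Rightarrow> complex) set" for j a b where
  base: "(\<lambda>x. of_real (c * hexp n (a + b * x $ j))) \<in> hexp_sums j a b"
| plus: "f \<in> hexp_sums j a b \<Longrightarrow> g \<in> hexp_sums j a b \<Longrightarrow> (\<lambda>x. f x + g x) \<in> hexp_sums j a b"

lemma continuous_hexp: "continuous_on UNIV (hexp n)"
  using hexp_deriv DERIV_isCont by (simp add: continuous_on_eq_continuous_at) blast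

lemma smooth_hexp: "smooth (\<lambda>x. complex_of_real (hexp n (a + b * x $ j)))"
proof (rule smoothI[of _ "hexp_sums j a b"])
  show "(\<lambda>x. complex_of_real (hexp n (a + b * x $ j))) \<in> hexp_sums j a b"
    using hexp_sums.base[of 1 n a b j] by simp
  show "continuous_on UNIV \<psi>" if "\<psi> \<in> hexp_sums j a b" for \<psi>
    using that
    by induction (auto intro!: continuous_intros continuous_on_compose2[OF continuous_hexp])
  show "\<exists>\<psi>'\<in>hexp_sums j a b. \<forall>x. ((\<lambda>t. \<psi> (x + t *\<^sub>R axis i 1)) has_vector_derivative \<psi>' x) (at 0)"
    if "\<psi> \<in> hexp_sums j a b" for \<psi> i
    using that
  proof induction
    case (base c n)
    define b' where "b' = (if j = i then b else 0)"
    have m: "(\<lambda>x. of_real ((c * b') * hexp (n + 2) (a + b * x $ j)) + of_real ((- c * b' * real n) * hexp (n + 1) (a + b * x $ j))) \<in> hexp_sums j a b"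
      by (intro hexp_sums.plus hexp_sums.base)
    have "((\<lambda>t. complex_of_real (c * hexp n (a + b * (x + t *\<^sub>R axis i 1) $ j))) has_vector_derivative
        (of_real ((c * b') * hexp (n + 2) (a + b * x $ j)) + of_real ((- c * b' * real n) * hexp (n + 1) (a + b * x $ j)))) (at 0)" for x :: R2
    proof -
      have 1: "((\<lambda>t. a + b * (x + t *\<^sub>R axis i 1) $ j) has_real_derivative b') (at 0)"
        by (auto simp: axis_nth b'_def intro!: derivative_eq_intros)
      have 2: "((\<lambda>t. hexp n (a + b * (x + t *\<^sub>R axis i 1) $ j)) has_real_derivative
          (hexp (n + 2) (a + b * x $ j) - real n * hexp (n + 1) (a + b * x $ j)) * b') (at 0)"
        using DERIV_chain2[OF _ 1, of "hexp n" "hexp (n + 2) (a + b * x $ j) - real n * hexp (n + 1) (a + b * x $ j)"]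
          hexp_deriv[of n "a + b * x $ j"] by simp
      have "((\<lambda>t. complex_of_real (c * hexp n (a + b * (x + t *\<^sub>R axis i 1) $ j))) has_vector_derivative
          of_real (c * ((hexp (n + 2) (a + b * x $ j) - real n * hexp (n + 1) (a + b * x $ j)) * b'))) (at 0)"
        using DERIV_cmult[OF 2, of c] by (intro has_vector_derivative_of_real) (simp add: has_real_derivative_iff_has_vector_derivative)
      then show ?thesis by (simp add: algebra_simps)
    qed
    then show ?case using m by (intro bexI[OF _ m]) auto
  next
    case (plus f g)
    then obtain f' g' where fg: "f' \<in> hexp_sums j a b" "g' \<in> hexp_sums j a b"
      "\<And>x. ((\<lambda>t. f (x + t *\<^sub>R axis i 1)) has_vector_derivative f' x) (at 0)"
      "\<And>x. ((\<lambda>t. g (x + t *\<^sub>R axis i 1)) has_vector_derivative g' x) (at 0)" by blast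
    then show ?case
      by (intro bexI[of _ "\<lambda>x. f' x + g' x"]) (auto intro: has_vector_derivative_add hexp_sums.plus)
  qed
qed

section \<open>Mollifier kernels and test functions\<close>

lemma integrable_compact_support:
  fixes f :: "R2 \<Rightarrow> 'b::{banach, second_countable_topology}"
  assumes "continuous_on UNIV f" "\<And>x. norm x \<ge> R \<Longrightarrow> f x = 0"
  shows "integrable lborel f"
proof -
  have "integrable lborel (\<lambda>x. indicator (cball 0 R) x *\<^sub>R f x)"
    by (rule borel_integrable_compact) (use assms in \<open>auto intro: continuous_on_subset\<close>)
  moreover have "(\<lambda>x. indicator (cball 0 R) x *\<^sub>R f x) = f"
    using assms(2) by (auto simp: fun_eq_iff indicator_def)
  ultimately show ?thesis by simp
qed

text \<open>Real valued, although only its complex embedding is smooth in the sense used here: it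
  also serves as a probability density in \<open>jensen_sq\<close>.\<close>

definition kern :: "real \<Rightarrow> (R2 \<Rightarrow> real) \<Rightarrow> bool" where
  "kern \<delta> \<rho> \<longleftrightarrow> smooth (\<lambda>x. complex_of_real (\<rho> x)) \<and> (\<forall>x. 0 \<le> \<rho> x) \<and> (\<forall>x. norm x \<ge> \<delta> \<longrightarrow> \<rho> x = 0)
     \<and> integrable lborel \<rho> \<and> (LINT x|lborel. \<rho> x) = 1"

lemma kern_exists:
  assumes "\<delta> > 0" shows "\<exists>\<rho>. kern \<delta> \<rho>"
proof -
  \<comment> \<open>The product of four flat functions lives on the square with half side
    \<open>e\<close>, where the sum of the coordinates in modulus, hence the norm, is below
    \<open>2 * e\<close>.\<close>
  define e where "e = \<delta> / 2"
  have e: "e > 0" using assms by (simp add: e_def)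
  define q where "q x = hexp 0 (e + 1 * x $ 1) * hexp 0 (e + (-1) * x $ 1) * hexp 0 (e + 1 * x $ 2) * hexp 0 (e + (-1) * x $ 2)" for x :: R2
  have q0: "q x \<ge> 0" for x by (simp add: q_def hexp_def)
  have sm: "smooth (\<lambda>x. complex_of_real (q x))"
    unfolding q_def of_real_mult by (intro smooth_mult smooth_hexp)
  have qz: "q x = 0" if "norm x \<ge> \<delta>" for x
  proof (rule ccontr)
    assume "q x \<noteq> 0"
    then have "\<bar>x $ 1\<bar> < e \<and> \<bar>x $ 2\<bar> < e" by (auto simp: q_def hexp_def split: if_splits)
    moreover have "norm x \<le> \<bar>x $ 1\<bar> + \<bar>x $ 2\<bar>" using norm_le_l1_cart[of x] by (simp add: sum_2)
    ultimately show False using that by (simp add: e_def)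
  qed
  have qc: "continuous_on UNIV q"
    unfolding q_def by (intro continuous_intros continuous_on_compose2[OF continuous_hexp]) auto
  have qi: "integrable lborel q" by (rule integrable_compact_support[OF qc qz])
  define I where "I = (LINT x|lborel. q x)"
  \<comment> \<open>The bump is continuous and positive at \<open>0\<close>; a vanishing integral
    would make a nonempty open set negligible.\<close>
  have "I \<noteq> 0"
  proof
    assume "I = 0"
    then have "AE x in lborel. q x = 0"
      using integral_nonneg_eq_0_iff_AE[OF qi] q0 by (simp add: I_def)
    then have "AE x in lebesgue. q x = 0" by (rule AE_completion)
    then obtain N where N: "N \<in> null_sets lebesgue" "{x. q x \<noteq> 0} \<subseteq> N"
      unfolding eventually_ae_filter by auto
    have "open {x. q x \<noteq> 0}"
      using open_Collect_neq[OF qc continuous_on_const[of UNIV "0::real"]] .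
    moreover have "0 \<in> {x. q x \<noteq> 0}" using e by (simp add: q_def hexp_def)
    ultimately have "\<not> negligible {x. q x \<noteq> 0}" using open_not_negligible by blast
    then show False using N negligible_iff_null_sets negligible_subset by blast
  qed
  moreover have "I \<ge> 0" unfolding I_def using q0 by simp
  ultimately have I: "I > 0" by simp
  have "smooth (\<lambda>x. complex_of_real (q x / I))"
    using smooth_cmult[OF sm, of "complex_of_real (1 / I)"] by simp
  then have "kern \<delta> (\<lambda>x. q x / I)" using q0 qz qi I by (auto simp: kern_def I_def[symmetric])
  then show ?thesis by (rule exI[of _ "\<lambda>x. q x / I"])
qed

lemma kern_smooth: "kern \<delta> \<rho> \<Longrightarrow> smooth (\<lambda>x. complex_of_real (\<rho> x))" by (simp add: kern_def)

lemma kern_borel: "kern \<delta> \<rho> \<Longrightarrow> \<rho> \<in> borel_measurable borel"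
proof -
  assume "kern \<delta> \<rho>"
  then have "(\<lambda>x. Re (complex_of_real (\<rho> x))) \<in> borel_measurable borel"
    using smooth_borel[OF kern_smooth] by measurable
  then show ?thesis by simp
qed

lemma tsupp_subset: "closed K \<Longrightarrow> (\<And>x. x \<notin> K \<Longrightarrow> \<phi> x = 0) \<Longrightarrow> tsupp \<phi> \<subseteq> K"
  unfolding tsupp_def by (rule closure_minimal) auto

lemma test_fnI:
  assumes "smooth \<phi>" "compact K" "K \<subseteq> U" "\<And>x. x \<notin> K \<Longrightarrow> \<phi> x = 0"
  shows "test_fn U \<phi>"
proof -
  have s: "tsupp \<phi> \<subseteq> K" using tsupp_subset[of K \<phi>] assms compact_imp_closed by blast
  moreover have "compact (tsupp \<phi>)"
    using compact_Int_closed[OF assms(2), of "tsupp \<phi>"] s by (simp add: tsupp_def Int_absorb1)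
  ultimately show ?thesis using assms by (auto simp: test_fn_def)
qed

lemma tsupp_zero: "x \<notin> tsupp \<phi> \<Longrightarrow> \<phi> x = 0"
  unfolding tsupp_def using closure_subset[of "{x. \<phi> x \<noteq> 0}"] by blast

lemma test_fn_smooth: "test_fn U \<phi> \<Longrightarrow> smooth \<phi>" by (simp add: test_fn_def)

lemma test_fn_bounded_support:
  assumes "test_fn U \<phi>" obtains R where "R > 0" "\<And>x. norm x \<ge> R \<Longrightarrow> \<phi> x = 0"
proof -
  have "bounded (tsupp \<phi>)" using assms compact_imp_bounded by (auto simp: test_fn_def)
  then obtain B where "\<And>x. x \<in> tsupp \<phi> \<Longrightarrow> norm x < B" "B > 0"
    using bounded_pos_less by blast
  then show ?thesis using that[of B] tsupp_zero[of _ \<phi>] by (metis not_le)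
qed

lemma pd_zero_outside:
  fixes \<phi> :: "R2 \<Rightarrow> 'a::real_normed_vector"
  assumes "closed K" "\<And>x. x \<notin> K \<Longrightarrow> \<phi> x = 0" "x \<notin> K"
  shows "pd \<phi> j x = 0"
proof (rule pd_eqI)
  have "open (- K)" using assms by auto
  then obtain d where d: "d > 0" "ball x d \<subseteq> - K" using assms(3) openE by blast
  have "((\<lambda>t::real. 0 :: 'a) has_vector_derivative 0) (at 0)" by simp
  then show "((\<lambda>t. \<phi> (x + t *\<^sub>R axis j 1)) has_vector_derivative 0) (at 0)"
  proof (rule has_vector_derivative_transform_within_open[of _ _ _ "ball 0 d"])
    fix t :: real assume "t \<in> ball 0 d"
    then have "x + t *\<^sub>R axis j 1 \<in> ball x d" by (simp add: dist_norm norm_axis_1)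
    then show "0 = \<phi> (x + t *\<^sub>R axis j 1)" using d assms(2) by auto
  qed (use d in auto)
qed

lemma test_fn_pd:
  assumes "test_fn U \<phi>" shows "test_fn U (pd \<phi> j)"
proof (rule test_fnI[of _ "tsupp \<phi>"])
  show "smooth (pd \<phi> j)" using assms by (intro smooth_pd) (simp add: test_fn_def)
  show "pd \<phi> j x = 0" if "x \<notin> tsupp \<phi>" for x
  proof (rule pd_zero_outside[of "tsupp \<phi>"])
    show "closed (tsupp \<phi>)" by (simp add: tsupp_def)
    show "\<phi> y = 0" if "y \<notin> tsupp \<phi>" for y using that by (rule tsupp_zero)
  qed fact
qed (use assms in \<open>auto simp: test_fn_def\<close>)

lemma test_fn_mult:
  assumes "smooth f" "test_fn U \<phi>" shows "test_fn U (\<lambda>x. f x * \<phi> x)"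
proof (rule test_fnI[of _ "tsupp \<phi>"])
  show "smooth (\<lambda>x. f x * \<phi> x)" using assms by (intro smooth_mult) (simp_all add: test_fn_def)
  show "f x * \<phi> x = 0" if "x \<notin> tsupp \<phi>" for x using tsupp_zero[OF that] by simp
qed (use assms in \<open>auto simp: test_fn_def\<close>)

lemma test_fn_cnj:
  assumes "test_fn U \<phi>" shows "test_fn U (\<lambda>x. cnj (\<phi> x))"
proof (rule test_fnI[of _ "tsupp \<phi>"])
  show "smooth (\<lambda>x. cnj (\<phi> x))" using assms by (intro smooth_cnj) (simp add: test_fn_def)
  show "cnj (\<phi> x) = 0" if "x \<notin> tsupp \<phi>" for x using tsupp_zero[OF that] by simp
qed (use assms in \<open>auto simp: test_fn_def\<close>)

lemma test_fn_mono: "test_fn U \<phi> \<Longrightarrow> U \<subseteq> V \<Longrightarrow> test_fn V \<phi>"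
  by (auto simp: test_fn_def)

lemma compact_support_bounded:
  fixes f :: "R2 \<Rightarrow> complex"
  assumes "continuous_on UNIV f" "\<And>x. norm x \<ge> R \<Longrightarrow> f x = 0"
  obtains B where "B > 0" "\<And>x. cmod (f x) \<le> B"
proof -
  have "bounded (f ` cball 0 R)"
    by (intro compact_imp_bounded compact_continuous_image continuous_on_subset[OF assms(1)]) auto
  then obtain B where B: "B > 0" "\<And>x. x \<in> cball 0 R \<Longrightarrow> cmod (f x) \<le> B"
    unfolding bounded_pos by auto
  then have "cmod (f x) \<le> B" for x
    using assms(2)[of x] by (cases "norm x \<le> R") (auto simp: less_imp_le)
  then show ?thesis using that B by blast
qed

lemma compact_support_uniform:
  fixes f :: "R2 \<Rightarrow> complex"
  assumes "continuous_on UNIV f" "\<And>x. norm x \<ge> R \<Longrightarrow> f x = 0" "e > 0"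
  obtains d where "d > 0" "\<And>x y. norm (x - y) < d \<Longrightarrow> cmod (f x - f y) < e"
proof -
  have "uniformly_continuous_on (cball 0 (R + 1)) f"
    by (intro compact_uniformly_continuous continuous_on_subset[OF assms(1)]) auto
  then obtain d where d: "d > 0" "\<And>x y. x \<in> cball 0 (R + 1) \<Longrightarrow> y \<in> cball 0 (R + 1) \<Longrightarrow> dist y x < d \<Longrightarrow> dist (f y) (f x) < e"
    unfolding uniformly_continuous_on_def using assms(3) by metis
  show ?thesis
  proof (rule that[of "min d 1"])
    fix x y :: R2 assume xy: "norm (x - y) < min d 1"
    show "cmod (f x - f y) < e"
    proof (cases "norm x \<le> R + 1 \<and> norm y \<le> R + 1")
      case True
      then show ?thesis using d(2)[of y x] xy by (simp add: dist_norm)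
    next
      case False
      have "norm x \<le> norm y + norm (x - y)" "norm y \<le> norm x + norm (x - y)"
        using norm_triangle_ineq[of y "x - y"] norm_triangle_ineq[of x "y - x"] by (auto simp: norm_minus_commute)
      then have "norm x \<ge> R" "norm y \<ge> R" using False xy by auto
      then show ?thesis using assms by simp
    qed
  qed (use d in auto)
qed

section \<open>Mollification\<close>

text \<open>Taken over \<open>lborel\<close> and the whole plane, so that substitution and Tonelli
  apply; a function on a domain enters through a Borel version of its zero extension.\<close>

definition conv :: "(R2 \<Rightarrow> complex) \<Rightarrow> (R2 \<Rightarrow> complex) \<Rightarrow> R2 \<Rightarrow> complex" where
  "conv u \<phi> x = (LINT y|lborel. u y * \<phi> (x - y))"

lemma conv_integrable:
  fixes u \<phi> :: "R2 \<Rightarrow> complex"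
  assumes u: "integrable lborel u" and c: "continuous_on UNIV \<phi>" "\<And>x. norm x \<ge> R \<Longrightarrow> \<phi> x = 0"
  shows "integrable lborel (\<lambda>y. u y * \<phi> (x - y))"
proof -
  obtain B where B: "B > 0" "\<And>x. cmod (\<phi> x) \<le> B" using compact_support_bounded[OF c] by blast
  have [measurable]: "\<phi> \<in> borel_measurable borel" by (intro borel_measurable_continuous_onI c)
  have [measurable]: "u \<in> borel_measurable borel" using u by (auto dest: borel_measurable_integrable)
  show ?thesis
    by (rule Bochner_Integration.integrable_bound[OF integrable_mult_left[OF integrable_norm[OF u], of B]])
       (use B in \<open>auto intro!: mult_left_mono simp: norm_mult less_imp_le\<close>)
qed

lemma conv_diff_bound:
  fixes u :: "R2 \<Rightarrow> complex" and w :: "R2 \<Rightarrow> R2 \<Rightarrow> complex"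
  assumes u: "integrable lborel u" and c: "\<And>x. integrable lborel (\<lambda>y. u y * w x y)"
    and "\<And>y. cmod (w x y) \<le> e"
  shows "cmod (LINT y|lborel. u y * w x y) \<le> e * (LINT y|lborel. cmod (u y))"
proof -
  have "cmod (LINT y|lborel. u y * w x y) \<le> (LINT y|lborel. cmod (u y * w x y))" by (rule integral_norm_bound)
  also have "\<dots> \<le> (LINT y|lborel. e * cmod (u y))"
  proof (rule integral_mono)
    show "integrable lborel (\<lambda>y. cmod (u y * w x y))" by (rule integrable_norm[OF c])
    show "cmod (u y * w x y) \<le> e * cmod (u y)" for y
      using mult_left_mono[OF assms(3)[of y], of "cmod (u y)"] by (simp add: norm_mult mult.commute)
  qed (use u in simp)
  finally show ?thesis by simp
qed

lemma test_increment:
  fixes \<phi> :: "R2 \<Rightarrow> complex"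
  assumes "smooth \<phi>" "\<And>x y. norm (x - y) < d \<Longrightarrow> cmod (pd \<phi> j x - pd \<phi> j y) < e" "\<bar>h\<bar> < d"
  shows "cmod (\<phi> (z + h *\<^sub>R axis j 1) - \<phi> z - h *\<^sub>R pd \<phi> j z) \<le> \<bar>h\<bar> * e"
proof (rule axis_increment)
  fix s assume "s \<in> closed_segment 0 h"
  then have "\<bar>s\<bar> < d" using assms(3) by (auto simp: closed_segment_eq_real_ivl split: if_splits)
  then show "cmod (pd \<phi> j (z + s *\<^sub>R axis j 1) - pd \<phi> j z) \<le> e"
    using assms(2)[of "z + s *\<^sub>R axis j 1" z] by (simp add: norm_axis_1)
  show "((\<lambda>t. \<phi> (z + s *\<^sub>R axis j 1 + t *\<^sub>R axis j 1)) has_vector_derivative pd \<phi> j (z + s *\<^sub>R axis j 1)) (at 0)"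
    by (rule smooth_pd_has[OF assms(1)])
qed

text \<open>The difference quotient falls on the test function, whose partial derivatives are
  uniformly continuous; integrability of \<open>u\<close> then suffices to pass it under the
  integral.\<close>

lemma conv_has:
  assumes u: "integrable lborel u" and "test_fn UNIV \<phi>"
  shows "((\<lambda>t. conv u \<phi> (x + t *\<^sub>R axis j 1)) has_vector_derivative conv u (pd \<phi> j) x) (at 0)"
    and "continuous_on UNIV (conv u \<phi>)"
proof -
  have sm: "smooth \<phi>" using assms(2) by (rule test_fn_smooth)
  obtain R where R: "R > 0" "\<And>x. norm x \<ge> R \<Longrightarrow> \<phi> x = 0" using test_fn_bounded_support[OF assms(2)] by blast
  obtain R' where R': "R' > 0" "\<And>x. norm x \<ge> R' \<Longrightarrow> pd \<phi> j x = 0"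
    using test_fn_bounded_support[OF test_fn_pd[OF assms(2)]] by blast
  note i1 = conv_integrable[OF u smooth_continuous[OF sm] R(2)]
  note i2 = conv_integrable[OF u smooth_continuous[OF smooth_pd[OF sm]] R'(2)]
  define A where "A = (LINT y|lborel. cmod (u y))"
  have A: "A \<ge> 0" by (simp add: A_def)
  show "((\<lambda>t. conv u \<phi> (x + t *\<^sub>R axis j 1)) has_vector_derivative conv u (pd \<phi> j) x) (at 0)"
    unfolding has_vector_derivative_def has_derivative_at_alt
  proof (intro conjI allI impI)
    show "bounded_linear (\<lambda>t. t *\<^sub>R conv u (pd \<phi> j) x)" by (rule bounded_linear_scaleR_left)
    fix e :: real assume e: "e > 0"
    define e' where "e' = e / (A + 1)"
    have e': "e' > 0" using e A by (simp add: e'_def)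
    obtain d where d: "d > 0" "\<And>x y. norm (x - y) < d \<Longrightarrow> cmod (pd \<phi> j x - pd \<phi> j y) < e'"
      using compact_support_uniform[OF smooth_continuous[OF smooth_pd[OF sm]] R'(2) e'] by blast
    show "\<exists>d>0. \<forall>h. norm (h - 0) < d \<longrightarrow> norm (conv u \<phi> (x + h *\<^sub>R axis j 1) - conv u \<phi> (x + 0 *\<^sub>R axis j 1)
        - (h - 0) *\<^sub>R conv u (pd \<phi> j) x) \<le> e * norm (h - 0)"
    proof (intro exI[of _ d] conjI allI impI)
      fix h :: real assume "norm (h - 0) < d"
      then have h: "\<bar>h\<bar> < d" by simp
      let ?w = "\<lambda>x y. \<phi> ((x - y) + h *\<^sub>R axis j 1) - \<phi> (x - y) - h *\<^sub>R pd \<phi> j (x - y)"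
      have eq: "u y * ?w x y = u y * \<phi> ((x + h *\<^sub>R axis j 1) - y) - u y * \<phi> (x - y) - h *\<^sub>R (u y * pd \<phi> j (x - y))" for x y
        by (simp add: algebra_simps)
      have "conv u \<phi> (x + h *\<^sub>R axis j 1) - conv u \<phi> x - h *\<^sub>R conv u (pd \<phi> j) x = (LINT y|lborel. u y * ?w x y)"
        unfolding eq conv_def using i1 i2 by (simp add: Bochner_Integration.integral_diff)
      also have "cmod \<dots> \<le> (\<bar>h\<bar> * e') * A" unfolding A_def
      proof (rule conv_diff_bound[OF u])
        show "integrable lborel (\<lambda>y. u y * ?w x y)" for x
          unfolding eq using i1 i2 by auto
        show "cmod (?w x y) \<le> \<bar>h\<bar> * e'" for y by (rule test_increment[OF sm d(2) h])
      qed
      also have "\<dots> \<le> e * \<bar>h\<bar>"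
      proof -
        have "e' * A \<le> e" using e A by (simp add: e'_def field_simps)
        then show ?thesis using mult_left_mono[of "e' * A" e "\<bar>h\<bar>"] by (simp add: mult_ac)
      qed
      finally show "norm (conv u \<phi> (x + h *\<^sub>R axis j 1) - conv u \<phi> (x + 0 *\<^sub>R axis j 1)
        - (h - 0) *\<^sub>R conv u (pd \<phi> j) x) \<le> e * norm (h - 0)" by simp
    qed (use d in auto)
  qed
  show "continuous_on UNIV (conv u \<phi>)"
    unfolding continuous_on_iff
  proof (intro ballI allI impI)
    fix x and e :: real assume e: "e > 0"
    define e' where "e' = e / (A + 1)"
    have e': "e' > 0" using e A by (simp add: e'_def)
    obtain d where d: "d > 0" "\<And>x y. norm (x - y) < d \<Longrightarrow> cmod (\<phi> x - \<phi> y) < e'"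
      using compact_support_uniform[OF smooth_continuous[OF sm] R(2) e'] by blast
    show "\<exists>d>0. \<forall>x'\<in>UNIV. dist x' x < d \<longrightarrow> dist (conv u \<phi> x') (conv u \<phi> x) < e"
    proof (intro exI[of _ d] conjI ballI impI)
      fix x' assume x': "dist x' x < d"
      have "conv u \<phi> x' - conv u \<phi> x = (LINT y|lborel. u y * (\<phi> (x' - y) - \<phi> (x - y)))"
        unfolding conv_def right_diff_distrib using i1 by (simp add: Bochner_Integration.integral_diff)
      also have "cmod \<dots> \<le> e' * A" unfolding A_def
      proof (rule conv_diff_bound[OF u, where w="\<lambda>x' y. \<phi> (x' - y) - \<phi> (x - y)"])
        show "integrable lborel (\<lambda>y. u y * (\<phi> (x' - y) - \<phi> (x - y)))" for x'
          unfolding right_diff_distrib using i1 by auto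
        show "cmod (\<phi> (x' - y) - \<phi> (x - y)) \<le> e'" for y
          using d(2)[of "x' - y" "x - y"] x' by (simp add: dist_norm less_imp_le)
      qed
      also have "\<dots> < e" using e A by (simp add: e'_def field_simps)
      finally show "dist (conv u \<phi> x') (conv u \<phi> x) < e" by (simp add: dist_norm)
    qed (use d in auto)
  qed
qed

lemma conv_smooth:
  assumes u: "integrable lborel u" and "test_fn UNIV \<phi>"
  shows "smooth (conv u \<phi>)"
proof (rule smoothI[of _ "{h. \<exists>\<phi>. test_fn UNIV \<phi> \<and> h = conv u \<phi>}"])
  fix \<psi> assume "\<psi> \<in> {h. \<exists>\<phi>. test_fn UNIV \<phi> \<and> h = conv u \<phi>}"
  then obtain \<phi> where p: "test_fn UNIV \<phi>" "\<psi> = conv u \<phi>" by blast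
  show "continuous_on UNIV \<psi>" unfolding p by (rule conv_has[OF u p(1)])
  fix j
  show "\<exists>\<psi>'\<in>{h. \<exists>\<phi>. test_fn UNIV \<phi> \<and> h = conv u \<phi>}. \<forall>x. ((\<lambda>t. \<psi> (x + t *\<^sub>R axis j 1)) has_vector_derivative \<psi>' x) (at 0)"
    unfolding p using conv_has(1)[OF u p(1)] test_fn_pd[OF p(1)] by (intro bexI[of _ "conv u (pd \<phi> j)"]) auto
qed (use assms in blast)

lemma conv_pd:
  assumes "integrable lborel u" "test_fn UNIV \<phi>" shows "pd (conv u \<phi>) j x = conv u (pd \<phi> j) x"
  by (rule pd_eqI[OF conv_has(1)[OF assms]])

text \<open>By translation invariance the integral of a difference quotient is exactly zero, and the
  quotient differs from the derivative by a uniformly small function on a fixed ball. This is the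
  only source of integration by parts in the development.\<close>

lemma integral_pd_zero:
  assumes "test_fn UNIV \<psi>" shows "(LINT x|lborel. pd \<psi> j x) = 0"
proof -
  have sm: "smooth \<psi>" using assms by (rule test_fn_smooth)
  obtain R1 where R1: "R1 > 0" "\<And>x. norm x \<ge> R1 \<Longrightarrow> \<psi> x = 0" using test_fn_bounded_support[OF assms] by blast
  obtain R2 where R2: "R2 > 0" "\<And>x. norm x \<ge> R2 \<Longrightarrow> pd \<psi> j x = 0"
    using test_fn_bounded_support[OF test_fn_pd[OF assms]] by blast
  define R where "R = max R1 R2"
  have R: "\<And>x. norm x \<ge> R \<Longrightarrow> \<psi> x = 0" "\<And>x. norm x \<ge> R \<Longrightarrow> pd \<psi> j x = 0"
    using R1 R2 by (auto simp: R_def)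
  define V where "V = measure lborel (cball (0::R2) (R + 1))"
  have fin: "emeasure lborel (cball (0::R2) (R + 1)) < \<infinity>" by (rule emeasure_lborel_cball_finite)
  have i1: "integrable lborel \<psi>" by (rule integrable_compact_support[OF smooth_continuous[OF sm] R(1)])
  have i2: "integrable lborel (pd \<psi> j)" by (rule integrable_compact_support[OF smooth_continuous[OF smooth_pd[OF sm]] R(2)])
  have i3: "integrable lborel (\<lambda>x. \<psi> (x + a))" "(LINT x|lborel. \<psi> (x + a)) = (LINT x|lborel. \<psi> x)" for a
    using lborel_distr_plus[of a] integrable_distr_eq[of "(+) a" lborel borel \<psi>] integral_distr[of "(+) a" lborel borel \<psi>] i1 smooth_borel[OF sm]
    by (auto simp: add.commute)
  have "cmod (LINT x|lborel. pd \<psi> j x) \<le> e * V" if e: "e > 0" for e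
  proof -
    obtain d where d: "d > 0" "\<And>x y. norm (x - y) < d \<Longrightarrow> cmod (pd \<psi> j x - pd \<psi> j y) < e"
      using compact_support_uniform[OF smooth_continuous[OF smooth_pd[OF sm]] R(2) e] by blast
    \<comment> \<open>Shifts below \<open>1\<close> keep everything inside the ball of radius
      \<open>R + 1\<close>, whose volume is a bound independent of \<open>h\<close>.\<close>
    define h where "h = min (d / 2) (1 / 2)"
    have h: "h > 0" "\<bar>h\<bar> < d" "h < 1" using d by (auto simp: h_def)
    let ?w = "\<lambda>x. \<psi> (x + h *\<^sub>R axis j 1) - \<psi> x - h *\<^sub>R pd \<psi> j x"
    have b: "cmod (?w x) \<le> h * e * indicator (cball 0 (R + 1)) x" for x
    proof (cases "norm x \<le> R + 1")
      case True
      then show ?thesis using test_increment[OF sm d(2) h(2), of x] h by simp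
    next
      case False
      have "norm x \<le> norm (x + h *\<^sub>R axis j 1) + h"
        using norm_triangle_ineq4[of "x + h *\<^sub>R axis j 1" "h *\<^sub>R (axis j 1 :: R2)"] h by (simp add: norm_axis_1)
      then have "norm (x + h *\<^sub>R axis j 1) \<ge> R" using False h by simp
      then show ?thesis using False R by simp
    qed
    have "h * cmod (LINT x|lborel. pd \<psi> j x) = cmod (LINT x|lborel. ?w x)"
      using i1 i2 i3 h by (simp add: Bochner_Integration.integral_diff)
    also have "\<dots> \<le> (LINT x|lborel. cmod (?w x))" by (rule integral_norm_bound)
    also have "\<dots> \<le> (LINT x|lborel. h * e * indicator (cball (0::R2) (R + 1)) x)"
    proof (rule integral_mono_AE)
      show "integrable lborel (\<lambda>x. cmod (?w x))" using i1 i2 i3 by (intro integrable_norm) auto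
      show "integrable lborel (\<lambda>x. h * e * indicat_real (cball (0::R2) (R + 1)) x)" using fin by auto
    qed (use b in auto)
    also have "\<dots> = h * e * V" using fin by (simp add: V_def)
    finally show ?thesis using h by simp
  qed
  note * = this
  have "V \<ge> 0" by (simp add: V_def)
  have "cmod (LINT x|lborel. pd \<psi> j x) \<le> 0"
  proof (rule field_le_epsilon)
    fix e :: real assume "e > 0"
    then have "cmod (LINT x|lborel. pd \<psi> j x) \<le> e / (V + 1) * V"
      using * [of "e / (V + 1)"] \<open>V \<ge> 0\<close> by simp
    also have "\<dots> \<le> 0 + e" using \<open>V \<ge> 0\<close> \<open>e > 0\<close> by (simp add: field_simps)
    finally show "cmod (LINT x|lborel. pd \<psi> j x) \<le> 0 + e" .
  qed
  then show ?thesis by simp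
qed

section \<open>Mean-square continuity under dilation and translation\<close>

lemma nn_integral_affine:
  fixes F :: "R2 \<Rightarrow> ennreal"
  assumes [measurable]: "F \<in> borel_measurable borel" and c: "c \<noteq> 0"
  shows "(\<integral>\<^sup>+x. F (a + c *\<^sub>R x) \<partial>lborel) = ennreal (1 / c\<^sup>2) * (\<integral>\<^sup>+x. F x \<partial>lborel)"
proof -
  have "(\<integral>\<^sup>+x. F x \<partial>lborel) = ennreal (c\<^sup>2) * (\<integral>\<^sup>+x. F (a + c *\<^sub>R x) \<partial>lborel)"
    by (subst lborel_affine[OF c, of a])
       (simp add: nn_integral_density nn_integral_distr nn_integral_cmult)
  then show ?thesis using c by (simp add: mult.assoc[symmetric] flip: ennreal_mult)
qed

lemma sqi_affine:
  fixes u :: "R2 \<Rightarrow> complex"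
  assumes u: "sqi lborel u" and c: "c \<noteq> 0"
  shows "sqi lborel (\<lambda>x. u (a + c *\<^sub>R x))" "nrm2 lborel (\<lambda>x. u (a + c *\<^sub>R x)) = nrm2 lborel u / \<bar>c\<bar>"
proof -
  have m [measurable]: "u \<in> borel_measurable borel" using sqi_measurable[OF u] by simp
  have "(\<integral>\<^sup>+x. ennreal ((cmod (u (a + c *\<^sub>R x)))\<^sup>2) \<partial>lborel) = ennreal (1 / c\<^sup>2) * ennreal ((nrm2 lborel u)\<^sup>2)"
    using nn_integral_affine[of "\<lambda>x. ennreal ((cmod (u x))\<^sup>2)" c a] c nrm2_nn_integral[OF u] by simp
  also have "\<dots> = ennreal ((nrm2 lborel u / \<bar>c\<bar>)\<^sup>2)"
    by (simp add: power_divide flip: ennreal_mult)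
  finally have *: "(\<integral>\<^sup>+x. ennreal ((cmod (u (a + c *\<^sub>R x)))\<^sup>2) \<partial>lborel) = ennreal ((nrm2 lborel u / \<bar>c\<bar>)\<^sup>2)" .
  show s: "sqi lborel (\<lambda>x. u (a + c *\<^sub>R x))"
    by (rule nrm2_le_nn_integral(1)[where c="nrm2 lborel u / \<bar>c\<bar>"]) (auto simp: * )
  have "(nrm2 lborel (\<lambda>x. u (a + c *\<^sub>R x)))\<^sup>2 = (nrm2 lborel u / \<bar>c\<bar>)\<^sup>2"
    using nrm2_nn_integral[OF s] * by simp
  then show "nrm2 lborel (\<lambda>x. u (a + c *\<^sub>R x)) = nrm2 lborel u / \<bar>c\<bar>"
    by (metis abs_ge_zero divide_nonneg_nonneg nrm2_nonneg power2_eq_imp_eq)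
qed

lemma nrm2_tendsto_zero_DCT:
  fixes f :: "nat \<Rightarrow> 'a \<Rightarrow> complex"
  assumes "\<And>n. f n \<in> borel_measurable M" "AE x in M. (\<lambda>n. f n x) \<longlonglongrightarrow> 0"
    and "integrable M w" "\<And>n. AE x in M. (cmod (f n x))\<^sup>2 \<le> w x"
  shows "(\<lambda>n. nrm2 M (f n)) \<longlonglongrightarrow> 0" "\<And>n. sqi M (f n)"
proof -
  have [measurable]: "\<And>n. f n \<in> borel_measurable M" by fact
  have "(\<lambda>n. LINT x|M. (cmod (f n x))\<^sup>2) \<longlonglongrightarrow> (LINT x|M. 0)"
  proof (rule integral_dominated_convergence[where w=w])
    show "AE x in M. (\<lambda>n. (cmod (f n x))\<^sup>2) \<longlonglongrightarrow> 0"
      using assms(2) by eventually_elim (metis norm_zero tendsto_norm tendsto_power zero_power2)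
  qed (use assms in auto)
  then have "(\<lambda>n. sqrt (LINT x|M. (cmod (f n x))\<^sup>2)) \<longlonglongrightarrow> sqrt 0"
    by (intro tendsto_real_sqrt) simp
  then show "(\<lambda>n. nrm2 M (f n)) \<longlonglongrightarrow> 0" by (simp add: nrm2_def)
  have "integrable M (\<lambda>x. (cmod (f n x))\<^sup>2)" for n
    by (rule Bochner_Integration.integrable_bound[OF assms(3)]) (use assms(4)[of n] in auto)
  then show "\<And>n. sqi M (f n)" by (simp add: sqi_def)
qed

text \<open>A truncation of the values that is continuous; together with \<open>cutoff\<close>, a
  truncation in the variable, it can be applied to \<open>u\<close> and to its continuous
  approximants alike without leaving the continuous functions.\<close>

definition clip :: "real \<Rightarrow> complex \<Rightarrow> complex" where
  "clip m z = (m / max m (cmod z)) *\<^sub>R z"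

definition cutoff :: "real \<Rightarrow> R2 \<Rightarrow> real" where
  "cutoff m x = max 0 (min 1 (m + 1 - norm x))"

lemma clip_props:
  assumes "m > 0"
  shows "cmod (clip m z) \<le> m" "cmod z \<le> m \<Longrightarrow> clip m z = z" "continuous_on UNIV (clip m)"
    "0 \<le> m / max m (cmod z)" "m / max m (cmod z) \<le> 1"
proof -
  have mx: "max m (cmod z) > 0" for z using assms by (auto simp: max_def)
  show "cmod (clip m z) \<le> m" using assms mx[of z] by (auto simp: clip_def field_simps max_def)
  show "cmod z \<le> m \<Longrightarrow> clip m z = z" using assms by (simp add: clip_def max_absorb1)
  show "continuous_on UNIV (clip m)" unfolding clip_def
    using mx by (intro continuous_intros) (auto simp: less_imp_neq[symmetric])
  show "0 \<le> m / max m (cmod z)" "m / max m (cmod z) \<le> 1" using assms mx[of z] by (auto simp: field_simps)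
qed

lemma cutoff_props: "0 \<le> cutoff m x" "cutoff m x \<le> 1" "norm x \<le> m \<Longrightarrow> cutoff m x = 1"
  "norm x \<ge> m + 1 \<Longrightarrow> cutoff m x = 0" "continuous_on UNIV (cutoff m)"
  by (auto simp: cutoff_def intro!: continuous_intros)

text \<open>A measurable function is almost everywhere a limit of continuous ones, but without
  domination. Truncating \<open>u\<close> and the approximants in the same way supplies a dominating
  function for both limits: first in the truncation level \<open>m\<close>, then in the index
  \<open>n\<close>.\<close>

lemma L2_approx_continuous:
  fixes u :: "R2 \<Rightarrow> complex"
  assumes u: "sqi lborel u" and e: "e > 0"
  obtains g R where "continuous_on UNIV g" "R > 0" "\<And>x. norm x \<ge> R \<Longrightarrow> g x = 0"
    "sqi lborel g" "nrm2 lborel (\<lambda>x. u x - g x) < e"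
proof -
  have um [measurable]: "u \<in> borel_measurable borel" using sqi_measurable[OF u] by simp
  then have "u \<in> borel_measurable lebesgue" by (simp add: measurable_completion)
  then have "u \<in> borel_measurable (lebesgue_on UNIV)" by simp
  then have "u measurable_on UNIV" by (intro lebesgue_measurable_imp_measurable_on) auto
  then obtain N g where N: "negligible N" and g: "\<And>n::nat. continuous_on UNIV (g n)"
    and lim: "\<And>x. x \<notin> N \<Longrightarrow> (\<lambda>n. g n x) \<longlonglongrightarrow> u x"
    unfolding measurable_on_def by auto
  from N have "N \<in> null_sets lebesgue" by (simp add: negligible_iff_null_sets)
  then obtain N' where N': "N' \<in> null_sets lborel" "N \<subseteq> N'"
    by (auto simp: null_sets_completion_iff2)
  have AEN: "AE x in lborel. x \<notin> N" using N' by (auto simp: eventually_ae_filter)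
  define um where "um m x = cutoff (real (Suc m)) x *\<^sub>R clip (real (Suc m)) (u x)" for m x
  define h where "h m n x = cutoff (real (Suc m)) x *\<^sub>R clip (real (Suc m)) (g n x)" for m n x
  have clipm [measurable]: "clip (real (Suc m)) \<in> borel_measurable borel" for m
    by (intro borel_measurable_continuous_onI clip_props) simp
  have cutm [measurable]: "cutoff a \<in> borel_measurable borel" for a
    by (intro borel_measurable_continuous_onI cutoff_props)
  have gm [measurable]: "g n \<in> borel_measurable borel" for n
    by (intro borel_measurable_continuous_onI g)
  have umm [measurable]: "um m \<in> borel_measurable borel" for m unfolding um_def by measurable
  have hm [measurable]: "h m n \<in> borel_measurable borel" for m n unfolding h_def by measurable
  have "(\<lambda>m. nrm2 lborel (\<lambda>x. u x - um m x)) \<longlonglongrightarrow> 0"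
  proof (rule nrm2_tendsto_zero_DCT(1)[where w="\<lambda>x. (cmod (u x))\<^sup>2"])
    show "AE x in lborel. (\<lambda>m. u x - um m x) \<longlonglongrightarrow> 0"
    proof (rule AE_I2)
      fix x
      obtain m0 where m0: "norm x \<le> real m0" "cmod (u x) \<le> real m0"
        using real_arch_simple[of "max (norm x) (cmod (u x))"] by auto
      have "u x - um m x = 0" if "m \<ge> m0" for m
        using m0 that clip_props(2)[of "real (Suc m)" "u x"] cutoff_props(3)[of x "real (Suc m)"] by (simp add: um_def)
      then show "(\<lambda>m. u x - um m x) \<longlonglongrightarrow> 0"
        by (intro tendsto_eventually) (auto simp: eventually_sequentially)
    qed
    show "AE x in lborel. (cmod (u x - um m x))\<^sup>2 \<le> (cmod (u x))\<^sup>2" for m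
    proof (rule AE_I2)
      fix x
      define c where "c = cutoff (real (Suc m)) x * (real (Suc m) / max (real (Suc m)) (cmod (u x)))"
      have c: "0 \<le> c" "c \<le> 1" unfolding c_def
        by (intro mult_nonneg_nonneg mult_le_one cutoff_props clip_props; simp)+
      have "u x - um m x = (1 - c) *\<^sub>R u x" by (simp add: um_def clip_def c_def algebra_simps)
      then have "cmod (u x - um m x) \<le> cmod (u x)" using c by (simp add: mult_left_le_one_le)
      then show "(cmod (u x - um m x))\<^sup>2 \<le> (cmod (u x))\<^sup>2" by (intro power_mono) auto
    qed
  qed (use u in \<open>auto simp: sqi_def\<close>)
  then have "\<forall>\<^sub>F m in sequentially. nrm2 lborel (\<lambda>x. u x - um m x) < e / 2"
    using e by (intro order_tendstoD) auto
  then obtain m where m: "nrm2 lborel (\<lambda>x. u x - um m x) < e / 2" by (auto simp: eventually_sequentially)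
  define M where "M = real (Suc m)"
  have M: "M > 0" by (simp add: M_def)
  have bd: "cmod (cutoff M x *\<^sub>R clip M z) \<le> M * indicator (cball 0 (M + 1)) x" for x :: R2 and z
    using cutoff_props(1,2)[of M x] cutoff_props(4)[of M x] clip_props(1)[OF M, of z] M
      mult_mono[of "cutoff M x" 1 "cmod (clip M z)" M]
    by (auto simp: indicator_def)
  have fin: "emeasure lborel (cball (0::R2) r) < \<infinity>" for r by (rule emeasure_lborel_cball_finite)
  have sqb: "sqi lborel (\<lambda>x. cutoff M x *\<^sub>R clip M (q x))" if [measurable]: "q \<in> borel_measurable borel" for q
  proof -
    have [measurable]: "clip M \<in> borel_measurable borel" using clipm by (simp add: M_def)
    have "integrable lborel (\<lambda>x. (cmod (cutoff M x *\<^sub>R clip M (q x)))\<^sup>2)"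
    proof (rule Bochner_Integration.integrable_bound[where f="\<lambda>x. M\<^sup>2 * indicator (cball (0::R2) (M + 1)) x"])
      show "AE x in lborel. norm ((cmod (cutoff M x *\<^sub>R clip M (q x)))\<^sup>2) \<le> norm (M\<^sup>2 * indicat_real (cball 0 (M + 1)) x)"
      proof (rule AE_I2)
        fix x
        show "norm ((cmod (cutoff M x *\<^sub>R clip M (q x)))\<^sup>2) \<le> norm (M\<^sup>2 * indicat_real (cball 0 (M + 1)) x)"
          using power_mono[OF bd[of x "q x"], of 2] by (auto simp: indicator_def)
      qed
    qed (use fin in auto)
    then show ?thesis by (simp add: sqi_def)
  qed
  have "(\<lambda>n. nrm2 lborel (\<lambda>x. um m x - h m n x)) \<longlonglongrightarrow> 0"
  proof (rule nrm2_tendsto_zero_DCT(1)[where w="\<lambda>x. (2 * M)\<^sup>2 * indicator (cball 0 (M + 1)) x"])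
    show "AE x in lborel. (\<lambda>n. um m x - h m n x) \<longlonglongrightarrow> 0"
      using AEN
    proof eventually_elim
      case (elim x)
      have "(\<lambda>n. h m n x) \<longlonglongrightarrow> um m x" unfolding um_def h_def
        by (intro tendsto_intros continuous_on_tendsto_compose[OF clip_props(3)] lim elim) auto
      then show ?case using tendsto_diff[OF tendsto_const, of "\<lambda>n. h m n x" "um m x" sequentially "um m x"] by simp
    qed
    show "AE x in lborel. (cmod (um m x - h m n x))\<^sup>2 \<le> (2 * M)\<^sup>2 * indicator (cball 0 (M + 1)) x" for n
    proof (rule AE_I2)
      fix x
      have "cmod (um m x - h m n x) \<le> 2 * M * indicator (cball 0 (M + 1)) x"
      proof -
        have "cmod (um m x) \<le> M * indicator (cball 0 (M + 1)) x" "cmod (h m n x) \<le> M * indicator (cball 0 (M + 1)) x"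
          using bd[of x "u x"] bd[of x "g n x"] unfolding um_def h_def M_def by auto
        then show ?thesis using norm_triangle_ineq4[of "um m x" "h m n x"] by linarith
      qed
      from power_mono[OF this, of 2] show "(cmod (um m x - h m n x))\<^sup>2 \<le> (2 * M)\<^sup>2 * indicator (cball 0 (M + 1)) x"
        by (auto simp: indicator_def)
    qed
  qed (use fin in auto)
  then have "\<forall>\<^sub>F n in sequentially. nrm2 lborel (\<lambda>x. um m x - h m n x) < e / 2"
    using e by (intro order_tendstoD) auto
  then obtain n where n: "nrm2 lborel (\<lambda>x. um m x - h m n x) < e / 2" by (auto simp: eventually_sequentially)
  have s1: "sqi lborel (um m)" using sqb[OF \<open>u \<in> borel_measurable borel\<close>] unfolding um_def M_def by simp
  have s2: "sqi lborel (h m n)" using sqb[OF gm, of n] unfolding h_def M_def by simp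
  show ?thesis
  proof (rule that[of "h m n" "M + 1"])
    show "continuous_on UNIV (h m n)" unfolding h_def
      by (intro continuous_on_scaleR cutoff_props continuous_on_compose2[OF clip_props(3) g]) auto
    show "h m n x = 0" if "norm x \<ge> M + 1" for x
      using cutoff_props(4)[OF that] by (simp add: h_def M_def)
    show "nrm2 lborel (\<lambda>x. u x - h m n x) < e"
      using nrm2_triangle_via[OF u s1 s2] m n by simp
  qed (use M s2 in auto)
qed

lemma nrm2_bounded_support:
  fixes f :: "R2 \<Rightarrow> complex"
  assumes f: "f \<in> borel_measurable borel" and b: "\<And>x. cmod (f x) \<le> B" and s: "\<And>x::R2. norm x > R \<Longrightarrow> f x = 0"
    and B: "B \<ge> 0"
  shows "sqi lborel f" "nrm2 lborel f \<le> B * sqrt (measure lborel (cball (0::R2) R))"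
proof -
  have fin: "emeasure lborel (cball (0::R2) R) < \<infinity>" by (rule emeasure_lborel_cball_finite)
  have "(\<integral>\<^sup>+x. ennreal ((cmod (f x))\<^sup>2) \<partial>lborel) \<le> (\<integral>\<^sup>+x. ennreal (B\<^sup>2) * indicator (cball (0::R2) R) x \<partial>lborel)"
    proof (rule nn_integral_mono)
    fix x :: R2
    show "ennreal ((cmod (f x))\<^sup>2) \<le> ennreal (B\<^sup>2) * indicator (cball 0 R) x"
      using power_mono[OF b[of x], of 2] s[of x] by (cases "norm x \<le> R") auto
  qed
  also have "\<dots> = ennreal (B\<^sup>2) * emeasure lborel (cball (0::R2) R)" by (simp add: nn_integral_cmult_indicator)
  also have "\<dots> = ennreal ((B * sqrt (measure lborel (cball (0::R2) R)))\<^sup>2)"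
    using fin by (simp add: emeasure_eq_ennreal_measure power_mult_distrib ennreal_mult)
  finally show "sqi lborel f" "nrm2 lborel f \<le> B * sqrt (measure lborel (cball (0::R2) R))"
    using nrm2_le_nn_integral[of f lborel "B * sqrt (measure lborel (cball (0::R2) R))"] f B by auto
qed

text \<open>For a continuous function of compact support this is uniform continuity on a fixed ball;
  the general case follows because substitution by a dilation near \<open>1\<close> distorts norms
  only boundedly. Dilation and translation are treated together since the density proof applies both
  at once.\<close>

lemma L2_affine_continuous:
  fixes u :: "R2 \<Rightarrow> complex"
  assumes u: "sqi lborel u" and e: "e > 0"
  shows "\<exists>d>0. d < 1/2 \<and> (\<forall>t z. \<bar>t - 1\<bar> < d \<longrightarrow> norm z < d \<longrightarrow> nrm2 lborel (\<lambda>x. u (t *\<^sub>R x - z) - u x) \<le> e)"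
proof -
  obtain g R where g: "continuous_on UNIV g" "R > 0" "\<And>x. norm x \<ge> R \<Longrightarrow> g x = 0"
    "sqi lborel g" "nrm2 lborel (\<lambda>x. u x - g x) < e / 4"
    using L2_approx_continuous[OF u, of "e / 4"] e by auto
  define R2 where "R2 = 2 * (R + 1)"
  define V where "V = sqrt (measure lborel (cball (0::R2) R2))"
  have V: "V \<ge> 0" by (simp add: V_def)
  define e' where "e' = e / 4 / (V + 1)"
  have e': "e' > 0" using e V by (simp add: e'_def)
  obtain d where d: "d > 0" "\<And>x y. norm (x - y) < d \<Longrightarrow> cmod (g x - g y) < e'"
    using compact_support_uniform[OF g(1,3) e'] by blast
  define d' where "d' = min (1/4) (d / (R2 + 1) / 2)"
  have R2: "R2 > 0" using g by (simp add: R2_def)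
  have d': "d' > 0" "d' < 1/2" using d R2 by (auto simp: d'_def)
  have "d' * (R2 + 1) \<le> d / (R2 + 1) / 2 * (R2 + 1)" using R2 by (intro mult_right_mono) (auto simp: d'_def)
  also have "\<dots> = d / 2" using R2 by (simp add: field_simps)
  also have "\<dots> < d" using d by simp
  finally have d'3: "d' * (R2 + 1) < d" .
  note d' = d' d'3
  show ?thesis
  proof (intro exI[of _ d'] conjI allI impI)
    fix t and z :: R2 assume tz: "\<bar>t - 1\<bar> < d'" "norm z < d'"
    have t: "t > 1/2" "t < 2" using tz d' by auto
    have s: "sqi lborel (\<lambda>x. q (t *\<^sub>R x - z))" "nrm2 lborel (\<lambda>x. q (t *\<^sub>R x - z)) = nrm2 lborel q / t" if "sqi lborel q" for q
      using sqi_affine[OF that, of t "- z"] t by (auto simp: algebra_simps)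
    have 1: "nrm2 lborel (\<lambda>x. u (t *\<^sub>R x - z) - g (t *\<^sub>R x - z)) \<le> e / 2"
    proof -
      have "nrm2 lborel (\<lambda>x. u (t *\<^sub>R x - z) - g (t *\<^sub>R x - z)) = nrm2 lborel (\<lambda>x. u x - g x) / t"
        using s(2)[OF sqi_diff[OF u g(4)]] by simp
      also have "\<dots> \<le> (e / 4) / (1 / 2)" using g(5) t e by (intro frac_le) auto
      finally show ?thesis by simp
    qed
    have gb: "g \<in> borel_measurable borel" by (intro borel_measurable_continuous_onI g)
    have "nrm2 lborel (\<lambda>x. g (t *\<^sub>R x - z) - g x) \<le> e' * V"
      unfolding V_def
    proof (rule nrm2_bounded_support(2))
      show "(\<lambda>x. g (t *\<^sub>R x - z) - g x) \<in> borel_measurable borel" using gb by measurable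
      show z: "g (t *\<^sub>R x - z) - g x = 0" if "norm x > R2" for x
      proof -
        have "norm (t *\<^sub>R x) \<le> norm (t *\<^sub>R x - z) + norm z" using norm_triangle_sub by (metis add.commute)
        moreover have "norm (t *\<^sub>R x) \<ge> R2 / 2" using that t mult_mono[of "1/2" t R2 "norm x"] R2 by simp
        ultimately have "norm (t *\<^sub>R x - z) \<ge> R" using tz d' by (simp add: R2_def)
        moreover have "norm x \<ge> R" using that g by (simp add: R2_def)
        ultimately show ?thesis using g(3) by simp
      qed
      show "cmod (g (t *\<^sub>R x - z) - g x) \<le> e'" for x
      proof (cases "norm x > R2")
        case True then show ?thesis using z[OF True] e' by simp
      next
        case False
        have eq: "t *\<^sub>R x - z - x = (t - 1) *\<^sub>R x - z" by (simp add: algebra_simps)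
        have "norm (t *\<^sub>R x - z - x) \<le> \<bar>t - 1\<bar> * norm x + norm z"
          unfolding eq using norm_triangle_ineq4[of "(t - 1) *\<^sub>R x" z] by simp
        also have "\<dots> \<le> d' * R2 + d'" using False tz by (intro add_mono mult_mono) auto
        also have "\<dots> < d" using d' by (simp add: algebra_simps)
        finally show ?thesis using d(2) by (simp add: less_imp_le)
      qed
    qed (use e' in auto)
    also have "e' * V \<le> e / 4" using e V by (simp add: e'_def field_simps)
    finally have 2: "nrm2 lborel (\<lambda>x. g (t *\<^sub>R x - z) - g x) \<le> e / 4" .
    have 3: "nrm2 lborel (\<lambda>x. g x - u x) \<le> e / 4" using g(5) nrm2_minus_commute[of lborel g u] by simp
    have "nrm2 lborel (\<lambda>x. u (t *\<^sub>R x - z) - u x) \<le> nrm2 lborel (\<lambda>x. u (t *\<^sub>R x - z) - g (t *\<^sub>R x - z)) + nrm2 lborel (\<lambda>x. g (t *\<^sub>R x - z) - u x)"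
      by (rule nrm2_triangle_via[OF s(1)[OF u] s(1)[OF g(4)] u])
    also have "nrm2 lborel (\<lambda>x. g (t *\<^sub>R x - z) - u x) \<le> nrm2 lborel (\<lambda>x. g (t *\<^sub>R x - z) - g x) + nrm2 lborel (\<lambda>x. g x - u x)"
      by (rule nrm2_triangle_via[OF s(1)[OF g(4)] g(4) u])
    finally show "nrm2 lborel (\<lambda>x. u (t *\<^sub>R x - z) - u x) \<le> e" using 1 2 3 by simp
  qed (use d' in auto)
qed

text \<open>Cauchy-Schwarz with the density split into two square roots. No integrability of
  \<open>h\<close> is assumed: if the right side is infinite there is nothing to prove.\<close>

lemma jensen_sq:
  fixes h :: "'a \<Rightarrow> complex" and \<rho> :: "'a \<Rightarrow> real"
  assumes [measurable]: "h \<in> borel_measurable M" and r: "integrable M \<rho>" "\<And>x. \<rho> x \<ge> 0" "(LINT x|M. \<rho> x) = 1"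
  shows "ennreal ((cmod (LINT x|M. h x * of_real (\<rho> x)))\<^sup>2) \<le> (\<integral>\<^sup>+x. ennreal ((cmod (h x))\<^sup>2) * ennreal (\<rho> x) \<partial>M)"
proof -
  have rm [measurable]: "\<rho> \<in> borel_measurable M" using r by auto
  define f where "f x = complex_of_real (sqrt (\<rho> x))" for x
  define g where "g x = h x * complex_of_real (sqrt (\<rho> x))" for x
  have [measurable]: "f \<in> borel_measurable M" "g \<in> borel_measurable M" unfolding f_def g_def by measurable
  have fg: "g x * f x = h x * of_real (\<rho> x)" for x
    using r(2)[of x] by (simp add: f_def g_def mult.assoc flip: of_real_mult)
  have g2: "ennreal ((cmod (g x))\<^sup>2) = ennreal ((cmod (h x))\<^sup>2) * ennreal (\<rho> x)" for x
    using r(2)[of x] by (simp add: g_def norm_mult power_mult_distrib ennreal_mult)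
  have f: "sqi M f" "nrm2 M f = 1" using r by (auto simp: sqi_def nrm2_def f_def)
  show ?thesis
  proof (cases "(\<integral>\<^sup>+x. ennreal ((cmod (g x))\<^sup>2) \<partial>M) = \<infinity>")
    case True
    then show ?thesis by (simp add: g2)
  next
    case False
    then have g: "sqi M g" by (subst sqi_nn_integral) (auto simp: less_top)
    have "cmod (LINT x|M. h x * of_real (\<rho> x)) \<le> nrm2 M g"
      using cauchy_schwarz[OF g f(1)] f(2) by (simp add: fg)
    then have "(cmod (LINT x|M. h x * of_real (\<rho> x)))\<^sup>2 \<le> (nrm2 M g)\<^sup>2" by (intro power_mono) auto
    then have "ennreal ((cmod (LINT x|M. h x * of_real (\<rho> x)))\<^sup>2) \<le> ennreal ((nrm2 M g)\<^sup>2)" by (rule ennreal_leI)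
    then show ?thesis using nrm2_nn_integral[OF g] by (simp add: g2)
  qed
qed

lemma kern_conv_integrable:
  fixes u :: "R2 \<Rightarrow> complex"
  assumes u: "sqi lborel u" and k: "kern \<delta> \<rho>"
  shows "integrable lborel (\<lambda>y. u y * complex_of_real (\<rho> (x - y)))"
proof (rule sqi_mult_integrable[OF u])
  have c: "continuous_on UNIV (\<lambda>y. complex_of_real (\<rho> y))" by (rule smooth_continuous[OF kern_smooth[OF k]])
  have z: "\<And>x. norm x \<ge> \<delta> \<Longrightarrow> complex_of_real (\<rho> x) = 0" using k by (simp add: kern_def)
  obtain B where B: "B > 0" "\<And>x. cmod (complex_of_real (\<rho> x)) \<le> B"
    using compact_support_bounded[OF c z] by blast
  have s: "sqi lborel (\<lambda>y. complex_of_real (\<rho> y))"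
    by (rule nrm2_bounded_support(1)[OF _ B(2), where R=\<delta>])
       (use B z smooth_borel[OF kern_smooth[OF k]] in auto)
  show "sqi lborel (\<lambda>y. complex_of_real (\<rho> (x - y)))"
    using sqi_affine(1)[OF s, of "-1" x] by simp
qed

text \<open>Jensen and Tonelli bound the squared error by the average over the kernel of the squared
  errors of \<open>u (t x - z) - u x\<close>. The dilation is placed outside the convolution, so
  that a single estimate covers dilating and mollifying.\<close>

lemma mollify_close:
  fixes u :: "R2 \<Rightarrow> complex"
  assumes u: "sqi lborel u" and k: "kern \<delta> \<rho>" and c: "continuous_on UNIV (conv u (\<lambda>y. complex_of_real (\<rho> y)))"
    and b: "\<And>z. norm z < \<delta> \<Longrightarrow> nrm2 lborel (\<lambda>x. u (t *\<^sub>R x - z) - u x) \<le> e" and e: "e \<ge> 0" and t: "t \<noteq> 0"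
  shows "sqi lborel (\<lambda>x. conv u (\<lambda>y. complex_of_real (\<rho> y)) (t *\<^sub>R x) - u x)"
    "nrm2 lborel (\<lambda>x. conv u (\<lambda>y. complex_of_real (\<rho> y)) (t *\<^sub>R x) - u x) \<le> e"
proof -
  let ?r = "\<lambda>y. complex_of_real (\<rho> y)"
  have um [measurable]: "u \<in> borel_measurable borel" using sqi_measurable[OF u] by simp
  have rm [measurable]: "\<rho> \<in> borel_measurable borel" by (rule kern_borel[OF k])
  have r0: "\<rho> x \<ge> 0" and ri: "integrable lborel \<rho>" and r1: "(LINT x|lborel. \<rho> x) = 1" for x
    using k by (auto simp: kern_def)
  have [measurable]: "conv u ?r \<in> borel_measurable borel" by (intro borel_measurable_continuous_onI c)
  have ri2: "integrable lborel (\<lambda>y. \<rho> (a - y))" for a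
  proof -
    have "(\<integral>\<^sup>+y. ennreal (\<rho> (a - y)) \<partial>lborel) = (\<integral>\<^sup>+y. ennreal (\<rho> y) \<partial>lborel)"
      using nn_integral_affine[of "\<lambda>y. ennreal (\<rho> y)" "-1" a] by simp
    then show ?thesis using ri r0 by (simp add: integrable_iff_bounded)
  qed
  have ri3: "(LINT y|lborel. \<rho> (a - y)) = 1" for a
  proof -
    have "(\<integral>\<^sup>+y. ennreal (\<rho> (a - y)) \<partial>lborel) = (\<integral>\<^sup>+y. ennreal (\<rho> y) \<partial>lborel)"
      using nn_integral_affine[of "\<lambda>y. ennreal (\<rho> y)" "-1" a] by simp
    then have "ennreal (LINT y|lborel. \<rho> (a - y)) = ennreal 1"
      using nn_integral_eq_integral[OF ri] nn_integral_eq_integral[OF ri2] r0 r1 by simp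
    then show ?thesis using r0 by (subst (asm) ennreal_inj) auto
  qed
  have pt: "ennreal ((cmod (conv u ?r (t *\<^sub>R x) - u x))\<^sup>2) \<le> (\<integral>\<^sup>+z. ennreal ((cmod (u (t *\<^sub>R x - z) - u x))\<^sup>2) * ennreal (\<rho> z) \<partial>lborel)" for x
  proof -
    have "(LINT y|lborel. u x * ?r (t *\<^sub>R x - y)) = u x * of_real (LINT y|lborel. \<rho> (t *\<^sub>R x - y))"
      by (simp)
    then have "(LINT y|lborel. u x * ?r (t *\<^sub>R x - y)) = u x" by (simp only: ri3) simp
    then have "conv u ?r (t *\<^sub>R x) - u x = (LINT y|lborel. u y * ?r (t *\<^sub>R x - y)) - (LINT y|lborel. u x * ?r (t *\<^sub>R x - y))"
      by (simp add: conv_def)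
    also have "\<dots> = (LINT y|lborel. (u y - u x) * ?r (t *\<^sub>R x - y))"
      using kern_conv_integrable[OF u k] ri2
      by (subst Bochner_Integration.integral_diff[symmetric]) (auto simp: algebra_simps)
    finally have "ennreal ((cmod (conv u ?r (t *\<^sub>R x) - u x))\<^sup>2) \<le> (\<integral>\<^sup>+y. ennreal ((cmod (u y - u x))\<^sup>2) * ennreal (\<rho> (t *\<^sub>R x - y)) \<partial>lborel)"
      using jensen_sq[of "\<lambda>y. u y - u x" lborel "\<lambda>y. \<rho> (t *\<^sub>R x - y)"] ri2 ri3 r0 by simp
    also have "\<dots> = (\<integral>\<^sup>+z. ennreal ((cmod (u (t *\<^sub>R x - z) - u x))\<^sup>2) * ennreal (\<rho> z) \<partial>lborel)"
      using nn_integral_affine[of "\<lambda>y. ennreal ((cmod (u y - u x))\<^sup>2) * ennreal (\<rho> (t *\<^sub>R x - y))" "-1" "t *\<^sub>R x"] by simp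
    finally show ?thesis .
  qed
  have s: "sqi lborel (\<lambda>x. u (t *\<^sub>R x - z) - u x)" for z
    using sqi_diff[OF sqi_affine(1)[OF u t, of "- z"] u] by (simp add: algebra_simps)
  have "(\<integral>\<^sup>+x. ennreal ((cmod (conv u ?r (t *\<^sub>R x) - u x))\<^sup>2) \<partial>lborel) \<le>
     (\<integral>\<^sup>+x. (\<integral>\<^sup>+z. ennreal ((cmod (u (t *\<^sub>R x - z) - u x))\<^sup>2) * ennreal (\<rho> z) \<partial>lborel) \<partial>lborel)"
    by (intro nn_integral_mono pt)
  also have "\<dots> = (\<integral>\<^sup>+z. (\<integral>\<^sup>+x. ennreal ((cmod (u (t *\<^sub>R x - z) - u x))\<^sup>2) * ennreal (\<rho> z) \<partial>lborel) \<partial>lborel)"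
    by (rule lborel_pair.Fubini'[symmetric]) simp
  also have "\<dots> = (\<integral>\<^sup>+z. ennreal ((nrm2 lborel (\<lambda>x. u (t *\<^sub>R x - z) - u x))\<^sup>2) * ennreal (\<rho> z) \<partial>lborel)"
    by (intro nn_integral_cong) (simp add: nn_integral_multc nrm2_nn_integral[OF s])
  also have "\<dots> \<le> (\<integral>\<^sup>+z. ennreal (e\<^sup>2) * ennreal (\<rho> z) \<partial>lborel)"
  proof (rule nn_integral_mono)
    fix z
    show "ennreal ((nrm2 lborel (\<lambda>x. u (t *\<^sub>R x - z) - u x))\<^sup>2) * ennreal (\<rho> z) \<le> ennreal (e\<^sup>2) * ennreal (\<rho> z)"
    proof (cases "norm z < \<delta>")
      case True
      then show ?thesis by (intro mult_right_mono ennreal_leI power_mono b) auto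
    next
      case False
      then have "\<rho> z = 0" using k by (simp add: kern_def)
      then show ?thesis by simp
    qed
  qed
  also have "\<dots> = ennreal (e\<^sup>2)"
    using r0 r1 ri by (simp add: nn_integral_cmult nn_integral_eq_integral)
  finally have *: "(\<integral>\<^sup>+x. ennreal ((cmod (conv u ?r (t *\<^sub>R x) - u x))\<^sup>2) \<partial>lborel) \<le> ennreal (e\<^sup>2)" .
  show "sqi lborel (\<lambda>x. conv u ?r (t *\<^sub>R x) - u x)" "nrm2 lborel (\<lambda>x. conv u ?r (t *\<^sub>R x) - u x) \<le> e"
    using nrm2_le_nn_integral[OF _ * e] by auto
qed

section \<open>Borel versions of functions given on a domain\<close>

lemma borel_version_complex:
  fixes f :: "R2 \<Rightarrow> complex"
  assumes f: "f \<in> borel_measurable lebesgue"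
  obtains f' where "f' \<in> borel_measurable borel" "AE x in lebesgue. f x = f' x"
proof -
  have "(\<lambda>x. Re (f x)) \<in> borel_measurable lebesgue" "(\<lambda>x. Im (f x)) \<in> borel_measurable lebesgue"
    using f by measurable
  from this[THEN completion_ex_borel_measurable_real]
  obtain g h where gh: "g \<in> borel_measurable lborel" "h \<in> borel_measurable lborel"
    "AE x in lborel. Re (f x) = g x" "AE x in lborel. Im (f x) = h x" by blast
  have [measurable]: "g \<in> borel_measurable borel" "h \<in> borel_measurable borel" using gh by auto
  show ?thesis
  proof (rule that[of "\<lambda>x. Complex (g x) (h x)"])
    have "(\<lambda>x. complex_of_real (g x) + \<i> * complex_of_real (h x)) \<in> borel_measurable borel" by measurable
    then show "(\<lambda>x. Complex (g x) (h x)) \<in> borel_measurable borel" by (simp add: Complex_eq)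
    have "AE x in lborel. f x = Complex (g x) (h x)"
      using gh(3,4) by eventually_elim (simp add: complex_eq_iff)
    then show "AE x in lebesgue. f x = Complex (g x) (h x)" by (rule AE_completion)
  qed
qed

definition zext :: "R2 set \<Rightarrow> (R2 \<Rightarrow> complex) \<Rightarrow> R2 \<Rightarrow> complex" where
  "zext U f x = (if x \<in> U then f x else 0)"

lemma zext_measurable:
  assumes "f \<in> borel_measurable (lebesgue_on U)" "U \<in> sets lebesgue"
  shows "zext U f \<in> borel_measurable lebesgue"
  unfolding zext_def using borel_measurable_if[OF assms(2), of f] assms(1) by simp

text \<open>Zero extension followed by a change on a null set. Borel measurability on the plane is
  what the product-measure arguments require; the last clause carries the pairings with test
  functions over to the new function.\<close>

lemma borel_extension:
  assumes f: "sqi (lebesgue_on U) f" and U: "U \<in> sets lebesgue"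
  shows "\<exists>f'. sqi lborel f' \<and> (AE x in lebesgue. zext U f x = f' x) \<and>
    nrm2 lborel f' = nrm2 (lebesgue_on U) f \<and>
    (\<forall>\<phi> \<in> borel_measurable borel. (LINT x|lborel. f' x * \<phi> x) = (LINT x|lebesgue_on U. f x * \<phi> x))"
proof -
  have zm: "zext U f \<in> borel_measurable lebesgue" using zext_measurable[OF sqi_measurable[OF f] U] .
  obtain f' where f': "f' \<in> borel_measurable borel" "AE x in lebesgue. zext U f x = f' x"
    using borel_version_complex[OF zm] by blast
  have f'l: "f' \<in> borel_measurable lebesgue" using f'(1) by (simp add: measurable_completion)
  have eq: "(\<integral>\<^sup>+x. ennreal ((cmod (f' x))\<^sup>2) \<partial>lborel) = ennreal ((nrm2 (lebesgue_on U) f)\<^sup>2)"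
  proof -
    have "(\<integral>\<^sup>+x. ennreal ((cmod (f' x))\<^sup>2) \<partial>lborel) = (\<integral>\<^sup>+x. ennreal ((cmod (f' x))\<^sup>2) \<partial>lebesgue)"
      by (simp add: nn_integral_completion)
    also have "\<dots> = (\<integral>\<^sup>+x. ennreal ((cmod (zext U f x))\<^sup>2) \<partial>lebesgue)"
      by (rule nn_integral_cong_AE) (use f'(2) in \<open>eventually_elim, simp\<close>)
    also have "\<dots> = (\<integral>\<^sup>+x. ennreal ((cmod (f x))\<^sup>2) * indicator U x \<partial>lebesgue)"
      by (rule nn_integral_cong) (simp add: zext_def indicator_def)
    also have "\<dots> = (\<integral>\<^sup>+x. ennreal ((cmod (f x))\<^sup>2) \<partial>lebesgue_on U)"
      using U by (subst nn_integral_restrict_space) auto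
    also have "\<dots> = ennreal ((nrm2 (lebesgue_on U) f)\<^sup>2)" by (rule nrm2_nn_integral[OF f])
    finally show ?thesis .
  qed
  have s: "sqi lborel f'"
    by (rule nrm2_le_nn_integral(1)[where c="nrm2 (lebesgue_on U) f"]) (use f' eq in auto)
  show ?thesis
  proof (intro exI[of _ f'] conjI ballI s f'(2))
    have "ennreal ((nrm2 lborel f')\<^sup>2) = ennreal ((nrm2 (lebesgue_on U) f)\<^sup>2)"
      using nrm2_nn_integral[OF s] eq by simp
    then have "(nrm2 lborel f')\<^sup>2 = (nrm2 (lebesgue_on U) f)\<^sup>2" by simp
    then show "nrm2 lborel f' = nrm2 (lebesgue_on U) f" by (rule power2_eq_imp_eq[OF _ nrm2_nonneg nrm2_nonneg])
    fix \<phi> :: "R2 \<Rightarrow> complex" assume p: "\<phi> \<in> borel_measurable borel"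
    then have p2: "\<phi> \<in> borel_measurable lebesgue" by (simp add: measurable_completion)
    have "(LINT x|lborel. f' x * \<phi> x) = (LINT x|lebesgue. f' x * \<phi> x)"
      using p f'(1) by (subst integral_completion) auto
    also have "\<dots> = (LINT x|lebesgue. zext U f x * \<phi> x)"
      by (rule integral_cong_AE) (use p2 f'l zm f'(2) in auto)
    also have "\<dots> = (LINT x|lebesgue. indicator U x *\<^sub>R (f x * \<phi> x))"
      by (rule Bochner_Integration.integral_cong) (auto simp: zext_def indicator_def)
    also have "\<dots> = (LINT x|lebesgue_on U. f x * \<phi> x)"
      using U by (subst integral_restrict_space) auto
    finally show "(LINT x|lborel. f' x * \<phi> x) = (LINT x|lebesgue_on U. f x * \<phi> x)" .
  qed
qed

lemma continuous_compact_sqi: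
  fixes f :: "R2 \<Rightarrow> complex"
  assumes c: "continuous_on UNIV f" and z: "\<And>x. norm x \<ge> R \<Longrightarrow> f x = 0" shows "sqi lborel f"
proof -
  obtain B where B: "B > 0" "\<And>x. cmod (f x) \<le> B" using compact_support_bounded[OF c z] by blast
  show ?thesis
    by (rule nrm2_bounded_support(1)[OF _ B(2), where R=R])
       (use B z c in \<open>auto intro: borel_measurable_continuous_onI\<close>)
qed

lemma kern_test_fn:
  assumes "kern \<delta> \<rho>" "cball x \<delta> \<subseteq> U"
  shows "test_fn U (\<lambda>y. complex_of_real (\<rho> (x - y)))"
proof (rule test_fnI[of _ "cball x \<delta>"])
  show "smooth (\<lambda>y. complex_of_real (\<rho> (x - y)))"
    using smooth_affine[OF kern_smooth[OF assms(1)], of x "-1"] by simp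
  show "complex_of_real (\<rho> (x - y)) = 0" if "y \<notin> cball x \<delta>" for y
    using that assms(1) by (auto simp: kern_def dist_norm)
qed (use assms in auto)

lemma kern_test_fn_UNIV:
  assumes "kern \<delta> \<rho>" shows "test_fn UNIV (\<lambda>y. complex_of_real (\<rho> y))"
proof (rule test_fnI[of _ "cball 0 \<delta>"])
  show "smooth (\<lambda>y. complex_of_real (\<rho> y))" using assms by (rule kern_smooth)
  show "complex_of_real (\<rho> y) = 0" if "y \<notin> cball 0 \<delta>" for y
    using that assms by (auto simp: kern_def)
qed auto

text \<open>Here \<open>u\<close> is merely square integrable, so \<open>conv_has\<close> is out of
  reach; Cauchy-Schwarz and the continuity of translations in mean square, applied to the kernel,
  give continuity nevertheless.\<close>

lemma conv_kern_continuous: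
  assumes u: "sqi lborel u" and k: "kern \<delta> \<rho>"
  shows "continuous_on UNIV (conv u (\<lambda>y. complex_of_real (\<rho> y)))"
  unfolding continuous_on_iff
proof (intro ballI allI impI)
  fix x and e :: real assume e: "e > 0"
  let ?r = "\<lambda>y. complex_of_real (\<rho> y)"
  have c: "continuous_on UNIV ?r" by (rule smooth_continuous[OF kern_smooth[OF k]])
  have z: "\<And>x. norm x \<ge> \<delta> \<Longrightarrow> ?r x = 0" using k by (simp add: kern_def)
  have s: "sqi lborel ?r" by (rule continuous_compact_sqi[OF c z])
  define e' where "e' = e / 2 / (nrm2 lborel u + 1)"
  have e': "e' > 0" using e by (simp add: e'_def add_nonneg_pos)
  obtain d where d: "d > 0" "\<forall>t z. \<bar>t - 1\<bar> < d \<longrightarrow> norm z < d \<longrightarrow> nrm2 lborel (\<lambda>x. ?r (t *\<^sub>R x - z) - ?r x) \<le> e'"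
    using L2_affine_continuous[OF s e'] by (elim exE conjE) (rule that)
  show "\<exists>d>0. \<forall>x'\<in>UNIV. dist x' x < d \<longrightarrow> dist (conv u ?r x') (conv u ?r x) < e"
  proof (intro exI[of _ d] conjI ballI impI)
    fix x' assume x': "dist x' x < d"
    have sx: "sqi lborel (\<lambda>y. ?r (w - y))" for w using sqi_affine(1)[OF s, of "-1" w] by simp
    have sd: "sqi lborel (\<lambda>y. ?r (y - (x - x')) - ?r y)"
      using sqi_diff[OF sqi_affine(1)[OF s, of 1 "- (x - x')"] s] by (simp add: algebra_simps)
    have "conv u ?r x' - conv u ?r x = (LINT y|lborel. u y * (?r (x' - y) - ?r (x - y)))"
      unfolding conv_def using kern_conv_integrable[OF u k]
      by (subst Bochner_Integration.integral_diff[symmetric]) (auto simp: algebra_simps)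
    also have "cmod \<dots> \<le> nrm2 lborel u * nrm2 lborel (\<lambda>y. ?r (x' - y) - ?r (x - y))"
      by (rule cauchy_schwarz[OF u sqi_diff[OF sx sx]])
    also have "nrm2 lborel (\<lambda>y. ?r (x' - y) - ?r (x - y)) = nrm2 lborel (\<lambda>y. ?r (y - (x - x')) - ?r y)"
      using sqi_affine(2)[OF sd, of "-1" x] by (simp add: algebra_simps)
    also have "\<dots> \<le> e'" using d(2)[rule_format, of 1 "x - x'"] d(1) x' by (simp add: dist_norm norm_minus_commute)
    finally have "dist (conv u ?r x') (conv u ?r x) \<le> nrm2 lborel u * e'"
      by (simp add: dist_norm mult_left_mono)
    also have "\<dots> < e"
    proof -
      have "nrm2 lborel u / (nrm2 lborel u + 1) \<le> 1" by (simp add: divide_le_eq add_nonneg_pos)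
      from mult_left_mono[OF this, of "e / 2"] have "nrm2 lborel u * e' \<le> e / 2" using e by (simp add: e'_def mult.commute)
      then show ?thesis using e by simp
    qed
    finally show "dist (conv u ?r x') (conv u ?r x) < e" .
  qed (use d in auto)
qed

section \<open>Weak gradients\<close>

text \<open>Mollify with radii tending to zero. At a point of \<open>U\<close> the convolution is
  eventually a pairing with a test function, hence zero, while along a subsequence it converges to
  the function almost everywhere.\<close>

lemma fundamental_lemma:
  assumes U: "open U" and v: "sqi (lebesgue_on U) v"
    and z: "\<And>\<phi>. test_fn U \<phi> \<Longrightarrow> (LINT x|lebesgue_on U. v x * \<phi> x) = 0"
  shows "AE x in lebesgue_on U. v x = 0"
proof -
  have Ul: "U \<in> sets lebesgue" using U by (simp add: borel_open)
  obtain v' where v': "sqi lborel v'" "AE x in lebesgue. zext U v x = v' x"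
    "\<forall>\<phi> \<in> borel_measurable borel. (LINT x|lborel. v' x * \<phi> x) = (LINT x|lebesgue_on U. v x * \<phi> x)"
    using borel_extension[OF v Ul] by (elim exE conjE) (rule that)
  define Q where "Q n \<rho> \<delta> \<longleftrightarrow> kern \<delta> \<rho> \<and> 0 < \<delta> \<and> \<delta> < inverse (real (Suc n)) \<and>
      sqi lborel (\<lambda>x. conv v' (\<lambda>y. complex_of_real (\<rho> y)) x - v' x) \<and>
      nrm2 lborel (\<lambda>x. conv v' (\<lambda>y. complex_of_real (\<rho> y)) x - v' x) \<le> inverse (real (Suc n))" for n \<rho> \<delta>
  have "\<exists>\<rho> \<delta>. Q n \<rho> \<delta>" for n
    unfolding Q_def
  proof -
    have "inverse (real (Suc n)) > 0" by simp
    from L2_affine_continuous[OF v'(1) this]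
    obtain d where d: "d > 0" "\<forall>t z. \<bar>t - 1\<bar> < d \<longrightarrow> norm z < d \<longrightarrow> nrm2 lborel (\<lambda>x. v' (t *\<^sub>R x - z) - v' x) \<le> inverse (real (Suc n))"
      by (elim exE conjE) (rule that)
    define \<delta> where "\<delta> = min d (inverse (real (Suc n))) / 2"
    have dl: "0 < \<delta>" "\<delta> < d" "\<delta> < inverse (real (Suc n))" using d(1) by (auto simp: \<delta>_def min_def)
    obtain \<rho> where k: "kern \<delta> \<rho>" using kern_exists[OF dl(1)] by blast
    have "\<And>z. norm z < \<delta> \<Longrightarrow> nrm2 lborel (\<lambda>x. v' (1 *\<^sub>R x - z) - v' x) \<le> inverse (real (Suc n))"
      using d(2)[rule_format, of 1] dl d(1) by auto
    note m = mollify_close[OF v'(1) k conv_kern_continuous[OF v'(1) k] this, simplified]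
    show "\<exists>\<rho> \<delta>. kern \<delta> \<rho> \<and> 0 < \<delta> \<and> \<delta> < inverse (real (Suc n)) \<and>
      sqi lborel (\<lambda>x. conv v' (\<lambda>y. complex_of_real (\<rho> y)) x - v' x) \<and>
      nrm2 lborel (\<lambda>x. conv v' (\<lambda>y. complex_of_real (\<rho> y)) x - v' x) \<le> inverse (real (Suc n))"
      by (intro exI[of _ \<rho>] exI[of _ \<delta>] conjI k dl) (use m in simp_all)
  qed
  then obtain \<rho> \<delta> where "\<And>n. Q n (\<rho> n) (\<delta> n)" by metis
  then have rd: "\<And>n. kern (\<delta> n) (\<rho> n)" "\<And>n. 0 < \<delta> n" "\<And>n. \<delta> n < inverse (real (Suc n))"
    "\<And>n. sqi lborel (\<lambda>x. conv v' (\<lambda>y. complex_of_real (\<rho> n y)) x - v' x)"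
    "\<And>n. nrm2 lborel (\<lambda>x. conv v' (\<lambda>y. complex_of_real (\<rho> n y)) x - v' x) \<le> inverse (real (Suc n))"
    unfolding Q_def by simp_all
  define w where "w n x = conv v' (\<lambda>y. complex_of_real (\<rho> n y)) x - v' x" for n x
  have inv0: "(\<lambda>n. inverse (real (Suc n))) \<longlonglongrightarrow> 0" by (rule LIMSEQ_inverse_real_of_nat)
  have w0: "(\<lambda>n. nrm2 lborel (w n)) \<longlonglongrightarrow> 0"
  proof (rule Lim_null_comparison[OF _ inv0], rule always_eventually, rule allI)
    show "norm (nrm2 lborel (w n)) \<le> inverse (real (Suc n))" for n
      using rd(5)[of n] by (simp add: w_def[abs_def])
  qed
  have "(\<lambda>n. LINT x|lborel. norm ((cmod (w n x))\<^sup>2)) \<longlonglongrightarrow> 0"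
    using tendsto_power[OF w0, of 2] by (simp add: nrm2_sq)
  then obtain r where r: "strict_mono r" "AE x in lborel. (\<lambda>n. (cmod (w (r n) x))\<^sup>2) \<longlonglongrightarrow> 0"
    using tendsto_L1_AE_subseq[of lborel "\<lambda>n x. (cmod (w n x))\<^sup>2"] rd(4) by (auto simp: w_def sqi_def)
  have cz: "v' x = 0" if x: "x \<in> U" and l: "(\<lambda>n. (cmod (w (r n) x))\<^sup>2) \<longlonglongrightarrow> 0" for x
  proof -
    obtain e where e: "e > 0" "cball x e \<subseteq> U" using U x open_contains_cball by blast
    have "\<forall>\<^sub>F n in sequentially. inverse (real (Suc n)) < e"
      using inv0 e by (intro order_tendstoD) auto
    then have ev: "\<forall>\<^sub>F n in sequentially. inverse (real (Suc (r n))) < e"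
      using r(1) filterlim_subseq eventually_compose_filterlim by blast
    have "\<forall>\<^sub>F n in sequentially. (cmod (w (r n) x))\<^sup>2 = (cmod (v' x))\<^sup>2"
      using ev
    proof eventually_elim
      case (elim n)
      have "cball x (\<delta> (r n)) \<subseteq> U" using elim e rd(3)[of "r n"] by (auto simp: subset_iff)
      then have t: "test_fn U (\<lambda>y. complex_of_real (\<rho> (r n) (x - y)))" by (rule kern_test_fn[OF rd(1)])
      have "conv v' (\<lambda>y. complex_of_real (\<rho> (r n) y)) x = 0"
        unfolding conv_def using v'(3)[rule_format, OF smooth_borel[OF test_fn_smooth[OF t]]] z[OF t] by simp
      then show ?case by (simp add: w_def)
    qed
    then have "(\<lambda>n. (cmod (w (r n) x))\<^sup>2) \<longlonglongrightarrow> (cmod (v' x))\<^sup>2" by (rule tendsto_eventually)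
    from LIMSEQ_unique[OF this l] show ?thesis by simp
  qed
  have "AE x in lebesgue. x \<in> U \<longrightarrow> v x = 0"
    using v'(2) AE_completion[OF r(2)] by eventually_elim (use cz in \<open>auto simp: zext_def\<close>)
  then show ?thesis using Ul by (simp add: AE_restrict_space_iff)
qed

text \<open>\<open>grad\<close> is a choice among weak gradients; by uniqueness it may be exchanged
  almost everywhere for whichever one is at hand.\<close>

lemma weak_grad_unique:
  assumes "open U" "weak_grad U u v" "weak_grad U u w"
  shows "AE x in lebesgue_on U. v j x = w j x"
proof -
  have s: "sqi (lebesgue_on U) (v j)" "sqi (lebesgue_on U) (w j)" using assms by (auto simp: weak_grad_def L2_sqi)
  have "AE x in lebesgue_on U. v j x - w j x = 0"
  proof (rule fundamental_lemma[OF assms(1) sqi_diff[OF s]])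
    fix \<phi> assume t: "test_fn U \<phi>"
    have e: "(LINT x|lebesgue_on U. v j x * \<phi> x) = (LINT x|lebesgue_on U. w j x * \<phi> x)"
    proof -
      have "(LINT x|lebesgue_on U. u x * pd \<phi> j x) = - (LINT x|lebesgue_on U. v j x * \<phi> x)"
        using assms(2) t unfolding weak_grad_def by blast
      moreover have "(LINT x|lebesgue_on U. u x * pd \<phi> j x) = - (LINT x|lebesgue_on U. w j x * \<phi> x)"
        using assms(3) t unfolding weak_grad_def by blast
      ultimately show ?thesis by simp
    qed
    have b: "\<phi> \<in> borel_measurable borel" using t by (intro smooth_borel test_fn_smooth)
    obtain R where R: "\<And>x. norm x \<ge> R \<Longrightarrow> \<phi> x = 0" using test_fn_bounded_support[OF t] by blast
    have "sqi lborel \<phi>" by (rule continuous_compact_sqi[OF smooth_continuous[OF test_fn_smooth[OF t]] R])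
    then have "sqi lebesgue \<phi>"
      using b by (simp add: sqi_def measurable_completion integrable_completion)
    then have p: "sqi (lebesgue_on U) \<phi>" using sqi_subset(1)[of UNIV \<phi> U] assms(1)
      by (simp add: borel_open lebesgue_on_UNIV_eq)
    show "(LINT x|lebesgue_on U. (v j x - w j x) * \<phi> x) = 0"
      using sqi_mult_integrable[OF s(1) p] sqi_mult_integrable[OF s(2) p] e
      by (simp add: algebra_simps)
  qed
  then show ?thesis by eventually_elim simp
qed

lemma H1_weak_grad: "H1 U u \<Longrightarrow> weak_grad U u (grad U u)"
  unfolding H1_def grad_def by (metis someI)

lemma H1_sqi: "H1 U u \<Longrightarrow> sqi (lebesgue_on U) u" by (simp add: H1_def L2_sqi)

lemma H1_grad_sqi: "H1 U u \<Longrightarrow> sqi (lebesgue_on U) (grad U u j)"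
  using H1_weak_grad[of U u] by (simp add: weak_grad_def L2_sqi)

lemma grad_AE: "open U \<Longrightarrow> weak_grad U u v \<Longrightarrow> L2 U u \<Longrightarrow> AE x in lebesgue_on U. grad U u j x = v j x"
  using weak_grad_unique[of U u "grad U u" v j] H1_weak_grad[of U u] by (auto simp: H1_def)

lemma continuous_sqi_on:
  fixes f :: "R2 \<Rightarrow> complex"
  assumes "continuous_on UNIV f" "bounded U" "U \<in> sets lebesgue"
  shows "sqi (lebesgue_on U) f"
proof -
  obtain R where "\<And>x. x \<in> U \<Longrightarrow> norm x \<le> R" using assms(2) by (auto simp: bounded_iff)
  then have R: "U \<subseteq> cball 0 R" by auto
  have "bounded (f ` cball 0 R)"
    by (intro compact_imp_bounded compact_continuous_image continuous_on_subset[OF assms(1)]) auto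
  then obtain B where B: "\<And>x. x \<in> cball 0 R \<Longrightarrow> cmod (f x) \<le> B" unfolding bounded_iff by blast
  have b: "cmod (f x) \<le> B" if "x \<in> space (lebesgue_on U)" for x
    using that B R by auto
  have "emeasure lebesgue U \<le> emeasure lebesgue (cball (0::R2) R)" using R by (intro emeasure_mono) auto
  also have "\<dots> < \<infinity>" using emeasure_lborel_cball_finite[of "0::R2" R] by simp
  finally have fin: "finite_measure (lebesgue_on U)"
    using assms(3) by (intro finite_measureI) (simp add: emeasure_restrict_space)
  have "f \<in> borel_measurable lebesgue"
    using borel_measurable_continuous_onI[OF assms(1)] by (simp add: measurable_completion)
  then have m: "f \<in> borel_measurable (lebesgue_on U)" by (rule measurable_restrict_space1)
  show ?thesis by (rule sqi_bounded[OF fin m b])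
qed

lemma lborel_integral_on:
  fixes f :: "R2 \<Rightarrow> complex"
  assumes "f \<in> borel_measurable borel" "U \<in> sets lebesgue" "\<And>x. x \<notin> U \<Longrightarrow> f x = 0"
  shows "(LINT x|lebesgue_on U. f x) = (LINT x|lborel. f x)"
proof -
  have "(LINT x|lebesgue_on U. f x) = (LINT x|lebesgue. indicator U x *\<^sub>R f x)"
    using assms(2) by (subst integral_restrict_space) auto
  also have "\<dots> = (LINT x|lebesgue. f x)"
    by (rule Bochner_Integration.integral_cong) (use assms(3) in \<open>auto simp: indicator_def\<close>)
  also have "\<dots> = (LINT x|lborel. f x)" using assms(1) by (subst integral_completion) auto
  finally show ?thesis .
qed

text \<open>The product with a test function has compact support in \<open>U\<close>, so
  \<open>integral_pd_zero\<close> and the product rule give the identity without any condition on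
  the boundary of \<open>U\<close>.\<close>

lemma weak_grad_smooth:
  assumes "smooth \<psi>" "bounded U" "U \<in> sets lebesgue"
  shows "weak_grad U \<psi> (pd \<psi>)" "L2 U \<psi>" "H1 U \<psi>"
proof -
  show 1: "weak_grad U \<psi> (pd \<psi>)"
    unfolding weak_grad_def
  proof (intro conjI allI impI)
    show "L2 U (pd \<psi> j)" for j unfolding L2_sqi
      by (rule continuous_sqi_on) (use assms in \<open>auto intro: smooth_continuous smooth_pd\<close>)
    fix \<phi> j assume t: "test_fn U \<phi>"
    have sp: "smooth \<phi>" by (rule test_fn_smooth[OF t])
    have tU: "test_fn UNIV \<phi>" by (rule test_fn_mono[OF t]) auto
    have out: "\<phi> x = 0" "pd \<phi> j x = 0" if "x \<notin> U" for x
    proof -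
      have "x \<notin> tsupp \<phi>" using that t by (auto simp: test_fn_def)
      then show "\<phi> x = 0" by (rule tsupp_zero)
      show "pd \<phi> j x = 0"
      proof (rule pd_zero_outside[of "tsupp \<phi>"])
        show "closed (tsupp \<phi>)" by (simp add: tsupp_def)
        show "\<phi> y = 0" if "y \<notin> tsupp \<phi>" for y using that by (rule tsupp_zero)
      qed fact
    qed
    have b [measurable]: "\<psi> \<in> borel_measurable borel" "\<phi> \<in> borel_measurable borel"
      "pd \<psi> j \<in> borel_measurable borel" "pd \<phi> j \<in> borel_measurable borel"
      using assms(1) sp smooth_pd smooth_borel by blast+
    have e1: "(LINT x|lebesgue_on U. \<psi> x * pd \<phi> j x) = (LINT x|lborel. \<psi> x * pd \<phi> j x)"
      by (rule lborel_integral_on) (use assms out in auto)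
    have e2: "(LINT x|lebesgue_on U. pd \<psi> j x * \<phi> x) = (LINT x|lborel. pd \<psi> j x * \<phi> x)"
      by (rule lborel_integral_on) (use assms out in auto)
    obtain R1 where R1: "\<And>x. norm x \<ge> R1 \<Longrightarrow> \<phi> x = 0" using test_fn_bounded_support[OF tU] by blast
    obtain R2 where R2: "\<And>x. norm x \<ge> R2 \<Longrightarrow> pd \<phi> j x = 0"
      using test_fn_bounded_support[OF test_fn_pd[OF tU]] by blast
    note c = smooth_continuous[OF assms(1)] smooth_continuous[OF sp]
      smooth_continuous[OF smooth_pd[OF assms(1)]] smooth_continuous[OF smooth_pd[OF sp]]
    have i1: "integrable lborel (\<lambda>x. \<psi> x * pd \<phi> j x)"
      by (rule integrable_compact_support[OF continuous_on_mult[OF c(1) c(4)], where R=R2]) (simp add: R2)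
    have i2: "integrable lborel (\<lambda>x. pd \<psi> j x * \<phi> x)"
      by (rule integrable_compact_support[OF continuous_on_mult[OF c(3) c(2)], where R=R1]) (simp add: R1)
    have "0 = (LINT x|lborel. pd (\<lambda>x. \<psi> x * \<phi> x) j x)"
      using integral_pd_zero[OF test_fn_mult[OF assms(1) tU], of j] by simp
    also have "\<dots> = (LINT x|lborel. \<psi> x * pd \<phi> j x + pd \<psi> j x * \<phi> x)"
      by (simp add: pd_mult[OF assms(1) sp])
    also have "\<dots> = (LINT x|lborel. \<psi> x * pd \<phi> j x) + (LINT x|lborel. pd \<psi> j x * \<phi> x)"
      using i1 i2 by simp
    finally show "(LINT x|lebesgue_on U. \<psi> x * pd \<phi> j x) = - (LINT x|lebesgue_on U. pd \<psi> j x * \<phi> x)"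
      unfolding e1 e2 by (simp add: add_eq_0_iff)
  qed
  show 2: "L2 U \<psi>" unfolding L2_sqi
    by (rule continuous_sqi_on) (use assms in \<open>auto intro: smooth_continuous\<close>)
  show "H1 U \<psi>" using 1 2 by (auto simp: H1_def)
qed

lemma grad_smooth_AE:
  assumes "smooth \<psi>" "bounded U" "open U"
  shows "AE x in lebesgue_on U. grad U \<psi> j x = pd \<psi> j x"
  using grad_AE[OF assms(3)] weak_grad_smooth[OF assms(1,2)] assms(3) by (simp add: borel_open)

section \<open>Density of smooth functions in H1 of a star-shaped domain\<close>

lemma AE_grad_nrm2:
  assumes "smooth \<psi>" "bounded U" "open U" "H1 U u"
  shows "nrm2 (lebesgue_on U) (\<lambda>x. grad U u j x - grad U \<psi> j x) = nrm2 (lebesgue_on U) (\<lambda>x. pd \<psi> j x - grad U u j x)"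
proof -
  have U: "U \<in> sets lebesgue" using assms by (simp add: borel_open)
  have m: "grad U \<psi> j \<in> borel_measurable (lebesgue_on U)" "grad U u j \<in> borel_measurable (lebesgue_on U)"
    "pd \<psi> j \<in> borel_measurable (lebesgue_on U)"
    using H1_grad_sqi[OF weak_grad_smooth(3)[OF assms(1,2) U]] H1_grad_sqi[OF assms(4)]
      weak_grad_smooth(1)[OF assms(1,2) U] by (auto simp: sqi_def weak_grad_def L2_def)
  have "nrm2 (lebesgue_on U) (\<lambda>x. grad U u j x - grad U \<psi> j x) = nrm2 (lebesgue_on U) (\<lambda>x. grad U u j x - pd \<psi> j x)"
    by (rule nrm2_AE) (use grad_smooth_AE[OF assms(1-3), of j] m in auto)
  then show ?thesis by (simp add: nrm2_minus_commute)
qed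

lemma H1dist_smooth:
  assumes "smooth \<psi>" "bounded U" "open U" "H1 U u"
  shows "H1dist U u \<psi> = sqrt ((nrm2 (lebesgue_on U) (\<lambda>x. \<psi> x - u x))\<^sup>2 +
     (\<Sum>j\<in>UNIV. (nrm2 (lebesgue_on U) (\<lambda>x. pd \<psi> j x - grad U u j x))\<^sup>2))"
  unfolding H1dist_def L2norm_nrm2 AE_grad_nrm2[OF assms] by (subst nrm2_minus_commute) simp

lemma nrm2_on_le_lborel:
  assumes v: "sqi lborel v" and G: "G \<in> sets lebesgue" and f: "f \<in> borel_measurable (lebesgue_on G)"
    and eq: "AE x in lebesgue. x \<in> G \<longrightarrow> f x = v x"
  shows "sqi (lebesgue_on G) f" "nrm2 (lebesgue_on G) f \<le> nrm2 lborel v"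
proof -
  have b: "v \<in> borel_measurable borel" using sqi_measurable[OF v] by simp
  have "sqi lebesgue v" using v b by (simp add: sqi_def measurable_completion integrable_completion)
  then have s: "sqi (lebesgue_on UNIV) v" by (simp add: lebesgue_on_UNIV_eq)
  note r = sqi_subset[OF s _ G]
  have eq': "AE x in lebesgue_on G. f x = v x" using eq G by (simp add: AE_restrict_space_iff)
  show "sqi (lebesgue_on G) f" by (rule sqi_AE[OF eq' f]) (use r in auto)
  have "nrm2 (lebesgue_on G) f = nrm2 (lebesgue_on G) v"
    by (rule nrm2_AE[OF eq' f]) (use r in \<open>auto simp: sqi_def\<close>)
  also have "\<dots> \<le> nrm2 (lebesgue_on UNIV) v" using r by auto
  also have "\<dots> = nrm2 lborel v"
    unfolding nrm2_def lebesgue_on_UNIV_eq using b by (subst integral_completion) auto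
  finally show "nrm2 (lebesgue_on G) f \<le> nrm2 lborel v" .
qed

text \<open>Dilate first, then mollify: \<open>x \<mapsto> u (t x)\<close> lives on a neighbourhood of \<open>closure G\<close>.\<close>

lemma H1_dense_step:
  assumes G: "open G" "bounded G" and sh: "\<And>t. 0 < t \<Longrightarrow> t < 1 \<Longrightarrow> (\<lambda>x. t *\<^sub>R x) ` closure G \<subseteq> G"
    and u: "H1 G u" and e: "e > 0"
  obtains v where "smooth v" "nrm2 (lebesgue_on G) (\<lambda>x. v x - u x) \<le> e"
    "\<And>j. nrm2 (lebesgue_on G) (\<lambda>x. pd v j x - grad G u j x) \<le> e"
proof -
  have Gl: "G \<in> sets lebesgue" using G by (simp add: borel_open)
  define p where "p = grad G u"
  have wg: "weak_grad G u p" unfolding p_def by (rule H1_weak_grad[OF u])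
  have us: "sqi (lebesgue_on G) u" by (rule H1_sqi[OF u])
  have ps: "sqi (lebesgue_on G) (p j)" for j unfolding p_def by (rule H1_grad_sqi[OF u])
  obtain u' where u': "sqi lborel u'" "AE x in lebesgue. zext G u x = u' x"
    "\<forall>\<phi> \<in> borel_measurable borel. (LINT x|lborel. u' x * \<phi> x) = (LINT x|lebesgue_on G. u x * \<phi> x)"
    using borel_extension[OF us Gl] by (elim exE conjE) (rule that)
  define Q where "Q j p' \<longleftrightarrow> sqi lborel p' \<and> (AE x in lebesgue. zext G (p j) x = p' x) \<and>
    (\<forall>\<phi> \<in> borel_measurable borel. (LINT x|lborel. p' x * \<phi> x) = (LINT x|lebesgue_on G. p j x * \<phi> x))" for j p'
  have "\<exists>p'. Q j p'" for j unfolding Q_def using borel_extension[OF ps Gl] by blast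
  then obtain p' where "\<And>j. Q j (p' j)" by metis
  then have p': "\<And>j. sqi lborel (p' j)" "\<And>j. AE x in lebesgue. zext G (p j) x = p' j x"
    "\<And>j. \<forall>\<phi> \<in> borel_measurable borel. (LINT x|lborel. p' j x * \<phi> x) = (LINT x|lebesgue_on G. p j x * \<phi> x)"
    unfolding Q_def by simp_all
  define P where "P = nrm2 lborel (p' 1) + nrm2 lborel (p' 2)"
  have P: "P \<ge> 0" "nrm2 lborel (p' j) \<le> P" for j
    using exhaust_2[of j] by (auto simp: P_def)
  obtain d0 where d0: "d0 > 0" "\<forall>t z. \<bar>t - 1\<bar> < d0 \<longrightarrow> norm z < d0 \<longrightarrow> nrm2 lborel (\<lambda>x. u' (t *\<^sub>R x - z) - u' x) \<le> e"
    using L2_affine_continuous[OF u'(1) e] by (elim exE conjE) (rule that)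
  have "e / 2 > 0" using e by simp
  note c = L2_affine_continuous[OF p'(1) this]
  obtain d1 where d1: "d1 > 0" "\<forall>t z. \<bar>t - 1\<bar> < d1 \<longrightarrow> norm z < d1 \<longrightarrow> nrm2 lborel (\<lambda>x. p' 1 (t *\<^sub>R x - z) - p' 1 x) \<le> e / 2"
    using c[of 1] by (elim exE conjE) (rule that)
  obtain d2 where d2: "d2 > 0" "\<forall>t z. \<bar>t - 1\<bar> < d2 \<longrightarrow> norm z < d2 \<longrightarrow> nrm2 lborel (\<lambda>x. p' 2 (t *\<^sub>R x - z) - p' 2 x) \<le> e / 2"
    using c[of 2] by (elim exE conjE) (rule that)
  \<comment> \<open>The first three entries are the moduli of continuity of \<open>u\<close> and of
    its two derivatives, the fourth keeps \<open>t\<close> away from zero, and the last one makes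
    the chain rule factor \<open>t\<close> harmless: \<open>(1 - t) * P\<close> stays below
    \<open>e / 2\<close>.\<close>
  define d where "d = Min {d0, d1, d2, 1/2, e / 2 / (P + 1)}"
  have d: "d > 0" "d \<le> d0" "d \<le> d1" "d \<le> d2" "d \<le> 1/2" "d \<le> e / 2 / (P + 1)"
  proof -
    have "0 < e / 2 / (P + 1)" using e P by (simp add: add_nonneg_pos)
    then show "d > 0" using d0(1) d1(1) d2(1) unfolding d_def by (subst Min_gr_iff) auto
  qed (auto simp only: d_def intro!: Min_le)
  define t where "t = 1 - d / 2"
  have t: "0 < t" "t < 1" "\<bar>t - 1\<bar> < d" "1 - t \<le> e / 2 / (P + 1)"
    using d(1,5,6) unfolding t_def by linarith+
  have "compact ((\<lambda>x. t *\<^sub>R x) ` closure G)"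
    using G by (intro compact_continuous_image continuous_intros) (simp add: compact_closure)
  then obtain r where r: "r > 0" "(\<Union>x\<in>(\<lambda>x. t *\<^sub>R x) ` closure G. cball x r) \<subseteq> G"
    by (rule compact_subset_open_imp_cball_epsilon_subset[OF _ G(1) sh[OF t(1,2)]])
  \<comment> \<open>Below \<open>r\<close> the kernel centred at a point of \<open>t G\<close> is a
    test function on \<open>G\<close>, so the weak derivative may be moved onto \<open>u\<close>;
    below \<open>d\<close> the translations are controlled.\<close>
  define \<delta> where "\<delta> = min r d / 2"
  have dl: "0 < \<delta>" "\<delta> < d" "\<delta> \<le> r" using r d by (auto simp: \<delta>_def min_def)
  obtain \<rho> where k: "kern \<delta> \<rho>" using kern_exists[OF dl(1)] by blast
  let ?r = "\<lambda>y. complex_of_real (\<rho> y)"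
  have cb: "cball (t *\<^sub>R x) \<delta> \<subseteq> G" if "x \<in> G" for x
  proof -
    have "x \<in> closure G" using that closure_subset by blast
    then have "cball (t *\<^sub>R x) r \<subseteq> G" using r(2) by blast
    then show ?thesis using dl(3) by (auto simp: subset_iff)
  qed
  have tU: "test_fn UNIV ?r" by (rule kern_test_fn_UNIV[OF k])
  obtain R where R: "G \<subseteq> cball 0 R"
    using G(2) by (metis bounded_iff mem_cball_0 subsetI)
  have u'i: "integrable lborel u'"
  proof -
    have um: "u \<in> borel_measurable (lebesgue_on G)" by (rule sqi_measurable[OF us])
    have "sqi (lebesgue_on G) (\<lambda>x. 1)" by (rule continuous_sqi_on[OF continuous_on_const G(2) Gl])
    from sqi_mult_integrable[OF us this] have "integrable (lebesgue_on G) u" by simp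
    then have "integrable lebesgue (\<lambda>x. indicator G x *\<^sub>R u x)"
      using Gl by (subst (asm) integrable_restrict_space) auto
    then have "integrable lebesgue u'"
    proof (rule integrable_cong_AE_imp)
      show "u' \<in> borel_measurable lebesgue" using sqi_measurable[OF u'(1)] by (simp add: measurable_completion)
      show "AE x in lebesgue. indicator G x *\<^sub>R u x = u' x"
        using u'(2) by eventually_elim (auto simp: zext_def indicator_def)
    qed
    then show ?thesis using sqi_measurable[OF u'(1)] by (simp add: integrable_completion)
  qed
  define v where "v x = conv u' ?r (t *\<^sub>R x)" for x
  have sm: "smooth v"
    unfolding v_def using smooth_affine[OF conv_smooth[OF u'i tU], of 0 t] by simp
  have pdv: "pd v j x = of_real t * conv (p' j) ?r (t *\<^sub>R x)" if x: "x \<in> G" for j x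
  proof -
    have tf: "test_fn G (\<lambda>y. ?r (t *\<^sub>R x - y))" by (rule kern_test_fn[OF k cb[OF x]])
    have pdr: "pd (\<lambda>y. ?r (t *\<^sub>R x - y)) j y = - pd ?r j (t *\<^sub>R x - y)" for y
      using pd_affine[OF kern_smooth[OF k], of "t *\<^sub>R x" "-1" j y] by simp
    have b1: "(\<lambda>y. pd ?r j (t *\<^sub>R x - y)) \<in> borel_measurable borel"
      using smooth_borel[OF smooth_affine[OF smooth_pd[OF kern_smooth[OF k], of j], of "t *\<^sub>R x" "-1"]] by simp
    have "pd v j x = of_real t * pd (conv u' ?r) j (t *\<^sub>R x)"
      unfolding v_def using pd_affine[OF conv_smooth[OF u'i tU], of 0 t j x] by simp
    also have "pd (conv u' ?r) j (t *\<^sub>R x) = conv u' (pd ?r j) (t *\<^sub>R x)" by (rule conv_pd[OF u'i tU])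
    also have "\<dots> = (LINT y|lebesgue_on G. u y * pd ?r j (t *\<^sub>R x - y))"
      unfolding conv_def using u'(3)[rule_format, OF b1] .
    also have "\<dots> = - (LINT y|lebesgue_on G. u y * pd (\<lambda>y. ?r (t *\<^sub>R x - y)) j y)"
      by (simp add: pdr)
    also have "\<dots> = (LINT y|lebesgue_on G. p j y * ?r (t *\<^sub>R x - y))"
      using wg tf unfolding weak_grad_def by simp
    also have "\<dots> = conv (p' j) ?r (t *\<^sub>R x)"
      unfolding conv_def using p'(3)[rule_format, OF smooth_borel[OF test_fn_smooth[OF tf]]] by simp
    finally show ?thesis .
  qed
  have um: "u \<in> borel_measurable (lebesgue_on G)" by (rule sqi_measurable[OF us])
  have pm: "p j \<in> borel_measurable (lebesgue_on G)" for j by (rule sqi_measurable[OF ps])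
  have mb: "f \<in> borel_measurable (lebesgue_on G)" if "f \<in> borel_measurable borel" for f :: "R2 \<Rightarrow> complex"
    using that by (intro measurable_restrict_space1) (simp add: measurable_completion)
  show ?thesis
  proof (rule that[OF sm])
    have b: "nrm2 lborel (\<lambda>x. u' (t *\<^sub>R x - z) - u' x) \<le> e" if "norm z < \<delta>" for z
      using d0(2) that t dl d by auto
    note mc = mollify_close[OF u'(1) k conv_kern_continuous[OF u'(1) k] b less_imp_le[OF e]]
    have "nrm2 (lebesgue_on G) (\<lambda>x. v x - u x) \<le> nrm2 lborel (\<lambda>x. conv u' ?r (t *\<^sub>R x) - u' x)"
    proof (rule nrm2_on_le_lborel(2))
      show "AE x in lebesgue. x \<in> G \<longrightarrow> v x - u x = conv u' ?r (t *\<^sub>R x) - u' x"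
        using u'(2) by eventually_elim (auto simp: v_def zext_def)
    qed (use mc t Gl um mb[OF smooth_borel[OF sm]] in auto)
    also have "\<dots> \<le> e" using mc t by auto
    finally show "nrm2 (lebesgue_on G) (\<lambda>x. v x - u x) \<le> e" .
  next
    fix j
    have b: "nrm2 lborel (\<lambda>x. p' j (t *\<^sub>R x - z) - p' j x) \<le> e / 2" if "norm z < \<delta>" for z
      using exhaust_2[of j] d1(2) d2(2) that t dl d by auto
    have e2: "0 \<le> e / 2" using e by simp
    note mc = mollify_close[OF p'(1) k conv_kern_continuous[OF p'(1) k] b e2]
    \<comment> \<open>The chain rule contributes a factor \<open>t\<close> in the derivative; it is
      split into a mollification error and a multiple \<open>1 - t\<close> of the gradient
      itself.\<close>
    let ?w = "\<lambda>x. of_real t * (conv (p' j) ?r (t *\<^sub>R x) - p' j x) - of_real (1 - t) * p' j x"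
    have s1: "sqi lborel (\<lambda>x. of_real t * (conv (p' j) ?r (t *\<^sub>R x) - p' j x))"
      by (rule sqi_cmult) (use mc t in auto)
    have s2: "sqi lborel (\<lambda>x. of_real (1 - t) * p' j x)" by (rule sqi_cmult[OF p'(1)])
    have "nrm2 (lebesgue_on G) (\<lambda>x. pd v j x - p j x) \<le> nrm2 lborel ?w"
    proof (rule nrm2_on_le_lborel(2)[OF sqi_diff[OF s1 s2] Gl])
      show "(\<lambda>x. pd v j x - p j x) \<in> borel_measurable (lebesgue_on G)"
        using mb[OF smooth_borel[OF smooth_pd[OF sm]]] pm by measurable
      show "AE x in lebesgue. x \<in> G \<longrightarrow> pd v j x - p j x = ?w x"
        using p'(2)[of j] by eventually_elim (auto simp: pdv zext_def algebra_simps)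
    qed
    also have "\<dots> \<le> t * nrm2 lborel (\<lambda>x. conv (p' j) ?r (t *\<^sub>R x) - p' j x) + (1 - t) * nrm2 lborel (p' j)"
    proof -
      have "cmod (1 - of_real t) = 1 - t" using t by (metis abs_of_pos diff_gt_0_iff_gt norm_of_real of_real_1 of_real_diff)
      then show ?thesis
        using nrm2_triangle_diff[OF s1 s2] t by (simp add: nrm2_cmult)
    qed
    also have "\<dots> \<le> 1 * (e / 2) + e / 2 / (P + 1) * P"
      using t P mc e by (intro add_mono mult_mono) auto
    also have "\<dots> \<le> e"
    proof -
      have "P / (P + 1) \<le> 1" using P by (simp add: divide_le_eq)
      from mult_left_mono[OF this, of "e / 2"] have "e / 2 / (P + 1) * P \<le> e / 2" using e by simp
      then show ?thesis by linarith
    qed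
    finally show "nrm2 (lebesgue_on G) (\<lambda>x. pd v j x - grad G u j x) \<le> e" by (simp add: p_def)
  qed
qed

text \<open>The geometric rate matters: it makes the boundary values converge pointwise almost
  everywhere in \<open>trace_exists\<close>, with no further subsequence.\<close>

lemma H1_dense:
  assumes G: "open G" "bounded G" and sh: "\<And>t. 0 < t \<Longrightarrow> t < 1 \<Longrightarrow> (\<lambda>x. t *\<^sub>R x) ` closure G \<subseteq> G"
    and u: "H1 G u"
  obtains un where "\<And>n. smooth (un n)" "(\<lambda>n. nrm2 (lebesgue_on G) (\<lambda>x. un n x - u x)) \<longlonglongrightarrow> 0"
    "\<And>j. (\<lambda>n. nrm2 (lebesgue_on G) (\<lambda>x. pd (un n) j x - grad G u j x)) \<longlonglongrightarrow> 0"
    "(\<lambda>n. H1dist G u (un n)) \<longlonglongrightarrow> 0"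
    "\<And>n. nrm2 (lebesgue_on G) (\<lambda>x. un n x - u x) \<le> (1/2) ^ n"
    "\<And>n j. nrm2 (lebesgue_on G) (\<lambda>x. pd (un n) j x - grad G u j x) \<le> (1/2) ^ n"
proof -
  define Q where "Q n v \<longleftrightarrow> smooth v \<and> nrm2 (lebesgue_on G) (\<lambda>x. v x - u x) \<le> (1/2) ^ n \<and>
    (\<forall>j. nrm2 (lebesgue_on G) (\<lambda>x. pd v j x - grad G u j x) \<le> (1/2) ^ n)" for n v
  have "\<exists>v. Q n v" for n
  proof -
    show ?thesis
    proof (rule H1_dense_step[OF G sh u, of "(1/2) ^ n"])
      show "(1/2 :: real) ^ n > 0" by simp
      fix v assume "smooth v" "nrm2 (lebesgue_on G) (\<lambda>x. v x - u x) \<le> (1/2) ^ n"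
        "\<And>j. nrm2 (lebesgue_on G) (\<lambda>x. pd v j x - grad G u j x) \<le> (1/2) ^ n"
      then show ?thesis unfolding Q_def by (intro exI[of _ v] conjI allI)
    qed
  qed
  then obtain un where un: "\<And>n. Q n (un n)" by metis
  have inv0: "(\<lambda>n. (1/2 :: real) ^ n) \<longlonglongrightarrow> 0" by (rule LIMSEQ_power_zero) simp
  have sm: "smooth (un n)" for n using un unfolding Q_def by blast
  have l1: "(\<lambda>n. nrm2 (lebesgue_on G) (\<lambda>x. un n x - u x)) \<longlonglongrightarrow> 0"
    by (rule Lim_null_comparison[OF always_eventually inv0]) (use un in \<open>simp add: Q_def\<close>)
  have l2: "(\<lambda>n. nrm2 (lebesgue_on G) (\<lambda>x. pd (un n) j x - grad G u j x)) \<longlonglongrightarrow> 0" for j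
    by (rule Lim_null_comparison[OF always_eventually inv0]) (use un in \<open>simp add: Q_def\<close>)
  have "(\<lambda>n. sqrt ((nrm2 (lebesgue_on G) (\<lambda>x. un n x - u x))\<^sup>2 +
     (\<Sum>j\<in>UNIV. (nrm2 (lebesgue_on G) (\<lambda>x. pd (un n) j x - grad G u j x))\<^sup>2))) \<longlonglongrightarrow> sqrt (0\<^sup>2 + (\<Sum>j\<in>(UNIV::2 set). 0\<^sup>2))"
    by (intro tendsto_intros l1 l2)
  then have "(\<lambda>n. H1dist G u (un n)) \<longlonglongrightarrow> 0"
    by (simp add: H1dist_smooth[OF sm G(2,1) u])
  then show ?thesis using un unfolding Q_def by (intro that[OF sm l1 l2]) simp_all
qed

section \<open>Polygons that are star-shaped about the origin\<close>

lemma R2_norm_sq: "(norm (x::R2))\<^sup>2 = (x $ 1)\<^sup>2 + (x $ 2)\<^sup>2"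
  by (simp add: norm_vec_def L2_set_def sum_2)

lemma R2_inner: "(x::R2) \<bullet> y = x $ 1 * y $ 1 + x $ 2 * y $ 2"
  by (simp add: inner_vec_def sum_2)

lemma R2_eq_iff: "(x::R2) = y \<longleftrightarrow> x $ 1 = y $ 1 \<and> x $ 2 = y $ 2"
  by (simp add: vec_eq_iff forall_2)

lemma perp_parallel:
  fixes w d n :: R2
  assumes "n \<noteq> 0" "n \<bullet> w = 0" "n \<bullet> d = 0"
  shows "(d \<bullet> d) *\<^sub>R w = (w \<bullet> d) *\<^sub>R d"
proof -
  have n: "n $ 1 \<noteq> 0 \<or> n $ 2 \<noteq> 0" using assms(1) by (auto simp: R2_eq_iff)
  have 1: "n $ 1 * w $ 1 = - (n $ 2 * w $ 2)" "n $ 1 * d $ 1 = - (n $ 2 * d $ 2)"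
    using assms by (auto simp: R2_inner)
  have "n $ 1 * (w $ 1 * d $ 2 - w $ 2 * d $ 1) = (n $ 1 * w $ 1) * d $ 2 - w $ 2 * (n $ 1 * d $ 1)"
    by (simp add: algebra_simps)
  also have "\<dots> = 0" unfolding 1 by (simp add: algebra_simps)
  finally have a: "n $ 1 * (w $ 1 * d $ 2 - w $ 2 * d $ 1) = 0" .
  have "n $ 2 * (w $ 1 * d $ 2 - w $ 2 * d $ 1) = - (w $ 1 * - (n $ 2 * d $ 2)) + - (n $ 2 * w $ 2) * d $ 1"
    by (simp add: algebra_simps)
  also have "\<dots> = 0" unfolding 1[symmetric] by (simp add: algebra_simps)
  finally have "w $ 1 * d $ 2 = w $ 2 * d $ 1" using a n by auto
  then show ?thesis by (simp add: R2_eq_iff R2_inner algebra_simps)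
qed

locale starpoly =
  fixes G :: "R2 set" and vs :: "R2 list" and \<gamma> :: real
  assumes poly: "convex_polygon G vs" and gamma: "\<gamma> > 0"
    and normals: "\<forall>p n. outer_normal G p n \<longrightarrow> p \<bullet> n \<ge> \<gamma>"
begin

definition va :: "nat \<Rightarrow> R2" where "va i = vtx vs i"
definition vd :: "nat \<Rightarrow> R2" where "vd i = vtx vs (Suc i) - vtx vs i"

lemma edge_eq: "edge vs i t = va i + t *\<^sub>R vd i"
  by (simp add: edge_def va_def vd_def)

lemma elen_eq: "elen vs i = norm (vd i)"
  by (simp add: elen_def vd_def dist_norm norm_minus_commute)

lemma len3: "length vs \<ge> 3" using poly by (simp add: convex_polygon_def)

lemma G_eq: "G = interior (convex hull (set vs))" using poly by (simp add: convex_polygon_def)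

lemma frontier_G: "frontier G = (\<Union>i<length vs. closed_segment (vtx vs i) (vtx vs (Suc i)))"
  using poly unfolding convex_polygon_def by blast

lemma open_G: "open G" and convex_G: "convex G"
  unfolding G_eq by (auto intro: convex_interior convex_convex_hull)

lemma bounded_G: "bounded G"
  using bounded_subset[OF bounded_convex_hull[OF finite_imp_bounded[of "set vs"]] interior_subset]
  by (simp add: G_eq)

lemma G_nonempty: "G \<noteq> {}"
proof
  assume "G = {}"
  then have "closed_segment (vtx vs 0) (vtx vs (Suc 0)) = {}" using frontier_G len3 by fastforce
  then show False by simp
qed

lemma vd_nonzero: assumes "i < length vs" shows "vd i \<noteq> 0"
proof -
  have d: "distinct vs" using poly by (simp add: convex_polygon_def)
  have "Suc i mod length vs \<noteq> i mod length vs"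
    using assms len3 by (cases "Suc i = length vs") auto
  moreover have "Suc i mod length vs < length vs" "i mod length vs < length vs"
    using len3 by (auto intro!: mod_less_divisor)
  ultimately show ?thesis using d by (simp add: vd_def vtx_def nth_eq_iff_index_eq)
qed

lemma G_lebesgue: "G \<in> sets lebesgue" using open_G by (simp add: borel_open)

lemma interior_shrink:
  assumes "q \<in> G" "x \<in> closure G" "0 < e" "e \<le> 1" shows "(1 - e) *\<^sub>R x + e *\<^sub>R q \<in> G"
proof -
  have "x - e *\<^sub>R (x - q) \<in> interior G"
    by (rule mem_interior_closure_convex_shrink[OF convex_G]) (use assms open_G in \<open>auto simp: interior_open\<close>)
  then show ?thesis using open_G by (simp add: interior_open algebra_simps)
qed

lemma edge_frontier: assumes "i < length vs" "0 \<le> s" "s \<le> 1" shows "va i + s *\<^sub>R vd i \<in> frontier G"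
proof -
  have "va i + s *\<^sub>R vd i \<in> closed_segment (vtx vs i) (vtx vs (Suc i))"
    using assms by (auto simp: closed_segment_def va_def vd_def algebra_simps)
  then show ?thesis using assms frontier_G by blast
qed

text \<open>The hypothesis on the normals speaks about \<open>outer_normal\<close>, so an edge can
  profit from it only after its normal is certified by a local defining function; an affine one will
  do.\<close>

lemma affine_outer_normal:
  fixes n p :: R2
  assumes n: "norm n = 1" and p: "p \<in> frontier G" and r: "r > 0"
    and loc: "\<And>x. x \<in> ball p r \<Longrightarrow> x \<in> G \<longleftrightarrow> n \<bullet> x < n \<bullet> p"
  shows "outer_normal G p n"
proof -
  define \<phi> where "\<phi> x = n \<bullet> x - n \<bullet> p" for x
  have hv: "((\<lambda>t. \<phi> (x + t *\<^sub>R axis j 1)) has_vector_derivative n $ j) (at 0)" for x j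
  proof -
    have "(\<lambda>t. \<phi> (x + t *\<^sub>R axis j 1)) = (\<lambda>t. (n \<bullet> x - n \<bullet> p) + t *\<^sub>R n $ j)"
      by (simp add: \<phi>_def fun_eq_iff inner_add_right inner_axis' inner_axis)
    then show ?thesis by (auto intro!: derivative_eq_intros)
  qed
  have pd: "pd \<phi> j = (\<lambda>x. n $ j)" for j using pd_eqI[OF hv] by (simp add: fun_eq_iff)
  have "Ck_on 1 (ball p r) \<phi>"
    unfolding Ck_on_def
  proof (intro conjI allI impI ballI)
    fix js :: "2 list" assume js: "length js \<le> 1"
    then consider "js = []" | j where "js = [j]" by (cases js) auto
    then show "continuous_on (ball p r) (pds js \<phi>)"
    proof cases
      case 1 then show ?thesis unfolding \<phi>_def by (auto intro!: continuous_intros)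
    next
      case 2 then show ?thesis by (simp add: pd)
    qed
  next
    fix js :: "2 list" and j x assume "length js < 1"
    then show "((\<lambda>t. pds js \<phi> (x + t *\<^sub>R axis j 1)) has_vector_derivative pds (j # js) \<phi> x) (at 0)"
      using hv pd by simp
  qed
  moreover have "rgrad \<phi> p = n" by (simp add: rgrad_def pd vec_eq_iff)
  ultimately show ?thesis
    unfolding outer_normal_def
    by (intro conjI p exI[of _ r] exI[of _ \<phi>]) (use r n loc in \<open>auto simp: \<phi>_def\<close>)
qed

text \<open>A supporting line at the midpoint contains the whole edge, since both end points lie on
  one side of it. To see that \<open>G\<close> coincides with the half plane near the midpoint, a
  nearby point below the line is written as a convex combination of an interior point and a point of
  the edge. The conclusion is that the edge lies on a line whose distance from the origin is at
  least \<gamma>.\<close>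

lemma edge_normal:
  assumes i: "i < length vs"
  obtains n h where "norm n = 1" "h \<ge> \<gamma>" "n \<bullet> va i = h" "n \<bullet> vd i = 0" "\<And>x. x \<in> G \<Longrightarrow> n \<bullet> x < h"
proof -
  define d where "d = vd i"
  have dz: "d \<noteq> 0" using vd_nonzero[OF i] by (simp add: d_def)
  define p where "p = va i + (1/2) *\<^sub>R d"
  have pf: "p \<in> frontier G" unfolding p_def d_def by (rule edge_frontier[OF i]) auto
  have pc: "p \<in> closure G" and pnot: "p \<notin> G" using pf open_G by (auto simp: frontier_def interior_open)
  have ri: "rel_interior G = G" using open_G rel_interior_open by blast
  obtain a where a: "a \<noteq> 0" "\<And>y. y \<in> closure G \<Longrightarrow> a \<bullet> p \<le> a \<bullet> y" "\<And>y. y \<in> rel_interior G \<Longrightarrow> a \<bullet> p < a \<bullet> y"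
    using supporting_hyperplane_relative_frontier[OF convex_G pc] pnot ri by auto
  define n where "n = - (1 / norm a) *\<^sub>R a"
  have nn: "norm n = 1" using a(1) by (simp add: n_def)
  have nle: "n \<bullet> y \<le> n \<bullet> p" if "y \<in> closure G" for y
    using a(2)[OF that] a(1) by (simp add: n_def divide_right_mono)
  have nlt: "n \<bullet> y < n \<bullet> p" if "y \<in> G" for y
    using a(3) that ri a(1) by (simp add: n_def divide_strict_right_mono)
  have ends: "va i \<in> closure G" "va i + d \<in> closure G"
    using edge_frontier[OF i, of 0] edge_frontier[OF i, of 1] by (auto simp: frontier_def d_def)
  have nd: "n \<bullet> d = 0"
    using nle[OF ends(1)] nle[OF ends(2)] by (simp add: p_def inner_add_right)
  have np: "n \<bullet> va i = n \<bullet> p" using nd by (simp add: p_def inner_add_right)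
  obtain q where q: "q \<in> G" using G_nonempty by blast
  define hq where "hq = n \<bullet> p - n \<bullet> q"
  have hq: "hq > 0" using nlt[OF q] by (simp add: hq_def)
  \<comment> \<open>The two bounds on \<open>r\<close> ensure that the weight \<open>l\<close> of
    the interior point is at most one half and that the point \<open>z\<close> found below is at
    most half an edge away from the midpoint, hence on the edge.\<close>
  define K where "K = 1 + norm (q - p) / hq"
  have K: "K \<ge> 1" using hq by (simp add: K_def)
  define r where "r = min (hq / 2) (norm d / 4 / K)"
  have r: "r > 0" "r \<le> hq / 2" "r * K \<le> norm d / 4"
    using hq dz K by (auto simp: r_def min_def field_simps)
  have "outer_normal G p n"
  proof (rule affine_outer_normal[OF nn pf r(1)])
    fix y assume y: "y \<in> ball p r"
    then have yp: "norm (y - p) < r" by (simp add: dist_norm norm_minus_commute)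
    show "y \<in> G \<longleftrightarrow> n \<bullet> y < n \<bullet> p"
    proof
      assume "n \<bullet> y < n \<bullet> p"
      \<comment> \<open>Chosen so that the ray from \<open>q\<close> through \<open>y\<close> meets
        the supporting line exactly at \<open>z\<close>.\<close>
      define l where "l = (n \<bullet> p - n \<bullet> y) / hq"
      have l0: "l > 0" using \<open>n \<bullet> y < n \<bullet> p\<close> hq by (simp add: l_def)
      have "n \<bullet> p - n \<bullet> y = n \<bullet> (p - y)" by (simp add: inner_diff_right)
      also have "\<dots> \<le> norm n * norm (p - y)" by (rule norm_cauchy_schwarz)
      also have "\<dots> \<le> r" using yp nn by (simp add: norm_minus_commute)
      finally have lr: "l \<le> r / hq" using hq by (simp add: l_def divide_right_mono)
      have "r / hq \<le> 1/2" using r hq by (simp add: field_simps)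
      then have l1: "l \<le> 1/2" using lr by linarith
      define z where "z = (1 / (1 - l)) *\<^sub>R (y - l *\<^sub>R q)"
      have yz: "y = (1 - l) *\<^sub>R z + l *\<^sub>R q" using l1 by (simp add: z_def)
      define w where "w = z - p"
      have w1: "(1 - l) *\<^sub>R w = (y - p) - l *\<^sub>R (q - p)" using yz by (simp add: w_def algebra_simps)
      have "(1 - l) * (n \<bullet> w) = n \<bullet> ((1 - l) *\<^sub>R w)" by simp
      also have "\<dots> = n \<bullet> y - n \<bullet> p + l * hq"
        unfolding w1 by (simp add: inner_diff_right hq_def algebra_simps)
      also have "\<dots> = 0" using hq by (simp add: l_def)
      finally have nw: "n \<bullet> w = 0" using l1 by simp
      have par: "(d \<bullet> d) *\<^sub>R w = (w \<bullet> d) *\<^sub>R d"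
        by (rule perp_parallel[OF _ nw nd]) (use nn in auto)
      define s where "s = (w \<bullet> d) / (d \<bullet> d)"
      have dd: "d \<bullet> d > 0" using dz by simp
      have ws: "w = s *\<^sub>R d"
      proof -
        have "w = (1 / (d \<bullet> d)) *\<^sub>R ((d \<bullet> d) *\<^sub>R w)" using dd by simp
        also have "\<dots> = s *\<^sub>R d" unfolding par by (simp add: s_def)
        finally show ?thesis .
      qed
      have "(1 - l) * norm w = norm ((y - p) - l *\<^sub>R (q - p))" unfolding w1[symmetric] using l1 by simp
      also have "\<dots> \<le> norm (y - p) + l * norm (q - p)"
        using norm_triangle_ineq4[of "y - p" "l *\<^sub>R (q - p)"] l0 by simp
      also have "\<dots> \<le> r + r / hq * norm (q - p)"
        using yp lr by (intro add_mono mult_right_mono) auto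
      also have "\<dots> = r * K" by (simp add: K_def algebra_simps)
      finally have "(1 - l) * norm w \<le> norm d / 4" using r(3) by simp
      moreover have "(1/2) * norm w \<le> (1 - l) * norm w" using l1 by (intro mult_right_mono) auto
      ultimately have "norm w \<le> norm d / 2" by simp
      then have "\<bar>s\<bar> \<le> 1/2" using ws dz by simp
      have "z = va i + (1/2 + s) *\<^sub>R d"
        using ws by (simp add: w_def p_def algebra_simps)
      then have "z \<in> frontier G" using edge_frontier[OF i, of "1/2 + s"] \<open>\<bar>s\<bar> \<le> 1/2\<close> by (simp add: d_def)
      then have "z \<in> closure G" by (simp add: frontier_def)
      then show "y \<in> G" using interior_shrink[OF q, of z l] l0 l1 yz by simp
    qed (rule nlt)
  qed
  then have "p \<bullet> n \<ge> \<gamma>" using normals by blast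
  then have "n \<bullet> p \<ge> \<gamma>" by (simp only: inner_commute)
  then show ?thesis using that[of n "n \<bullet> p"] nn np nd nlt by (simp add: d_def)
qed

lemma frontier_edge:
  assumes "x \<in> frontier G" obtains i s where "i < length vs" "0 \<le> s" "s \<le> 1" "x = va i + s *\<^sub>R vd i"
proof -
  obtain i where "i < length vs" "x \<in> closed_segment (vtx vs i) (vtx vs (Suc i))" using assms frontier_G by blast
  then show ?thesis using that[of i] by (auto simp: closed_segment_def va_def vd_def algebra_simps)
qed

text \<open>Otherwise the segment from an interior point \<open>q\<close> to the origin crosses an
  edge at \<open>(1 - l) *\<^sub>R q\<close>; shrinking a vector cannot increase its positive
  component along the normal, yet that component reaches \<open>h\<close> while that of
  \<open>q\<close> is below \<open>h\<close>.\<close>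

lemma zero_in_G: "0 \<in> G"
proof (rule ccontr)
  assume z: "0 \<notin> G"
  obtain q where q: "q \<in> G" using G_nonempty by blast
  have "closed_segment q 0 \<inter> frontier G \<noteq> {}"
    by (rule connected_Int_frontier) (use q z in auto)
  then obtain l where l: "0 \<le> l" "l \<le> 1" "(1 - l) *\<^sub>R q \<in> frontier G" by (auto simp: closed_segment_def)
  obtain i s where i: "i < length vs" "(1 - l) *\<^sub>R q = va i + s *\<^sub>R vd i" using frontier_edge[OF l(3)] by metis
  obtain n h where nh: "h \<ge> \<gamma>" "n \<bullet> va i = h" "n \<bullet> vd i = 0" "\<And>x. x \<in> G \<Longrightarrow> n \<bullet> x < h"
    using edge_normal[OF i(1)] by metis
  have "(1 - l) * (n \<bullet> q) = n \<bullet> ((1 - l) *\<^sub>R q)" by simp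
  also have "\<dots> = h" unfolding i(2) using nh by (simp add: inner_add_right)
  finally have e: "(1 - l) * (n \<bullet> q) = h" .
  then have "n \<bullet> q > 0" using nh(1) gamma l by (smt (verit) mult_nonneg_nonpos)
  then have "(1 - l) * (n \<bullet> q) \<le> 1 * (n \<bullet> q)" using l by (intro mult_right_mono) auto
  then show False using e nh(4)[OF q] by simp
qed

lemma shrink_G: "0 \<le> t \<Longrightarrow> t < 1 \<Longrightarrow> x \<in> closure G \<Longrightarrow> t *\<^sub>R x \<in> G"
  using interior_shrink[OF zero_in_G, of x "1 - t"] by simp

lemma shrink_image: "0 < t \<Longrightarrow> t < 1 \<Longrightarrow> (\<lambda>x. t *\<^sub>R x) ` closure G \<subseteq> G"
  using shrink_G by auto

text \<open>This is \<open>G - t G\<close>.\<close>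

definition annulus :: "real \<Rightarrow> R2 set" where "annulus t = {y \<in> G. (1 / t) *\<^sub>R y \<notin> G}"

lemma annulus_mono: assumes "0 < t" "t \<le> s" "s \<le> 1" shows "annulus s \<subseteq> annulus t"
proof
  fix y assume y: "y \<in> annulus s"
  have "(1 / t) *\<^sub>R y \<notin> G"
  proof
    assume a: "(1 / t) *\<^sub>R y \<in> G"
    have "(1 / s) *\<^sub>R y = (t / s) *\<^sub>R ((1 / t) *\<^sub>R y) + (1 - t / s) *\<^sub>R 0" using assms by simp
    also have "\<dots> \<in> G" using convexD[OF convex_G a zero_in_G, of "t / s" "1 - t / s"] assms by simp
    finally show False using y by (simp add: annulus_def)
  qed
  then show "y \<in> annulus t" using y by (simp add: annulus_def)
qed

lemma annulus_borel: "annulus t \<in> sets borel"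
proof -
  have "open ((\<lambda>y. (1 / t) *\<^sub>R y) -` G)" by (intro open_vimage open_G continuous_intros)
  then have "G - ((\<lambda>y. (1 / t) *\<^sub>R y) -` G) \<in> sets borel" using open_G by (intro sets.Diff borel_open)
  moreover have "annulus t = G - ((\<lambda>y. (1 / t) *\<^sub>R y) -` G)" by (auto simp: annulus_def)
  ultimately show ?thesis by simp
qed

lemma edge_in_annulus:
  assumes "i < length vs" "0 \<le> \<tau>" "\<tau> \<le> 1" "0 < t" "t \<le> s" "s < 1"
  shows "s *\<^sub>R (va i + \<tau> *\<^sub>R vd i) \<in> annulus t"
proof -
  have f: "va i + \<tau> *\<^sub>R vd i \<in> closure G" using edge_frontier assms by (auto simp: frontier_def)
  obtain n h where nh: "h \<ge> \<gamma>" "n \<bullet> va i = h" "n \<bullet> vd i = 0" "\<And>x. x \<in> G \<Longrightarrow> n \<bullet> x < h"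
    using edge_normal[OF assms(1)] by metis
  have "(1 / t) *\<^sub>R (s *\<^sub>R (va i + \<tau> *\<^sub>R vd i)) \<notin> G"
  proof
    assume "(1 / t) *\<^sub>R (s *\<^sub>R (va i + \<tau> *\<^sub>R vd i)) \<in> G"
    from nh(4)[OF this] have "s / t * h < h" using nh by (simp add: inner_add_right)
    moreover have "1 * h \<le> s / t * h" using assms nh gamma by (intro mult_right_mono) auto
    ultimately show False by simp
  qed
  then show ?thesis using shrink_G[of s] f assms by (simp add: annulus_def)
qed

text \<open>The segment from \<open>y\<close> to \<open>(1 / t) *\<^sub>R y\<close> leaves
  \<open>G\<close>; the edge that it crosses provides the cone coordinates.\<close>

lemma annulus_cover:
  assumes "y \<in> annulus t" "0 < t" "t < 1"
  obtains i s \<tau> where "i < length vs" "t \<le> s" "s \<le> 1" "0 \<le> \<tau>" "\<tau> \<le> 1" "y = s *\<^sub>R (va i + \<tau> *\<^sub>R vd i)"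
proof -
  have "closed_segment y ((1 / t) *\<^sub>R y) \<inter> frontier G \<noteq> {}"
    by (rule connected_Int_frontier) (use assms in \<open>auto simp: annulus_def\<close>)
  then obtain l where l: "0 \<le> l" "l \<le> 1" "(1 - l) *\<^sub>R y + l *\<^sub>R ((1 / t) *\<^sub>R y) \<in> frontier G"
    by (auto simp: closed_segment_def)
  define c where "c = (1 - l) + l / t"
  have "l \<le> l / t" using assms l mult_right_mono[of 1 "1/t" l] by simp
  then have c1: "1 \<le> c" by (simp add: c_def)
  have "c * t = (1 - l) * t + l" using assms by (simp add: c_def algebra_simps)
  also have "\<dots> \<le> (1 - l) * 1 + l" using assms l by (intro add_mono mult_left_mono) auto
  finally have c2: "c * t \<le> 1" by simp
  have "c *\<^sub>R y \<in> frontier G" using l(3) by (simp add: c_def algebra_simps)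
  then obtain i \<tau> where i: "i < length vs" "0 \<le> \<tau>" "\<tau> \<le> 1" "c *\<^sub>R y = va i + \<tau> *\<^sub>R vd i" using frontier_edge by metis
  show ?thesis
  proof (rule that[of i "1 / c" \<tau>])
    have "y = (1 / c) *\<^sub>R (c *\<^sub>R y)" using c1 by simp
    then show "y = (1 / c) *\<^sub>R (va i + \<tau> *\<^sub>R vd i)" using i(4) by simp
  qed (use c1 c2 i assms in \<open>auto simp: field_simps\<close>)
qed

text \<open>Twice the signed area of the triangle with apex \<open>0\<close> over the edge, the Jacobian of its cone coordinates.\<close>

definition vD :: "nat \<Rightarrow> real" where "vD i = va i $ 1 * vd i $ 2 - va i $ 2 * vd i $ 1"

text \<open>A vanishing determinant would put the origin on the edge line, which stays at distance
  \<open>h \<ge> \<gamma>\<close> from it.\<close>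

lemma vD_nonzero: assumes i: "i < length vs" shows "vD i \<noteq> 0"
proof
  assume z: "vD i = 0"
  obtain n h where nh: "h \<ge> \<gamma>" "n \<bullet> va i = h" "n \<bullet> vd i = 0"
    using edge_normal[OF i] by metis
  have h: "h > 0" using nh gamma by simp
  have a: "n $ 1 * vd i $ 1 = - (n $ 2 * vd i $ 2)" using nh(3) by (simp add: R2_inner)
  have b: "h = n $ 1 * va i $ 1 + n $ 2 * va i $ 2" using nh(2) by (simp add: R2_inner)
  have "n $ 1 * vD i = n $ 1 * va i $ 1 * vd i $ 2 - va i $ 2 * (n $ 1 * vd i $ 1)"
    by (simp add: vD_def algebra_simps)
  also have "\<dots> = h * vd i $ 2" unfolding a b by (simp add: algebra_simps)
  finally have 1: "vd i $ 2 = 0" using z h by simp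
  have "n $ 2 * vD i = - (va i $ 1) * (- (n $ 2 * vd i $ 2)) - n $ 2 * va i $ 2 * vd i $ 1"
    by (simp add: vD_def algebra_simps)
  also have "\<dots> = - h * vd i $ 1" unfolding a[symmetric] b by (simp add: algebra_simps)
  finally have "vd i $ 1 = 0" using z h by simp
  then show False using 1 vd_nonzero[OF i] by (simp add: R2_eq_iff)
qed

end

section \<open>Cone coordinates over an edge\<close>

definition vec2 :: "real \<Rightarrow> real \<Rightarrow> R2" where "vec2 x y = x *\<^sub>R axis 1 1 + y *\<^sub>R axis 2 1"

lemma vec2_nth [simp]: "vec2 x y $ 1 = x" "vec2 x y $ 2 = y"
  by (simp_all add: vec2_def axis_nth)

lemma R2_Basis: "(Basis :: R2 set) = {axis 1 1, axis 2 1}"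
  by (auto simp: Basis_vec_def UNIV_2)

lemma vec2_measurable [measurable]: "case_prod vec2 \<in> borel_measurable (lborel \<Otimes>\<^sub>M lborel)"
  unfolding vec2_def by measurable

text \<open>The bridge from the measure on \<open>real^2\<close> to iterated integrals, checked on
  boxes, which determine the measure.\<close>

lemma lborel_R2: "(lborel :: R2 measure) = distr (lborel \<Otimes>\<^sub>M lborel) borel (case_prod vec2)"
proof (rule lborel_eqI)
  fix l u :: R2 assume lub: "\<And>b. b \<in> Basis \<Longrightarrow> l \<bullet> b \<le> u \<bullet> b"
  have lu: "l $ 1 \<le> u $ 1" "l $ 2 \<le> u $ 2"
    using lub[of "axis 1 1"] lub[of "axis 2 1"] by (auto simp: R2_Basis inner_axis)
  have ne: "axis 1 1 \<noteq> (axis 2 1 :: R2)" by (simp add: axis_eq_axis)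
  have pre: "case_prod vec2 -` box l u \<inter> space (lborel \<Otimes>\<^sub>M lborel) = {l $ 1<..<u $ 1} \<times> {l $ 2<..<u $ 2}"
    by (auto simp: mem_box_cart forall_2 space_pair_measure)
  have "emeasure (distr (lborel \<Otimes>\<^sub>M lborel) borel (case_prod vec2)) (box l u)
      = emeasure (lborel \<Otimes>\<^sub>M lborel) ({l $ 1<..<u $ 1} \<times> {l $ 2<..<u $ 2})"
    by (subst emeasure_distr) (use vec2_measurable pre in auto)
  also have "\<dots> = ennreal (u $ 1 - l $ 1) * ennreal (u $ 2 - l $ 2)"
    by (subst lborel.emeasure_pair_measure_Times) (use lu in auto)
  also have "\<dots> = ennreal (\<Prod>b\<in>Basis. (u - l) \<bullet> b)"
    using lu ne by (simp add: R2_Basis inner_axis ennreal_mult)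
  finally show "emeasure (distr (lborel \<Otimes>\<^sub>M lborel) borel (case_prod vec2)) (box l u) = ennreal (\<Prod>b\<in>Basis. (u - l) \<bullet> b)" .
qed simp

lemma nn_integral_R2:
  assumes [measurable]: "F \<in> borel_measurable borel"
  shows "(\<integral>\<^sup>+x. F x \<partial>(lborel :: R2 measure)) = (\<integral>\<^sup>+x. (\<integral>\<^sup>+y. F (vec2 x y) \<partial>lborel) \<partial>lborel)"
proof -
  have "(\<integral>\<^sup>+x. F x \<partial>(lborel :: R2 measure)) = (\<integral>\<^sup>+p. F (case_prod vec2 p) \<partial>(lborel \<Otimes>\<^sub>M lborel))"
    by (subst lborel_R2, subst nn_integral_distr) auto
  also have "\<dots> = (\<integral>\<^sup>+x. (\<integral>\<^sup>+y. F (vec2 x y) \<partial>lborel) \<partial>lborel)"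
    by (subst lborel.nn_integral_fst[symmetric]) auto
  finally show ?thesis .
qed

text \<open>A linear substitution in the plane as two one-dimensional affine ones with an exchange
  of integrals in between: first \<open>y\<close> for fixed \<open>x\<close>, then \<open>x\<close>
  for fixed \<open>s\<close>. The entry \<open>c\<close> is the pivot, and \<open>k\<close> the
  determinant divided by \<open>- c\<close>.\<close>

lemma shear1:
  fixes f :: "real \<Rightarrow> real \<Rightarrow> ennreal"
  assumes m [measurable]: "case_prod f \<in> borel_measurable (lborel \<Otimes>\<^sub>M lborel)" and c: "c \<noteq> 0" and D: "a * e - b * c \<noteq> 0"
  shows "(\<integral>\<^sup>+x. (\<integral>\<^sup>+y. f x y \<partial>lborel) \<partial>lborel) =
    ennreal \<bar>a * e - b * c\<bar> * (\<integral>\<^sup>+s. (\<integral>\<^sup>+\<sigma>. f (s * a + \<sigma> * c) (s * b + \<sigma> * e) \<partial>lborel) \<partial>lborel)"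
proof -
  define k where "k = (b * c - a * e) / c"
  have k: "k \<noteq> 0" using c D by (simp add: k_def)
  have kc: "\<bar>k\<bar> * \<bar>c\<bar> = \<bar>a * e - b * c\<bar>" using c by (simp add: k_def abs_divide abs_minus_commute)
  have 1: "(\<integral>\<^sup>+y. f x y \<partial>lborel) = ennreal \<bar>k\<bar> * (\<integral>\<^sup>+s. f x (x * e / c + k * s) \<partial>lborel)" for x
    by (rule nn_integral_real_affine[OF _ k]) measurable
  have 2: "(\<integral>\<^sup>+x. f x (x * e / c + k * s) \<partial>lborel) = ennreal \<bar>c\<bar> * (\<integral>\<^sup>+\<sigma>. f (s * a + \<sigma> * c) (s * b + \<sigma> * e) \<partial>lborel)" for s
  proof -
    have e: "(s * a + c * \<sigma>) * e / c + k * s = s * b + \<sigma> * e" for \<sigma>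
      using c by (simp add: k_def field_simps)
    have "(\<integral>\<^sup>+x. f x (x * e / c + k * s) \<partial>lborel) = ennreal \<bar>c\<bar> * (\<integral>\<^sup>+\<sigma>. f (s * a + c * \<sigma>) ((s * a + c * \<sigma>) * e / c + k * s) \<partial>lborel)"
      by (rule nn_integral_real_affine[OF _ c]) measurable
    then show ?thesis unfolding e by (simp add: mult.commute)
  qed
  have "(\<integral>\<^sup>+x. (\<integral>\<^sup>+y. f x y \<partial>lborel) \<partial>lborel) = ennreal \<bar>k\<bar> * (\<integral>\<^sup>+x. (\<integral>\<^sup>+s. f x (x * e / c + k * s) \<partial>lborel) \<partial>lborel)"
    unfolding 1 by (rule nn_integral_cmult) measurable
  also have "(\<integral>\<^sup>+x. (\<integral>\<^sup>+s. f x (x * e / c + k * s) \<partial>lborel) \<partial>lborel) = (\<integral>\<^sup>+s. (\<integral>\<^sup>+x. f x (x * e / c + k * s) \<partial>lborel) \<partial>lborel)"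
    by (rule lborel_pair.Fubini'[symmetric]) measurable
  also have "\<dots> = ennreal \<bar>c\<bar> * (\<integral>\<^sup>+s. (\<integral>\<^sup>+\<sigma>. f (s * a + \<sigma> * c) (s * b + \<sigma> * e) \<partial>lborel) \<partial>lborel)"
    unfolding 2 by (rule nn_integral_cmult) measurable
  finally show ?thesis by (simp add: mult.assoc[symmetric] kc flip: ennreal_mult)
qed

text \<open>If the pivot vanishes, the determinant forces \<open>e\<close> to be nonzero, and the
  coordinates exchange their roles.\<close>

lemma shear2:
  fixes f :: "real \<Rightarrow> real \<Rightarrow> ennreal"
  assumes m [measurable]: "case_prod f \<in> borel_measurable (lborel \<Otimes>\<^sub>M lborel)" and D: "a * e - b * c \<noteq> 0"
  shows "(\<integral>\<^sup>+x. (\<integral>\<^sup>+y. f x y \<partial>lborel) \<partial>lborel) =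
    ennreal \<bar>a * e - b * c\<bar> * (\<integral>\<^sup>+s. (\<integral>\<^sup>+\<sigma>. f (s * a + \<sigma> * c) (s * b + \<sigma> * e) \<partial>lborel) \<partial>lborel)"
proof (cases "c = 0")
  case False
  then show ?thesis by (rule shear1[OF m _ D])
next
  case True
  then have e: "e \<noteq> 0" using D by auto
  have [measurable]: "(\<lambda>(y, x). f x y) \<in> borel_measurable (lborel \<Otimes>\<^sub>M lborel)" by measurable
  have "(\<integral>\<^sup>+x. (\<integral>\<^sup>+y. f x y \<partial>lborel) \<partial>lborel) = (\<integral>\<^sup>+y. (\<integral>\<^sup>+x. f x y \<partial>lborel) \<partial>lborel)"
    by (rule lborel_pair.Fubini'[symmetric]) measurable
  also have "\<dots> = ennreal \<bar>b * c - a * e\<bar> * (\<integral>\<^sup>+s. (\<integral>\<^sup>+\<sigma>. f (s * a + \<sigma> * c) (s * b + \<sigma> * e) \<partial>lborel) \<partial>lborel)"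
    by (rule shear1[OF _ e]) (use D in auto)
  finally show ?thesis by (simp add: abs_minus_commute)
qed

lemma nn_integral_linear:
  fixes A E :: R2
  assumes [measurable]: "F \<in> borel_measurable borel" and D: "A $ 1 * E $ 2 - A $ 2 * E $ 1 \<noteq> 0"
  shows "(\<integral>\<^sup>+x. F x \<partial>lborel) = ennreal \<bar>A $ 1 * E $ 2 - A $ 2 * E $ 1\<bar> *
     (\<integral>\<^sup>+s. (\<integral>\<^sup>+\<sigma>. F (s *\<^sub>R A + \<sigma> *\<^sub>R E) \<partial>lborel) \<partial>lborel)"
proof -
  have e: "vec2 (s * A $ 1 + \<sigma> * E $ 1) (s * A $ 2 + \<sigma> * E $ 2) = s *\<^sub>R A + \<sigma> *\<^sub>R E" for s \<sigma>
    by (simp add: R2_eq_iff)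
  have m: "(\<lambda>(x, y). F (vec2 x y)) \<in> borel_measurable (lborel \<Otimes>\<^sub>M lborel)"
    using measurable_compose[OF vec2_measurable assms(1)] by (simp add: case_prod_beta')
  show ?thesis unfolding nn_integral_R2[OF assms(1)]
    by (subst shear2[OF m D]) (simp add: e)
qed

text \<open>Substituting a multiple of \<open>s\<close> for the second linear coordinate produces
  the weight \<open>\<bar>s\<bar>\<close>; the rays from the origin become coordinate lines, as
  needed to compare \<open>v x\<close> with \<open>v (t x)\<close>.\<close>

lemma nn_integral_polar:
  fixes A E :: R2
  assumes [measurable]: "F \<in> borel_measurable borel" and D: "A $ 1 * E $ 2 - A $ 2 * E $ 1 \<noteq> 0"
  shows "(\<integral>\<^sup>+x. F x \<partial>lborel) = ennreal \<bar>A $ 1 * E $ 2 - A $ 2 * E $ 1\<bar> *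
     (\<integral>\<^sup>+s. ennreal \<bar>s\<bar> * (\<integral>\<^sup>+\<tau>. F (s *\<^sub>R (A + \<tau> *\<^sub>R E)) \<partial>lborel) \<partial>lborel)"
proof -
  have "(\<integral>\<^sup>+s. (\<integral>\<^sup>+\<sigma>. F (s *\<^sub>R A + \<sigma> *\<^sub>R E) \<partial>lborel) \<partial>lborel) =
     (\<integral>\<^sup>+s. ennreal \<bar>s\<bar> * (\<integral>\<^sup>+\<tau>. F (s *\<^sub>R (A + \<tau> *\<^sub>R E)) \<partial>lborel) \<partial>lborel)"
  proof (rule nn_integral_cong_AE)
    have "AE s in lborel. s \<noteq> (0::real)" by (rule AE_lborel_singleton)
    then show "AE s in lborel. (\<integral>\<^sup>+\<sigma>. F (s *\<^sub>R A + \<sigma> *\<^sub>R E) \<partial>lborel) = ennreal \<bar>s\<bar> * (\<integral>\<^sup>+\<tau>. F (s *\<^sub>R (A + \<tau> *\<^sub>R E)) \<partial>lborel)"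
    proof eventually_elim
      case (elim s)
      have "(\<integral>\<^sup>+\<sigma>. F (s *\<^sub>R A + \<sigma> *\<^sub>R E) \<partial>lborel) = ennreal \<bar>s\<bar> * (\<integral>\<^sup>+\<tau>. F (s *\<^sub>R A + (0 + s * \<tau>) *\<^sub>R E) \<partial>lborel)"
        by (rule nn_integral_real_affine[OF _ elim]) measurable
      then show ?case by (simp add: scaleR_add_right)
    qed
  qed
  then show ?thesis using nn_integral_linear[OF assms] by simp
qed

definition grad_sq :: "(R2 \<Rightarrow> complex) \<Rightarrow> R2 \<Rightarrow> real" where
  "grad_sq v y = (\<Sum>j\<in>UNIV. (cmod (pd v j y))\<^sup>2)"

lemma grad_sq_nonneg [simp]: "grad_sq v y \<ge> 0" by (simp add: grad_sq_def sum_nonneg)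

lemma grad_sq_continuous: "smooth v \<Longrightarrow> continuous_on UNIV (grad_sq v)"
  unfolding grad_sq_def by (intro continuous_intros smooth_continuous smooth_pd)

lemma grad_sq_borel [measurable (raw)]: "smooth v \<Longrightarrow> grad_sq v \<in> borel_measurable borel"
  by (intro borel_measurable_continuous_onI grad_sq_continuous)

text \<open>Fundamental theorem of calculus along the ray and Cauchy-Schwarz. The gain is the factor
  \<open>b - a\<close>, the length of the parameter interval, in front of the energy on the same
  interval.\<close>

lemma line_estimate:
  assumes v: "smooth v" and ab: "a \<le> b"
  shows "ennreal ((cmod (v (b *\<^sub>R x) - v (a *\<^sub>R x)))\<^sup>2) \<le>
     ennreal ((b - a) * (norm x)\<^sup>2) * (\<integral>\<^sup>+s. ennreal (grad_sq v (s *\<^sub>R x)) * indicator {a..b} s \<partial>lborel)"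
proof -
  define f' where "f' s = (\<Sum>j\<in>UNIV. x $ j *\<^sub>R pd v j (s *\<^sub>R x))" for s
  have fd: "((\<lambda>s. v (s *\<^sub>R x)) has_vector_derivative f' s) (at s within {a..b})" for s
  proof -
    have 1: "((\<lambda>s. s *\<^sub>R x) has_vector_derivative x) (at s within {a..b})"
      by (auto intro!: derivative_eq_intros)
    have "((v \<circ> (\<lambda>s. s *\<^sub>R x)) has_vector_derivative (\<Sum>j\<in>UNIV. x $ j *\<^sub>R pd v j (s *\<^sub>R x))) (at s within {a..b})"
      by (rule vector_derivative_diff_chain_within[OF 1 has_derivative_at_withinI[OF smooth_has_derivative[OF v]]])
    then show ?thesis by (simp add: o_def f'_def)
  qed
  have cf: "continuous_on UNIV f'" unfolding f'_def
    by (intro continuous_intros continuous_on_compose2[OF smooth_continuous[OF smooth_pd[OF v]]]) auto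
  have [measurable]: "f' \<in> borel_measurable borel" by (intro borel_measurable_continuous_onI cf)
  define g where "g s = indicator {a..b} s *\<^sub>R f' s" for s
  define h where "h s = complex_of_real (indicator {a..b} s)" for s :: real
  have [measurable]: "g \<in> borel_measurable borel" "h \<in> borel_measurable borel" unfolding g_def h_def by measurable
  have "(\<integral>s. indicator {a..b} s *\<^sub>R f' s \<partial>lborel) = v (b *\<^sub>R x) - v (a *\<^sub>R x)"
    by (rule integral_FTC_atLeastAtMost[OF ab fd continuous_on_subset[OF cf]]) auto
  moreover have "(\<lambda>s. h s * g s) = (\<lambda>s. indicator {a..b} s *\<^sub>R f' s)" by (auto simp: g_def h_def fun_eq_iff indicator_def)
  ultimately have eq: "v (b *\<^sub>R x) - v (a *\<^sub>R x) = (\<integral>s. h s * g s \<partial>lborel)" by (simp only:)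
  have gb: "(cmod (g s))\<^sup>2 = indicator {a..b} s * (cmod (f' s))\<^sup>2" for s by (auto simp: g_def indicator_def)
  have "integrable lborel (\<lambda>s. indicator {a..b} s *\<^sub>R (cmod (f' s))\<^sup>2)"
    by (rule borel_integrable_compact) (auto intro!: continuous_intros continuous_on_subset[OF cf])
  then have sg: "sqi lborel g" by (simp add: sqi_def gb)
  have hh: "(cmod (h s))\<^sup>2 = indicator {a..b} s" for s by (auto simp: h_def indicator_def)
  have sh: "sqi lborel h" using ab by (simp add: sqi_def hh)
  have nh: "(nrm2 lborel h)\<^sup>2 = b - a" using ab by (simp add: nrm2_sq hh)
  have "(cmod (v (b *\<^sub>R x) - v (a *\<^sub>R x)))\<^sup>2 \<le> (nrm2 lborel h * nrm2 lborel g)\<^sup>2"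
    unfolding eq by (intro power_mono cauchy_schwarz sh sg) auto
  also have "\<dots> = (b - a) * (nrm2 lborel g)\<^sup>2" by (simp add: power_mult_distrib nh)
  finally have "ennreal ((cmod (v (b *\<^sub>R x) - v (a *\<^sub>R x)))\<^sup>2) \<le> ennreal (b - a) * ennreal ((nrm2 lborel g)\<^sup>2)"
    using ab by (simp add: ennreal_leI flip: ennreal_mult)
  also have "ennreal ((nrm2 lborel g)\<^sup>2) = (\<integral>\<^sup>+s. ennreal ((cmod (g s))\<^sup>2) \<partial>lborel)" using nrm2_nn_integral[OF sg] by simp
  also have "\<dots> \<le> (\<integral>\<^sup>+s. ennreal ((norm x)\<^sup>2) * (ennreal (grad_sq v (s *\<^sub>R x)) * indicator {a..b} s) \<partial>lborel)"
  proof (rule nn_integral_mono)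
    fix s :: real
    have "cmod (f' s) \<le> \<bar>x $ 1\<bar> * cmod (pd v 1 (s *\<^sub>R x)) + \<bar>x $ 2\<bar> * cmod (pd v 2 (s *\<^sub>R x))"
      unfolding f'_def sum_2 by (intro order_trans[OF norm_triangle_ineq]) simp
    then have "(cmod (f' s))\<^sup>2 \<le> (\<bar>x $ 1\<bar> * cmod (pd v 1 (s *\<^sub>R x)) + \<bar>x $ 2\<bar> * cmod (pd v 2 (s *\<^sub>R x)))\<^sup>2"
      by (intro power_mono) auto
    also have "\<dots> \<le> (norm x)\<^sup>2 * grad_sq v (s *\<^sub>R x)"
    proof -
      define p q where "p = cmod (pd v 1 (s *\<^sub>R x))" and "q = cmod (pd v 2 (s *\<^sub>R x))"
      have "0 \<le> (\<bar>x $ 1\<bar> * q - \<bar>x $ 2\<bar> * p)\<^sup>2" by simp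
      then have "(\<bar>x $ 1\<bar> * p + \<bar>x $ 2\<bar> * q)\<^sup>2 \<le> (\<bar>x $ 1\<bar>\<^sup>2 + \<bar>x $ 2\<bar>\<^sup>2) * (p\<^sup>2 + q\<^sup>2)"
        by (simp add: power2_eq_square algebra_simps)
      then show ?thesis by (simp add: grad_sq_def sum_2 R2_norm_sq p_def q_def)
    qed
    finally have "(cmod (f' s))\<^sup>2 \<le> (norm x)\<^sup>2 * grad_sq v (s *\<^sub>R x)" .
    then show "ennreal ((cmod (g s))\<^sup>2) \<le> ennreal ((norm x)\<^sup>2) * (ennreal (grad_sq v (s *\<^sub>R x)) * indicator {a..b} s)"
      by (auto simp: gb indicator_def simp flip: ennreal_mult intro: ennreal_leI)
  qed
  also have "\<dots> = ennreal ((norm x)\<^sup>2) * (\<integral>\<^sup>+s. ennreal (grad_sq v (s *\<^sub>R x)) * indicator {a..b} s \<partial>lborel)"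
    by (rule nn_integral_cmult) (use grad_sq_borel[OF v] in measurable)
  finally show ?thesis using ab
    by (simp add: ennreal_mult mult.assoc mult_left_mono)
qed

lemma nn_integral_on_borel:
  fixes f :: "'a::euclidean_space \<Rightarrow> complex"
  assumes S: "S \<in> sets lebesgue" and f: "sqi (lebesgue_on S) f"
  shows "(\<integral>\<^sup>+x. ennreal ((cmod (f x))\<^sup>2) * indicator S x \<partial>lborel) = ennreal ((nrm2 (lebesgue_on S) f)\<^sup>2)"
proof -
  have "(\<integral>\<^sup>+x. ennreal ((cmod (f x))\<^sup>2) * indicator S x \<partial>lborel) = (\<integral>\<^sup>+x. ennreal ((cmod (f x))\<^sup>2) * indicator S x \<partial>lebesgue)"
    by (simp add: nn_integral_completion)
  also have "\<dots> = (\<integral>\<^sup>+x. ennreal ((cmod (f x))\<^sup>2) \<partial>lebesgue_on S)"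
    using S by (subst nn_integral_restrict_space) auto
  finally show ?thesis using nrm2_nn_integral[OF f] by simp
qed

lemma continuous_sqi_01:
  fixes f :: "real \<Rightarrow> complex"
  assumes c: "continuous_on UNIV f"
  shows "sqi (lebesgue_on {0..1}) f"
proof -
  have "bounded (f ` {0..1})"
    by (intro compact_imp_bounded compact_continuous_image continuous_on_subset[OF c]) auto
  then obtain B where B: "\<forall>x\<in>{0..1}. cmod (f x) \<le> B" unfolding bounded_iff by auto
  have "f \<in> borel_measurable lebesgue"
    using borel_measurable_continuous_onI[OF c] by (simp add: measurable_completion)
  then have m: "f \<in> borel_measurable (lebesgue_on {0..1})" by (rule measurable_restrict_space1)
  have fin: "finite_measure (lebesgue_on {0..1::real})"
    by (intro finite_measureI) (simp add: emeasure_restrict_space)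
  show ?thesis by (rule sqi_bounded[OF fin m]) (use B in auto)
qed

lemma ennreal_cmod_sq_le:
  "ennreal ((cmod a)\<^sup>2) \<le> ennreal 2 * ennreal ((cmod b)\<^sup>2) + ennreal 2 * ennreal ((cmod (a - b))\<^sup>2)"
proof -
  have "(cmod a)\<^sup>2 \<le> 2 * (cmod b)\<^sup>2 + 2 * (cmod (a - b))\<^sup>2" using cmod_add_sq_le[of b "a - b"] by simp
  then have "ennreal ((cmod a)\<^sup>2) \<le> ennreal (2 * (cmod b)\<^sup>2 + 2 * (cmod (a - b))\<^sup>2)" by (rule ennreal_leI)
  also have "\<dots> = ennreal 2 * ennreal ((cmod b)\<^sup>2) + ennreal 2 * ennreal ((cmod (a - b))\<^sup>2)"
    by (simp add: ennreal_plus ennreal_mult)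
  finally show ?thesis .
qed

lemma indep2:
  fixes A E :: R2
  assumes "A $ 1 * E $ 2 - A $ 2 * E $ 1 \<noteq> 0" "a *\<^sub>R A + b *\<^sub>R E = 0"
  shows "a = 0" "b = 0"
proof -
  have e: "a * A $ 1 = - (b * E $ 1)" "a * A $ 2 = - (b * E $ 2)"
    using assms(2) by (auto simp: R2_eq_iff)
  have "a * (A $ 1 * E $ 2 - A $ 2 * E $ 1) = (a * A $ 1) * E $ 2 - (a * A $ 2) * E $ 1" by (simp add: algebra_simps)
  also have "\<dots> = 0" unfolding e by (simp add: algebra_simps)
  finally show "a = 0" using assms(1) by simp
  have "b * (A $ 1 * E $ 2 - A $ 2 * E $ 1) = - (A $ 1 * - (b * E $ 2)) + A $ 2 * - (b * E $ 1)" by (simp add: algebra_simps)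
  also have "\<dots> = 0" unfolding e[symmetric] by (simp add: algebra_simps)
  finally show "b = 0" using assms(1) by simp
qed

section \<open>Smooth functions in the shell and on the edges\<close>

context starpoly
begin

definition rad :: real where "rad = (SOME r. r > 0 \<and> (\<forall>x\<in>closure G. norm x \<le> r))"

lemma rad: "rad > 0" "\<And>x. x \<in> closure G \<Longrightarrow> norm x \<le> rad"
proof -
  have "bounded (closure G)" by (rule bounded_closure[OF bounded_G])
  then have "\<exists>r. r > 0 \<and> (\<forall>x\<in>closure G. norm x \<le> r)" by (auto simp: bounded_pos)
  from someI_ex[OF this] show "rad > 0" "\<And>x. x \<in> closure G \<Longrightarrow> norm x \<le> rad"
    unfolding rad_def by auto
qed

definition pt :: "nat \<Rightarrow> real \<Rightarrow> R2" where "pt i \<tau> = va i + \<tau> *\<^sub>R vd i"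

lemma pt_closure: "i < length vs \<Longrightarrow> \<tau> \<in> {0..1} \<Longrightarrow> pt i \<tau> \<in> closure G"
  using edge_frontier by (auto simp: pt_def frontier_def)

lemma pt_measurable [measurable]: "pt i \<in> borel_measurable borel"
  unfolding pt_def by measurable

lemma annulus_lebesgue: "annulus t \<in> sets lebesgue"
  by (simp add: annulus_borel)

text \<open>Only the sector over one edge is used, and the Jacobian weight \<open>s\<close> is
  estimated from below by \<open>t\<close>.\<close>

lemma polar_le:
  assumes i: "i < length vs" and t: "0 < t" "t < 1" and F [measurable]: "F \<in> borel_measurable borel"
  shows "(\<integral>\<^sup>+\<tau>. (\<integral>\<^sup>+s. F (s *\<^sub>R pt i \<tau>) * indicator {t..1} s \<partial>lborel) * indicator {0..1} \<tau> \<partial>lborel)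
    \<le> ennreal (1 / (t * \<bar>vD i\<bar>)) * (\<integral>\<^sup>+x. F x * indicator (annulus t) x \<partial>lborel)"
proof -
  note annulus_borel [measurable]
  have D: "va i $ 1 * vd i $ 2 - va i $ 2 * vd i $ 1 \<noteq> 0" using vD_nonzero[OF i] by (simp add: vD_def)
  define L where "L = (\<integral>\<^sup>+\<tau>. (\<integral>\<^sup>+s. F (s *\<^sub>R pt i \<tau>) * indicator {t..1} s \<partial>lborel) * indicator {0..1} \<tau> \<partial>lborel)"
  have m1 [measurable]: "(\<lambda>(s, \<tau>). F (s *\<^sub>R pt i \<tau>)) \<in> borel_measurable (lborel \<Otimes>\<^sub>M lborel)" by measurable
  have "L = (\<integral>\<^sup>+\<tau>. (\<integral>\<^sup>+s. F (s *\<^sub>R pt i \<tau>) * indicator {t..1} s * indicator {0..1} \<tau> \<partial>lborel) \<partial>lborel)"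
    unfolding L_def
  proof (rule nn_integral_cong)
    fix \<tau> :: real
    show "(\<integral>\<^sup>+s. F (s *\<^sub>R pt i \<tau>) * indicator {t..1} s \<partial>lborel) * indicator {0..1} \<tau> =
        (\<integral>\<^sup>+s. F (s *\<^sub>R pt i \<tau>) * indicator {t..1} s * indicator {0..1} \<tau> \<partial>lborel)"
      by (subst nn_integral_multc) auto
  qed
  also have "\<dots> = (\<integral>\<^sup>+s. (\<integral>\<^sup>+\<tau>. F (s *\<^sub>R pt i \<tau>) * indicator {t..1} s * indicator {0..1} \<tau> \<partial>lborel) \<partial>lborel)"
    by (rule lborel_pair.Fubini') measurable
  finally have "ennreal t * L = (\<integral>\<^sup>+s. ennreal t * (\<integral>\<^sup>+\<tau>. F (s *\<^sub>R pt i \<tau>) * indicator {t..1} s * indicator {0..1} \<tau> \<partial>lborel) \<partial>lborel)"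
    by (subst nn_integral_cmult) auto
  also have "\<dots> \<le> (\<integral>\<^sup>+s. ennreal \<bar>s\<bar> * (\<integral>\<^sup>+\<tau>. F (s *\<^sub>R pt i \<tau>) * indicator (annulus t) (s *\<^sub>R pt i \<tau>) \<partial>lborel) \<partial>lborel)"
  proof (rule nn_integral_mono_AE)
    \<comment> \<open>At \<open>s = 1\<close> the point lies on the boundary and no longer in the
      open set \<open>G\<close>; this one value is discarded.\<close>
    have "AE s in lborel. s \<noteq> (1::real)" by (rule AE_lborel_singleton)
    then show "AE s in lborel. ennreal t * (\<integral>\<^sup>+\<tau>. F (s *\<^sub>R pt i \<tau>) * indicator {t..1} s * indicator {0..1} \<tau> \<partial>lborel)
      \<le> ennreal \<bar>s\<bar> * (\<integral>\<^sup>+\<tau>. F (s *\<^sub>R pt i \<tau>) * indicator (annulus t) (s *\<^sub>R pt i \<tau>) \<partial>lborel)"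
    proof eventually_elim
      case (elim s)
      show ?case
      proof (cases "t \<le> s \<and> s < 1")
        case True
        show ?thesis
        proof (rule mult_mono, goal_cases)
          case 2
          show ?case
          proof (rule nn_integral_mono)
          fix \<tau> :: real
          have "s *\<^sub>R pt i \<tau> \<in> annulus t" if "\<tau> \<in> {0..1}"
            using edge_in_annulus[OF i, of \<tau> t s] that True t by (simp add: pt_def)
          then show "F (s *\<^sub>R pt i \<tau>) * indicator {t..1} s * indicator {0..1} \<tau> \<le> F (s *\<^sub>R pt i \<tau>) * indicator (annulus t) (s *\<^sub>R pt i \<tau>)"
            by (auto simp: indicator_def)
          qed
        qed (use True t in \<open>auto intro: ennreal_leI\<close>)
      next
        case False
        then have "indicator {t..1} s = (0::ennreal)" using elim by (auto simp: indicator_def)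
        then show ?thesis by simp
      qed
    qed
  qed
  finally have "ennreal \<bar>vD i\<bar> * (ennreal t * L) \<le> (\<integral>\<^sup>+x. F x * indicator (annulus t) x \<partial>lborel)"
    using nn_integral_polar[of "\<lambda>x. F x * indicator (annulus t) x", OF _ D]
    by (simp add: vD_def pt_def mult_left_mono)
  then have "ennreal (1 / (t * \<bar>vD i\<bar>)) * (ennreal \<bar>vD i\<bar> * (ennreal t * L)) \<le> ennreal (1 / (t * \<bar>vD i\<bar>)) * (\<integral>\<^sup>+x. F x * indicator (annulus t) x \<partial>lborel)"
    by (rule mult_left_mono) simp
  moreover have "ennreal (1 / (t * \<bar>vD i\<bar>)) * (ennreal \<bar>vD i\<bar> * (ennreal t * L)) = L"
    using t vD_nonzero[OF i] by (simp add: mult.assoc[symmetric] flip: ennreal_mult)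
  ultimately show ?thesis by (simp add: L_def)
qed

text \<open>The counterpart of \<open>polar_le\<close>: the closed sectors cover the shell, an
  overlap only enlarges the sum, and the Jacobian weight is at most \<open>1\<close>.\<close>

lemma polar_ge:
  assumes t: "0 < t" "t < 1" and F [measurable]: "F \<in> borel_measurable borel"
  shows "(\<integral>\<^sup>+x. F x * indicator (annulus t) x \<partial>lborel) \<le>
    (\<Sum>i<length vs. ennreal \<bar>vD i\<bar> * (\<integral>\<^sup>+s. (\<integral>\<^sup>+\<tau>. F (s *\<^sub>R pt i \<tau>) * indicator {0..1} \<tau> \<partial>lborel) * indicator {t..1} s \<partial>lborel))"
proof -
  define S where "S i = (\<lambda>p. fst p *\<^sub>R pt i (snd p)) ` ({t..1} \<times> {0..1})" for i
  have "compact (S i)" for i unfolding S_def pt_def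
    by (intro compact_continuous_image continuous_intros compact_Times) auto
  then have Sb [measurable]: "S i \<in> sets borel" for i by (intro borel_closed compact_imp_closed)
  have "(\<integral>\<^sup>+x. F x * indicator (annulus t) x \<partial>lborel) \<le> (\<integral>\<^sup>+x. (\<Sum>i<length vs. F x * indicator (S i) x) \<partial>lborel)"
  proof (rule nn_integral_mono)
    fix x
    show "F x * indicator (annulus t) x \<le> (\<Sum>i<length vs. F x * indicator (S i) x)"
    proof (cases "x \<in> annulus t")
      case True
      then obtain i s \<tau> where i: "i < length vs" "t \<le> s" "s \<le> 1" "0 \<le> \<tau>" "\<tau> \<le> 1" "x = s *\<^sub>R (va i + \<tau> *\<^sub>R vd i)"
        using annulus_cover t by metis
      then have "x \<in> S i" unfolding S_def pt_def by (intro image_eqI[of _ _ "(s, \<tau>)"]) auto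
      then have "F x * indicator (annulus t) x \<le> F x * indicator (S i) x" by (simp add: indicator_def)
      also have "\<dots> \<le> (\<Sum>i<length vs. F x * indicator (S i) x)" by (rule member_le_sum) (use i in auto)
      finally show ?thesis .
    qed auto
  qed
  also have "\<dots> = (\<Sum>i<length vs. (\<integral>\<^sup>+x. F x * indicator (S i) x \<partial>lborel))"
    by (rule nn_integral_sum) measurable
  also have "\<dots> \<le> (\<Sum>i<length vs. ennreal \<bar>vD i\<bar> * (\<integral>\<^sup>+s. (\<integral>\<^sup>+\<tau>. F (s *\<^sub>R pt i \<tau>) * indicator {0..1} \<tau> \<partial>lborel) * indicator {t..1} s \<partial>lborel))"
  proof (rule sum_mono)
    fix i assume "i \<in> {..<length vs}"
    then have D: "va i $ 1 * vd i $ 2 - va i $ 2 * vd i $ 1 \<noteq> 0" using vD_nonzero[of i] by (simp add: vD_def)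
    \<comment> \<open>Cone coordinates are unique because position and direction of the edge are
      linearly independent.\<close>
    have mem: "s \<in> {t..1} \<and> \<tau> \<in> {0..1}" if mS: "s *\<^sub>R pt i \<tau> \<in> S i" for s \<tau>
    proof -
      obtain s' \<tau>' where st: "s' \<in> {t..1}" "\<tau>' \<in> {0..1}" "s *\<^sub>R pt i \<tau> = s' *\<^sub>R pt i \<tau>'"
        using mS unfolding S_def by auto
      have "(s - s') *\<^sub>R va i + (s * \<tau> - s' * \<tau>') *\<^sub>R vd i = s *\<^sub>R pt i \<tau> - s' *\<^sub>R pt i \<tau>'"
        by (simp add: pt_def algebra_simps)
      then have "(s - s') *\<^sub>R va i + (s * \<tau> - s' * \<tau>') *\<^sub>R vd i = 0" using st(3) by simp
      from indep2[OF D this] show ?thesis using st t by auto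
    qed
    have "(\<integral>\<^sup>+x. F x * indicator (S i) x \<partial>lborel) = ennreal \<bar>vD i\<bar> *
       (\<integral>\<^sup>+s. ennreal \<bar>s\<bar> * (\<integral>\<^sup>+\<tau>. F (s *\<^sub>R pt i \<tau>) * indicator (S i) (s *\<^sub>R pt i \<tau>) \<partial>lborel) \<partial>lborel)"
      using nn_integral_polar[of "\<lambda>x. F x * indicator (S i) x", OF _ D] by (simp add: vD_def pt_def)
    also have "\<dots> \<le> ennreal \<bar>vD i\<bar> * (\<integral>\<^sup>+s. (\<integral>\<^sup>+\<tau>. F (s *\<^sub>R pt i \<tau>) * indicator {0..1} \<tau> \<partial>lborel) * indicator {t..1} s \<partial>lborel)"
    proof (intro mult_left_mono nn_integral_mono)
      fix s :: real
      show "ennreal \<bar>s\<bar> * (\<integral>\<^sup>+\<tau>. F (s *\<^sub>R pt i \<tau>) * indicator (S i) (s *\<^sub>R pt i \<tau>) \<partial>lborel)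
        \<le> (\<integral>\<^sup>+\<tau>. F (s *\<^sub>R pt i \<tau>) * indicator {0..1} \<tau> \<partial>lborel) * indicator {t..1} s"
      proof (cases "s \<in> {t..1}")
        case True
        have "ennreal \<bar>s\<bar> * (\<integral>\<^sup>+\<tau>. F (s *\<^sub>R pt i \<tau>) * indicator (S i) (s *\<^sub>R pt i \<tau>) \<partial>lborel)
          \<le> ennreal 1 * (\<integral>\<^sup>+\<tau>. F (s *\<^sub>R pt i \<tau>) * indicator {0..1} \<tau> \<partial>lborel)"
        proof (rule mult_mono, goal_cases)
          case 1 show ?case using True t by (intro ennreal_leI) auto
        next
          case 2
          show ?case
          proof (rule nn_integral_mono)
          show "F (s *\<^sub>R pt i \<tau>) * indicator (S i) (s *\<^sub>R pt i \<tau>) \<le> F (s *\<^sub>R pt i \<tau>) * indicator {0..1} \<tau>" for \<tau>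
            using mem[of s \<tau>] by (auto simp: indicator_def)
          qed
        qed auto
        then show ?thesis using True by simp
      next
        case False
        then have z: "(\<lambda>\<tau>. F (s *\<^sub>R pt i \<tau>) * indicator (S i) (s *\<^sub>R pt i \<tau>)) = (\<lambda>\<tau>. 0)"
          using mem[of s] by (auto simp: indicator_def fun_eq_iff)
        show ?thesis unfolding z by simp
      qed
    qed simp
    finally show "(\<integral>\<^sup>+x. F x * indicator (S i) x \<partial>lborel) \<le> ennreal \<bar>vD i\<bar> * (\<integral>\<^sup>+s. (\<integral>\<^sup>+\<tau>. F (s *\<^sub>R pt i \<tau>) * indicator {0..1} \<tau> \<partial>lborel) * indicator {t..1} s \<partial>lborel)" .
  qed
  finally show ?thesis .
qed

definition edge_diff_sq :: "nat \<Rightarrow> (R2 \<Rightarrow> complex) \<Rightarrow> real \<Rightarrow> ennreal" where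
  "edge_diff_sq i v t = (\<integral>\<^sup>+\<tau>. ennreal ((cmod (v (pt i \<tau>) - v (t *\<^sub>R pt i \<tau>)))\<^sup>2) * indicator {0..1} \<tau> \<partial>lborel)"

definition edge_sq :: "nat \<Rightarrow> (R2 \<Rightarrow> complex) \<Rightarrow> ennreal" where
  "edge_sq i v = (\<integral>\<^sup>+\<tau>. ennreal ((cmod (v (pt i \<tau>)))\<^sup>2) * indicator {0..1} \<tau> \<partial>lborel)"

definition annulus_grad :: "(R2 \<Rightarrow> complex) \<Rightarrow> real \<Rightarrow> ennreal" where
  "annulus_grad v t = (\<integral>\<^sup>+x. ennreal (grad_sq v x) * indicator (annulus t) x \<partial>lborel)"

text \<open>The estimate that replaces boundary regularity: the difference between the boundary
  values and those on the dilated edge is small of order \<open>1 - t\<close> relative to the energy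
  of the shell between them.\<close>

lemma edge_diff_sq_le:
  assumes i: "i < length vs" and t: "0 < t" "t < 1" and v: "smooth v"
  shows "edge_diff_sq i v t \<le> ennreal ((1 - t) * rad\<^sup>2 / (t * \<bar>vD i\<bar>)) * annulus_grad v t"
proof -
  have [measurable]: "grad_sq v \<in> borel_measurable borel" by (rule grad_sq_borel[OF v])
  have "edge_diff_sq i v t \<le> (\<integral>\<^sup>+\<tau>. ennreal ((1 - t) * rad\<^sup>2) * ((\<integral>\<^sup>+s. ennreal (grad_sq v (s *\<^sub>R pt i \<tau>)) * indicator {t..1} s \<partial>lborel) * indicator {0..1} \<tau>) \<partial>lborel)"
    unfolding edge_diff_sq_def
  proof (rule nn_integral_mono)
    fix \<tau> :: real
    show "ennreal ((cmod (v (pt i \<tau>) - v (t *\<^sub>R pt i \<tau>)))\<^sup>2) * indicator {0..1} \<tau> \<le>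
      ennreal ((1 - t) * rad\<^sup>2) * ((\<integral>\<^sup>+s. ennreal (grad_sq v (s *\<^sub>R pt i \<tau>)) * indicator {t..1} s \<partial>lborel) * indicator {0..1} \<tau>)"
    proof (cases "\<tau> \<in> {0..1}")
      case True
      have "ennreal ((cmod (v (pt i \<tau>) - v (t *\<^sub>R pt i \<tau>)))\<^sup>2) \<le>
        ennreal ((1 - t) * (norm (pt i \<tau>))\<^sup>2) * (\<integral>\<^sup>+s. ennreal (grad_sq v (s *\<^sub>R pt i \<tau>)) * indicator {t..1} s \<partial>lborel)"
        using line_estimate[OF v, of t 1 "pt i \<tau>"] t by simp
      also have "\<dots> \<le> ennreal ((1 - t) * rad\<^sup>2) * (\<integral>\<^sup>+s. ennreal (grad_sq v (s *\<^sub>R pt i \<tau>)) * indicator {t..1} s \<partial>lborel)"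
        using rad(2)[OF pt_closure[OF i True]] t by (intro mult_right_mono ennreal_leI mult_left_mono power_mono) auto
      finally show ?thesis using True by simp
    qed simp
  qed
  also have "\<dots> = ennreal ((1 - t) * rad\<^sup>2) * (\<integral>\<^sup>+\<tau>. (\<integral>\<^sup>+s. ennreal (grad_sq v (s *\<^sub>R pt i \<tau>)) * indicator {t..1} s \<partial>lborel) * indicator {0..1} \<tau> \<partial>lborel)"
    by (rule nn_integral_cmult) measurable
  also have "\<dots> \<le> ennreal ((1 - t) * rad\<^sup>2) * (ennreal (1 / (t * \<bar>vD i\<bar>)) * annulus_grad v t)"
    unfolding annulus_grad_def by (intro mult_left_mono polar_le[OF i t]) auto
  also have "\<dots> = ennreal ((1 - t) * rad\<^sup>2 / (t * \<bar>vD i\<bar>)) * annulus_grad v t"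
    using t by (simp add: mult.assoc[symmetric] flip: ennreal_mult)
  finally show ?thesis .
qed

lemma annulus_grad_mono: "0 < t \<Longrightarrow> t \<le> s \<Longrightarrow> s \<le> 1 \<Longrightarrow> annulus_grad v s \<le> annulus_grad v t"
  unfolding annulus_grad_def using annulus_mono[of t s] by (intro nn_integral_mono) (auto simp: indicator_def)

text \<open>One bound for all dilation factors between \<open>t\<close> and \<open>1\<close>, so
  that it can be integrated over them.\<close>

lemma edge_diff_sq_le_unif:
  assumes i: "i < length vs" and t: "0 < t" "t \<le> s" "s \<le> 1" "t < 1" and v: "smooth v"
  shows "edge_diff_sq i v s \<le> ennreal ((1 - t) * rad\<^sup>2 / (t * \<bar>vD i\<bar>)) * annulus_grad v t"
proof (cases "s = 1")
  case True then show ?thesis by (simp add: edge_diff_sq_def)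
next
  case False
  have D: "\<bar>vD i\<bar> > 0" using vD_nonzero[OF i] by simp
  have "edge_diff_sq i v s \<le> ennreal ((1 - s) * rad\<^sup>2 / (s * \<bar>vD i\<bar>)) * annulus_grad v s" by (rule edge_diff_sq_le) (use i t v False in auto)
  also have "\<dots> \<le> ennreal ((1 - t) * rad\<^sup>2 / (t * \<bar>vD i\<bar>)) * annulus_grad v t"
  proof (intro mult_mono ennreal_leI annulus_grad_mono frac_le mult_right_mono)
    show "0 < t * \<bar>vD i\<bar>" using t D by simp
  qed (use t D in auto)
  finally show ?thesis .
qed

text \<open>Each value in the shell is compared with the boundary value on the same ray; integration
  over the rays' parameter in \<open>{t..1}\<close> gains the thickness \<open>1 - t\<close>. The
  gradient part therefore carries its square.\<close>

lemma annulus_L2: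
  assumes t: "0 < t" "t < 1" and v: "smooth v"
  shows "(\<integral>\<^sup>+x. ennreal ((cmod (v x))\<^sup>2) * indicator (annulus t) x \<partial>lborel) \<le>
    (\<Sum>i<length vs. ennreal \<bar>vD i\<bar> * (ennreal (2 * (1 - t)) * (edge_sq i v + ennreal ((1 - t) * rad\<^sup>2 / (t * \<bar>vD i\<bar>)) * annulus_grad v t)))"
proof -
  have [measurable]: "v \<in> borel_measurable borel" by (rule smooth_borel[OF v])
  have "(\<integral>\<^sup>+x. ennreal ((cmod (v x))\<^sup>2) * indicator (annulus t) x \<partial>lborel) \<le>
    (\<Sum>i<length vs. ennreal \<bar>vD i\<bar> * (\<integral>\<^sup>+s. (\<integral>\<^sup>+\<tau>. ennreal ((cmod (v (s *\<^sub>R pt i \<tau>)))\<^sup>2) * indicator {0..1} \<tau> \<partial>lborel) * indicator {t..1} s \<partial>lborel))"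
    by (rule polar_ge[OF t]) measurable
  also have "\<dots> \<le> (\<Sum>i<length vs. ennreal \<bar>vD i\<bar> * (ennreal (2 * (1 - t)) * (edge_sq i v + ennreal ((1 - t) * rad\<^sup>2 / (t * \<bar>vD i\<bar>)) * annulus_grad v t)))"
  proof (intro sum_mono mult_left_mono)
    fix i assume "i \<in> {..<length vs}"
    then have i: "i < length vs" by simp
    have "(\<integral>\<^sup>+s. (\<integral>\<^sup>+\<tau>. ennreal ((cmod (v (s *\<^sub>R pt i \<tau>)))\<^sup>2) * indicator {0..1} \<tau> \<partial>lborel) * indicator {t..1} s \<partial>lborel)
      \<le> (\<integral>\<^sup>+s. ennreal 2 * (edge_sq i v + ennreal ((1 - t) * rad\<^sup>2 / (t * \<bar>vD i\<bar>)) * annulus_grad v t) * indicator {t..1} s \<partial>lborel)"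
    proof (rule nn_integral_mono)
      fix s :: real
      show "(\<integral>\<^sup>+\<tau>. ennreal ((cmod (v (s *\<^sub>R pt i \<tau>)))\<^sup>2) * indicator {0..1} \<tau> \<partial>lborel) * indicator {t..1} s
         \<le> ennreal 2 * (edge_sq i v + ennreal ((1 - t) * rad\<^sup>2 / (t * \<bar>vD i\<bar>)) * annulus_grad v t) * indicator {t..1} s"
      proof (cases "s \<in> {t..1}")
        case True
        have "(\<integral>\<^sup>+\<tau>. ennreal ((cmod (v (s *\<^sub>R pt i \<tau>)))\<^sup>2) * indicator {0..1} \<tau> \<partial>lborel)
          \<le> (\<integral>\<^sup>+\<tau>. ennreal 2 * (ennreal ((cmod (v (pt i \<tau>)))\<^sup>2) * indicator {0..1} \<tau> + ennreal ((cmod (v (pt i \<tau>) - v (s *\<^sub>R pt i \<tau>)))\<^sup>2) * indicator {0..1} \<tau>) \<partial>lborel)"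
        proof (rule nn_integral_mono)
          fix \<tau> :: real
          have "ennreal ((cmod (v (s *\<^sub>R pt i \<tau>)))\<^sup>2) \<le> ennreal 2 * (ennreal ((cmod (v (pt i \<tau>)))\<^sup>2) + ennreal ((cmod (v (pt i \<tau>) - v (s *\<^sub>R pt i \<tau>)))\<^sup>2))"
            using ennreal_cmod_sq_le[of "v (s *\<^sub>R pt i \<tau>)" "v (pt i \<tau>)"] by (simp add: norm_minus_commute distrib_left)
          then show "ennreal ((cmod (v (s *\<^sub>R pt i \<tau>)))\<^sup>2) * indicator {0..1} \<tau> \<le> ennreal 2 * (ennreal ((cmod (v (pt i \<tau>)))\<^sup>2) * indicator {0..1} \<tau> + ennreal ((cmod (v (pt i \<tau>) - v (s *\<^sub>R pt i \<tau>)))\<^sup>2) * indicator {0..1} \<tau>)"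
            by (auto simp: indicator_def)
        qed
        also have "\<dots> = ennreal 2 * (edge_sq i v + edge_diff_sq i v s)"
          unfolding edge_sq_def edge_diff_sq_def by (subst nn_integral_cmult, measurable, subst nn_integral_add, auto)
        also have "\<dots> \<le> ennreal 2 * (edge_sq i v + ennreal ((1 - t) * rad\<^sup>2 / (t * \<bar>vD i\<bar>)) * annulus_grad v t)"
          using True t by (intro mult_left_mono add_left_mono edge_diff_sq_le_unif[OF i _ _ _ _ v]) auto
        finally show ?thesis using True by simp
      qed simp
    qed
    also have "\<dots> = ennreal 2 * (edge_sq i v + ennreal ((1 - t) * rad\<^sup>2 / (t * \<bar>vD i\<bar>)) * annulus_grad v t) * ennreal (1 - t)"
      using t by (subst nn_integral_cmult_indicator) auto
    also have "\<dots> = ennreal (2 * (1 - t)) * (edge_sq i v + ennreal ((1 - t) * rad\<^sup>2 / (t * \<bar>vD i\<bar>)) * annulus_grad v t)"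
    proof -
      have "ennreal (2 * (1 - t)) = ennreal 2 * ennreal (1 - t)" using t by (subst ennreal_mult) auto
      then show ?thesis by (simp only: mult_ac)
    qed
    finally show "(\<integral>\<^sup>+s. (\<integral>\<^sup>+\<tau>. ennreal ((cmod (v (s *\<^sub>R pt i \<tau>)))\<^sup>2) * indicator {0..1} \<tau> \<partial>lborel) * indicator {t..1} s \<partial>lborel)
      \<le> ennreal (2 * (1 - t)) * (edge_sq i v + ennreal ((1 - t) * rad\<^sup>2 / (t * \<bar>vD i\<bar>)) * annulus_grad v t)" .
  qed simp
  finally show ?thesis .
qed

text \<open>The comparison of \<open>annulus_L2\<close> read in the other direction, at the fixed
  factor \<open>1/2\<close>: the boundary values are averaged over \<open>s\<close> in
  \<open>{1/2..1}\<close>. The length \<open>1/2\<close> of this interval and the two splittings of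
  squares account for the constants \<open>8\<close> and \<open>2\<close>.\<close>

lemma trace_le:
  assumes i: "i < length vs" and v: "smooth v"
  shows "edge_sq i v \<le> ennreal (8 / \<bar>vD i\<bar>) * (\<integral>\<^sup>+x. ennreal ((cmod (v x))\<^sup>2) * indicator (annulus (1/2)) x \<partial>lborel)
     + ennreal (2 * rad\<^sup>2 / \<bar>vD i\<bar>) * annulus_grad v (1/2)"
proof -
  have [measurable]: "v \<in> borel_measurable borel" by (rule smooth_borel[OF v])
  define B where "B = ennreal (rad\<^sup>2 / \<bar>vD i\<bar>) * annulus_grad v (1/2)"
  define P where "P = (\<integral>\<^sup>+x. ennreal ((cmod (v x))\<^sup>2) * indicator (annulus (1/2)) x \<partial>lborel)"
  have edB: "edge_diff_sq i v s \<le> B" if "s \<in> {1/2..1}" for s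
    using edge_diff_sq_le_unif[OF i, of "1/2" s v] that v by (simp add: B_def)
  have pl: "(\<integral>\<^sup>+s. (\<integral>\<^sup>+\<tau>. ennreal ((cmod (v (s *\<^sub>R pt i \<tau>)))\<^sup>2) * indicator {1/2..1} s * indicator {0..1} \<tau> \<partial>lborel) \<partial>lborel)
     \<le> ennreal (2 / \<bar>vD i\<bar>) * P"
  proof -
    have "(\<integral>\<^sup>+s. (\<integral>\<^sup>+\<tau>. ennreal ((cmod (v (s *\<^sub>R pt i \<tau>)))\<^sup>2) * indicator {1/2..1} s * indicator {0..1} \<tau> \<partial>lborel) \<partial>lborel)
      = (\<integral>\<^sup>+\<tau>. (\<integral>\<^sup>+s. ennreal ((cmod (v (s *\<^sub>R pt i \<tau>)))\<^sup>2) * indicator {1/2..1} s * indicator {0..1} \<tau> \<partial>lborel) \<partial>lborel)"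
      by (rule lborel_pair.Fubini') measurable
    also have "\<dots> = (\<integral>\<^sup>+\<tau>. (\<integral>\<^sup>+s. ennreal ((cmod (v (s *\<^sub>R pt i \<tau>)))\<^sup>2) * indicator {1/2..1} s \<partial>lborel) * indicator {0..1} \<tau> \<partial>lborel)"
    proof (rule nn_integral_cong)
      fix \<tau> :: real
      show "(\<integral>\<^sup>+s. ennreal ((cmod (v (s *\<^sub>R pt i \<tau>)))\<^sup>2) * indicator {1/2..1} s * indicator {0..1} \<tau> \<partial>lborel) =
          (\<integral>\<^sup>+s. ennreal ((cmod (v (s *\<^sub>R pt i \<tau>)))\<^sup>2) * indicator {1/2..1} s \<partial>lborel) * indicator {0..1} \<tau>"
        by (subst nn_integral_multc) auto
    qed
    also have "\<dots> \<le> ennreal (1 / (1/2 * \<bar>vD i\<bar>)) * P" unfolding P_def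
      by (rule polar_le[OF i, where F="\<lambda>x. ennreal ((cmod (v x))\<^sup>2)"]) auto
    finally show ?thesis by simp
  qed
  have "edge_sq i v * ennreal (1/2) = (\<integral>\<^sup>+s. edge_sq i v * indicator {1/2..1::real} s \<partial>lborel)"
    by (subst nn_integral_cmult_indicator) auto
  also have "\<dots> \<le> (\<integral>\<^sup>+s. ennreal 2 * (\<integral>\<^sup>+\<tau>. ennreal ((cmod (v (s *\<^sub>R pt i \<tau>)))\<^sup>2) * indicator {1/2..1} s * indicator {0..1} \<tau> \<partial>lborel)
       + ennreal 2 * B * indicator {1/2..1} s \<partial>lborel)"
  proof (rule nn_integral_mono)
    fix s :: real
    show "edge_sq i v * indicator {1/2..1} s \<le> ennreal 2 * (\<integral>\<^sup>+\<tau>. ennreal ((cmod (v (s *\<^sub>R pt i \<tau>)))\<^sup>2) * indicator {1/2..1} s * indicator {0..1} \<tau> \<partial>lborel)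
       + ennreal 2 * B * indicator {1/2..1} s"
    proof (cases "s \<in> {1/2..1}")
      case True
      have "edge_sq i v \<le> (\<integral>\<^sup>+\<tau>. ennreal 2 * (ennreal ((cmod (v (s *\<^sub>R pt i \<tau>)))\<^sup>2) * indicator {0..1} \<tau>) + ennreal 2 * (ennreal ((cmod (v (pt i \<tau>) - v (s *\<^sub>R pt i \<tau>)))\<^sup>2) * indicator {0..1} \<tau>) \<partial>lborel)"
        unfolding edge_sq_def
      proof (rule nn_integral_mono)
        fix \<tau> :: real
        have "ennreal ((cmod (v (pt i \<tau>)))\<^sup>2) \<le> ennreal 2 * ennreal ((cmod (v (s *\<^sub>R pt i \<tau>)))\<^sup>2) + ennreal 2 * ennreal ((cmod (v (pt i \<tau>) - v (s *\<^sub>R pt i \<tau>)))\<^sup>2)"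
          by (rule ennreal_cmod_sq_le)
        then show "ennreal ((cmod (v (pt i \<tau>)))\<^sup>2) * indicator {0..1} \<tau> \<le> ennreal 2 * (ennreal ((cmod (v (s *\<^sub>R pt i \<tau>)))\<^sup>2) * indicator {0..1} \<tau>) + ennreal 2 * (ennreal ((cmod (v (pt i \<tau>) - v (s *\<^sub>R pt i \<tau>)))\<^sup>2) * indicator {0..1} \<tau>)"
          by (auto simp: indicator_def)
      qed
      also have "\<dots> = ennreal 2 * (\<integral>\<^sup>+\<tau>. ennreal ((cmod (v (s *\<^sub>R pt i \<tau>)))\<^sup>2) * indicator {0..1} \<tau> \<partial>lborel) + ennreal 2 * edge_diff_sq i v s"
        unfolding edge_diff_sq_def by (subst nn_integral_add, measurable, subst nn_integral_cmult, measurable, subst nn_integral_cmult, auto)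
      also have "\<dots> \<le> ennreal 2 * (\<integral>\<^sup>+\<tau>. ennreal ((cmod (v (s *\<^sub>R pt i \<tau>)))\<^sup>2) * indicator {0..1} \<tau> \<partial>lborel) + ennreal 2 * B"
        by (intro add_left_mono mult_left_mono edB True) auto
      finally show ?thesis using True by simp
    qed simp
  qed
  also have "\<dots> = ennreal 2 * (\<integral>\<^sup>+s. (\<integral>\<^sup>+\<tau>. ennreal ((cmod (v (s *\<^sub>R pt i \<tau>)))\<^sup>2) * indicator {1/2..1} s * indicator {0..1} \<tau> \<partial>lborel) \<partial>lborel) + ennreal 2 * B * ennreal (1/2)"
    by (subst nn_integral_add, measurable, subst nn_integral_cmult, measurable, subst nn_integral_cmult_indicator, auto)
  also have "\<dots> \<le> ennreal 2 * (ennreal (2 / \<bar>vD i\<bar>) * P) + ennreal 2 * B * ennreal (1/2)"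
    by (intro add_right_mono mult_left_mono pl) auto
  finally have "ennreal 2 * (edge_sq i v * ennreal (1/2)) \<le> ennreal 2 * (ennreal 2 * (ennreal (2 / \<bar>vD i\<bar>) * P) + ennreal 2 * B * ennreal (1/2))"
    by (rule mult_left_mono) simp
  moreover have "ennreal 2 * (edge_sq i v * ennreal (1/2)) = edge_sq i v"
  proof -
    have "ennreal 2 * (edge_sq i v * ennreal (1/2)) = (ennreal 2 * ennreal (1/2)) * edge_sq i v" by (simp only: mult_ac)
    also have "ennreal 2 * ennreal (1/2) = 1" by (subst ennreal_mult[symmetric]) auto
    finally show ?thesis by simp
  qed
  moreover have "ennreal 2 * (ennreal 2 * (ennreal (2 / \<bar>vD i\<bar>) * P) + ennreal 2 * B * ennreal (1/2))
     = ennreal (8 / \<bar>vD i\<bar>) * P + ennreal (2 * rad\<^sup>2 / \<bar>vD i\<bar>) * annulus_grad v (1/2)"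
  proof -
    have "ennreal 2 * (ennreal 2 * (ennreal (2 / \<bar>vD i\<bar>) * P)) = (ennreal 2 * ennreal 2 * ennreal (2 / \<bar>vD i\<bar>)) * P" by (simp only: mult_ac)
    also have "ennreal 2 * ennreal 2 * ennreal (2 / \<bar>vD i\<bar>) = ennreal (8 / \<bar>vD i\<bar>)"
      using ennreal_mult[of 4 "2 / \<bar>vD i\<bar>"] ennreal_mult[of 2 2] by simp
    finally have 1: "ennreal 2 * (ennreal 2 * (ennreal (2 / \<bar>vD i\<bar>) * P)) = ennreal (8 / \<bar>vD i\<bar>) * P" .
    have "ennreal 2 * (ennreal 2 * B * ennreal (1/2)) = (ennreal 2 * ennreal 2 * ennreal (1/2) * ennreal (rad\<^sup>2 / \<bar>vD i\<bar>)) * annulus_grad v (1/2)"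
      unfolding B_def by (simp only: mult_ac)
    also have "ennreal 2 * ennreal 2 * ennreal (1/2) * ennreal (rad\<^sup>2 / \<bar>vD i\<bar>) = ennreal (2 * rad\<^sup>2 / \<bar>vD i\<bar>)"
    proof -
      have "ennreal 2 * ennreal 2 * ennreal (1/2) * ennreal (rad\<^sup>2 / \<bar>vD i\<bar>) = ennreal 2 * ennreal (rad\<^sup>2 / \<bar>vD i\<bar>) * (ennreal 2 * ennreal (1/2))"
        by (simp only: mult_ac)
      also have "ennreal 2 * ennreal (1/2) = 1" by (subst ennreal_mult[symmetric]) auto
      finally show ?thesis using ennreal_mult[of 2 "rad\<^sup>2 / \<bar>vD i\<bar>"] by simp
    qed
    finally show ?thesis using 1 by (simp add: distrib_left)
  qed
  ultimately show ?thesis by (simp add: P_def)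
qed

text \<open>After exchanging the integrals, the energy of \<open>v\<close> at \<open>s x\<close> is
  rescaled for each \<open>s\<close>; since \<open>s G\<close> lies in \<open>G\<close>, each slice
  costs at most \<open>1 / t\<^sup>2\<close>. The length of the ray segment and the length of the
  parameter interval contribute one factor \<open>1 - t\<close> each.\<close>

lemma dilation_le:
  assumes t: "0 < t" "t < 1" and v: "smooth v"
  shows "(\<integral>\<^sup>+x. ennreal ((cmod (v x - v (t *\<^sub>R x)))\<^sup>2) * indicator G x \<partial>lborel) \<le>
    ennreal ((1 - t)\<^sup>2 * rad\<^sup>2 / t\<^sup>2) * (\<integral>\<^sup>+x. ennreal (grad_sq v x) * indicator G x \<partial>lborel)"
proof -
  have [measurable]: "grad_sq v \<in> borel_measurable borel" "v \<in> borel_measurable borel"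
    by (rule grad_sq_borel[OF v], rule smooth_borel[OF v])
  have [measurable]: "G \<in> sets borel" using open_G by (rule borel_open)
  define Q where "Q = (\<integral>\<^sup>+x. ennreal (grad_sq v x) * indicator G x \<partial>lborel)"
  have "(\<integral>\<^sup>+x. ennreal ((cmod (v x - v (t *\<^sub>R x)))\<^sup>2) * indicator G x \<partial>lborel) \<le>
     (\<integral>\<^sup>+x. ennreal ((1 - t) * rad\<^sup>2) * (\<integral>\<^sup>+s. ennreal (grad_sq v (s *\<^sub>R x)) * indicator {t..1} s * indicator G x \<partial>lborel) \<partial>lborel)"
  proof (rule nn_integral_mono)
    fix x
    show "ennreal ((cmod (v x - v (t *\<^sub>R x)))\<^sup>2) * indicator G x \<le>
      ennreal ((1 - t) * rad\<^sup>2) * (\<integral>\<^sup>+s. ennreal (grad_sq v (s *\<^sub>R x)) * indicator {t..1} s * indicator G x \<partial>lborel)"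
    proof (cases "x \<in> G")
      case True
      then have x: "norm x \<le> rad" using rad(2) closure_subset by blast
      have "ennreal ((cmod (v x - v (t *\<^sub>R x)))\<^sup>2) \<le> ennreal ((1 - t) * (norm x)\<^sup>2) * (\<integral>\<^sup>+s. ennreal (grad_sq v (s *\<^sub>R x)) * indicator {t..1} s \<partial>lborel)"
        using line_estimate[OF v, of t 1 x] t by simp
      also have "\<dots> \<le> ennreal ((1 - t) * rad\<^sup>2) * (\<integral>\<^sup>+s. ennreal (grad_sq v (s *\<^sub>R x)) * indicator {t..1} s \<partial>lborel)"
        using x t by (intro mult_right_mono ennreal_leI mult_left_mono power_mono) auto
      finally show ?thesis using True by simp
    qed simp
  qed
  also have "\<dots> = ennreal ((1 - t) * rad\<^sup>2) * (\<integral>\<^sup>+x. (\<integral>\<^sup>+s. ennreal (grad_sq v (s *\<^sub>R x)) * indicator {t..1} s * indicator G x \<partial>lborel) \<partial>lborel)"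
    by (rule nn_integral_cmult) measurable
  also have "(\<integral>\<^sup>+x. (\<integral>\<^sup>+s. ennreal (grad_sq v (s *\<^sub>R x)) * indicator {t..1} s * indicator G x \<partial>lborel) \<partial>lborel)
     = (\<integral>\<^sup>+s. (\<integral>\<^sup>+x. ennreal (grad_sq v (s *\<^sub>R x)) * indicator {t..1} s * indicator G x \<partial>lborel) \<partial>lborel)"
    by (rule lborel_pair.Fubini'[symmetric]) measurable
  also have "\<dots> \<le> (\<integral>\<^sup>+s. ennreal (1 / t\<^sup>2) * Q * indicator {t..1} s \<partial>lborel)"
  proof (rule nn_integral_mono)
    fix s :: real
    show "(\<integral>\<^sup>+x. ennreal (grad_sq v (s *\<^sub>R x)) * indicator {t..1} s * indicator G x \<partial>lborel) \<le> ennreal (1 / t\<^sup>2) * Q * indicator {t..1} s"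
    proof (cases "s \<in> {t..1}")
      case True
      have sG: "s *\<^sub>R x \<in> G" if "x \<in> G" for x
        using shrink_G[of s x] that True t closure_subset by (cases "s = 1") auto
      have "(\<integral>\<^sup>+x. ennreal (grad_sq v (s *\<^sub>R x)) * indicator G x \<partial>lborel) \<le> (\<integral>\<^sup>+x. ennreal (grad_sq v (s *\<^sub>R x)) * indicator G (s *\<^sub>R x) \<partial>lborel)"
        by (rule nn_integral_mono) (use sG in \<open>auto simp: indicator_def\<close>)
      also have "\<dots> = ennreal (1 / s\<^sup>2) * Q"
        using nn_integral_affine[of "\<lambda>x. ennreal (grad_sq v x) * indicator G x" s 0] True t by (simp add: Q_def)
      also have "\<dots> \<le> ennreal (1 / t\<^sup>2) * Q"
        using True t by (intro mult_right_mono ennreal_leI frac_le power_mono) auto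
      finally show ?thesis using True by simp
    qed simp
  qed
  also have "\<dots> = ennreal (1 / t\<^sup>2) * Q * ennreal (1 - t)"
    using t by (subst nn_integral_cmult_indicator) auto
  finally have "(\<integral>\<^sup>+x. ennreal ((cmod (v x - v (t *\<^sub>R x)))\<^sup>2) * indicator G x \<partial>lborel)
     \<le> ennreal ((1 - t) * rad\<^sup>2) * (ennreal (1 / t\<^sup>2) * Q * ennreal (1 - t))" by (simp add: mult_left_mono)
  also have "\<dots> = (ennreal ((1 - t) * rad\<^sup>2) * ennreal (1 / t\<^sup>2) * ennreal (1 - t)) * Q" by (simp only: mult_ac)
  also have "ennreal ((1 - t) * rad\<^sup>2) * ennreal (1 / t\<^sup>2) * ennreal (1 - t) = ennreal ((1 - t)\<^sup>2 * rad\<^sup>2 / t\<^sup>2)"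
  proof -
    have "ennreal ((1 - t) * rad\<^sup>2) * ennreal (1 / t\<^sup>2) * ennreal (1 - t) = ennreal ((1 - t) * rad\<^sup>2 * (1 / t\<^sup>2) * (1 - t))"
      using t by (simp only: ennreal_mult[symmetric] mult_nonneg_nonneg zero_le_power2 divide_nonneg_nonneg zero_le_one diff_ge_0_iff_ge less_imp_le)
    also have "(1 - t) * rad\<^sup>2 * (1 / t\<^sup>2) * (1 - t) = (1 - t)\<^sup>2 * rad\<^sup>2 / t\<^sup>2" by (simp add: power2_eq_square)
    finally show ?thesis .
  qed
  finally show ?thesis by (simp add: Q_def)
qed

end

text \<open>Completeness with a prescribed limit. The geometric rate makes the increments summable
  almost everywhere, and Fatou's lemma bounds the distance. Fixing the limit as a pointwise
  \<open>lim\<close> allows a single function on the plane to serve all edges at once.\<close>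

lemma L2_fast_cauchy_limit:
  fixes f :: "nat \<Rightarrow> 'a \<Rightarrow> complex"
  assumes fin: "finite_measure M" and f: "\<And>n. sqi M (f n)"
    and c: "\<And>n m. n \<le> m \<Longrightarrow> nrm2 M (\<lambda>x. f n x - f m x) \<le> K * (1/2) ^ n" and K: "K \<ge> 0"
    and h: "\<And>x. h x = lim (\<lambda>n. f n x)"
  shows "sqi M h" "\<And>n. nrm2 M (\<lambda>x. f n x - h x) \<le> K * (1/2) ^ n"
proof -
  interpret finite_measure M by fact
  have fm [measurable]: "f n \<in> borel_measurable M" for n using f by (simp add: sqi_def)
  have hm [measurable]: "h \<in> borel_measurable M" unfolding h[abs_def] by (rule borel_measurable_lim_metric) measurable
  have one: "sqi M (\<lambda>x. 1)" by (simp add: sqi_def)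
  define B where "B = nrm2 M (\<lambda>x. 1)"
  have d1: "(\<integral>\<^sup>+x. ennreal (cmod (f (Suc n) x - f n x)) \<partial>M) \<le> ennreal (K * B * (1/2) ^ n)" for n
  proof -
    have s: "sqi M (\<lambda>x. f (Suc n) x - f n x)" by (rule sqi_diff[OF f f])
    have "(LINT x|M. cmod (f (Suc n) x - f n x)) \<le> nrm2 M (\<lambda>x. f (Suc n) x - f n x) * B"
      using cauchy_schwarz_norm[OF s one] by (simp add: B_def)
    also have "nrm2 M (\<lambda>x. f (Suc n) x - f n x) \<le> K * (1/2) ^ n"
      using c[of n "Suc n"] nrm2_minus_commute[of M "f n" "f (Suc n)"] by simp
    finally have "(LINT x|M. cmod (f (Suc n) x - f n x)) \<le> K * B * (1/2) ^ n"
      by (simp add: mult_right_mono B_def mult_ac)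
    moreover have "integrable M (\<lambda>x. cmod (f (Suc n) x - f n x))"
      using integrable_norm[OF sqi_mult_integrable[OF s one]] by simp
    ultimately show ?thesis by (simp add: nn_integral_eq_integral ennreal_leI)
  qed
  have "(\<integral>\<^sup>+x. (\<Sum>n. ennreal (cmod (f (Suc n) x - f n x))) \<partial>M) = (\<Sum>n. \<integral>\<^sup>+x. ennreal (cmod (f (Suc n) x - f n x)) \<partial>M)"
    by (rule nn_integral_suminf) measurable
  also have "\<dots> \<le> (\<Sum>n. ennreal (K * B * (1/2) ^ n))" by (intro suminf_le d1) auto
  also have "\<dots> = ennreal (\<Sum>n. K * B * (1/2) ^ n)"
    by (rule suminf_ennreal2) (use K in \<open>auto simp: B_def intro!: summable_mult summable_geometric\<close>)
  finally have "(\<integral>\<^sup>+x. (\<Sum>n. ennreal (cmod (f (Suc n) x - f n x))) \<partial>M) \<noteq> \<infinity>"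
    by (auto simp: top_unique)
  then have AEs: "AE x in M. (\<Sum>n. ennreal (cmod (f (Suc n) x - f n x))) \<noteq> \<infinity>"
    by (intro nn_integral_PInf_AE) auto
  have AEl: "AE x in M. (\<lambda>n. f n x) \<longlonglongrightarrow> h x"
    using AEs
  proof eventually_elim
    case (elim x)
    then have "summable (\<lambda>n. cmod (f (Suc n) x - f n x))" by (intro summable_suminf_not_top) auto
    then have "summable (\<lambda>n. f (Suc n) x - f n x)" by (rule summable_norm_cancel)
    then have "convergent (\<lambda>n. f n x)"
    proof -
      assume "summable (\<lambda>n. f (Suc n) x - f n x)"
      then have "(\<lambda>n. \<Sum>i<n. f (Suc i) x - f i x) \<longlonglongrightarrow> (\<Sum>n. f (Suc n) x - f n x)" by (rule summable_LIMSEQ)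
      then have "(\<lambda>n. f n x - f 0 x) \<longlonglongrightarrow> (\<Sum>n. f (Suc n) x - f n x)" by (simp only: sum_lessThan_telescope[of "\<lambda>n. f n x"])
      then have "(\<lambda>n. (f n x - f 0 x) + f 0 x) \<longlonglongrightarrow> (\<Sum>n. f (Suc n) x - f n x) + f 0 x"
        by (intro tendsto_add tendsto_const)
      then show ?thesis by (auto simp: convergent_def)
    qed
    then show ?case unfolding h by (simp add: convergent_LIMSEQ_iff)
  qed
  have *: "(\<integral>\<^sup>+x. ennreal ((cmod (f n x - h x))\<^sup>2) \<partial>M) \<le> ennreal ((K * (1/2) ^ n)\<^sup>2)" for n
  proof -
    have "(\<integral>\<^sup>+x. ennreal ((cmod (f n x - h x))\<^sup>2) \<partial>M) = (\<integral>\<^sup>+x. liminf (\<lambda>m. ennreal ((cmod (f n x - f m x))\<^sup>2)) \<partial>M)"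
    proof (rule nn_integral_cong_AE)
      show "AE x in M. ennreal ((cmod (f n x - h x))\<^sup>2) = liminf (\<lambda>m. ennreal ((cmod (f n x - f m x))\<^sup>2))"
        using AEl
      proof eventually_elim
        case (elim x)
        then have "(\<lambda>m. ennreal ((cmod (f n x - f m x))\<^sup>2)) \<longlonglongrightarrow> ennreal ((cmod (f n x - h x))\<^sup>2)"
          by (intro tendsto_ennrealI tendsto_intros)
        from lim_imp_Liminf[OF trivial_limit_sequentially this] show ?case by simp
      qed
    qed
    also have "\<dots> \<le> liminf (\<lambda>m. \<integral>\<^sup>+x. ennreal ((cmod (f n x - f m x))\<^sup>2) \<partial>M)"
      by (rule nn_integral_liminf) measurable
    also have "\<dots> \<le> liminf (\<lambda>m. ennreal ((K * (1/2) ^ n)\<^sup>2))"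
    proof (rule Liminf_mono)
      show "\<forall>\<^sub>F m in sequentially. (\<integral>\<^sup>+x. ennreal ((cmod (f n x - f m x))\<^sup>2) \<partial>M) \<le> ennreal ((K * (1/2) ^ n)\<^sup>2)"
        unfolding eventually_sequentially
      proof (intro exI[of _ n] allI impI)
        fix m assume "n \<le> m"
        then show "(\<integral>\<^sup>+x. ennreal ((cmod (f n x - f m x))\<^sup>2) \<partial>M) \<le> ennreal ((K * (1/2) ^ n)\<^sup>2)"
          using nrm2_nn_integral[OF sqi_diff[OF f f], of n m] c[of n m] by (auto intro!: ennreal_leI power_mono)
      qed
    qed
    also have "\<dots> = ennreal ((K * (1/2) ^ n)\<^sup>2)" by (simp add: Liminf_const)
    finally show ?thesis .
  qed
  have r: "sqi M (\<lambda>x. f n x - h x)" "nrm2 M (\<lambda>x. f n x - h x) \<le> K * (1/2) ^ n" for n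
    using nrm2_le_nn_integral[OF _ *[of n]] K by auto
  then show "\<And>n. nrm2 M (\<lambda>x. f n x - h x) \<le> K * (1/2) ^ n" by blast
  show "sqi M h" using sqi_diff[OF f[of 0] r(1)[of 0]] by simp
qed

section \<open>Boundary norms, the trace inequality and traces of H1 functions\<close>

context starpoly
begin

definition edge_nrm2 :: "nat \<Rightarrow> (R2 \<Rightarrow> complex) \<Rightarrow> real" where
  "edge_nrm2 i f = nrm2 (lebesgue_on {0..1}) (\<lambda>\<tau>. f (edge vs i \<tau>))"

lemma edge_pt: "edge vs i = pt i" by (simp add: edge_eq pt_def fun_eq_iff)

lemma edge_nrm2_nonneg [simp]: "edge_nrm2 i f \<ge> 0" by (simp add: edge_nrm2_def)

lemma continuous_pt: "continuous_on UNIV (pt i)" unfolding pt_def by (intro continuous_intros)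

lemma edge_sqi:
  assumes "continuous_on UNIV f" shows "sqi (lebesgue_on {0..1}) (\<lambda>\<tau>. f (edge vs i \<tau>))"
  unfolding edge_pt by (intro continuous_sqi_01 continuous_on_compose2[OF assms continuous_pt]) auto

lemma bL2_sqi: "bL2 vs h \<longleftrightarrow> (\<forall>i<length vs. sqi (lebesgue_on {0..1}) (\<lambda>t. h (edge vs i t)))"
  by (simp add: bL2_def sqi_def)

lemma bL2_continuous: "continuous_on UNIV f \<Longrightarrow> bL2 vs f"
  by (simp add: bL2_sqi edge_sqi)

text \<open>In this form the triangle and Cauchy-Schwarz inequalities on the boundary follow from
  those on the edges and from the finite-dimensional ones.\<close>

lemma bL2norm_eq: "bL2norm vs h = L2_set (\<lambda>i. sqrt (elen vs i) * edge_nrm2 i h) {..<length vs}"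
  by (simp add: bL2norm_def L2_set_def power_mult_distrib edge_nrm2_def nrm2_sq elen_def)

lemma bL2norm_nonneg [simp]: "bL2norm vs h \<ge> 0" unfolding bL2norm_eq by simp

lemma bL2norm_sq: "(bL2norm vs h)\<^sup>2 = (\<Sum>i<length vs. elen vs i * (edge_nrm2 i h)\<^sup>2)"
  unfolding bL2norm_eq L2_set_def by (simp add: power_mult_distrib elen_def sum_nonneg)

lemma bL2_add: "bL2 vs f \<Longrightarrow> bL2 vs g \<Longrightarrow> bL2 vs (\<lambda>x. f x + g x)"
  by (simp add: bL2_sqi sqi_add)

lemma bL2_diff: "bL2 vs f \<Longrightarrow> bL2 vs g \<Longrightarrow> bL2 vs (\<lambda>x. f x - g x)"
  by (simp add: bL2_sqi sqi_diff)

lemma bL2_cmult: "bL2 vs f \<Longrightarrow> bL2 vs (\<lambda>x. c * f x)"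
  by (simp add: bL2_sqi sqi_cmult)

lemma bL2norm_triangle:
  assumes "bL2 vs f" "bL2 vs g" shows "bL2norm vs (\<lambda>x. f x + g x) \<le> bL2norm vs f + bL2norm vs g"
proof -
  have "bL2norm vs (\<lambda>x. f x + g x) \<le> L2_set (\<lambda>i. sqrt (elen vs i) * edge_nrm2 i f + sqrt (elen vs i) * edge_nrm2 i g) {..<length vs}"
    unfolding bL2norm_eq
  proof (rule L2_set_mono)
    fix i assume "i \<in> {..<length vs}"
    then show "sqrt (elen vs i) * edge_nrm2 i (\<lambda>x. f x + g x) \<le> sqrt (elen vs i) * edge_nrm2 i f + sqrt (elen vs i) * edge_nrm2 i g"
      using nrm2_triangle assms unfolding bL2_sqi edge_nrm2_def distrib_left[symmetric]
      by (intro mult_left_mono nrm2_triangle) (auto simp: elen_def)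
  qed (auto simp: elen_def)
  also have "\<dots> \<le> bL2norm vs f + bL2norm vs g" unfolding bL2norm_eq by (rule L2_set_triangle_ineq)
  finally show ?thesis .
qed

lemma bL2norm_cmult: "bL2norm vs (\<lambda>x. c * f x) = cmod c * bL2norm vs f"
proof -
  have "(bL2norm vs (\<lambda>x. c * f x))\<^sup>2 = (cmod c * bL2norm vs f)\<^sup>2"
    unfolding power_mult_distrib bL2norm_sq by (simp add: edge_nrm2_def nrm2_cmult power_mult_distrib sum_distrib_left mult_ac)
  then show ?thesis by (rule power2_eq_imp_eq) auto
qed

lemma bL2norm_minus_commute: "bL2norm vs (\<lambda>x. f x - g x) = bL2norm vs (\<lambda>x. g x - f x)"
  unfolding bL2norm_eq edge_nrm2_def by (subst nrm2_minus_commute) simp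

lemma bint_add:
  assumes "\<And>i. i < length vs \<Longrightarrow> integrable (lebesgue_on {0..1}) (\<lambda>t. f (edge vs i t))"
    "\<And>i. i < length vs \<Longrightarrow> integrable (lebesgue_on {0..1}) (\<lambda>t. g (edge vs i t))"
  shows "bint vs (\<lambda>x. f x + g x) = bint vs f + bint vs g"
  using assms by (simp add: bint_def sum.distrib scaleR_add_right)

lemma bint_cmult: "bint vs (\<lambda>x. c * f x) = c * bint vs f"
  by (simp add: bint_def sum_distrib_left)

lemma bL2_mult_integrable:
  assumes "bL2 vs f" "bL2 vs g" "i < length vs"
  shows "integrable (lebesgue_on {0..1}) (\<lambda>t. f (edge vs i t) * cnj (g (edge vs i t)))"
  using assms by (intro sqi_mult_cnj_integrable) (auto simp: bL2_sqi)

lemma bint_cauchy_schwarz: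
  assumes "bL2 vs f" "bL2 vs g"
  shows "cmod (bint vs (\<lambda>x. f x * cnj (g x))) \<le> bL2norm vs f * bL2norm vs g"
proof -
  have "cmod (bint vs (\<lambda>x. f x * cnj (g x))) \<le> (\<Sum>i<length vs. \<bar>sqrt (elen vs i) * edge_nrm2 i f\<bar> * \<bar>sqrt (elen vs i) * edge_nrm2 i g\<bar>)"
    unfolding bint_def
  proof (rule sum_norm_le)
    fix i assume "i \<in> {..<length vs}"
    then have i: "i < length vs" by simp
    have "cmod (LINT t|lebesgue_on {0..1}. f (edge vs i t) * cnj (g (edge vs i t))) \<le> edge_nrm2 i f * edge_nrm2 i g"
      unfolding edge_nrm2_def using assms i by (intro cauchy_schwarz_cnj) (auto simp: bL2_sqi)
    then have "elen vs i * cmod (LINT t|lebesgue_on {0..1}. f (edge vs i t) * cnj (g (edge vs i t))) \<le> elen vs i * (edge_nrm2 i f * edge_nrm2 i g)"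
      by (rule mult_left_mono) (simp add: elen_def)
    also have "\<dots> = \<bar>sqrt (elen vs i) * edge_nrm2 i f\<bar> * \<bar>sqrt (elen vs i) * edge_nrm2 i g\<bar>"
      by (simp add: abs_mult elen_def)
    finally show "cmod (elen vs i *\<^sub>R (LINT t|lebesgue_on {0..1}. f (edge vs i t) * cnj (g (edge vs i t)))) \<le> \<bar>sqrt (elen vs i) * edge_nrm2 i f\<bar> * \<bar>sqrt (elen vs i) * edge_nrm2 i g\<bar>"
      by (simp add: elen_def)
  qed
  also have "\<dots> \<le> bL2norm vs f * bL2norm vs g"
    unfolding bL2norm_eq by (rule L2_set_mult_ineq)
  finally show ?thesis .
qed

lemma edge_sq_edge_nrm2: assumes "continuous_on UNIV v" shows "edge_sq i v = ennreal ((edge_nrm2 i v)\<^sup>2)"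
  unfolding edge_sq_def edge_nrm2_def edge_pt
  using nn_integral_on_borel[OF _ edge_sqi[OF assms, unfolded edge_pt, of i]] by simp

lemma edge_diff_sq_edge_nrm2: assumes "smooth v" shows "edge_diff_sq i v t = ennreal ((edge_nrm2 i (\<lambda>x. v x - v (t *\<^sub>R x)))\<^sup>2)"
proof -
  have "continuous_on UNIV (\<lambda>x. v x - v (t *\<^sub>R x))"
    by (intro continuous_intros smooth_continuous[OF assms] continuous_on_compose2[OF smooth_continuous[OF assms]]) auto
  from edge_sq_edge_nrm2[OF this, of i] show ?thesis by (simp add: edge_diff_sq_def edge_sq_def)
qed

definition dirichlet :: "R2 set \<Rightarrow> (R2 \<Rightarrow> complex) \<Rightarrow> real" where
  "dirichlet S v = (\<Sum>j\<in>UNIV. (nrm2 (lebesgue_on S) (pd v j))\<^sup>2)"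

lemma dirichlet_nonneg [simp]: "dirichlet S v \<ge> 0" by (simp add: dirichlet_def sum_nonneg)

lemma grad_sq_dirichlet:
  assumes v: "smooth v" and S: "S \<in> sets borel" "S \<subseteq> G"
  shows "(\<integral>\<^sup>+x. ennreal (grad_sq v x) * indicator S x \<partial>lborel) = ennreal (dirichlet S v)"
proof -
  have Sl: "S \<in> sets lebesgue" using S by simp
  have bS: "bounded S" using S bounded_G bounded_subset by blast
  have [measurable]: "pd v j \<in> borel_measurable borel" for j by (rule smooth_borel[OF smooth_pd[OF v]])
  note S(1) [measurable]
  have s: "sqi (lebesgue_on S) (pd v j)" for j
    by (rule continuous_sqi_on[OF smooth_continuous[OF smooth_pd[OF v]] bS Sl])
  have "(\<integral>\<^sup>+x. ennreal (grad_sq v x) * indicator S x \<partial>lborel) =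
    (\<integral>\<^sup>+x. (\<Sum>j\<in>UNIV. ennreal ((cmod (pd v j x))\<^sup>2) * indicator S x) \<partial>lborel)"
    by (intro nn_integral_cong) (simp add: grad_sq_def sum_ennreal[symmetric] sum_distrib_right del: sum_ennreal)
  also have "\<dots> = (\<Sum>j\<in>UNIV. (\<integral>\<^sup>+x. ennreal ((cmod (pd v j x))\<^sup>2) * indicator S x \<partial>lborel))"
    by (rule nn_integral_sum) measurable
  also have "\<dots> = ennreal (dirichlet S v)"
    using nn_integral_on_borel[OF Sl s] by (simp add: dirichlet_def)
  finally show ?thesis .
qed

lemma G_borel: "G \<in> sets borel" using open_G by (rule borel_open)

lemma annulus_sub: "annulus t \<subseteq> G" by (auto simp: annulus_def)

lemma annulus_grad_dirichlet: "smooth v \<Longrightarrow> annulus_grad v t = ennreal (dirichlet (annulus t) v)"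
  unfolding annulus_grad_def by (rule grad_sq_dirichlet[OF _ annulus_borel annulus_sub])

lemma smooth_sqi_G: "smooth v \<Longrightarrow> S \<subseteq> G \<Longrightarrow> S \<in> sets lebesgue \<Longrightarrow> sqi (lebesgue_on S) v"
  using continuous_sqi_on[OF smooth_continuous, of v S] bounded_subset[OF bounded_G] by blast

lemma edge_diff_le:
  assumes i: "i < length vs" and t: "0 < t" "t < 1" and v: "smooth v"
  shows "(edge_nrm2 i (\<lambda>x. v x - v (t *\<^sub>R x)))\<^sup>2 \<le> (1 - t) * rad\<^sup>2 / (t * \<bar>vD i\<bar>) * dirichlet (annulus t) v"
  using edge_diff_sq_le[OF assms] t unfolding edge_diff_sq_edge_nrm2[OF v] annulus_grad_dirichlet[OF v]
  by (simp add: ennreal_le_iff flip: ennreal_mult)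

lemma annulus_le:
  assumes t: "0 < t" "t < 1" and v: "smooth v"
  shows "(nrm2 (lebesgue_on (annulus t)) v)\<^sup>2 \<le>
    (\<Sum>i<length vs. \<bar>vD i\<bar> * (2 * (1 - t) * ((edge_nrm2 i v)\<^sup>2 + (1 - t) * rad\<^sup>2 / (t * \<bar>vD i\<bar>) * dirichlet (annulus t) v)))"
proof -
  have e: "ennreal \<bar>vD i\<bar> * (ennreal (2 * (1 - t)) * (edge_sq i v + ennreal ((1 - t) * rad\<^sup>2 / (t * \<bar>vD i\<bar>)) * annulus_grad v t))
     = ennreal (\<bar>vD i\<bar> * (2 * (1 - t) * ((edge_nrm2 i v)\<^sup>2 + (1 - t) * rad\<^sup>2 / (t * \<bar>vD i\<bar>) * dirichlet (annulus t) v)))" for i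
  proof -
    define c where "c = (1 - t) * rad\<^sup>2 / (t * \<bar>vD i\<bar>)"
    have c: "c \<ge> 0" using t by (simp add: c_def)
    show ?thesis
      using t c unfolding edge_sq_edge_nrm2[OF smooth_continuous[OF v]] annulus_grad_dirichlet[OF v] c_def[symmetric]
      by (simp add: ennreal_mult ennreal_plus)
  qed
  have nn: "\<bar>vD i\<bar> * (2 * (1 - t) * ((edge_nrm2 i v)\<^sup>2 + (1 - t) * rad\<^sup>2 / (t * \<bar>vD i\<bar>) * dirichlet (annulus t) v)) \<ge> 0" for i
    using t by (intro mult_nonneg_nonneg add_nonneg_nonneg divide_nonneg_nonneg) auto
  have "ennreal ((nrm2 (lebesgue_on (annulus t)) v)\<^sup>2) \<le> ennreal (\<Sum>i<length vs. \<bar>vD i\<bar> * (2 * (1 - t) * ((edge_nrm2 i v)\<^sup>2 + (1 - t) * rad\<^sup>2 / (t * \<bar>vD i\<bar>) * dirichlet (annulus t) v)))"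
    using annulus_L2[OF t v] nn_integral_on_borel[OF annulus_lebesgue smooth_sqi_G[OF v annulus_sub annulus_lebesgue]]
    unfolding e by (simp only: sum_ennreal[OF nn])
  then show ?thesis by (subst (asm) ennreal_le_iff) (rule sum_nonneg[OF nn])
qed

lemma dirichlet_mono:
  assumes v: "smooth v" and "S \<subseteq> G" "S \<in> sets lebesgue" shows "dirichlet S v \<le> dirichlet G v"
  unfolding dirichlet_def
  by (intro sum_mono power_mono sqi_subset(2)[OF smooth_sqi_G[OF smooth_pd[OF v]]]) (use assms G_lebesgue in auto)

text \<open>Summed over the edges to have one constant for all of them; the numerator dominates both
  coefficients in \<open>trace_le\<close>.\<close>

definition trace_const :: real where "trace_const = sqrt (\<Sum>i<length vs. (8 + 2 * rad\<^sup>2) / \<bar>vD i\<bar>)"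

lemma trace_const_nonneg: "trace_const \<ge> 0" by (simp add: trace_const_def sum_nonneg)

lemma trace_ineq:
  assumes i: "i < length vs" and v: "smooth v"
  shows "edge_nrm2 i v \<le> trace_const * (nrm2 (lebesgue_on G) v + (\<Sum>j\<in>UNIV. nrm2 (lebesgue_on G) (pd v j)))"
proof -
  have sv: "sqi (lebesgue_on (annulus (1/2))) v" by (rule smooth_sqi_G[OF v annulus_sub annulus_lebesgue])
  have "ennreal ((edge_nrm2 i v)\<^sup>2) \<le> ennreal (8 / \<bar>vD i\<bar>) * ennreal ((nrm2 (lebesgue_on (annulus (1/2))) v)\<^sup>2) + ennreal (2 * rad\<^sup>2 / \<bar>vD i\<bar>) * ennreal (dirichlet (annulus (1/2)) v)"
    using trace_le[OF i v] nn_integral_on_borel[OF annulus_lebesgue sv]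
    unfolding edge_sq_edge_nrm2[OF smooth_continuous[OF v]] annulus_grad_dirichlet[OF v] by simp
  then have "(edge_nrm2 i v)\<^sup>2 \<le> 8 / \<bar>vD i\<bar> * (nrm2 (lebesgue_on (annulus (1/2))) v)\<^sup>2 + 2 * rad\<^sup>2 / \<bar>vD i\<bar> * dirichlet (annulus (1/2)) v"
    by (simp add: ennreal_le_iff flip: ennreal_mult ennreal_plus)
  also have "\<dots> \<le> 8 / \<bar>vD i\<bar> * (nrm2 (lebesgue_on G) v)\<^sup>2 + 2 * rad\<^sup>2 / \<bar>vD i\<bar> * dirichlet G v"
    by (intro add_mono mult_left_mono power_mono dirichlet_mono[OF v annulus_sub annulus_lebesgue]
        sqi_subset(2)[OF smooth_sqi_G[OF v]] annulus_sub annulus_lebesgue G_lebesgue) auto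
  also have "\<dots> \<le> (8 + 2 * rad\<^sup>2) / \<bar>vD i\<bar> * ((nrm2 (lebesgue_on G) v)\<^sup>2 + dirichlet G v)"
  proof -
    have "8 / \<bar>vD i\<bar> * (nrm2 (lebesgue_on G) v)\<^sup>2 + 2 * rad\<^sup>2 / \<bar>vD i\<bar> * dirichlet G v
      \<le> (8 + 2 * rad\<^sup>2) / \<bar>vD i\<bar> * (nrm2 (lebesgue_on G) v)\<^sup>2 + (8 + 2 * rad\<^sup>2) / \<bar>vD i\<bar> * dirichlet G v"
      by (intro add_mono mult_right_mono divide_right_mono) auto
    then show ?thesis by (simp add: distrib_left)
  qed
  also have "\<dots> \<le> trace_const\<^sup>2 * (nrm2 (lebesgue_on G) v + (\<Sum>j\<in>UNIV. nrm2 (lebesgue_on G) (pd v j)))\<^sup>2"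
  proof (rule mult_mono)
    have "(8 + 2 * rad\<^sup>2) / \<bar>vD i\<bar> \<le> (\<Sum>i<length vs. (8 + 2 * rad\<^sup>2) / \<bar>vD i\<bar>)"
      by (rule member_le_sum) (use i in auto)
    also have "\<dots> = trace_const\<^sup>2" unfolding trace_const_def by (subst real_sqrt_pow2) (auto intro!: sum_nonneg)
    finally show "(8 + 2 * rad\<^sup>2) / \<bar>vD i\<bar> \<le> trace_const\<^sup>2" .
    show "(nrm2 (lebesgue_on G) v)\<^sup>2 + dirichlet G v \<le> (nrm2 (lebesgue_on G) v + (\<Sum>j\<in>UNIV. nrm2 (lebesgue_on G) (pd v j)))\<^sup>2"
      by (simp add: dirichlet_def sum_2 power2_eq_square algebra_simps)
  qed auto
  also have "\<dots> = (trace_const * (nrm2 (lebesgue_on G) v + (\<Sum>j\<in>UNIV. nrm2 (lebesgue_on G) (pd v j))))\<^sup>2"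
    by (simp add: power_mult_distrib)
  finally show ?thesis
    by (rule power2_le_imp_le) (auto intro!: mult_nonneg_nonneg trace_const_nonneg add_nonneg_nonneg sum_nonneg)
qed

lemma dilation_ineq:
  assumes t: "0 < t" "t < 1" and v: "smooth v"
  shows "(nrm2 (lebesgue_on G) (\<lambda>x. v x - v (t *\<^sub>R x)))\<^sup>2 \<le> (1 - t)\<^sup>2 * rad\<^sup>2 / t\<^sup>2 * dirichlet G v"
proof -
  have s: "smooth (\<lambda>x. v x - v (t *\<^sub>R x))" using smooth_diff[OF v smooth_affine[OF v, of 0 t]] by simp
  have "ennreal ((nrm2 (lebesgue_on G) (\<lambda>x. v x - v (t *\<^sub>R x)))\<^sup>2) \<le> ennreal ((1 - t)\<^sup>2 * rad\<^sup>2 / t\<^sup>2) * ennreal (dirichlet G v)"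
    using dilation_le[OF t v] nn_integral_on_borel[OF G_lebesgue smooth_sqi_G[OF s order_refl G_lebesgue]]
      grad_sq_dirichlet[OF v G_borel order_refl] by simp
  then show ?thesis using t by (simp add: ennreal_le_iff flip: ennreal_mult)
qed

text \<open>Along the rapidly converging approximants of \<open>H1_dense\<close> the boundary values are Cauchy by \<open>trace_ineq\<close>.\<close>

lemma trace_exists:
  assumes u: "H1 G u"
  shows "\<exists>un h. (\<forall>n. smooth (un n)) \<and> (\<lambda>n. nrm2 (lebesgue_on G) (\<lambda>x. un n x - u x)) \<longlonglongrightarrow> 0 \<and>
    (\<forall>j. (\<lambda>n. nrm2 (lebesgue_on G) (\<lambda>x. pd (un n) j x - grad G u j x)) \<longlonglongrightarrow> 0) \<and>
    is_trace G vs u h \<and> (\<lambda>n. bL2norm vs (\<lambda>x. un n x - h x)) \<longlonglongrightarrow> 0"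
proof (rule H1_dense[OF open_G bounded_G shrink_image u])
  fix un :: "nat \<Rightarrow> R2 \<Rightarrow> complex"
  assume sm: "\<And>n. smooth (un n)" and l1: "(\<lambda>n. nrm2 (lebesgue_on G) (\<lambda>x. un n x - u x)) \<longlonglongrightarrow> 0"
    and l2: "\<And>j. (\<lambda>n. nrm2 (lebesgue_on G) (\<lambda>x. pd (un n) j x - grad G u j x)) \<longlonglongrightarrow> 0"
    and l3: "(\<lambda>n. H1dist G u (un n)) \<longlonglongrightarrow> 0"
    and b1: "\<And>n. nrm2 (lebesgue_on G) (\<lambda>x. un n x - u x) \<le> (1/2) ^ n"
    and b2: "\<And>n j. nrm2 (lebesgue_on G) (\<lambda>x. pd (un n) j x - grad G u j x) \<le> (1/2) ^ n"
  define h where "h x = lim (\<lambda>n. un n x)" for x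
  \<comment> \<open>Three norms enter the trace inequality, of the function and of its two
    derivatives, each at most \<open>2 * (1/2) ^ n\<close> for a difference of approximants.\<close>
  define K where "K = 6 * trace_const"
  have K: "K \<ge> 0" using trace_const_nonneg by (simp add: K_def)
  have us: "sqi (lebesgue_on G) u" by (rule H1_sqi[OF u])
  have gs': "sqi (lebesgue_on G) (grad G u j)" for j by (rule H1_grad_sqi[OF u])
  have usn: "sqi (lebesgue_on G) (un n)" for n by (rule smooth_sqi_G[OF sm order_refl G_lebesgue])
  have gsn: "sqi (lebesgue_on G) (pd (un n) j)" for n j by (rule smooth_sqi_G[OF smooth_pd[OF sm] order_refl G_lebesgue])
  have two: "(1/2::real) ^ n + (1/2) ^ m \<le> 2 * (1/2) ^ n" if "n \<le> m" for n m :: nat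
    using power_decreasing[OF that, of "1/2::real"] by simp
  have cau: "edge_nrm2 i (\<lambda>x. un n x - un m x) \<le> K * (1/2) ^ n" if i: "i < length vs" and nm: "n \<le> m" for i n m
  proof -
    have s: "smooth (\<lambda>x. un n x - un m x)" by (rule smooth_diff[OF sm sm])
    have 1: "nrm2 (lebesgue_on G) (\<lambda>x. un n x - un m x) \<le> 2 * (1/2) ^ n"
      using nrm2_triangle_via[OF usn us usn, of n m] b1[of n] b1[of m] nrm2_minus_commute[of "lebesgue_on G" u "un m"] two[OF nm] by linarith
    have 2: "nrm2 (lebesgue_on G) (pd (\<lambda>x. un n x - un m x) j) \<le> 2 * (1/2) ^ n" for j
    proof -
      have "pd (\<lambda>x. un n x - un m x) j = (\<lambda>x. pd (un n) j x - pd (un m) j x)"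
        by (simp add: pd_diff[OF sm sm] fun_eq_iff)
      moreover have "nrm2 (lebesgue_on G) (\<lambda>x. pd (un n) j x - pd (un m) j x) \<le> 2 * (1/2) ^ n"
        using nrm2_triangle_via[OF gsn[of n j] gs'[of j] gsn[of m j]] b2[of n j] b2[of m j] nrm2_minus_commute[of "lebesgue_on G" "grad G u j" "pd (un m) j"] two[OF nm] by linarith
      ultimately show ?thesis by simp
    qed
    have "edge_nrm2 i (\<lambda>x. un n x - un m x) \<le> trace_const * (nrm2 (lebesgue_on G) (\<lambda>x. un n x - un m x) + (\<Sum>j\<in>UNIV. nrm2 (lebesgue_on G) (pd (\<lambda>x. un n x - un m x) j)))"
      by (rule trace_ineq[OF i s])
    also have "\<dots> \<le> trace_const * (6 * (1/2) ^ n)"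
      by (rule mult_left_mono[OF _ trace_const_nonneg]) (use 1 2[of 1] 2[of 2] in \<open>simp add: sum_2\<close>)
    finally show ?thesis by (simp add: K_def mult_ac)
  qed
  have fin: "finite_measure (lebesgue_on {0..1::real})"
    by (intro finite_measureI) (simp add: emeasure_restrict_space)
  have tr: "sqi (lebesgue_on {0..1}) (\<lambda>\<tau>. h (edge vs i \<tau>))" "edge_nrm2 i (\<lambda>x. un n x - h x) \<le> K * (1/2) ^ n" if i: "i < length vs" for i n
  proof -
    have c: "nrm2 (lebesgue_on {0..1}) (\<lambda>\<tau>. un n (edge vs i \<tau>) - un m (edge vs i \<tau>)) \<le> K * (1/2) ^ n" if "n \<le> m" for n m
      using cau[OF i that] by (simp add: edge_nrm2_def)
    have hl: "h (edge vs i \<tau>) = lim (\<lambda>n. un n (edge vs i \<tau>))" for \<tau> by (simp add: h_def)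
    have e: "sqi (lebesgue_on {0..1}) (\<lambda>\<tau>. un n (edge vs i \<tau>))" for n
      by (rule edge_sqi[OF smooth_continuous[OF sm]])
    show "sqi (lebesgue_on {0..1}) (\<lambda>\<tau>. h (edge vs i \<tau>))" by (rule L2_fast_cauchy_limit(1)[OF fin e c K hl])
    show "edge_nrm2 i (\<lambda>x. un n x - h x) \<le> K * (1/2) ^ n" for n
      unfolding edge_nrm2_def by (rule L2_fast_cauchy_limit(2)[OF fin e c K hl])
  qed
  have bh: "bL2 vs h" using tr(1) by (simp add: bL2_sqi)
  have "(\<lambda>n. bL2norm vs (\<lambda>x. un n x - h x)) \<longlonglongrightarrow> 0"
  proof (rule Lim_null_comparison[OF always_eventually])
    show "\<forall>n. norm (bL2norm vs (\<lambda>x. un n x - h x)) \<le> (\<Sum>i<length vs. sqrt (elen vs i) * K) * (1/2) ^ n"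
    proof
      fix n
      have "bL2norm vs (\<lambda>x. un n x - h x) \<le> (\<Sum>i<length vs. sqrt (elen vs i) * edge_nrm2 i (\<lambda>x. un n x - h x))"
        unfolding bL2norm_eq by (rule L2_set_le_sum) (simp add: elen_def)
      also have "\<dots> \<le> (\<Sum>i<length vs. sqrt (elen vs i) * (K * (1/2) ^ n))"
        by (intro sum_mono mult_left_mono tr(2)) (auto simp: elen_def)
      finally show "norm (bL2norm vs (\<lambda>x. un n x - h x)) \<le> (\<Sum>i<length vs. sqrt (elen vs i) * K) * (1/2) ^ n"
        by (simp add: sum_distrib_right mult.assoc)
    qed
    have "(\<lambda>n. (1/2 :: real) ^ n) \<longlonglongrightarrow> 0" by (rule LIMSEQ_power_zero) simp
    from tendsto_mult[OF tendsto_const this, of "\<Sum>i<length vs. sqrt (elen vs i) * K"]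
    show "(\<lambda>n. (\<Sum>i<length vs. sqrt (elen vs i) * K) * (1/2) ^ n) \<longlonglongrightarrow> 0" by simp
  qed
  moreover from this have "is_trace G vs u h"
    unfolding is_trace_def using u bh sm l3 by blast
  ultimately show ?thesis using sm l1 l2 by blast
qed

end

section \<open>Domains with boundary of class C2\<close>

lemma Ck_on_mono: "Ck_on k V \<phi> \<Longrightarrow> l \<le> k \<Longrightarrow> Ck_on l V \<phi>"
  unfolding Ck_on_def by auto

lemma Ck_on_continuous: "Ck_on k V \<phi> \<Longrightarrow> continuous_on V \<phi>"
proof -
  assume "Ck_on k V \<phi>"
  then have "length ([] :: 2 list) \<le> k \<longrightarrow> continuous_on V (pds [] \<phi>)" unfolding Ck_on_def by blast
  then show ?thesis by simp
qed

lemma Ck_on_pd_continuous: "Ck_on (Suc k) V \<phi> \<Longrightarrow> continuous_on V (pd \<phi> j)"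
proof -
  assume "Ck_on (Suc k) V \<phi>"
  then have "length [j] \<le> Suc k \<longrightarrow> continuous_on V (pds [j] \<phi>)" unfolding Ck_on_def by blast
  then show ?thesis by simp
qed

lemma Ck_on_pd_has:
  assumes "Ck_on (Suc k) V \<phi>" "x \<in> V"
  shows "((\<lambda>t. \<phi> (x + t *\<^sub>R axis j 1)) has_vector_derivative pd \<phi> j x) (at 0)"
proof -
  have "\<forall>js. length js < Suc k \<longrightarrow> (\<forall>j. \<forall>x\<in>V.
      ((\<lambda>t. pds js \<phi> (x + t *\<^sub>R axis j 1)) has_vector_derivative pds (j # js) \<phi> x) (at 0))"
    using assms(1) unfolding Ck_on_def by blast
  from this[rule_format, of "[]" x j] assms(2) show ?thesis by simp
qed

lemma defining_function_zero:
  fixes \<phi> :: "R2 \<Rightarrow> real"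
  assumes U: "open U" and c: "continuous_on (ball p r) \<phi>"
    and eq: "U \<inter> ball p r = {x \<in> ball p r. \<phi> x < 0}" and x: "x \<in> frontier U" "x \<in> ball p r"
  shows "\<phi> x = 0"
proof -
  have "x \<notin> U" using x(1) U by (simp add: frontier_def interior_open)
  have mem: "z \<in> U \<longleftrightarrow> \<phi> z < 0" if "z \<in> ball p r" for z
  proof -
    have "z \<in> U \<inter> ball p r \<longleftrightarrow> z \<in> {x \<in> ball p r. \<phi> x < 0}" by (simp only: eq)
    then show ?thesis using that by simp
  qed
  have ge: "\<phi> x \<ge> 0" using mem[OF x(2)] \<open>x \<notin> U\<close> by simp
  moreover have "\<not> \<phi> x > 0"
  proof
    assume pos: "\<phi> x > 0"
    have "open (\<phi> -` {0<..} \<inter> ball p r)"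
      using continuous_on_open_vimage[OF open_ball, THEN iffD1, OF c, rule_format, OF open_greaterThan] .
    moreover have "x \<in> \<phi> -` {0<..} \<inter> ball p r" using pos x by auto
    moreover have "x \<in> closure U" using x by (simp add: frontier_def)
    ultimately have "(\<phi> -` {0<..} \<inter> ball p r) \<inter> U \<noteq> {}"
      using open_Int_closure_eq_empty[of "\<phi> -` {0<..} \<inter> ball p r" U] by blast
    then obtain z where "z \<in> U" "z \<in> ball p r" "\<phi> z > 0" by auto
    then show False using mem[of z] by simp
  qed
  ultimately show ?thesis by simp
qed

text \<open>Arbitrarily many pairwise disjoint translates of equal measure fit into one ball, so the
  common measure is zero.\<close>

lemma negligible_disjoint_translates:
  fixes K :: "R2 set"
  assumes K: "compact K" and d: "\<delta> > 0"
    and dj: "\<And>x s. x \<in> K \<Longrightarrow> 0 < s \<Longrightarrow> s < \<delta> \<Longrightarrow> x + s *\<^sub>R e \<notin> K"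
  shows "negligible K"
proof -
  define m where "m = measure lebesgue K"
  have Km: "K \<in> lmeasurable" using K by (rule lmeasurable_compact)
  obtain R where R: "K \<subseteq> cball 0 R" using compact_imp_bounded[OF K] by (metis bounded_iff mem_cball_0 subsetI)
  define V where "V = measure lebesgue (cball (0::R2) (R + \<delta> * norm e))"
  have "real N * m \<le> V" for N :: nat
  proof -
    \<comment> \<open>All shifts have length parameter below \<delta>, and so have their
      differences, to which \<open>dj\<close> applies.\<close>
    define T where "T i = (\<lambda>x. (\<delta> * real i / real N) *\<^sub>R e + x) ` K" for i
    have Tm: "T i \<in> lmeasurable" "measure lebesgue (T i) = m" for i
      unfolding T_def m_def using measurable_translation[OF Km] measure_translation by auto
    have dis: "T i \<inter> T j = {}" if "i < j" "j < N" for i j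
    proof (rule ccontr)
      assume "T i \<inter> T j \<noteq> {}"
      then obtain x y where xy: "x \<in> K" "y \<in> K" "(\<delta> * real i / real N) *\<^sub>R e + x = (\<delta> * real j / real N) *\<^sub>R e + y"
        unfolding T_def by auto
      define s where "s = \<delta> * (real j - real i) / real N"
      have "\<delta> * (real j - real i) < \<delta> * real N" using that d by (intro mult_strict_left_mono) auto
      then have s: "0 < s" "s < \<delta>" using that d by (auto simp: s_def divide_less_eq)
      have "x = y + s *\<^sub>R e" using xy(3) by (simp add: s_def algebra_simps diff_divide_distrib)
      then show False using dj[OF xy(2) s] xy(1) by simp
    qed
    have djf: "disjoint_family_on T {..<N}"
      unfolding disjoint_family_on_def using dis by (metis Int_commute lessThan_iff linorder_neqE_nat)
    have "real N * m = (\<Sum>i<N. measure lebesgue (T i))" using Tm by simp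
    also have "\<dots> = measure lebesgue (\<Union>i<N. T i)"
    proof (rule measure_finite_Union[symmetric])
      show "T ` {..<N} \<subseteq> sets lebesgue" using fmeasurableD[OF Tm(1)] by blast
      show "emeasure lebesgue (T i) \<noteq> \<infinity>" for i using fmeasurableD2[OF Tm(1)] by simp
    qed (use djf in auto)
    also have "\<dots> \<le> V" unfolding V_def
    proof (rule measure_mono_fmeasurable)
      show "(\<Union>i<N. T i) \<subseteq> cball 0 (R + \<delta> * norm e)"
      proof
        fix z assume "z \<in> (\<Union>i<N. T i)"
        then obtain i x where i: "i < N" "x \<in> K" "z = (\<delta> * real i / real N) *\<^sub>R e + x" by (auto simp: T_def)
        have "\<bar>\<delta> * real i / real N\<bar> \<le> \<delta>" using i d by (simp add: divide_le_eq)
        then have "norm ((\<delta> * real i / real N) *\<^sub>R e) \<le> \<delta> * norm e" unfolding norm_scaleR by (rule mult_right_mono) simp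
        moreover have "norm x \<le> R" using R i(2) by auto
        ultimately show "z \<in> cball 0 (R + \<delta> * norm e)"
          using norm_triangle_ineq[of "(\<delta> * real i / real N) *\<^sub>R e" x] i(3) by simp
      qed
      show "(\<Union>i<N. T i) \<in> sets lebesgue" by (intro sets.finite_UN) (use fmeasurableD[OF Tm(1)] in auto)
    qed (rule lmeasurable_cball)
    finally show ?thesis .
  qed
  note b = this
  have "m = 0"
  proof (rule ccontr)
    assume "m \<noteq> 0"
    then have "m > 0" by (simp add: m_def zero_less_measure_iff)
    then obtain N where "V < real N * m" using reals_Archimedean3 by blast
    then show False using b[of N] by simp
  qed
  then show ?thesis using Km unfolding negligible_iff_measure m_def by simp
qed

text \<open>Near a boundary point some partial derivative of the defining function keeps its sign,
  so each line in that coordinate direction meets the boundary there at most once and small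
  translates in this direction are disjoint. The result is needed to pass between
  \<open>G - \<Omega>\<close> and the complement of the closure of \<Omega>.\<close>

lemma C2_frontier_negligible:
  assumes U: "open U" "C2_boundary U"
  shows "negligible (frontier U)"
proof -
  have "\<exists>V. openin (top_of_set (frontier U)) V \<and> p \<in> V \<and> negligible V" if p: "p \<in> frontier U" for p
  proof -
    obtain r and \<phi> :: "R2 \<Rightarrow> real" where r: "r > 0" "Ck_on 2 (ball p r) \<phi>" "\<forall>x\<in>ball p r. rgrad \<phi> x \<noteq> 0"
      "U \<inter> ball p r = {x\<in>ball p r. \<phi> x < 0}"
      using U(2) p unfolding C2_boundary_def by blast
    have C1: "Ck_on (Suc 0) (ball p r) \<phi>" by (rule Ck_on_mono[OF r(2)]) simp
    have cphi: "continuous_on (ball p r) \<phi>" by (rule Ck_on_continuous[OF C1])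
    have "rgrad \<phi> p \<noteq> 0" using r by simp
    then obtain j where j: "pd \<phi> j p \<noteq> 0" by (auto simp: rgrad_def vec_eq_iff)
    have cpd: "continuous_on (ball p r) (pd \<phi> j)" by (rule Ck_on_pd_continuous[OF C1])
    \<comment> \<open>Multiplying by the value at \<open>p\<close> normalises the unknown sign of
      the derivative.\<close>
    have "open ((\<lambda>x. pd \<phi> j x * pd \<phi> j p) -` {0<..} \<inter> ball p r)"
      using continuous_on_open_vimage[OF open_ball, THEN iffD1, OF continuous_on_mult_right[OF cpd], rule_format, OF open_greaterThan] .
    moreover have "p \<in> (\<lambda>x. pd \<phi> j x * pd \<phi> j p) -` {0<..} \<inter> ball p r"
      using j r by (simp add: power2_eq_square[symmetric])
    ultimately obtain d where d: "d > 0" "ball p d \<subseteq> (\<lambda>x. pd \<phi> j x * pd \<phi> j p) -` {0<..} \<inter> ball p r"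
      using open_contains_ball by blast
    \<comment> \<open>A third of the radius for the set and a third for the shift keep all points of
      the connecting segment in the ball where the derivative has its sign.\<close>
    define K where "K = frontier U \<inter> cball p (d / 3)"
    have "compact K" unfolding K_def by (simp add: closed_Int_compact)
    have "negligible K"
    proof (rule negligible_disjoint_translates[OF \<open>compact K\<close>, of "d / 3" "axis j 1"])
      fix x s assume x: "x \<in> K" and s: "0 < s" "s < d / 3"
      show "x + s *\<^sub>R axis j 1 \<notin> K"
      proof
        assume x': "x + s *\<^sub>R axis j 1 \<in> K"
        have inb: "x + \<sigma> *\<^sub>R axis j 1 \<in> ball p d" if "0 \<le> \<sigma>" "\<sigma> \<le> s" for \<sigma>
        proof -
          have "dist p (x + \<sigma> *\<^sub>R axis j 1) \<le> dist p x + dist x (x + \<sigma> *\<^sub>R axis j 1)" by (rule dist_triangle)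
          also have "dist x (x + \<sigma> *\<^sub>R axis j 1) = \<sigma>" using that by (simp add: dist_norm norm_axis_1)
          also have "dist p x \<le> d / 3" using x by (simp add: K_def)
          finally show ?thesis using that s d(1) by simp
        qed
        have zero: "\<phi> x = 0" "\<phi> (x + s *\<^sub>R axis j 1) = 0"
        proof -
          have bs: "z \<in> ball p r" if "z \<in> ball p d" for z using d(2) that by blast
          have "x \<in> ball p d" using inb[of 0] s by simp
          then show "\<phi> x = 0" using x by (intro defining_function_zero[OF U(1) cphi r(4)] bs) (auto simp: K_def)
          have "x + s *\<^sub>R axis j 1 \<in> ball p d" using inb[of s] s by simp
          then show "\<phi> (x + s *\<^sub>R axis j 1) = 0" using x' by (intro defining_function_zero[OF U(1) cphi r(4)] bs) (auto simp: K_def)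
        qed
        define q where "q \<sigma> = \<phi> (x + \<sigma> *\<^sub>R axis j 1) * pd \<phi> j p" for \<sigma>
        have der: "(q has_real_derivative pd \<phi> j (x + \<sigma> *\<^sub>R axis j 1) * pd \<phi> j p) (at \<sigma>)" if "0 \<le> \<sigma>" "\<sigma> \<le> s" for \<sigma>
        proof -
          have "x + \<sigma> *\<^sub>R axis j 1 \<in> ball p r" using inb[OF that] d by auto
          from line_vd[OF Ck_on_pd_has[OF C1 this]] show ?thesis unfolding q_def
            by (intro DERIV_cmult_right) (simp add: has_real_derivative_iff_has_vector_derivative)
        qed
        have "q 0 < q s"
        proof (rule DERIV_pos_imp_increasing[OF s(1)])
          fix \<sigma> assume a: "0 \<le> \<sigma>" "\<sigma> \<le> s"
          then have "pd \<phi> j (x + \<sigma> *\<^sub>R axis j 1) * pd \<phi> j p > 0" using inb[OF a] d by auto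
          then show "\<exists>y. (q has_real_derivative y) (at \<sigma>) \<and> 0 < y" using der[OF a] by blast
        qed
        then show False using zero by (simp add: q_def)
      qed
    qed (use d in auto)
    then have "negligible (frontier U \<inter> ball p (d / 3))"
      by (rule negligible_subset) (auto simp: K_def)
    then show ?thesis using d p by (intro exI[of _ "frontier U \<inter> ball p (d / 3)"]) (auto intro: openin_open_Int)
  qed
  then show ?thesis using locally_negligible_alt by blast
qed

text \<open>A ball inside \<open>U\<close> touching the boundary at \<open>p\<close> has its centre on the inner normal at \<open>p\<close>.\<close>

lemma interior_ball_normal:
  assumes U: "open U" "C2_boundary U" and star: "\<forall>p n. outer_normal U p n \<longrightarrow> p \<bullet> n \<ge> 0"
    and p: "p \<notin> U" and y: "y \<noteq> p" "ball y (dist y p) \<subseteq> U"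
  shows "p \<bullet> (y - p) \<le> 0"
proof -
  define v where "v = y - p"
  have vz: "v \<bullet> v > 0" using y by (simp add: v_def)
  \<comment> \<open>Every direction with a positive component along \<open>v\<close> enters the ball
    at \<open>p\<close>: the quadratic term loses against the linear one for small
    \<open>s\<close>.\<close>
  have inU: "\<exists>\<epsilon>>0. \<forall>s. 0 < s \<and> s < \<epsilon> \<longrightarrow> p + s *\<^sub>R d \<in> U" if dv: "d \<bullet> v > 0" for d
  proof -
    have dd: "d \<bullet> d > 0" using dv by auto
    show ?thesis
    proof (intro exI[of _ "2 * (d \<bullet> v) / (d \<bullet> d)"] conjI allI impI)
      show "2 * (d \<bullet> v) / (d \<bullet> d) > 0" using dv dd by simp
      fix s assume s: "0 < s \<and> s < 2 * (d \<bullet> v) / (d \<bullet> d)"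
      then have "s * (d \<bullet> d) < 2 * (d \<bullet> v)" using dd by (simp add: field_simps)
      then have "s * (s * (d \<bullet> d)) < s * (2 * (d \<bullet> v))" using s by (intro mult_strict_left_mono) auto
      moreover have "(norm (v - s *\<^sub>R d))\<^sup>2 = v \<bullet> v - s * (2 * (d \<bullet> v)) + s * (s * (d \<bullet> d))"
        by (simp add: power2_norm_eq_inner inner_diff_left inner_diff_right inner_commute algebra_simps)
      ultimately have "(norm (v - s *\<^sub>R d))\<^sup>2 < (norm v)\<^sup>2" by (simp add: power2_norm_eq_inner)
      then have "norm (v - s *\<^sub>R d) < norm v" by (rule power2_less_imp_less) simp
      then have "p + s *\<^sub>R d \<in> ball y (dist y p)" by (simp add: dist_norm v_def algebra_simps)
      then show "p + s *\<^sub>R d \<in> U" using y by blast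
    qed
  qed
  have "p \<in> closure U"
    unfolding closure_approachable
  proof (intro allI impI)
    fix e :: real assume e: "e > 0"
    obtain \<epsilon> where eps: "\<epsilon> > 0" "\<forall>s. 0 < s \<and> s < \<epsilon> \<longrightarrow> p + s *\<^sub>R v \<in> U" using inU[OF vz] by blast
    define s where "s = min (\<epsilon> / 2) (e / (2 * norm v))"
    have nv: "norm v > 0" using vz by auto
    have s: "0 < s" "s < \<epsilon>" using eps e nv by (auto simp: s_def)
    have "s * norm v \<le> e / (2 * norm v) * norm v" by (rule mult_right_mono) (auto simp: s_def)
    then have "s * norm v < e" using nv e by simp
    then show "\<exists>z\<in>U. dist z p < e" using eps(2) s by (intro bexI[of _ "p + s *\<^sub>R v"]) (auto simp: dist_norm)
  qed
  then have pf: "p \<in> frontier U" using p U by (simp add: frontier_def interior_open)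
  obtain r and \<phi> :: "R2 \<Rightarrow> real" where r: "r > 0" "Ck_on 2 (ball p r) \<phi>" "\<forall>x\<in>ball p r. rgrad \<phi> x \<noteq> 0"
    "U \<inter> ball p r = {x\<in>ball p r. \<phi> x < 0}"
    using U(2) pf unfolding C2_boundary_def by blast
  have C1: "Ck_on (Suc 0) (ball p r) \<phi>" by (rule Ck_on_mono[OF r(2)]) simp
  define g where "g = rgrad \<phi> p"
  have gz: "g \<noteq> 0" using r by (simp add: g_def)
  have "outer_normal U p ((1 / norm g) *\<^sub>R g)"
    unfolding outer_normal_def using pf r C1 gz g_def by (intro conjI exI[of _ r] exI[of _ \<phi>]) auto
  then have "p \<bullet> ((1 / norm g) *\<^sub>R g) \<ge> 0" using star by blast
  then have pg: "p \<bullet> g \<ge> 0" using gz by (simp add: zero_le_divide_iff)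
  have phi0: "\<phi> p = 0" using defining_function_zero[OF U(1) Ck_on_continuous[OF C1] r(4) pf] r(1) by simp
  have hd: "(\<phi> has_derivative (\<lambda>h. \<Sum>j\<in>UNIV. h $ j *\<^sub>R pd \<phi> j p)) (at p)"
    by (rule C1_has_derivative[OF C1]) (use r in auto)
  \<comment> \<open>The defining function vanishes at \<open>p\<close> and is negative on
    \<open>U\<close>, so it cannot increase in a direction that enters \<open>U\<close>.\<close>
  have gd: "g \<bullet> d \<le> 0" if dv: "d \<bullet> v > 0" for d
  proof (rule ccontr)
    assume "\<not> g \<bullet> d \<le> 0"
    have 1: "((\<lambda>s. p + s *\<^sub>R d) has_vector_derivative d) (at 0)" by (auto intro!: derivative_eq_intros)
    have 2: "(\<phi> has_derivative (\<lambda>h. \<Sum>j\<in>UNIV. h $ j *\<^sub>R pd \<phi> j p)) (at (p + 0 *\<^sub>R d) within range (\<lambda>s. p + s *\<^sub>R d))"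
      using hd by (auto intro: has_derivative_at_withinI)
    have "((\<phi> \<circ> (\<lambda>s. p + s *\<^sub>R d)) has_vector_derivative (\<Sum>j\<in>UNIV. d $ j *\<^sub>R pd \<phi> j p)) (at 0)"
      by (rule vector_derivative_diff_chain_within[OF 1 2])
    then have "((\<lambda>s. \<phi> (p + s *\<^sub>R d)) has_real_derivative g \<bullet> d) (at 0)"
      by (simp add: o_def has_real_derivative_iff_has_vector_derivative g_def rgrad_def inner_vec_def mult.commute)
    then obtain e where e: "e > 0" "\<forall>h>0. h < e \<longrightarrow> \<phi> (p + 0 *\<^sub>R d) < \<phi> (p + (0 + h) *\<^sub>R d)"
      using DERIV_pos_inc_right[of "\<lambda>s. \<phi> (p + s *\<^sub>R d)" "g \<bullet> d" 0] \<open>\<not> g \<bullet> d \<le> 0\<close> by auto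
    obtain \<epsilon> where eps: "\<epsilon> > 0" "\<forall>s. 0 < s \<and> s < \<epsilon> \<longrightarrow> p + s *\<^sub>R d \<in> U" using inU[OF dv] by blast
    define h where "h = min (e / 2) (min (\<epsilon> / 2) (r / (2 * (norm d + 1))))"
    have dn: "norm d + 1 > 0" by (simp add: add_nonneg_pos)
    have h: "0 < h" "h < e" "h < \<epsilon>" using e eps r dn by (auto simp: h_def)
    have "h * (norm d + 1) \<le> r / (2 * (norm d + 1)) * (norm d + 1)" using dn by (intro mult_right_mono) (auto simp: h_def)
    also have "\<dots> = r / 2" using dn by (simp add: field_simps)
    finally have "h * norm d < r" using h r(1) by (simp add: algebra_simps)
    then have "p + h *\<^sub>R d \<in> ball p r" using h by (simp add: dist_norm)
    moreover have "p + h *\<^sub>R d \<in> U" using eps h by blast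
    ultimately have "\<phi> (p + h *\<^sub>R d) < 0" using r(4) by blast
    moreover have "\<phi> (p + h *\<^sub>R d) > 0" using e(2) h phi0 by auto
    ultimately show False by simp
  qed
  \<comment> \<open>A component \<open>w\<close> of the gradient orthogonal to \<open>v\<close> is
    impossible: a large multiple of it can be added to \<open>v\<close> without leaving the open
    half space of entering directions. So the gradient is a negative multiple of
    \<open>v\<close>.\<close>
  define c where "c = (g \<bullet> v) / (v \<bullet> v)"
  define w where "w = g - c *\<^sub>R v"
  have wv: "w \<bullet> v = 0" using vz by (simp add: w_def c_def inner_diff_left)
  have gw: "g \<bullet> w = w \<bullet> w" using wv by (simp add: w_def inner_diff_left inner_diff_right inner_commute)
  have "w = 0"
  proof (rule ccontr)
    assume "w \<noteq> 0"
    then have ww: "w \<bullet> w > 0" by simp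
    define M where "M = (\<bar>g \<bullet> v\<bar> + 1) / (w \<bullet> w)"
    have "(v + M *\<^sub>R w) \<bullet> v > 0" using vz wv by (simp add: inner_add_left)
    from gd[OF this] have "g \<bullet> v + M * (w \<bullet> w) \<le> 0" by (simp add: inner_add_right gw)
    moreover have "M * (w \<bullet> w) = \<bar>g \<bullet> v\<bar> + 1" using ww by (simp add: M_def)
    ultimately show False by simp
  qed
  then have gc: "g = c *\<^sub>R v" by (simp add: w_def)
  have "g \<bullet> v \<le> 0" using gd[OF vz] .
  then have "c \<le> 0" using vz by (simp add: c_def divide_le_0_iff)
  moreover have "c \<noteq> 0" using gc gz by auto
  ultimately have "c < 0" by simp
  moreover have "c * (p \<bullet> v) \<ge> 0" using pg gc by simp
  ultimately show ?thesis by (simp add: zero_le_mult_iff v_def)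
qed

text \<open>Bony--Brezis: the complement of \<open>U\<close> is invariant under dilations by factors at least \<open>1\<close>,
  because \<open>dist (s x, - U)\<^sup>2 / s\<^sup>3\<close> strictly decreases to the right wherever it is positive.\<close>

lemma star_shaped:
  assumes U: "open U" "C2_boundary U" and star: "\<forall>p n. outer_normal U p n \<longrightarrow> p \<bullet> n \<ge> 0"
    and y: "y \<in> U" and t: "0 < t" "t \<le> 1"
  shows "t *\<^sub>R y \<in> U"
proof (rule ccontr)
  assume "t *\<^sub>R y \<notin> U"
  define x where "x = t *\<^sub>R y"
  define l where "l = 1 / t"
  have l: "l \<ge> 1" "l *\<^sub>R x = y" using t by (auto simp: l_def x_def)
  have xK: "x \<in> - U" using \<open>t *\<^sub>R y \<notin> U\<close> by (simp add: x_def)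
  have cK: "closed (- U)" and neK: "- U \<noteq> {}" using U xK by auto
  \<comment> \<open>The inequality \<open>s * (x \<bullet> v) \<le> v \<bullet> v\<close> bounds the
    logarithmic derivative of the squared distance by \<open>2 / s\<close>. Dividing by the square
    of \<open>s\<close> would thus only give weak monotonicity; the cube makes it strict.\<close>
  define F where "F s = (infdist (s *\<^sub>R x) (- U))\<^sup>2 / s ^ 3" for s :: real
  have F1: "F 1 = 0" using xK by (simp add: F_def)
  have infy: "infdist y (- U) > 0"
    using y in_closed_iff_infdist_zero[OF cK neK, of y] infdist_nonneg[of y "- U"] by auto
  define m where "m = F l"
  have m: "m > 0" using infy l by (simp add: m_def F_def)
  have cF: "continuous_on {1..l} F"
    unfolding F_def by (intro continuous_intros) auto
  have dec: "\<exists>d>0. \<forall>h>0. h < d \<longrightarrow> F (s + h) < F s" if s: "1 \<le> s" "F s > 0" for s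
  proof -
    obtain p where p: "p \<in> - U" "infdist (s *\<^sub>R x) (- U) = dist (s *\<^sub>R x) p"
      using infdist_attains_inf[OF cK neK] by metis
    \<comment> \<open>The nearest point for the parameter \<open>s\<close> is frozen: this majorant
      touches \<open>F\<close> at \<open>s\<close> and, unlike the distance, is
      differentiable.\<close>
    define q where "q \<sigma> = ((\<sigma> *\<^sub>R x - p) \<bullet> (\<sigma> *\<^sub>R x - p)) / \<sigma> ^ 3" for \<sigma> :: real
    define v where "v = s *\<^sub>R x - p"
    have Fq: "F \<sigma> \<le> q \<sigma>" if "\<sigma> > 0" for \<sigma>
    proof -
      have "infdist (\<sigma> *\<^sub>R x) (- U) \<le> dist (\<sigma> *\<^sub>R x) p" by (rule infdist_le[OF p(1)])
      then have "(infdist (\<sigma> *\<^sub>R x) (- U))\<^sup>2 \<le> (dist (\<sigma> *\<^sub>R x) p)\<^sup>2" by (intro power_mono infdist_nonneg)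
      then show ?thesis using that
        by (simp add: F_def q_def dist_norm power2_norm_eq_inner divide_right_mono)
    qed
    have Fs: "F s = q s" by (simp add: F_def q_def p(2) dist_norm power2_norm_eq_inner)
    have vv: "v \<bullet> v > 0" using s Fs by (auto simp: q_def v_def)
    have "ball (s *\<^sub>R x) (dist (s *\<^sub>R x) p) \<subseteq> U"
    proof
      fix z assume "z \<in> ball (s *\<^sub>R x) (dist (s *\<^sub>R x) p)"
      then show "z \<in> U" using infdist_le[of z "- U" "s *\<^sub>R x"] p(2) by (cases "z \<in> U") auto
    qed
    then have pv: "p \<bullet> v \<le> 0"
      unfolding v_def using interior_ball_normal[OF U star, of p "s *\<^sub>R x"] p(1) vv by (auto simp: v_def)
    have sv: "s * (x \<bullet> v) \<le> v \<bullet> v"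
    proof -
      have "s *\<^sub>R x = p + v" by (simp add: v_def)
      then have "s * (x \<bullet> v) = p \<bullet> v + v \<bullet> v" by (metis inner_add_left inner_scaleR_left)
      then show ?thesis using pv by simp
    qed
    have d1: "((\<lambda>\<sigma>. (\<sigma> *\<^sub>R x - p) \<bullet> (\<sigma> *\<^sub>R x - p)) has_real_derivative 2 * (x \<bullet> v)) (at s)"
    proof -
      have "(\<lambda>\<sigma>. (\<sigma> *\<^sub>R x - p) \<bullet> (\<sigma> *\<^sub>R x - p)) = (\<lambda>\<sigma>. \<sigma>\<^sup>2 * (x \<bullet> x) - 2 * \<sigma> * (x \<bullet> p) + p \<bullet> p)"
        by (simp add: fun_eq_iff inner_diff_left inner_diff_right inner_commute power2_eq_square algebra_simps)
      moreover have "((\<lambda>\<sigma>. \<sigma>\<^sup>2 * (x \<bullet> x) - 2 * \<sigma> * (x \<bullet> p) + p \<bullet> p) has_real_derivative 2 * (x \<bullet> v)) (at s)"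
        by (auto intro!: derivative_eq_intros simp: v_def inner_diff_right algebra_simps)
      ultimately show ?thesis by simp
    qed
    have sz: "s ^ 3 \<noteq> 0" using s by simp
    have d2: "((\<lambda>\<sigma>. \<sigma> ^ 3) has_real_derivative 3 * s\<^sup>2) (at s)"
      by (auto intro!: derivative_eq_intros)
    have dq: "(q has_real_derivative (2 * (x \<bullet> v) * s ^ 3 - (v \<bullet> v) * (3 * s\<^sup>2)) / (s ^ 3 * s ^ 3)) (at s)"
      unfolding q_def using DERIV_divide[OF d1 d2 sz] by (simp add: v_def)
    have "2 * (x \<bullet> v) * s ^ 3 - (v \<bullet> v) * (3 * s\<^sup>2) = s\<^sup>2 * (2 * (s * (x \<bullet> v)) - 3 * (v \<bullet> v))"
      by (simp add: power2_eq_square power3_eq_cube algebra_simps)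
    also have "\<dots> < 0"
    proof (rule mult_pos_neg)
      show "2 * (s * (x \<bullet> v)) - 3 * (v \<bullet> v) < 0" using sv vv by linarith
    qed (use s in simp)
    finally have neg: "(2 * (x \<bullet> v) * s ^ 3 - (v \<bullet> v) * (3 * s\<^sup>2)) / (s ^ 3 * s ^ 3) < 0"
      using s by (simp add: divide_neg_pos)
    obtain d where "d > 0" "\<forall>h>0. h < d \<longrightarrow> q (s + h) < q s"
      using DERIV_neg_dec_right[OF dq neg] by blast
    then show ?thesis using Fq Fs s by (intro exI[of _ d]) (smt (verit))
  qed
  \<comment> \<open>The last parameter with \<open>F \<le> m / 2\<close> attains equality by the
    intermediate value theorem, but \<open>F\<close> decreases to the right of it, so there would be
    a later one.\<close>
  define S where "S = {1..l} \<inter> F -` {..m / 2}"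
  have "closed S" unfolding S_def by (rule continuous_closed_preimage[OF cF]) auto
  then have "compact S" unfolding S_def by (metis bounded_Int bounded_closed_interval compact_eq_bounded_closed box_real(2) bounded_cbox)
  moreover have "S \<noteq> {}" using F1 m l by (auto simp: S_def intro!: exI[of _ 1])
  ultimately obtain s1 where s1: "s1 \<in> S" "\<And>s. s \<in> S \<Longrightarrow> s \<le> s1" using compact_attains_sup by metis
  have s1l: "1 \<le> s1" "s1 < l" "F s1 \<le> m / 2"
    using s1(1) m by (auto simp: S_def m_def less_le)
  have "F s1 = m / 2"
  proof (rule ccontr)
    assume "F s1 \<noteq> m / 2"
    then have "F s1 < m / 2" using s1l by simp
    moreover have "continuous_on {s1..l} F" by (rule continuous_on_subset[OF cF]) (use s1l in auto)
    ultimately obtain s where "s1 \<le> s" "s \<le> l" "F s = m / 2"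
      using IVT'[of F s1 "m / 2" l] s1l m by (auto simp: m_def)
    then have "s \<le> s1" using s1l by (intro s1(2)) (auto simp: S_def)
    then show False using \<open>F s = m / 2\<close> \<open>s1 \<le> s\<close> \<open>F s1 \<noteq> m / 2\<close> by simp
  qed
  then obtain d where d: "d > 0" "\<forall>h>0. h < d \<longrightarrow> F (s1 + h) < F s1" using dec[OF s1l(1)] m by auto
  define h where "h = min (d / 2) (l - s1)"
  have "h > 0" "h < d" "s1 + h \<le> l" using d s1l by (auto simp: h_def)
  then have "s1 + h \<in> S" using d \<open>F s1 = m / 2\<close> s1l by (auto simp: S_def less_imp_le)
  then show False using s1(2) \<open>h > 0\<close> by fastforce
qed

section \<open>The cell problems\<close>

lemma test_fn_sqi:
  assumes t: "test_fn V \<phi>" and U: "U \<in> sets lebesgue" shows "sqi (lebesgue_on U) \<phi>"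
proof -
  have b: "\<phi> \<in> borel_measurable borel" using t by (intro smooth_borel test_fn_smooth)
  obtain R where R: "\<And>x. norm x \<ge> R \<Longrightarrow> \<phi> x = 0" using test_fn_bounded_support[OF t] by blast
  have "sqi lborel \<phi>" by (rule continuous_compact_sqi[OF smooth_continuous[OF test_fn_smooth[OF t]] R])
  then have "sqi lebesgue \<phi>"
    using b by (simp add: sqi_def measurable_completion integrable_completion)
  then show ?thesis using sqi_subset(1)[of UNIV \<phi> U] U by (simp add: lebesgue_on_UNIV_eq)
qed

lemma weak_grad_cnj:
  assumes "weak_grad U u v" shows "weak_grad U (\<lambda>x. cnj (u x)) (\<lambda>j x. cnj (v j x))"
  unfolding weak_grad_def
proof (intro conjI allI impI)
  show "L2 U (\<lambda>x. cnj (v j x))" for j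
    using assms by (simp add: weak_grad_def L2_sqi sqi_cnj)
  fix \<phi> j assume t: "test_fn U \<phi>"
  have e: "(LINT x|lebesgue_on U. u x * pd (\<lambda>x. cnj (\<phi> x)) j x) = - (LINT x|lebesgue_on U. v j x * cnj (\<phi> x))"
    using assms test_fn_cnj[OF t] unfolding weak_grad_def by blast
  have "(LINT x|lebesgue_on U. cnj (u x) * pd \<phi> j x) = (LINT x|lebesgue_on U. cnj (u x * pd (\<lambda>x. cnj (\<phi> x)) j x))"
    by (simp add: pd_cnj[OF test_fn_smooth[OF t]])
  also have "\<dots> = cnj (LINT x|lebesgue_on U. u x * pd (\<lambda>x. cnj (\<phi> x)) j x)" by (rule Bochner_Integration.integral_cnj)
  also have "\<dots> = - (LINT x|lebesgue_on U. cnj (v j x * cnj (\<phi> x)))"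
    unfolding e by (simp only: Bochner_Integration.integral_cnj complex_cnj_minus)
  finally show "(LINT x|lebesgue_on U. cnj (u x) * pd \<phi> j x) = - (LINT x|lebesgue_on U. cnj (v j x) * \<phi> x)" by simp
qed

lemma weak_grad_diff:
  assumes U: "U \<in> sets lebesgue" and u: "L2 U u" "weak_grad U u v" and u': "L2 U u'" "weak_grad U u' v'"
  shows "weak_grad U (\<lambda>x. u x - u' x) (\<lambda>j x. v j x - v' j x)"
  unfolding weak_grad_def
proof (intro conjI allI impI)
  have s: "sqi (lebesgue_on U) (v j)" "sqi (lebesgue_on U) (v' j)" for j
    using u u' by (auto simp: weak_grad_def L2_sqi)
  show "L2 U (\<lambda>x. v j x - v' j x)" for j using sqi_diff[OF s] by (simp add: L2_sqi)
  fix \<phi> j assume t: "test_fn U \<phi>"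
  have p: "sqi (lebesgue_on U) \<phi>" "sqi (lebesgue_on U) (pd \<phi> j)"
    using test_fn_sqi[OF t U] test_fn_sqi[OF test_fn_pd[OF t] U] by auto
  have e: "(LINT x|lebesgue_on U. u x * pd \<phi> j x) = - (LINT x|lebesgue_on U. v j x * \<phi> x)"
    "(LINT x|lebesgue_on U. u' x * pd \<phi> j x) = - (LINT x|lebesgue_on U. v' j x * \<phi> x)"
    using u u' t unfolding weak_grad_def by blast+
  show "(LINT x|lebesgue_on U. (u x - u' x) * pd \<phi> j x) = - (LINT x|lebesgue_on U. (v j x - v' j x) * \<phi> x)"
    using e u u' s p by (simp add: left_diff_distrib L2_sqi sqi_mult_integrable)
qed

lemma H1_cnj_diff:
  assumes U: "open U" and u: "H1 U u"
  shows "H1 U (\<lambda>x. u x - cnj (u x))"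
    "AE x in lebesgue_on U. grad U (\<lambda>x. u x - cnj (u x)) j x = grad U u j x - cnj (grad U u j x)"
proof -
  have Ul: "U \<in> sets lebesgue" using U by (simp add: borel_open)
  have us: "L2 U u" using u by (simp add: H1_def)
  have c: "L2 U (\<lambda>x. cnj (u x))" using us by (simp add: L2_sqi sqi_cnj)
  note wg = weak_grad_diff[OF Ul us H1_weak_grad[OF u] c weak_grad_cnj[OF H1_weak_grad[OF u]]]
  have d: "L2 U (\<lambda>x. u x - cnj (u x))" using us c by (simp add: L2_sqi sqi_diff)
  show "H1 U (\<lambda>x. u x - cnj (u x))" using d wg by (auto simp: H1_def)
  show "AE x in lebesgue_on U. grad U (\<lambda>x. u x - cnj (u x)) j x = grad U u j x - cnj (grad U u j x)"
    using grad_AE[OF U wg d] by simp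
qed

section \<open>The periodicity cell and the correctors\<close>

lemma closed_Zlat: "closed Zlat"
proof -
  have "Zlat = (\<Inter>j. (\<lambda>z. z $ j) -` \<int>)" by (auto simp: Zlat_def)
  moreover have "closed (\<Inter>j. (\<lambda>z::R2. z $ j) -` \<int>)"
    by (intro closed_INT ballI closed_vimage closed_Ints continuous_intros)
  ultimately show ?thesis by simp
qed

lemma Ycell_norm: assumes "x \<in> Ycell" shows "norm x < 1"
proof -
  have "\<bar>x $ j\<bar> \<le> 1/2" for j
  proof -
    have "-(1/2) \<le> x $ j \<and> x $ j < 1/2" using assms unfolding Ycell_def by blast
    then show ?thesis by linarith
  qed
  then have "(x $ j)\<^sup>2 \<le> (1/2)\<^sup>2" for j by (metis abs_le_square_iff abs_of_pos half_gt_zero zero_less_one)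
  then have "(norm x)\<^sup>2 \<le> 1/2" unfolding R2_norm_sq using add_mono[of "(x $ 1)\<^sup>2" "1/4" "(x $ 2)\<^sup>2" "1/4"] by (simp add: power2_eq_square)
  then have "(norm x)\<^sup>2 < 1\<^sup>2" by simp
  then show ?thesis by (rule power2_less_imp_less) simp
qed

lemma Ycell_borel: "Ycell \<in> sets borel"
proof -
  have "Ycell = {x. -(1/2) \<le> x $ 1 \<and> x $ 1 < 1/2 \<and> -(1/2) \<le> x $ 2 \<and> x $ 2 < 1/2}"
    by (auto simp: Ycell_def forall_2)
  also have "\<dots> \<in> sets borel" by measurable
  finally show ?thesis .
qed

lemma bounded_Ycell: "bounded Ycell"
  using Ycell_norm by (meson bounded_iff less_imp_le)

context
  fixes D :: "R2 set"
  assumes D: "open D" "closure D \<subseteq> interior Ycell"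
begin

lemma D_Ycell: "closure D \<subseteq> Ycell" using D interior_subset by blast

lemma bounded_D: "bounded D"
  using bounded_subset[OF bounded_Ycell] D_Ycell closure_subset by blast

lemma D_lebesgue: "D \<in> sets lebesgue" using D by (simp add: borel_open)

lemma open_Yper: "open (Yper D)"
proof -
  have "(\<Union>z\<in>Zlat. (\<lambda>y. z + y) ` closure D) = (\<Union>x\<in>Zlat. \<Union>y\<in>closure D. {x + y})" by auto
  moreover have "closed (\<Union>x\<in>Zlat. \<Union>y\<in>closure D. {x + y})"
    by (rule closed_compact_sums[OF closed_Zlat]) (simp add: compact_closure bounded_D)
  ultimately have "closed (\<Union>z\<in>Zlat. (\<lambda>y. z + y) ` closure D)" by (simp only:)
  then show ?thesis unfolding Yper_def by (rule open_Compl)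
qed

text \<open>\<open>gradY\<close> is a gradient on the part of the periodic domain inside the unit
  ball, so the cell must lie there. A lattice vector between two points of the half-open cell has
  coordinates of modulus below \<open>1\<close> and vanishes.\<close>

lemma Ystar_sub: "Ystar D \<subseteq> Yper D \<inter> ball 0 1"
proof
  fix y assume y: "y \<in> Ystar D"
  then have yY: "y \<in> Ycell" "y \<notin> closure D" by (auto simp: Ystar_def)
  have "y \<in> Yper D"
  proof (rule ccontr)
    assume "y \<notin> Yper D"
    then obtain z d where zd: "z \<in> Zlat" "d \<in> closure D" "y = z + d" by (auto simp: Yper_def)
    then have dY: "d \<in> Ycell" using D_Ycell by blast
    have "z $ j = 0" for j
    proof -
      obtain n :: int where n: "z $ j = of_int n" using zd(1) by (auto simp: Zlat_def Ints_def)
      have "-(1/2) \<le> y $ j \<and> y $ j < 1/2" "-(1/2) \<le> d $ j \<and> d $ j < 1/2"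
        using yY(1) dY unfolding Ycell_def by blast+
      moreover have "y $ j = z $ j + d $ j" using zd(3) by simp
      ultimately have "\<bar>z $ j\<bar> < 1" by linarith
      then show ?thesis using n by (simp add: abs_less_iff)
    qed
    then have "z = 0" by (simp add: vec_eq_iff)
    then show False using zd yY by simp
  qed
  then show "y \<in> Yper D \<inter> ball 0 1" using Ycell_norm[OF yY(1)] by simp
qed

lemma Ystar_lebesgue: "Ystar D \<in> sets lebesgue"
  using Ycell_borel by (simp add: Ystar_def)

lemma Hper_H1: "Hper D w \<Longrightarrow> H1 (Yper D \<inter> ball 0 1) w"
  by (simp add: Hper_def)

lemma AE_Ystar:
  "AE y in lebesgue_on (Yper D \<inter> ball 0 1). P y \<Longrightarrow> AE y in lebesgue_on (Ystar D). P y"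
  using Ystar_sub Ystar_lebesgue open_Yper
  by (subst (asm) AE_restrict_space_iff; (subst AE_restrict_space_iff)?) (auto simp: borel_open open_Int elim!: eventually_mono)

lemma gradY_sqi:
  assumes "Hper D w" shows "sqi (lebesgue_on (Ystar D)) (gradY D w l)"
  unfolding gradY_def
  by (rule sqi_subset(1)[OF H1_grad_sqi[OF Hper_H1[OF assms]] Ystar_sub Ystar_lebesgue])
     (simp add: borel_open open_Int open_Yper)

lemma Ystar_one: "sqi (lebesgue_on (Ystar D)) (\<lambda>y. c)"
  by (rule continuous_sqi_on[OF continuous_on_const _ Ystar_lebesgue])
     (use bounded_subset[OF bounded_Ycell] in \<open>auto simp: Ystar_def\<close>)

text \<open>A corrector and its conjugate solve the same cell problem, so their difference is an admissible test
  function with vanishing energy.\<close>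

lemma corrector_real:
  assumes c: "cell_corrector D \<epsilon>e j w" and e: "\<epsilon>e > 0"
  shows "AE y in lebesgue_on (Ystar D). Im (gradY D w l y) = 0"
proof -
  let ?M = "lebesgue_on (Ystar D)"
  have w: "Hper D w" and w0: "(LINT y|?M. w y) = 0"
    and eq: "\<And>\<psi>. Hper D \<psi> \<Longrightarrow> (LINT y|?M. \<psi> y) = 0 \<Longrightarrow>
      (LINT y|?M. complex_of_real (1 / \<epsilon>e) * (\<Sum>l\<in>UNIV. (kd j l + gradY D w l y) * cnj (gradY D \<psi> l y))) = 0"
    using c unfolding cell_corrector_def by blast+
  define z where "z x = w x - cnj (w x)" for x
  have zH: "Hper D z"
    unfolding Hper_def
  proof (intro conjI allI ballI impI)
    show "z (x + k) = z x" if "k \<in> Zlat" for x k using w that by (simp add: Hper_def z_def)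
    fix r :: real assume "r > 0"
    then show "H1 (Yper D \<inter> ball 0 r) z"
      using w open_Yper unfolding z_def by (intro H1_cnj_diff) (auto simp: Hper_def open_Int)
  qed
  have ws: "sqi ?M w"
    by (rule sqi_subset(1)[OF H1_sqi[OF Hper_H1[OF w]] Ystar_sub Ystar_lebesgue])
       (simp add: borel_open open_Int open_Yper)
  have "integrable ?M w" using sqi_mult_integrable[OF ws Ystar_one[of 1]] by simp
  then have z0: "(LINT y|?M. z y) = 0" using w0 by (simp add: z_def)
  have gz: "AE y in ?M. gradY D z l y = gradY D w l y - cnj (gradY D w l y)" for l
    unfolding gradY_def z_def
    by (intro AE_Ystar H1_cnj_diff(2)[OF _ Hper_H1[OF w]]) (simp add: open_Int open_Yper)
  have ps: "sqi ?M (gradY D w l)" for l by (rule gradY_sqi[OF w])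
  define F where "F y = (\<Sum>l\<in>UNIV. (kd j l + gradY D w l y) * cnj (gradY D w l y - cnj (gradY D w l y)))" for y
  have zs: "sqi ?M (gradY D z l)" for l by (rule gradY_sqi[OF zH])
  have Fi: "integrable ?M F" unfolding F_def
    by (intro Bochner_Integration.integrable_sum sqi_mult_cnj_integrable sqi_add Ystar_one ps sqi_diff sqi_cnj)
  have "(LINT y|?M. complex_of_real (1 / \<epsilon>e) * F y) = (LINT y|?M. complex_of_real (1 / \<epsilon>e) * (\<Sum>l\<in>UNIV. (kd j l + gradY D w l y) * cnj (gradY D z l y)))"
  proof (rule integral_cong_AE)
    show "(\<lambda>y. complex_of_real (1 / \<epsilon>e) * F y) \<in> borel_measurable ?M" using Fi by auto
    have "integrable ?M (\<lambda>y. \<Sum>l\<in>UNIV. (kd j l + gradY D w l y) * cnj (gradY D z l y))"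
      by (intro Bochner_Integration.integrable_sum sqi_mult_cnj_integrable sqi_add Ystar_one ps zs)
    then show "(\<lambda>y. complex_of_real (1 / \<epsilon>e) * (\<Sum>l\<in>UNIV. (kd j l + gradY D w l y) * cnj (gradY D z l y))) \<in> borel_measurable ?M" by auto
    show "AE y in ?M. complex_of_real (1 / \<epsilon>e) * F y = complex_of_real (1 / \<epsilon>e) * (\<Sum>l\<in>UNIV. (kd j l + gradY D w l y) * cnj (gradY D z l y))"
      using gz[of 1] gz[of 2] by eventually_elim (simp add: F_def sum_2)
  qed
  also have "\<dots> = 0" by (rule eq[OF zH z0])
  finally have "(LINT y|?M. F y) = 0" using e by simp
  then have "(LINT y|?M. Re (F y)) = 0" using integral_Re[OF Fi] by simp
  \<comment> \<open>The tested difference is purely imaginary, so the real unit vector and the real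
    part of the gradient only contribute imaginary terms; what remains is a sum of squares.\<close>
  moreover have ReF: "Re (F y) = 2 * ((Im (gradY D w 1 y))\<^sup>2 + (Im (gradY D w 2 y))\<^sup>2)" for y
    by (simp add: F_def sum_2 kd_def power2_eq_square)
  moreover have "integrable ?M (\<lambda>y. Re (F y))" using integrable_Re[OF Fi] .
  ultimately have "AE y in ?M. 2 * ((Im (gradY D w 1 y))\<^sup>2 + (Im (gradY D w 2 y))\<^sup>2) = 0"
    by (subst (asm) integral_nonneg_eq_0_iff_AE) auto
  then show ?thesis
  proof eventually_elim
    case (elim y)
    then have "(Im (gradY D w 1 y))\<^sup>2 + (Im (gradY D w 2 y))\<^sup>2 = 0" by (metis mult_eq_0_iff zero_neq_numeral)
    then have "Im (gradY D w 1 y) = 0 \<and> Im (gradY D w 2 y) = 0"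
      by (simp only: sum_power2_eq_zero_iff)
    then show ?case using exhaust_2[of l] by auto
  qed
qed

text \<open>\<open>neg_semidef\<close> tests with real vectors and takes a real part, so it sees
  only the real symmetric part of a matrix. For \<open>a_eff\<close> this is the whole matrix: real
  since the correctors have real gradients, and symmetric since it is Hermitian.\<close>

lemma a_eff_real_symmetric:
  assumes c: "\<forall>j. cell_corrector D \<epsilon>e j (wc j)" and e: "\<epsilon>e > 0"
  shows "Im (a_eff D \<epsilon>e wc j l) = 0" "a_eff D \<epsilon>e wc j l = a_eff D \<epsilon>e wc l j"
proof -
  let ?M = "lebesgue_on (Ystar D)"
  define f where "f j l y = complex_of_real (1 / \<epsilon>e) *
      (\<Sum>m\<in>UNIV. (kd j m + gradY D (wc j) m y) * (kd l m + cnj (gradY D (wc l) m y)))" for j l y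
  have ps: "sqi ?M (gradY D (wc j) m)" for j m
    by (rule gradY_sqi) (use c in \<open>auto simp: cell_corrector_def\<close>)
  have fi: "integrable ?M (f j l)" for j l unfolding f_def
    by (intro integrable_mult_right Bochner_Integration.integrable_sum sqi_mult_integrable sqi_add Ystar_one ps sqi_cnj)
  have im: "AE y in ?M. Im (gradY D (wc j) m y) = 0" for j m
    by (rule corrector_real[OF _ e]) (use c in auto)
  have "AE y in ?M. Im (f j l y) = 0" for j l
    using im[of j 1] im[of j 2] im[of l 1] im[of l 2]
    by eventually_elim (simp add: f_def sum_2 kd_def)
  then have "(LINT y|?M. Im (f j l y)) = (LINT y|?M. 0)" for j l
    by (intro integral_cong_AE) (use fi in \<open>auto intro: borel_measurable_integrable\<close>)
  then have im0: "Im (a_eff D \<epsilon>e wc j l) = 0" for j l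
    unfolding a_eff_def f_def[symmetric] using integral_Im[OF fi, of j l] by simp
  then show "Im (a_eff D \<epsilon>e wc j l) = 0" .
  have "cnj (f l j y) = f j l y" for y
    by (simp add: f_def kd_def sum_2 mult.commute)
  then have "a_eff D \<epsilon>e wc j l = cnj (a_eff D \<epsilon>e wc l j)"
    unfolding a_eff_def f_def[symmetric] by (simp flip: Bochner_Integration.integral_cnj)
  then show "a_eff D \<epsilon>e wc j l = a_eff D \<epsilon>e wc l j" using im0[of l j] by (simp add: complex_eq_iff)
qed

end

section \<open>The Dirichlet cell problem and bounds for the effective permeability\<close>

lemma H10_test_fn:
  assumes U: "bounded U" "open U" and t: "test_fn U \<phi>" shows "H10 U \<phi>"
proof -
  have "H1 U \<phi>" using weak_grad_smooth(3)[OF test_fn_smooth[OF t] U(1)] U(2) by (simp add: borel_open)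
  moreover have "H1dist U \<phi> \<phi> = 0" by (simp add: H1dist_def L2norm_def)
  ultimately show ?thesis unfolding H10_def using t by (intro conjI exI[of _ "\<lambda>n. \<phi>"]) auto
qed

text \<open>Integration by parts against the multiplier \<open>x $ 1\<close>, whose derivative is
  \<open>1\<close>: the squared norm of \<open>w\<close> becomes two pairings of
  \<open>x $ 1\<close> times \<open>w\<close> with the first derivative. This gives the constant
  \<open>2 * R\<close>.\<close>

lemma H10_poincare:
  assumes U: "bounded U" "open U" and R: "\<And>x. x \<in> U \<Longrightarrow> norm x \<le> R" and R0: "R \<ge> 0" and w: "H10 U w"
  shows "nrm2 (lebesgue_on U) w \<le> 2 * R * nrm2 (lebesgue_on U) (grad U w 1)"
proof -
  let ?M = "lebesgue_on U"
  have Ul: "U \<in> sets lebesgue" using U by (simp add: borel_open)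
  have h1: "H1 U w" using w by (simp add: H10_def)
  obtain \<phi> where tf: "\<And>n. test_fn U (\<phi> n)" and lim: "(\<lambda>n. H1dist U w (\<phi> n)) \<longlonglongrightarrow> 0"
    using w unfolding H10_def by blast
  have sm: "smooth (\<phi> n)" for n by (rule test_fn_smooth[OF tf])
  define P where "P = grad U w 1"
  have ws: "sqi ?M w" by (rule H1_sqi[OF h1])
  have Ps: "sqi ?M P" unfolding P_def by (rule H1_grad_sqi[OF h1])
  have fs: "sqi ?M (\<phi> n)" "sqi ?M (pd (\<phi> n) 1)" for n
    using test_fn_sqi[OF tf Ul] test_fn_sqi[OF test_fn_pd[OF tf] Ul] by auto
  have l1: "(\<lambda>n. nrm2 ?M (\<lambda>x. \<phi> n x - w x)) \<longlonglongrightarrow> 0"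
  proof (rule Lim_null_comparison[OF always_eventually lim], rule allI)
    fix n
    have "sqrt ((nrm2 ?M (\<lambda>x. \<phi> n x - w x))\<^sup>2) \<le> H1dist U w (\<phi> n)"
      unfolding H1dist_smooth[OF sm U h1] by (rule real_sqrt_le_mono) (simp add: sum_nonneg)
    then show "norm (nrm2 ?M (\<lambda>x. \<phi> n x - w x)) \<le> H1dist U w (\<phi> n)" by simp
  qed
  have l2: "(\<lambda>n. nrm2 ?M (\<lambda>x. pd (\<phi> n) 1 x - P x)) \<longlonglongrightarrow> 0"
  proof (rule Lim_null_comparison[OF always_eventually lim], rule allI)
    fix n
    have "(nrm2 ?M (\<lambda>x. pd (\<phi> n) 1 x - P x))\<^sup>2 \<le> (\<Sum>j\<in>UNIV. (nrm2 ?M (\<lambda>x. pd (\<phi> n) j x - grad U w j x))\<^sup>2)"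
      unfolding P_def by (rule member_le_sum) auto
    then have "sqrt ((nrm2 ?M (\<lambda>x. pd (\<phi> n) 1 x - P x))\<^sup>2) \<le> H1dist U w (\<phi> n)"
      unfolding H1dist_smooth[OF sm U h1] by (intro real_sqrt_le_mono) (simp add: add_increasing)
    then show "norm (nrm2 ?M (\<lambda>x. pd (\<phi> n) 1 x - P x)) \<le> H1dist U w (\<phi> n)" by simp
  qed
  let ?c = "\<lambda>x::R2. complex_of_real (x $ 1)"
  have xm: "?c \<in> borel_measurable ?M"
    using smooth_borel[OF smooth_coord[of 1]] by (intro measurable_restrict_space1) (simp add: measurable_completion)
  have xb: "cmod (?c x) \<le> R" if "x \<in> space ?M" for x
    using that R[of x] component_le_norm_cart[of x 1] by simp
  note xw = sqi_mult_bounded[OF ws xm xb R0] and xP = sqi_mult_bounded[OF Ps xm xb R0]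
  \<comment> \<open>The definition of the weak gradient is applied to \<open>w\<close> with a test
    function built from \<open>\<phi> n\<close>; both occurrences of \<open>\<phi> n\<close> are
    then sent to \<open>w\<close>.\<close>
  have id: "(LINT x|?M. w x * cnj (\<phi> n x)) + (LINT x|?M. (?c x * w x) * cnj (pd (\<phi> n) 1 x))
      = - (LINT x|?M. (?c x * P x) * cnj (\<phi> n x))" for n
  proof -
    have tc: "test_fn U (\<lambda>x. ?c x * cnj (\<phi> n x))" by (rule test_fn_mult[OF smooth_coord test_fn_cnj[OF tf]])
    have pdc: "pd (\<lambda>x. ?c x * cnj (\<phi> n x)) 1 x = ?c x * cnj (pd (\<phi> n) 1 x) + cnj (\<phi> n x)" for x
      by (simp add: pd_mult[OF smooth_coord smooth_cnj[OF sm]] pd_cnj[OF sm] pd_coord)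
    have "(LINT x|?M. w x * pd (\<lambda>x. ?c x * cnj (\<phi> n x)) 1 x) = - (LINT x|?M. P x * (?c x * cnj (\<phi> n x)))"
      using H1_weak_grad[OF h1] tc unfolding weak_grad_def P_def by blast
    moreover have "(LINT x|?M. w x * pd (\<lambda>x. ?c x * cnj (\<phi> n x)) 1 x)
      = (LINT x|?M. w x * cnj (\<phi> n x) + (?c x * w x) * cnj (pd (\<phi> n) 1 x))"
      by (rule Bochner_Integration.integral_cong) (simp, unfold pdc, simp add: algebra_simps)
    moreover have "\<dots> = (LINT x|?M. w x * cnj (\<phi> n x)) + (LINT x|?M. (?c x * w x) * cnj (pd (\<phi> n) 1 x))"
      by (rule Bochner_Integration.integral_add[OF sqi_mult_cnj_integrable[OF ws fs(1)] sqi_mult_cnj_integrable[OF xw(1) fs(2)]])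
    ultimately show ?thesis by (simp add: mult_ac)
  qed
  have "(\<lambda>n. (LINT x|?M. w x * cnj (\<phi> n x)) + (LINT x|?M. (?c x * w x) * cnj (pd (\<phi> n) 1 x)))
     \<longlonglongrightarrow> (LINT x|?M. w x * cnj (w x)) + (LINT x|?M. (?c x * w x) * cnj (P x))"
    by (intro tendsto_add inner_tendsto fs ws Ps xw l1 l2)
  moreover have "(\<lambda>n. - (LINT x|?M. (?c x * P x) * cnj (\<phi> n x))) \<longlonglongrightarrow> - (LINT x|?M. (?c x * P x) * cnj (w x))"
    by (intro tendsto_minus inner_tendsto fs ws xP l1)
  ultimately have "(LINT x|?M. w x * cnj (w x)) + (LINT x|?M. (?c x * w x) * cnj (P x)) = - (LINT x|?M. (?c x * P x) * cnj (w x))"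
    unfolding id by (rule LIMSEQ_unique)
  moreover have "a = - b - c" if "a + b = - c" for a b c :: complex using that by (metis add_diff_cancel_right' minus_diff_commute)
  ultimately have e: "(LINT x|?M. w x * cnj (w x)) = - (LINT x|?M. (?c x * w x) * cnj (P x)) - (LINT x|?M. (?c x * P x) * cnj (w x))"
    by blast
  have ww: "(LINT x|?M. w x * cnj (w x)) = of_real ((nrm2 ?M w)\<^sup>2)"
    unfolding nrm2_sq integral_complex_of_real[symmetric] by (simp add: complex_norm_square[symmetric])
  have "(nrm2 ?M w)\<^sup>2 = cmod (LINT x|?M. w x * cnj (w x))" unfolding ww by (simp add: norm_power)
  also have "\<dots> \<le> cmod (LINT x|?M. (?c x * w x) * cnj (P x)) + cmod (LINT x|?M. (?c x * P x) * cnj (w x))"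
    unfolding e using norm_triangle_ineq4[of "- (LINT x|?M. (?c x * w x) * cnj (P x))"] by simp
  also have "\<dots> \<le> R * nrm2 ?M w * nrm2 ?M P + R * nrm2 ?M P * nrm2 ?M w"
    by (intro add_mono order_trans[OF cauchy_schwarz_cnj[OF xw(1) Ps]] order_trans[OF cauchy_schwarz_cnj[OF xP(1) ws]] mult_right_mono xw xP) auto
  finally have "nrm2 ?M w * nrm2 ?M w \<le> nrm2 ?M w * (2 * R * nrm2 ?M P)"
    by (simp add: power2_eq_square algebra_simps)
  then show ?thesis
    using R0 nrm2_nonneg[of ?M w] by (cases "nrm2 ?M w = 0") (auto simp: P_def)
qed

lemma inner_self: "(LINT x|M. w x * cnj (w x)) = of_real ((nrm2 M w)\<^sup>2)"
  unfolding nrm2_sq integral_complex_of_real[symmetric] by (simp add: complex_norm_square[symmetric])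

context
  fixes D :: "R2 set" and \<epsilon>i :: complex and k0 :: real
  assumes D: "open D" "closure D \<subseteq> interior Ycell" and Dne: "D \<noteq> {}"
    and eps: "Re \<epsilon>i > 0" "Im \<epsilon>i > 0" and k0: "k0 > 0"
begin

lemma cell_identity:
  assumes c: "cell_w D \<epsilon>i k w" and p: "H10 D \<psi>"
  shows "(1 / \<epsilon>i) * (\<Sum>l\<in>UNIV. (LINT y|lebesgue_on D. grad D w l y * cnj (grad D \<psi> l y)))
     - of_real (k\<^sup>2) * (LINT y|lebesgue_on D. w y * cnj (\<psi> y)) = cnj (LINT y|lebesgue_on D. \<psi> y)"
proof -
  let ?M = "lebesgue_on D"
  have h: "H1 D w" "H1 D \<psi>" using c p by (auto simp: cell_w_def H10_def)
  have e: "(LINT y|?M. (1 / \<epsilon>i) * (\<Sum>l\<in>UNIV. grad D w l y * cnj (grad D \<psi> l y)) - complex_of_real (k\<^sup>2) * w y * cnj (\<psi> y))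
     = (LINT y|?M. cnj (\<psi> y))"
    using c p by (simp add: cell_w_def)
  have i1: "integrable ?M (\<lambda>y. grad D w l y * cnj (grad D \<psi> l y))" for l
    by (rule sqi_mult_cnj_integrable[OF H1_grad_sqi[OF h(1)] H1_grad_sqi[OF h(2)]])
  have i2: "integrable ?M (\<lambda>y. w y * cnj (\<psi> y))"
    by (rule sqi_mult_cnj_integrable[OF H1_sqi[OF h(1)] H1_sqi[OF h(2)]])
  have "(LINT y|?M. (1 / \<epsilon>i) * (\<Sum>l\<in>UNIV. grad D w l y * cnj (grad D \<psi> l y)) - complex_of_real (k\<^sup>2) * (w y * cnj (\<psi> y)))
    = (1 / \<epsilon>i) * (\<Sum>l\<in>UNIV. (LINT y|?M. grad D w l y * cnj (grad D \<psi> l y))) - of_real (k\<^sup>2) * (LINT y|?M. w y * cnj (\<psi> y))"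
    using i1 i2 by (subst Bochner_Integration.integral_diff) (auto simp: sum_distrib_left)
  then show ?thesis using e by (simp add: mult.assoc)
qed

text \<open>The volume of the cell can stay unevaluated: being real it does not influence the
  imaginary part, and for the modulus it is just a constant.\<close>

lemma mu_eff_eq:
  assumes w: "sqi (lebesgue_on D) w"
  shows "mu_eff D k w = of_real (measure lebesgue Ycell) + of_real (k\<^sup>2) * (LINT y|lebesgue_on D. w y)"
proof -
  have DY: "D \<subseteq> Ycell" using D_Ycell[OF D] closure_subset by blast
  have Dl: "D \<in> sets lebesgue" by (rule D_lebesgue[OF D])
  have Yl: "Ycell \<in> sets lebesgue" using Ycell_borel by simp
  have one: "sqi (lebesgue_on D) (\<lambda>y. 1)" "sqi (lebesgue_on Ycell) (\<lambda>y. 1)"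
    by (rule continuous_sqi_on[OF continuous_on_const bounded_D[OF D] Dl],
        rule continuous_sqi_on[OF continuous_on_const bounded_Ycell Yl])
  have iD: "integrable (lebesgue_on D) w" using sqi_mult_integrable[OF w one(1)] by simp
  have iDl: "integrable lebesgue (\<lambda>y. indicator D y *\<^sub>R w y)"
    using iD Dl by (subst (asm) integrable_restrict_space) auto
  have eq: "indicator Ycell y *\<^sub>R (w y * indicator D y) = indicator D y *\<^sub>R w y" for y
    using DY by (auto simp: indicator_def)
  have iY: "integrable (lebesgue_on Ycell) (\<lambda>y. w y * indicator D y)"
    using iDl Yl by (subst integrable_restrict_space) (auto simp: eq)
  have "(LINT y|lebesgue_on Ycell. w y * indicator D y) = (LINT y|lebesgue. indicator D y *\<^sub>R w y)"
    using Yl by (subst integral_restrict_space) (auto simp: eq)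
  also have "\<dots> = (LINT y|lebesgue_on D. w y)" using Dl by (subst integral_restrict_space) auto
  finally have 1: "(LINT y|lebesgue_on Ycell. w y * indicator D y) = (LINT y|lebesgue_on D. w y)" .
  have i1: "integrable (lebesgue_on Ycell) (\<lambda>y. 1 :: complex)"
    using sqi_mult_integrable[OF one(2) one(2)] by simp
  have 2: "(LINT y|lebesgue_on Ycell. 1 :: complex) = of_real (measure lebesgue Ycell)"
    using Yl by (simp add: measure_restrict_space scaleR_conv_of_real)
  have "mu_eff D k w = (LINT y|lebesgue_on Ycell. 1 + of_real (k\<^sup>2) * (w y * indicator D y))"
    by (simp add: mu_eff_def mult.assoc)
  also have "\<dots> = of_real (measure lebesgue Ycell) + of_real (k\<^sup>2) * (LINT y|lebesgue_on D. w y)"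
    by (subst Bochner_Integration.integral_add[OF i1 integrable_mult_right[OF iY]]) (simp only: 1 2 integral_mult_right_zero)
  finally show ?thesis .
qed

text \<open>Testing the cell problem with \<open>w\<close> gives \<open>Im (\<integral> w) = - Im (1 / \<epsilon>i) \<parallel>\<nabla> w\<parallel>\<^sup>2\<close> and \<open>k\<^sup>2 \<parallel>w\<parallel> = O(1)\<close>;
  testing it with a fixed bump function forces \<open>\<parallel>\<nabla> w\<parallel> \<ge> c / k\<^sup>2\<close>.\<close>

lemma mu_eff_bounds:
  obtains C c where "C > 0" "c > 0"
    "\<And>k w. k \<ge> k0 \<Longrightarrow> cell_w D \<epsilon>i k w \<Longrightarrow> cmod (mu_eff D k w) \<le> C \<and> Im (mu_eff D k w) \<ge> c / k\<^sup>2"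
proof -
  let ?M = "lebesgue_on D"
  have Dl: "D \<in> sets lebesgue" by (rule D_lebesgue[OF D])
  have bD: "bounded D" by (rule bounded_D[OF D])
  define \<kappa> where "\<kappa> = 1 / \<epsilon>i"
  define b where "b = - Im \<kappa>"
  have ez: "(Re \<epsilon>i)\<^sup>2 + (Im \<epsilon>i)\<^sup>2 > 0" using eps by (simp add: sum_power2_gt_zero_iff)
  have b: "b > 0" using eps ez by (simp add: b_def \<kappa>_def complex_eq_iff Im_divide)
  have rk: "Re \<kappa> > 0" using eps ez by (simp add: \<kappa>_def Re_divide)
  obtain x0 r where r: "r > 0" "cball x0 r \<subseteq> D" using Dne D(1) open_contains_cball by blast
  obtain \<rho> where \<rho>: "kern r \<rho>" using kern_exists[OF r(1)] by blast
  define \<psi> where "\<psi> y = complex_of_real (\<rho> (x0 - y))" for y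
  have pt: "test_fn D \<psi>" unfolding \<psi>_def by (rule kern_test_fn[OF \<rho> r(2)])
  have p10: "H10 D \<psi>" by (rule H10_test_fn[OF bD D(1) pt])
  have psi1: "(LINT y|?M. \<psi> y) = 1"
  proof -
    have bm: "\<psi> \<in> borel_measurable borel" by (rule smooth_borel[OF test_fn_smooth[OF pt]])
    have z: "\<psi> x = 0" if "x \<notin> D" for x
    proof -
      have "x \<notin> cball x0 r" using that r by blast
      then show ?thesis using \<rho> by (auto simp: \<psi>_def kern_def dist_norm)
    qed
    have "(LINT y|?M. \<psi> y) = (LINT y|lborel. \<psi> y)" by (rule lborel_integral_on[OF bm Dl z])
    also have "\<dots> = of_real (LINT y|lborel. \<rho> (x0 - y))" by (simp add: \<psi>_def)
    also have "(LINT y|lborel. \<rho> (x0 - y)) = (LINT y|lborel. \<rho> y)"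
    proof -
      have rb: "\<rho> \<in> borel_measurable borel" by (rule kern_borel[OF \<rho>])
      have eq: "(lborel :: R2 measure) = distr lborel borel (\<lambda>x. x0 + (-1) *\<^sub>R x)"
        using lborel_affine[of "-1" x0] by (simp add: density_1)
      have "(LINT y|lborel. \<rho> y) = (LINT y|distr lborel borel (\<lambda>x. x0 + (-1) *\<^sub>R x). \<rho> y)"
        by (subst eq) (rule refl)
      also have "\<dots> = (LINT y|lborel. \<rho> (x0 - y))"
        using rb by (subst integral_distr) auto
      finally show ?thesis by simp
    qed
    also have "\<dots> = 1" using \<rho> by (simp add: kern_def)
    finally show ?thesis by simp
  qed
  obtain R where R: "R > 0" "\<And>x. x \<in> D \<Longrightarrow> norm x \<le> R" using bD unfolding bounded_pos by blast
  define d where "d = nrm2 ?M (\<lambda>x. 1)"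
  have d0: "d \<ge> 0" by (simp add: d_def)
  define S where "S = nrm2 ?M (grad D \<psi> 1) + nrm2 ?M (grad D \<psi> 2)"
  define T where "T = nrm2 ?M \<psi>"
  have ST: "S \<ge> 0" "T \<ge> 0" by (auto simp: S_def T_def)
  define Y0 where "Y0 = measure lebesgue Ycell"
  define C where "C = Y0 + d * (d * (Re \<kappa> / b + 1)) + 1"
  \<comment> \<open>Bounds the pairing with the bump function per unit of \<open>k\<^sup>2\<close>
    times the gradient norm of \<open>w\<close>. The gradient term lacks the factor
    \<open>k\<^sup>2\<close>; it is supplied by
    \<open>k\<^sup>2 / k0\<^sup>2 \<ge> 1\<close>.\<close>
  define A where "A = cmod \<kappa> * S / k0\<^sup>2 + 2 * R * T + 1"
  have A: "A > 0" using ST R by (simp add: A_def add_nonneg_pos)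
  define c where "c = b / A\<^sup>2"
  show ?thesis
  proof (rule that[of C c])
    show "C > 0" using d0 b rk by (simp add: C_def Y0_def add_nonneg_pos)
    show "c > 0" using b A by (simp add: c_def)
    fix k w assume k: "k \<ge> k0" and cw: "cell_w D \<epsilon>i k w"
    have kp: "k > 0" using k k0 by simp
    have w10: "H10 D w" using cw by (simp add: cell_w_def)
    then have h1: "H1 D w" by (simp add: H10_def)
    have ws: "sqi ?M w" by (rule H1_sqi[OF h1])
    have Ps: "sqi ?M (grad D w l)" for l by (rule H1_grad_sqi[OF h1])
    define W where "W = nrm2 ?M w"
    define N1 where "N1 = nrm2 ?M (grad D w 1)"
    define N2 where "N2 = nrm2 ?M (grad D w 2)"
    define I where "I = (LINT y|?M. w y)"
    have one: "sqi ?M (\<lambda>y. 1)" by (rule continuous_sqi_on[OF continuous_on_const bD Dl])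
    have Ib: "cmod I \<le> W * d" using cauchy_schwarz[OF ws one] by (simp add: I_def W_def d_def)
    have id: "\<kappa> * of_real (N1\<^sup>2 + N2\<^sup>2) - of_real (k\<^sup>2 * W\<^sup>2) = cnj I"
      using cell_identity[OF cw w10] by (simp add: \<kappa>_def inner_self sum_2 N1_def N2_def W_def I_def)
    \<comment> \<open>Absorption in the inclusion: the imaginary part bounds the gradient linearly
      in \<open>W\<close>, and then the real part leaves \<open>k\<^sup>2 * W\<^sup>2\<close> below
      a multiple of \<open>W\<close>. The bound is uniform in \<open>k\<close>, also near the
      Dirichlet eigenvalues of the cell inclusion.\<close>
    have imI: "Im I = b * (N1\<^sup>2 + N2\<^sup>2)" using arg_cong[OF id, of Im] by (simp add: b_def)
    have reI: "Re \<kappa> * (N1\<^sup>2 + N2\<^sup>2) - k\<^sup>2 * W\<^sup>2 = Re I" using arg_cong[OF id, of Re] by simp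
    have "b * (N1\<^sup>2 + N2\<^sup>2) \<le> W * d" using imI Ib abs_Im_le_cmod[of I] by linarith
    then have "N1\<^sup>2 + N2\<^sup>2 \<le> W * d / b" using b by (simp add: field_simps)
    then have "Re \<kappa> * (N1\<^sup>2 + N2\<^sup>2) \<le> Re \<kappa> * (W * d / b)" using rk by (intro mult_left_mono) auto
    then have "k\<^sup>2 * W\<^sup>2 \<le> Re \<kappa> * (W * d / b) + W * d" using reI Ib abs_Re_le_cmod[of I] by linarith
    also have "\<dots> = W * (d * (Re \<kappa> / b + 1))" by (simp add: algebra_simps)
    finally have "W * (k\<^sup>2 * W) \<le> W * (d * (Re \<kappa> / b + 1))" by (simp add: power2_eq_square mult_ac)
    then have kW: "k\<^sup>2 * W \<le> d * (Re \<kappa> / b + 1)"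
    proof (cases "W = 0")
      case True then show ?thesis using d0 b rk by simp
    next
      case False
      then have "W > 0" unfolding W_def less_le by simp
      then show ?thesis using \<open>W * (k\<^sup>2 * W) \<le> _\<close> by simp
    qed
    note mu = mu_eff_eq[OF ws, of k, folded I_def Y0_def]
    have "cmod (mu_eff D k w) \<le> Y0 + k\<^sup>2 * cmod I"
      unfolding mu by (rule order_trans[OF norm_triangle_ineq]) (simp add: norm_mult norm_power Y0_def)
    also have "\<dots> \<le> Y0 + (k\<^sup>2 * W) * d" using mult_left_mono[OF Ib, of "k\<^sup>2"] by (simp add: mult.assoc)
    also have "\<dots> \<le> Y0 + (d * (Re \<kappa> / b + 1)) * d" by (intro add_left_mono mult_right_mono kW d0)
    also have "\<dots> \<le> C" by (simp add: C_def mult_ac)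
    finally have "cmod (mu_eff D k w) \<le> C" .
    moreover have "Im (mu_eff D k w) \<ge> c / k\<^sup>2"
    proof -
      have poin: "W \<le> 2 * R * N1" unfolding W_def N1_def
        by (rule H10_poincare[OF bD D(1) R(2) _ w10]) (use R in auto)
      have p1: "H1 D \<psi>" using p10 by (simp add: H10_def)
      define N where "N = sqrt (N1\<^sup>2 + N2\<^sup>2)"
      have NN: "N \<ge> 0" "N\<^sup>2 = N1\<^sup>2 + N2\<^sup>2" "N1 \<le> N" "N2 \<le> N"
        by (auto simp: N_def intro!: real_le_rsqrt)
      have l: "cmod (LINT y|?M. grad D w l y * cnj (grad D \<psi> l y)) \<le> nrm2 ?M (grad D w l) * nrm2 ?M (grad D \<psi> l)" for l
        by (rule cauchy_schwarz_cnj[OF Ps H1_grad_sqi[OF p1]])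
      have "cmod (\<Sum>l\<in>UNIV. (LINT y|?M. grad D w l y * cnj (grad D \<psi> l y))) \<le> N1 * nrm2 ?M (grad D \<psi> 1) + N2 * nrm2 ?M (grad D \<psi> 2)"
        unfolding sum_2 using l[of 1] l[of 2] by (intro order_trans[OF norm_triangle_ineq]) (simp add: N1_def N2_def)
      also have "\<dots> \<le> N * S" unfolding S_def distrib_left by (intro add_mono mult_right_mono NN) auto
      finally have s1: "cmod (\<Sum>l\<in>UNIV. (LINT y|?M. grad D w l y * cnj (grad D \<psi> l y))) \<le> N * S" .
      have s2: "cmod (LINT y|?M. w y * cnj (\<psi> y)) \<le> W * T"
        unfolding W_def T_def by (rule cauchy_schwarz_cnj[OF ws H1_sqi[OF p1]])
      have "1 = cmod (\<kappa> * (\<Sum>l\<in>UNIV. (LINT y|?M. grad D w l y * cnj (grad D \<psi> l y))) - of_real (k\<^sup>2) * (LINT y|?M. w y * cnj (\<psi> y)))"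
        using cell_identity[OF cw p10] by (simp add: \<kappa>_def psi1)
      also have "\<dots> \<le> cmod \<kappa> * cmod (\<Sum>l\<in>UNIV. (LINT y|?M. grad D w l y * cnj (grad D \<psi> l y))) + k\<^sup>2 * cmod (LINT y|?M. w y * cnj (\<psi> y))"
        by (rule order_trans[OF norm_triangle_ineq4]) (simp add: norm_mult norm_power)
      also have "\<dots> \<le> cmod \<kappa> * (N * S) + k\<^sup>2 * (W * T)"
        by (intro add_mono mult_left_mono s1 s2) auto
      also have "\<dots> \<le> cmod \<kappa> * (N * S) * (k\<^sup>2 / k0\<^sup>2) + k\<^sup>2 * (2 * R * N * T)"
      proof (intro add_mono mult_left_mono mult_right_mono)
        have "1 \<le> k\<^sup>2 / k0\<^sup>2" using k k0 by (simp add: power_mono)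
        then show "cmod \<kappa> * (N * S) \<le> cmod \<kappa> * (N * S) * (k\<^sup>2 / k0\<^sup>2)"
          using mult_left_mono[of 1 "k\<^sup>2 / k0\<^sup>2" "cmod \<kappa> * (N * S)"] NN ST by simp
        show "W \<le> 2 * R * N" using poin mult_left_mono[OF NN(3), of "2 * R"] R(1) by linarith
      qed (use ST in auto)
      also have "\<dots> = (k\<^sup>2 * N) * (cmod \<kappa> * S / k0\<^sup>2 + 2 * R * T)" by (simp add: algebra_simps)
      also have "\<dots> \<le> (k\<^sup>2 * N) * A" by (rule mult_left_mono) (use NN in \<open>auto simp: A_def\<close>)
      finally have "1 \<le> k\<^sup>2 * N * A" .
      then have "1 / A \<le> k\<^sup>2 * N" using A by (simp add: divide_le_eq)
      \<comment> \<open>Squaring \<open>1 \<le> k\<^sup>2 * N * A\<close> shows that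
        \<open>k\<^sup>2 * N\<^sup>2\<close> is at least \<open>1 / (A\<^sup>2 * k\<^sup>2)\<close>;
        multiplied by \<open>b\<close> this is the claimed lower bound.\<close>
      then have "(1 / A)\<^sup>2 \<le> (k\<^sup>2 * N)\<^sup>2" using A by (intro power_mono) auto
      then have "b * (1 / A\<^sup>2) \<le> b * (k\<^sup>2 * (k\<^sup>2 * N\<^sup>2))"
        using b by (intro mult_left_mono) (auto simp: power_divide power_mult_distrib power2_eq_square mult_ac)
      then have "c \<le> k\<^sup>2 * (k\<^sup>2 * (b * N\<^sup>2))" by (simp add: c_def mult_ac)
      then have "c / k\<^sup>2 \<le> k\<^sup>2 * (b * N\<^sup>2)" using kp by (simp add: divide_le_eq mult_ac)
      also have "\<dots> = Im (mu_eff D k w)" unfolding mu using imI NN(2) by simp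
      finally show ?thesis .
    qed
    ultimately show "cmod (mu_eff D k w) \<le> C \<and> Im (mu_eff D k w) \<ge> c / k\<^sup>2" ..
  qed
qed

end

section \<open>Dilations and the energy density\<close>

text \<open>Unlike \<open>nn_integral_affine\<close> this covers Lebesgue measurable integrands; the
  solution and its chosen gradient are not known to be Borel.\<close>

lemma nn_integral_lebesgue_scale:
  fixes F :: "R2 \<Rightarrow> ennreal"
  assumes F [measurable]: "F \<in> borel_measurable lebesgue" and c: "c \<noteq> 0"
  shows "(\<integral>\<^sup>+x. F (c *\<^sub>R x) \<partial>lebesgue) = ennreal (1 / c\<^sup>2) * (\<integral>\<^sup>+x. F x \<partial>lebesgue)"
proof -
  have T: "(\<lambda>x::R2. 0 + (\<Sum>j\<in>Basis. (c * (x \<bullet> j)) *\<^sub>R j)) = (*\<^sub>R) c"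
    unfolding scaleR_scaleR[symmetric] scaleR_sum_right[symmetric] euclidean_representation by simp
  have leb: "(lebesgue :: R2 measure) = density (distr lebesgue lebesgue ((*\<^sub>R) c)) (\<lambda>_. ennreal (c\<^sup>2))"
    using lebesgue_affine_euclidean[of "\<lambda>_::R2. c" 0] c unfolding T by (simp add: power2_eq_square)
  have "(\<integral>\<^sup>+x. F x \<partial>lebesgue) = (\<integral>\<^sup>+x. F x \<partial>density (distr lebesgue lebesgue ((*\<^sub>R) c)) (\<lambda>_. ennreal (c\<^sup>2)))"
    by (subst leb[symmetric]) (rule refl)
  also have "\<dots> = (\<integral>\<^sup>+x. ennreal (c\<^sup>2) * F x \<partial>distr lebesgue lebesgue ((*\<^sub>R) c))"
    by (subst nn_integral_density) auto
  also have "\<dots> = (\<integral>\<^sup>+x. ennreal (c\<^sup>2) * F (c *\<^sub>R x) \<partial>lebesgue)"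
    by (subst nn_integral_distr) auto
  also have "\<dots> = ennreal (c\<^sup>2) * (\<integral>\<^sup>+x. F (c *\<^sub>R x) \<partial>lebesgue)"
  proof (rule nn_integral_cmult)
    show "(\<lambda>x. F (c *\<^sub>R x)) \<in> borel_measurable lebesgue" by measurable
  qed
  finally show ?thesis using c by (simp add: mult.assoc[symmetric] flip: ennreal_mult)
qed

context starpoly
begin

lemma measurable_dilation:
  fixes f :: "R2 \<Rightarrow> 'b::{second_countable_topology, real_normed_vector}"
  assumes f: "f \<in> borel_measurable (lebesgue_on G)" and t: "0 < t" "t < 1"
  shows "(\<lambda>x. f (t *\<^sub>R x)) \<in> borel_measurable (lebesgue_on G)"
proof (rule measurable_compose[where g=f, OF _ f])
  have "(\<lambda>x. t *\<^sub>R x) \<in> lebesgue_on G \<rightarrow>\<^sub>M lebesgue" by (intro measurable_restrict_space1) measurable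
  moreover have "t *\<^sub>R x \<in> G" if "x \<in> G" for x using shrink_G[of t x] that t closure_subset by auto
  ultimately show "(\<lambda>x. t *\<^sub>R x) \<in> lebesgue_on G \<rightarrow>\<^sub>M lebesgue_on G"
    by (intro measurable_restrict_space2) auto
qed

text \<open>The substitution maps \<open>G\<close> onto \<open>t G\<close>, which is
  \<open>G\<close> without the shell; \<open>1 / t\<^sup>2\<close> is the Jacobian in the
  plane.\<close>

lemma dilation_integral:
  fixes h :: "R2 \<Rightarrow> real"
  assumes h: "integrable (lebesgue_on G) h" and h0: "\<And>x. h x \<ge> 0" and t: "0 < t" "t < 1"
  shows "integrable (lebesgue_on G) (\<lambda>x. h (t *\<^sub>R x))"
    "(LINT x|lebesgue_on G. h (t *\<^sub>R x)) = (1 / t\<^sup>2) * ((LINT x|lebesgue_on G. h x) - (LINT x|lebesgue_on (annulus t). h x))"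
    "integrable (lebesgue_on (annulus t)) h"
proof -
  have al: "annulus t \<in> sets lebesgue" by (rule annulus_lebesgue)
  have hm: "h \<in> borel_measurable (lebesgue_on G)" using h by auto
  define H where "H x = (if x \<in> G then h x else 0)" for x
  have Hm [measurable]: "H \<in> borel_measurable lebesgue"
    unfolding H_def using borel_measurable_if[OF G_lebesgue, of h] hm by simp
  have nG: "(\<integral>\<^sup>+x. ennreal (h x) \<partial>lebesgue_on S) = (\<integral>\<^sup>+x. ennreal (H x) * indicator S x \<partial>lebesgue)" if "S \<subseteq> G" "S \<in> sets lebesgue" for S
    using that by (subst nn_integral_restrict_space) (auto simp: H_def indicator_def intro!: nn_integral_cong)
  have h': "integrable (lebesgue_on S) h" if S: "S \<subseteq> G" "S \<in> sets lebesgue" for S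
  proof (rule integrableI_bounded)
    show "h \<in> borel_measurable (lebesgue_on S)" by (rule measurable_restrict_mono[OF hm S(1)])
    have "(\<integral>\<^sup>+x. ennreal (norm (h x)) \<partial>lebesgue_on S) \<le> (\<integral>\<^sup>+x. ennreal (h x) \<partial>lebesgue_on G)"
      using nG[OF S] nG[OF order_refl G_lebesgue] S(1) h0
      by (simp) (intro nn_integral_mono, auto simp: indicator_def)
    also have "\<dots> < \<infinity>" using h h0 by (simp add: nn_integral_eq_integral)
    finally show "(\<integral>\<^sup>+x. ennreal (norm (h x)) \<partial>lebesgue_on S) < \<infinity>" .
  qed
  show ia: "integrable (lebesgue_on (annulus t)) h" by (rule h'[OF annulus_sub al])
  have Cm: "G - annulus t \<in> sets lebesgue" using G_lebesgue al by blast
  have ic: "integrable (lebesgue_on (G - annulus t)) h" by (rule h'[OF _ Cm]) auto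
  have ind: "indicator G x = (indicator (G - annulus t) (t *\<^sub>R x) :: ennreal)" for x
    using shrink_G[of t x] t closure_subset by (auto simp: indicator_def annulus_def)
  have mt: "(\<lambda>x. h (t *\<^sub>R x)) \<in> borel_measurable (lebesgue_on G)" by (rule measurable_dilation[OF hm t])
  have "(\<integral>\<^sup>+x. ennreal (h (t *\<^sub>R x)) \<partial>lebesgue_on G) = (\<integral>\<^sup>+x. ennreal (h (t *\<^sub>R x)) * indicator G x \<partial>lebesgue)"
    using G_lebesgue by (subst nn_integral_restrict_space) auto
  also have "\<dots> = (\<integral>\<^sup>+x. ennreal (H (t *\<^sub>R x)) * indicator (G - annulus t) (t *\<^sub>R x) \<partial>lebesgue)"
    unfolding ind by (intro nn_integral_cong) (auto simp: H_def indicator_def)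
  also have "\<dots> = ennreal (1 / t\<^sup>2) * (\<integral>\<^sup>+x. ennreal (H x) * indicator (G - annulus t) x \<partial>lebesgue)"
    by (rule nn_integral_lebesgue_scale[of "\<lambda>x. ennreal (H x) * indicator (G - annulus t) x"]) (use t Cm in auto)
  also have "\<dots> = ennreal (1 / t\<^sup>2) * ennreal (LINT x|lebesgue_on (G - annulus t). h x)"
    using nG[OF _ Cm] ic h0 by (simp add: nn_integral_eq_integral)
  also have "\<dots> = ennreal ((1 / t\<^sup>2) * (LINT x|lebesgue_on (G - annulus t). h x))"
    by (rule ennreal_mult[symmetric]) (use h0 in auto)
  finally have eq: "(\<integral>\<^sup>+x. ennreal (h (t *\<^sub>R x)) \<partial>lebesgue_on G) = ennreal ((1 / t\<^sup>2) * (LINT x|lebesgue_on (G - annulus t). h x))" .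
  show it: "integrable (lebesgue_on G) (\<lambda>x. h (t *\<^sub>R x))"
    by (rule integrableI_bounded[OF mt]) (use eq h0 in simp)
  have "(LINT x|lebesgue_on G. h (t *\<^sub>R x)) = (1 / t\<^sup>2) * (LINT x|lebesgue_on (G - annulus t). h x)"
    using eq it h0 by (simp add: nn_integral_eq_integral ennreal_inj integral_nonneg_AE)
  also have "(LINT x|lebesgue_on (G - annulus t). h x) = (LINT x|lebesgue_on G. h x) - (LINT x|lebesgue_on (annulus t). h x)"
  proof -
    have r: "(LINT x|lebesgue_on S. h x) = (LINT x|lebesgue. indicator S x * h x)"
      "integrable lebesgue (\<lambda>x. indicator S x * h x)" if "S \<subseteq> G" "S \<in> sets lebesgue" for S
      using that h'[OF that] integral_restrict_space[of S lebesgue h] integrable_restrict_space[of S lebesgue h] by auto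
    have "(LINT x|lebesgue_on G. h x) = (LINT x|lebesgue. indicator (G - annulus t) x * h x + indicator (annulus t) x * h x)"
      unfolding r(1)[OF order_refl G_lebesgue]
      by (rule Bochner_Integration.integral_cong) (use annulus_sub in \<open>auto simp: indicator_def\<close>)
    also have "\<dots> = (LINT x|lebesgue_on (G - annulus t). h x) + (LINT x|lebesgue_on (annulus t). h x)"
      using r[OF _ Cm] r[OF annulus_sub al] by (subst Bochner_Integration.integral_add) auto
    finally show ?thesis by simp
  qed
  finally show "(LINT x|lebesgue_on G. h (t *\<^sub>R x)) = (1 / t\<^sup>2) * ((LINT x|lebesgue_on G. h x) - (LINT x|lebesgue_on (annulus t). h x))" .
qed

lemma sqi_dilation:
  assumes f: "sqi (lebesgue_on G) f" and t: "0 < t" "t < 1"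
  shows "sqi (lebesgue_on G) (\<lambda>x. f (t *\<^sub>R x))" "nrm2 (lebesgue_on G) (\<lambda>x. f (t *\<^sub>R x)) \<le> (1 / t) * nrm2 (lebesgue_on G) f"
proof -
  note d = dilation_integral[OF sqi_integrable_sq[OF f] _ t]
  show "sqi (lebesgue_on G) (\<lambda>x. f (t *\<^sub>R x))"
    using measurable_dilation[OF sqi_measurable[OF f] t] d(1) by (simp add: sqi_def)
  have "(nrm2 (lebesgue_on G) (\<lambda>x. f (t *\<^sub>R x)))\<^sup>2 \<le> (1 / t\<^sup>2) * (nrm2 (lebesgue_on G) f)\<^sup>2"
    unfolding nrm2_sq using d(2) by (simp add: divide_right_mono)
  also have "\<dots> = ((1 / t) * nrm2 (lebesgue_on G) f)\<^sup>2" by (simp add: power_divide)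
  finally show "nrm2 (lebesgue_on G) (\<lambda>x. f (t *\<^sub>R x)) \<le> (1 / t) * nrm2 (lebesgue_on G) f"
    by (rule power2_le_imp_le) (use t in simp)
qed

end

section \<open>The energy density as a quadratic form\<close>

definition qf :: "(2 \<Rightarrow> 2 \<Rightarrow> complex) \<Rightarrow> (2 \<Rightarrow> complex) \<Rightarrow> (2 \<Rightarrow> complex) \<Rightarrow> complex" where
  "qf A \<xi> \<eta> = (\<Sum>j\<in>UNIV. (\<Sum>l\<in>UNIV. A j l * \<xi> l) * cnj (\<eta> j))"

text \<open>Real symmetric and bounded below by the identity, written out in coordinates. Real
  arguments suffice, since the form at a complex vector is the sum of its values at the real and
  imaginary parts. The identity qualifies too, so both phases are handled uniformly.\<close>

definition coercive :: "(2 \<Rightarrow> 2 \<Rightarrow> complex) \<Rightarrow> bool" where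
  "coercive A \<longleftrightarrow> (\<forall>j l. Im (A j l) = 0) \<and> (\<forall>j l. A j l = A l j) \<and>
     (\<forall>x y. Re (A 1 1) * x\<^sup>2 + 2 * Re (A 1 2) * x * y + Re (A 2 2) * y\<^sup>2 \<ge> x\<^sup>2 + y\<^sup>2)"

lemma coercive_kd: "coercive kd"
  by (simp add: coercive_def kd_def)

lemma coercive_nsd:
  assumes "\<And>j l. Im (a j l) = 0" "\<And>j l. a j l = a l j" "neg_semidef (\<lambda>j l. kd j l - a j l)"
  shows "coercive a"
  unfolding coercive_def
proof (intro conjI allI)
  fix x y :: real
  have "Re (\<Sum>j\<in>UNIV. \<Sum>l\<in>UNIV. complex_of_real (vec2 x y $ j) * (kd j l - a j l) * complex_of_real (vec2 x y $ l)) \<le> 0"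
    using assms(3) unfolding neg_semidef_def by blast
  then have "x\<^sup>2 + y\<^sup>2 - (Re (a 1 1) * x\<^sup>2 + Re (a 1 2) * x * y + Re (a 2 1) * x * y + Re (a 2 2) * y\<^sup>2) \<le> 0"
    by (simp add: sum_2 kd_def algebra_simps power2_eq_square)
  then show "Re (a 1 1) * x\<^sup>2 + 2 * Re (a 1 2) * x * y + Re (a 2 2) * y\<^sup>2 \<ge> x\<^sup>2 + y\<^sup>2"
    using assms(2)[of 2 1] by (simp add: mult_ac)
qed (use assms in auto)

lemma qf_Re:
  assumes "coercive A"
  shows "Re (qf A \<xi> \<eta>) = Re (A 1 1) * (Re (\<xi> 1) * Re (\<eta> 1) + Im (\<xi> 1) * Im (\<eta> 1))
    + Re (A 1 2) * (Re (\<xi> 2) * Re (\<eta> 1) + Im (\<xi> 2) * Im (\<eta> 1) + Re (\<xi> 1) * Re (\<eta> 2) + Im (\<xi> 1) * Im (\<eta> 2))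
    + Re (A 2 2) * (Re (\<xi> 2) * Re (\<eta> 2) + Im (\<xi> 2) * Im (\<eta> 2))"
proof -
  have "Im (A j l) = 0" "A 2 1 = A 1 2" for j l using assms by (auto simp: coercive_def)
  then show ?thesis by (simp add: qf_def sum_2 algebra_simps)
qed

lemma qf_coercive:
  assumes "coercive A" shows "Re (qf A \<xi> \<xi>) \<ge> (\<Sum>j\<in>UNIV. (cmod (\<xi> j))\<^sup>2)"
proof -
  have c: "x\<^sup>2 + y\<^sup>2 \<le> Re (A 1 1) * x\<^sup>2 + 2 * Re (A 1 2) * x * y + Re (A 2 2) * y\<^sup>2" for x y
    using assms by (simp add: coercive_def)
  show ?thesis unfolding qf_Re[OF assms] sum_2 cmod_power2
    using c[of "Re (\<xi> 1)" "Re (\<xi> 2)"] c[of "Im (\<xi> 1)" "Im (\<xi> 2)"]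
    by (simp add: algebra_simps power2_eq_square)
qed

lemma qf_diff_right: "qf A \<xi> (\<lambda>j. \<eta> j - \<zeta> j) = qf A \<xi> \<eta> - qf A \<xi> \<zeta>"
  by (simp add: qf_def right_diff_distrib sum_subtractf)

lemma qf_diff_left: "qf A (\<lambda>j. \<eta> j - \<zeta> j) \<xi> = qf A \<eta> \<xi> - qf A \<zeta> \<xi>"
  by (simp add: qf_def right_diff_distrib left_diff_distrib sum_subtractf)

lemma qf_sym: "coercive A \<Longrightarrow> Re (qf A \<xi> \<eta>) = Re (qf A \<eta> \<xi>)"
  by (simp add: qf_Re mult.commute add_ac)

lemma qf_nonneg: "coercive A \<Longrightarrow> 0 \<le> Re (qf A \<xi> \<xi>)"
  by (rule order_trans[OF _ qf_coercive]) (auto intro: sum_nonneg)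

text \<open>For a symmetric form \<open>Q\<close>, twice the left side equals
  \<open>Q \<xi> - Q \<eta> + Q (\<xi> - \<eta>)\<close>, and the last term is nonnegative.\<close>

lemma qf_convex:
  assumes "coercive A"
  shows "Re (qf A \<xi> (\<lambda>j. \<xi> j - \<eta> j)) \<ge> (Re (qf A \<xi> \<xi>) - Re (qf A \<eta> \<eta>)) / 2"
  using qf_nonneg[OF assms, of "\<lambda>j. \<xi> j - \<eta> j"] qf_sym[OF assms, of \<eta> \<xi>]
  by (simp add: qf_diff_left qf_diff_right)

lemma qf_Im:
  assumes "coercive A" shows "Im (qf A \<xi> \<xi>) = 0"
proof -
  have "Im (A j l) = 0" "A 2 1 = A 1 2" for j l using assms by (auto simp: coercive_def)
  then show ?thesis by (simp add: qf_def sum_2 algebra_simps)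
qed

lemma qf_scale: "Re (qf A (\<lambda>j. of_real t * \<xi> j) (\<lambda>j. of_real t * \<xi> j)) = t\<^sup>2 * Re (qf A \<xi> \<xi>)"
  by (simp add: qf_def sum_2 power2_eq_square algebra_simps)

lemma qf_kd: "Re (qf kd \<xi> \<xi>) = (\<Sum>j\<in>UNIV. (cmod (\<xi> j))\<^sup>2)"
  unfolding sum_2 cmod_power2 by (simp add: qf_def kd_def sum_2 power2_eq_square)

lemma qf_kd_le: "coercive A \<Longrightarrow> Re (qf kd \<xi> \<xi>) \<le> Re (qf A \<xi> \<xi>)"
  unfolding qf_kd by (rule qf_coercive)

section \<open>Elimination of the unknown norms with explicit powers of \<open>k\<close>\<close>

lemma young: "d > 0 \<Longrightarrow> x * y \<le> d * x\<^sup>2 + y\<^sup>2 / (4 * (d::real))"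
proof -
  assume d: "d > 0"
  have "0 \<le> (2 * d * x - y)\<^sup>2" by simp
  then have "4 * d * (x * y) \<le> 4 * d * (d * x\<^sup>2) + y\<^sup>2" by (simp add: power2_eq_square algebra_simps)
  also have "\<dots> = 4 * d * (d * x\<^sup>2 + y\<^sup>2 / (4 * d))" using d by (simp add: distrib_left)
  finally show ?thesis using d by simp
qed

text \<open>The premises are the imaginary and real parts of the energy identity and the Rellich estimate; for the
  letters see locale \<open>solution\<close>.\<close>

lemma combine_estimates:
  fixes c m K k0 :: real
  assumes c: "c > 0" and m: "m \<ge> 0" and K: "K > 0" and k0: "k0 > 0"
  obtains C where "C > 0" "\<And>k T g P W Ov F H. k \<ge> k0 \<Longrightarrow> T \<ge> 0 \<Longrightarrow> g \<ge> 0 \<Longrightarrow> P \<ge> 0 \<Longrightarrow> W \<ge> 0 \<Longrightarrow> Ov \<ge> 0 \<Longrightarrow> F \<ge> 0 \<Longrightarrow> H \<ge> 0 \<Longrightarrow>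
      c * W\<^sup>2 + k * T\<^sup>2 \<le> H * W + F * Ov + g * T \<Longrightarrow>
      P\<^sup>2 \<le> k\<^sup>2 * (m * W\<^sup>2 + Ov\<^sup>2) + (H * W + F * Ov + g * T) \<Longrightarrow>
      k\<^sup>2 * Ov\<^sup>2 \<le> K * (k\<^sup>2 * T\<^sup>2 + (k * T + g)\<^sup>2 + P * (k\<^sup>2 * W + H + F)) \<Longrightarrow>
      P\<^sup>2 + k\<^sup>2 * (W\<^sup>2 + Ov\<^sup>2) \<le> C * (k ^ 4 * H\<^sup>2 + k ^ 3 * g\<^sup>2 + k ^ 6 * F\<^sup>2)"
proof -
  \<comment> \<open>Since \<open>i * k \<ge> 1\<close>, powers of \<open>i\<close> trade a lower
    power of \<open>k\<close> for a higher one; this is how the constants depend on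
    \<open>k0\<close> but not on \<open>k\<close>.\<close>
  define i where "i = 1 / k0"
  define mm where "mm = 1 / (2 * c) + 1"
  define C1 where "C1 = 2 * mm / c + 2 * mm"
  define C2 where "C2 = m * (i\<^sup>2 * C1) + (i ^ 4 + i ^ 4 * C1) + i ^ 4 + (i ^ 3 + i ^ 5 * C1)"
  define C3 where "C3 = K * (3 * (i ^ 3 * C1) + 2 * i ^ 3 + 3 * K / 2 * (C1 + i ^ 4 + i ^ 6))"
  define C5 where "C5 = C2 + 2 * C3"
  define C6 where "C6 = 2 * C5 + C5\<^sup>2"
  define C7 where "C7 = C6 / (2 * C5) + C5 / 2"
  define C where "C = 2 * C6 + (C2 + i\<^sup>2 * C1) * (1 + C7)"
  have i: "i > 0" using k0 by (simp add: i_def)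
  have mm: "mm > 0" using c by (simp add: mm_def add_pos_pos)
  have C1: "C1 > 0" using mm c by (simp add: C1_def add_pos_pos)
  have C2: "C2 > 0" using i C1 m by (simp add: C2_def add_pos_pos add_nonneg_pos)
  have C3: "C3 > 0" using i C1 K by (simp add: C3_def add_pos_pos)
  have C5: "C5 > 0" using C2 C3 by (simp add: C5_def)
  have C6: "C6 > 0" using C5 by (simp add: C6_def add_pos_pos)
  have C7: "C7 > 0" using C5 C6 by (simp add: C7_def add_pos_pos)
  have Cp: "C > 0" using C6 C2 i C1 C7 by (simp add: C_def add_pos_pos)
  show ?thesis
  proof (rule that[OF Cp])
    fix k T g P W Ov F H :: real
    assume k: "k \<ge> k0" and nn: "T \<ge> 0" "g \<ge> 0" "P \<ge> 0" "W \<ge> 0" "Ov \<ge> 0" "F \<ge> 0" "H \<ge> 0"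
      and e1: "c * W\<^sup>2 + k * T\<^sup>2 \<le> H * W + F * Ov + g * T"
      and e2: "P\<^sup>2 \<le> k\<^sup>2 * (m * W\<^sup>2 + Ov\<^sup>2) + (H * W + F * Ov + g * T)"
      and e3: "k\<^sup>2 * Ov\<^sup>2 \<le> K * (k\<^sup>2 * T\<^sup>2 + (k * T + g)\<^sup>2 + P * (k\<^sup>2 * W + H + F))"
    have kp: "k > 0" using k k0 by simp
    define X where "X = k ^ 4 * H\<^sup>2"
    \<comment> \<open>The product with the unknown exterior norm is carried along as if it were data
      and resolved only at the end.\<close>
    define Y where "Y = k ^ 4 * (F * Ov)"
    define Z where "Z = k ^ 3 * g\<^sup>2"
    define \<Phi> where "\<Phi> = k ^ 6 * F\<^sup>2"
    define S where "S = X + Y + Z"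
    have n2: "X \<ge> 0" "Y \<ge> 0" "Z \<ge> 0" "\<Phi> \<ge> 0" using nn kp by (auto simp: X_def Y_def Z_def \<Phi>_def)
    then have S: "S \<ge> 0" "X \<le> S" "Y \<le> S" "Z \<le> S" by (auto simp: S_def)
    have low: "x \<le> i ^ n * (k ^ n * x)" if "x \<ge> 0" for x n
    proof -
      have "1 \<le> (i * k) ^ n" using k k0 by (intro one_le_power) (simp add: i_def)
      then have "1 * x \<le> (i * k) ^ n * x" using that by (intro mult_right_mono) auto
      then show ?thesis by (simp add: power_mult_distrib mult.assoc)
    qed
    have up: "i ^ n * a \<le> i ^ n * b" if "a \<le> b" for a b n using that i by (intro mult_left_mono) auto
    have y1: "H * W \<le> c / 2 * W\<^sup>2 + H\<^sup>2 / (2 * c)" using young[of "c / 2" W H] c by (simp add: mult.commute)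
    have y2: "g * T \<le> k / 2 * T\<^sup>2 + g\<^sup>2 / (2 * k)" using young[of "k / 2" T g] kp by (simp add: mult.commute)
    have "c / 2 * W\<^sup>2 + k / 2 * T\<^sup>2 \<le> H\<^sup>2 / (2 * c) + F * Ov + g\<^sup>2 / (2 * k)" using e1 y1 y2 by simp
    \<comment> \<open>The third premise contains \<open>P\<close> times
      \<open>k\<^sup>2 * W\<close>; after splitting this product, \<open>k ^ 4 * W\<^sup>2\<close>
      is what must be bounded. This factor fixes all exponents of the result.\<close>
    then have "k ^ 4 * (c / 2 * W\<^sup>2 + k / 2 * T\<^sup>2) \<le> k ^ 4 * (H\<^sup>2 / (2 * c) + F * Ov + g\<^sup>2 / (2 * k))"
      using kp by (intro mult_left_mono) auto
    moreover have "k ^ 4 * (H\<^sup>2 / (2 * c) + F * Ov + g\<^sup>2 / (2 * k)) = X / (2 * c) + Y + Z / 2"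
      using kp by (simp add: X_def Y_def Z_def distrib_left power_numeral_reduce)
    moreover have "k ^ 4 * (c / 2 * W\<^sup>2 + k / 2 * T\<^sup>2) = c / 2 * (k ^ 4 * W\<^sup>2) + (k ^ 5 * T\<^sup>2) / 2"
      by (simp add: distrib_left power_numeral_reduce mult_ac)
    moreover have "X / (2 * c) + Y + Z / 2 \<le> mm * S"
    proof -
      have "X / (2 * c) \<le> S / (2 * c)" using S c by (intro divide_right_mono) auto
      moreover have "Y + Z / 2 \<le> S" using n2 by (simp add: S_def)
      ultimately show ?thesis by (simp add: mm_def distrib_right)
    qed
    ultimately have s1: "c / 2 * (k ^ 4 * W\<^sup>2) + (k ^ 5 * T\<^sup>2) / 2 \<le> mm * S" by simp
    have w0: "k ^ 4 * W\<^sup>2 \<ge> 0" "k ^ 5 * T\<^sup>2 \<ge> 0" using kp by auto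
    have kW: "k ^ 4 * W\<^sup>2 \<le> C1 * S"
    proof -
      have "c / 2 * (k ^ 4 * W\<^sup>2) \<le> mm * S" using s1 w0 by linarith
      then have "k ^ 4 * W\<^sup>2 \<le> 2 * mm / c * S" using c by (simp add: field_simps)
      also have "\<dots> \<le> C1 * S" using mm S by (intro mult_right_mono) (auto simp: C1_def)
      finally show ?thesis .
    qed
    have kT: "k ^ 5 * T\<^sup>2 \<le> C1 * S"
    proof -
      have "c / 2 * (k ^ 4 * W\<^sup>2) \<ge> 0" using w0 c by simp
      then have "k ^ 5 * T\<^sup>2 \<le> 2 * mm * S" using s1 by linarith
      also have "\<dots> \<le> C1 * S" using mm c S by (intro mult_right_mono) (auto simp: C1_def)
      finally show ?thesis .
    qed
    have T2: "T\<^sup>2 \<le> i ^ 5 * (C1 * S)" by (rule order_trans[OF low[of "T\<^sup>2" 5] up[OF kT]]) simp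
    have kT2: "k\<^sup>2 * T\<^sup>2 \<le> i ^ 3 * (C1 * S)"
    proof -
      have "k ^ 3 * (k\<^sup>2 * T\<^sup>2) = k ^ 5 * T\<^sup>2" by (simp add: power_numeral_reduce mult_ac)
      then show ?thesis using low[of "k\<^sup>2 * T\<^sup>2" 3] up[OF kT, of 3] by simp
    qed
    have W2: "W\<^sup>2 \<le> i ^ 4 * (C1 * S)" by (rule order_trans[OF low[of "W\<^sup>2" 4] up[OF kW]]) simp
    have kW2: "k\<^sup>2 * W\<^sup>2 \<le> i\<^sup>2 * (C1 * S)"
    proof -
      have "k\<^sup>2 * (k\<^sup>2 * W\<^sup>2) = k ^ 4 * W\<^sup>2" by (simp add: power_numeral_reduce mult_ac)
      then show ?thesis using low[of "k\<^sup>2 * W\<^sup>2" 2] up[OF kW, of 2] by simp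
    qed
    have g2: "g\<^sup>2 \<le> i ^ 3 * S" using low[of "g\<^sup>2" 3] up[OF S(4), of 3] by (simp add: Z_def)
    have H2: "H\<^sup>2 \<le> i ^ 4 * S" using low[of "H\<^sup>2" 4] up[OF S(2), of 4] by (simp add: X_def)
    have F2: "F\<^sup>2 \<le> i ^ 6 * \<Phi>" using low[of "F\<^sup>2" 6] by (simp add: \<Phi>_def)
    have FO: "F * Ov \<le> i ^ 4 * S" using low[of "F * Ov" 4] up[OF S(3), of 4] nn by (simp add: Y_def)
    have P2: "P\<^sup>2 \<le> k\<^sup>2 * Ov\<^sup>2 + C2 * S"
    proof -
      have "H * W \<le> H\<^sup>2 + W\<^sup>2" using two_mult_le[of H W] nn mult_nonneg_nonneg[of H W] by linarith
      moreover have "g * T \<le> g\<^sup>2 + T\<^sup>2" using two_mult_le[of g T] nn mult_nonneg_nonneg[of g T] by linarith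
      moreover have "m * (k\<^sup>2 * W\<^sup>2) \<le> m * (i\<^sup>2 * (C1 * S))" by (rule mult_left_mono[OF kW2 m])
      moreover have "k\<^sup>2 * (m * W\<^sup>2 + Ov\<^sup>2) = m * (k\<^sup>2 * W\<^sup>2) + k\<^sup>2 * Ov\<^sup>2" by (simp add: algebra_simps)
      moreover have "C2 * S = m * (i\<^sup>2 * (C1 * S)) + (i ^ 4 * S + i ^ 4 * (C1 * S)) + i ^ 4 * S + (i ^ 3 * S + i ^ 5 * (C1 * S))"
        by (simp add: C2_def algebra_simps)
      ultimately show ?thesis using e2 H2 W2 g2 T2 FO by linarith
    qed
    have kO: "k\<^sup>2 * Ov\<^sup>2 \<le> C5 * (S + \<Phi>)"
    proof -
      \<comment> \<open>Three products with \<open>P\<close> are split, so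
        \<open>K * 3 * d = 1/2\<close> of the squared gradient norm arises; the bound
        \<open>P2\<close> returns half of \<open>k\<^sup>2 * Ov\<^sup>2\<close>, which is
        absorbed.\<close>
      define d where "d = 1 / (6 * K)"
      have d: "d > 0" using K by (simp add: d_def)
      have yd: "P * y \<le> d * P\<^sup>2 + 3 * K / 2 * y\<^sup>2" for y
        using young[OF d, of P y] K by (simp add: d_def mult.commute)
      have K32: "0 \<le> 3 * K / 2" using K by simp
      have kW4: "(k\<^sup>2 * W)\<^sup>2 = k ^ 4 * W\<^sup>2" by (simp add: power_mult_distrib)
      have a1: "P * (k\<^sup>2 * W) \<le> d * P\<^sup>2 + 3 * K / 2 * (C1 * S)"
        by (rule order_trans[OF yd[of "k\<^sup>2 * W", unfolded kW4] add_left_mono[OF mult_left_mono[OF kW K32]]])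
      have a2: "P * H \<le> d * P\<^sup>2 + 3 * K / 2 * (i ^ 4 * S)"
        by (rule order_trans[OF yd[of H] add_left_mono[OF mult_left_mono[OF H2 K32]]])
      have a3: "P * F \<le> d * P\<^sup>2 + 3 * K / 2 * (i ^ 6 * \<Phi>)"
        by (rule order_trans[OF yd[of F] add_left_mono[OF mult_left_mono[OF F2 K32]]])
      have a4: "(k * T + g)\<^sup>2 \<le> 2 * (k\<^sup>2 * T\<^sup>2) + 2 * g\<^sup>2"
        using two_mult_le[of "k * T" g] by (simp add: power2_sum power_mult_distrib mult_ac)
      have "k\<^sup>2 * T\<^sup>2 + (k * T + g)\<^sup>2 + P * (k\<^sup>2 * W + H + F) \<le>
        3 * d * P\<^sup>2 + (3 * (i ^ 3 * (C1 * S)) + 2 * (i ^ 3 * S) + 3 * K / 2 * (C1 * S) + 3 * K / 2 * (i ^ 4 * S) + 3 * K / 2 * (i ^ 6 * \<Phi>))"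
        using a1 a2 a3 a4 kT2 g2 unfolding distrib_left by linarith
      then have "k\<^sup>2 * Ov\<^sup>2 \<le> K * (3 * d * P\<^sup>2 + (3 * (i ^ 3 * (C1 * S)) + 2 * (i ^ 3 * S) + 3 * K / 2 * (C1 * S) + 3 * K / 2 * (i ^ 4 * S) + 3 * K / 2 * (i ^ 6 * \<Phi>)))"
        using e3 K by (meson less_imp_le mult_left_mono order_trans)
      also have "\<dots> = P\<^sup>2 / 2 + K * (3 * (i ^ 3 * (C1 * S)) + 2 * (i ^ 3 * S) + 3 * K / 2 * (C1 * S) + 3 * K / 2 * (i ^ 4 * S) + 3 * K / 2 * (i ^ 6 * \<Phi>))"
        using K by (simp add: d_def distrib_left)
      also have "\<dots> \<le> P\<^sup>2 / 2 + C3 * (S + \<Phi>)"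
      proof -
        have "C3 * (S + \<Phi>) - K * (3 * (i ^ 3 * (C1 * S)) + 2 * (i ^ 3 * S) + 3 * K / 2 * (C1 * S) + 3 * K / 2 * (i ^ 4 * S) + 3 * K / 2 * (i ^ 6 * \<Phi>))
          = K * (3 * (i ^ 3 * C1) + 2 * i ^ 3 + 3 * K / 2 * (C1 + i ^ 4)) * \<Phi> + K * (3 * K / 2 * i ^ 6) * S"
          by (simp add: C3_def algebra_simps add_divide_distrib)
        also have "\<dots> \<ge> 0" using K i C1 n2 S by simp
        finally show ?thesis by simp
      qed
      finally have "k\<^sup>2 * Ov\<^sup>2 \<le> P\<^sup>2 / 2 + C3 * (S + \<Phi>)" .
      moreover have "C2 * S \<le> C2 * (S + \<Phi>)" using C2 n2 by (intro mult_left_mono) auto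
      moreover have "C5 * (S + \<Phi>) = C2 * (S + \<Phi>) + 2 * (C3 * (S + \<Phi>))" by (simp add: C5_def algebra_simps)
      ultimately show ?thesis using P2 by linarith
    qed
    define Q where "Q = X + Z + \<Phi>"
    have Q: "Q \<ge> 0" "\<Phi> \<le> Q" "X + Z \<le> Q" using n2 by (auto simp: Q_def)
    \<comment> \<open>The weight is chosen so that, after multiplication by \<open>C5\<close>,
      exactly half of \<open>k\<^sup>2 * Ov\<^sup>2\<close> comes back. Pairing
      \<open>k * Ov\<close> with \<open>k ^ 3 * F\<close> is the origin of the cubic power for the
      exterior source.\<close>
    have Yy: "Y \<le> (k\<^sup>2 * Ov\<^sup>2) / (2 * C5) + C5 / 2 * \<Phi>"
    proof -
      have "Y = (k * Ov) * (k ^ 3 * F)" by (simp add: Y_def power_numeral_reduce mult_ac)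
      also have "\<dots> \<le> (1 / (2 * C5)) * (k * Ov)\<^sup>2 + (k ^ 3 * F)\<^sup>2 / (4 * (1 / (2 * C5)))"
        by (rule young) (use C5 in simp)
      also have "\<dots> = (k\<^sup>2 * Ov\<^sup>2) / (2 * C5) + C5 / 2 * \<Phi>"
        by (simp add: power_mult_distrib \<Phi>_def flip: power_mult)
      finally show ?thesis .
    qed
    have kO6: "k\<^sup>2 * Ov\<^sup>2 \<le> C6 * Q"
    proof -
      have "C5 * (S + \<Phi>) = C5 * Q + C5 * Y" by (simp add: S_def Q_def algebra_simps)
      moreover have "C5 * Y \<le> C5 * ((k\<^sup>2 * Ov\<^sup>2) / (2 * C5) + C5 / 2 * \<Phi>)" using Yy C5 by (intro mult_left_mono) auto
      moreover have "C5 * ((k\<^sup>2 * Ov\<^sup>2) / (2 * C5) + C5 / 2 * \<Phi>) = (k\<^sup>2 * Ov\<^sup>2) / 2 + C5\<^sup>2 / 2 * \<Phi>"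
        using C5 by (simp add: distrib_left power2_eq_square)
      moreover have "C5\<^sup>2 / 2 * \<Phi> \<le> C5\<^sup>2 / 2 * Q" using Q by (intro mult_left_mono) auto
      moreover have "C6 * Q = 2 * (C5 * Q) + 2 * (C5\<^sup>2 / 2 * Q)" by (simp add: C6_def algebra_simps)
      ultimately show ?thesis using kO by linarith
    qed
    have "Y \<le> C7 * Q"
    proof -
      have "(k\<^sup>2 * Ov\<^sup>2) / (2 * C5) \<le> (C6 * Q) / (2 * C5)" using kO6 C5 by (intro divide_right_mono) auto
      moreover have "C5 / 2 * \<Phi> \<le> C5 / 2 * Q" using Q C5 by (intro mult_left_mono) auto
      ultimately show ?thesis using Yy by (simp add: C7_def distrib_right)
    qed
    then have SQ: "S \<le> (1 + C7) * Q" using Q by (simp add: S_def distrib_right)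
    have "P\<^sup>2 + k\<^sup>2 * (W\<^sup>2 + Ov\<^sup>2) \<le> 2 * (k\<^sup>2 * Ov\<^sup>2) + (C2 + i\<^sup>2 * C1) * S"
      using P2 kW2 by (simp add: algebra_simps)
    also have "\<dots> \<le> 2 * (C6 * Q) + (C2 + i\<^sup>2 * C1) * ((1 + C7) * Q)"
      using kO6 SQ C2 i C1 by (intro add_mono mult_left_mono) auto
    also have "\<dots> = C * Q" by (simp add: C_def algebra_simps)
    finally show "P\<^sup>2 + k\<^sup>2 * (W\<^sup>2 + Ov\<^sup>2) \<le> C * (k ^ 4 * H\<^sup>2 + k ^ 3 * g\<^sup>2 + k ^ 6 * F\<^sup>2)"
      by (simp add: Q_def X_def Z_def \<Phi>_def)
  qed
qed

section \<open>The scattering problem\<close>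

text \<open>What the analysis retains of the homogenised problem: the normals of \<Omega> have
  become star-shapedness, its C2 boundary a null set, and the cell problems a coercive matrix
  \<open>a\<close>.\<close>

locale inclusion = starpoly G vs \<gamma> for G vs \<gamma> +
  fixes \<Omega> :: "R2 set" and a :: "2 \<Rightarrow> 2 \<Rightarrow> complex"
  assumes open_Om: "open \<Omega>" and Om_sub: "\<Omega> \<subseteq> G"
    and Om_star: "\<And>y t. y \<in> \<Omega> \<Longrightarrow> 0 < t \<Longrightarrow> t \<le> 1 \<Longrightarrow> t *\<^sub>R y \<in> \<Omega>"
    and Om_null: "negligible (frontier \<Omega>)"
    and coer: "coercive a"
begin

lemma Om_lebesgue: "\<Omega> \<in> sets lebesgue" using open_Om by (simp add: borel_open)

lemma out_lebesgue: "G - \<Omega> \<in> sets lebesgue" using G_lebesgue Om_lebesgue by blast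

lemma coer_A: "coercive (Acoef \<Omega> a x)"
  using coer coercive_kd by (simp add: Acoef_def)

lemma split_G:
  fixes h :: "R2 \<Rightarrow> 'b::{banach, second_countable_topology}"
  assumes h: "integrable (lebesgue_on G) h"
  shows "integrable (lebesgue_on \<Omega>) h" "integrable (lebesgue_on (G - \<Omega>)) h"
    "(LINT x|lebesgue_on G. h x) = (LINT x|lebesgue_on \<Omega>. h x) + (LINT x|lebesgue_on (G - \<Omega>). h x)"
proof -
  have hG: "integrable lebesgue (\<lambda>x. indicator G x *\<^sub>R h x)"
    using h G_lebesgue by (subst (asm) integrable_restrict_space) auto
  have iO: "integrable lebesgue (\<lambda>x. indicator \<Omega> x *\<^sub>R h x)"
  proof -
    have "integrable lebesgue (\<lambda>x. indicator \<Omega> x *\<^sub>R (indicator G x *\<^sub>R h x))"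
      by (rule integrable_mult_indicator[OF Om_lebesgue hG])
    moreover have "(\<lambda>x. indicator \<Omega> x *\<^sub>R (indicator G x *\<^sub>R h x)) = (\<lambda>x. indicator \<Omega> x *\<^sub>R h x)"
      using Om_sub by (auto simp: indicator_def fun_eq_iff)
    ultimately show ?thesis by simp
  qed
  have iC: "integrable lebesgue (\<lambda>x. indicator (G - \<Omega>) x *\<^sub>R h x)"
  proof -
    have "integrable lebesgue (\<lambda>x. indicator (G - \<Omega>) x *\<^sub>R (indicator G x *\<^sub>R h x))"
      by (rule integrable_mult_indicator[OF out_lebesgue hG])
    moreover have "(\<lambda>x. indicator (G - \<Omega>) x *\<^sub>R (indicator G x *\<^sub>R h x)) = (\<lambda>x. indicator (G - \<Omega>) x *\<^sub>R h x)"
      by (auto simp: indicator_def fun_eq_iff)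
    ultimately show ?thesis by simp
  qed
  show "integrable (lebesgue_on \<Omega>) h" "integrable (lebesgue_on (G - \<Omega>)) h"
    using iO iC Om_lebesgue out_lebesgue by (auto simp: integrable_restrict_space)
  have "(LINT x|lebesgue_on G. h x) = (LINT x|lebesgue. indicator \<Omega> x *\<^sub>R h x + indicator (G - \<Omega>) x *\<^sub>R h x)"
    using G_lebesgue Om_sub by (subst integral_restrict_space) (auto intro!: Bochner_Integration.integral_cong simp: indicator_def)
  also have "\<dots> = (LINT x|lebesgue_on \<Omega>. h x) + (LINT x|lebesgue_on (G - \<Omega>). h x)"
    using iO iC Om_lebesgue out_lebesgue by (simp add: integral_restrict_space)
  finally show "(LINT x|lebesgue_on G. h x) = (LINT x|lebesgue_on \<Omega>. h x) + (LINT x|lebesgue_on (G - \<Omega>). h x)" .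
qed

lemma sqi_parts:
  assumes "sqi (lebesgue_on G) h"
  shows "sqi (lebesgue_on \<Omega>) h" "sqi (lebesgue_on (G - \<Omega>)) h"
    "(nrm2 (lebesgue_on G) h)\<^sup>2 = (nrm2 (lebesgue_on \<Omega>) h)\<^sup>2 + (nrm2 (lebesgue_on (G - \<Omega>)) h)\<^sup>2"
  using sqi_subset(1)[OF assms Om_sub Om_lebesgue G_lebesgue] sqi_subset(1)[OF assms _ out_lebesgue G_lebesgue]
    split_G(3)[OF sqi_integrable_sq[OF assms]] by (auto simp: nrm2_sq)

text \<open>The coefficients switch at the open set \<Omega>, whereas the claim measures
  \<open>f\<close> outside its closure; the difference is a null set.\<close>

lemma out_norm:
  assumes "sqi (lebesgue_on G) h"
  shows "nrm2 (lebesgue_on (G - \<Omega>)) h = L2norm (G - closure \<Omega>) h"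
proof -
  have "closure \<Omega> \<in> sets lebesgue" by (simp add: borel_closed)
  then have cl: "G - closure \<Omega> \<in> sets lebesgue" using G_lebesgue by (intro sets.Diff)
  have "AE x in lebesgue. x \<notin> frontier \<Omega>"
    using Om_null by (simp add: AE_not_in negligible_iff_null_sets)
  then have "AE x in lebesgue. (indicator (G - \<Omega>) x :: real) = indicator (G - closure \<Omega>) x"
    by eventually_elim (use open_Om closure_subset[of \<Omega>] in \<open>auto simp: indicator_def frontier_def interior_open\<close>)
  then have eq: "AE x in lebesgue. indicator (G - \<Omega>) x *\<^sub>R (cmod (h x))\<^sup>2 = indicator (G - closure \<Omega>) x *\<^sub>R (cmod (h x))\<^sup>2"
    by eventually_elim simp
  have i1: "integrable lebesgue (\<lambda>x. indicator (G - \<Omega>) x *\<^sub>R (cmod (h x))\<^sup>2)"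
    using sqi_integrable_sq[OF sqi_parts(2)[OF assms]] out_lebesgue by (simp add: integrable_restrict_space)
  have "integrable (lebesgue_on (G - closure \<Omega>)) (\<lambda>x. (cmod (h x))\<^sup>2)"
    by (rule sqi_integrable_sq[OF sqi_subset(1)[OF assms _ cl G_lebesgue]]) auto
  then have i2: "integrable lebesgue (\<lambda>x. indicator (G - closure \<Omega>) x *\<^sub>R (cmod (h x))\<^sup>2)"
    using cl by (simp add: integrable_restrict_space)
  have "(LINT x|lebesgue. indicator (G - \<Omega>) x *\<^sub>R (cmod (h x))\<^sup>2) = (LINT x|lebesgue. indicator (G - closure \<Omega>) x *\<^sub>R (cmod (h x))\<^sup>2)"
    by (rule integral_cong_AE) (use i1 i2 eq in \<open>auto intro: borel_measurable_integrable\<close>)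
  then show ?thesis using out_lebesgue cl by (simp add: nrm2_def L2norm_def integral_restrict_space)
qed

lemma piecewise_measurable: "(\<lambda>x. if x \<in> \<Omega> then b else c) \<in> borel_measurable (lebesgue_on G)"
  for b c :: "'b::topological_space"
  by (rule measurable_restrict_space1) (use Om_lebesgue in measurable)

abbreviation "MG \<equiv> lebesgue_on G"

definition ip :: "(R2 \<Rightarrow> complex) \<Rightarrow> (R2 \<Rightarrow> complex) \<Rightarrow> complex" where
  "ip f h = (LINT x|MG. f x * cnj (h x))"

definition flux :: "(2 \<Rightarrow> R2 \<Rightarrow> complex) \<Rightarrow> 2 \<Rightarrow> R2 \<Rightarrow> complex" where
  "flux p j x = (\<Sum>l\<in>UNIV. Acoef \<Omega> a x j l * p l x)"

lemma flux_sqi: assumes "\<And>l. sqi MG (p l)" shows "sqi MG (flux p j)"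
proof -
  have "sqi MG (\<lambda>x. Acoef \<Omega> a x j l * p l x)" for l
  proof (rule sqi_mult_bounded(1)[OF assms])
    have "(\<lambda>x. Acoef \<Omega> a x j l) = (\<lambda>x. if x \<in> \<Omega> then a j l else kd j l)" by (auto simp: Acoef_def fun_eq_iff)
    then show "(\<lambda>x. Acoef \<Omega> a x j l) \<in> borel_measurable MG" using piecewise_measurable by simp
    show "cmod (Acoef \<Omega> a x j l) \<le> cmod (a j l) + cmod (kd j l)" for x by (simp add: Acoef_def)
  qed simp
  then show ?thesis unfolding flux_def[abs_def] sum_2 by (intro sqi_add)
qed

lemma mu_sqi: assumes "sqi MG u" shows "sqi MG (\<lambda>x. mucoef \<Omega> \<mu> x * u x)"
proof (rule sqi_mult_bounded(1)[OF assms])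
  show "(\<lambda>x. mucoef \<Omega> \<mu> x) \<in> borel_measurable MG" unfolding mucoef_def by (rule piecewise_measurable)
  show "cmod (mucoef \<Omega> \<mu> x) \<le> cmod \<mu> + 1" for x by (simp add: mucoef_def)
qed simp

lemma smooth_trace: assumes "smooth \<psi>" shows "is_trace G vs \<psi> \<psi>"
proof -
  have "H1dist G \<psi> \<psi> = 0" "bL2norm vs (\<lambda>x. \<psi> x - \<psi> x) = 0" by (simp_all add: H1dist_def L2norm_def bL2norm_def)
  then show ?thesis unfolding is_trace_def
    using weak_grad_smooth(3)[OF assms bounded_G G_lebesgue] bL2_continuous[OF smooth_continuous[OF assms]] assms
    by (intro conjI exI[of _ "\<lambda>n. \<psi>"]) auto
qed

text \<open>A smooth test function is its own trace and its chosen gradient may be replaced by the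
  classical one, so the weak form only calls for a trace of \<open>u\<close>.\<close>

lemma weak_form_smooth:
  assumes sol: "weak_sol G vs \<Omega> a \<mu> k f g u" and tr: "is_trace G vs u tu" and g: "bL2 vs g" and f: "sqi MG f"
    and psi: "smooth \<psi>"
  shows "(\<Sum>j\<in>UNIV. ip (flux (grad G u) j) (pd \<psi> j)) - of_real (k\<^sup>2) * ip (\<lambda>x. mucoef \<Omega> \<mu> x * u x) \<psi> - ip f \<psi>
    = bint vs (\<lambda>x. (\<i> * of_real k * tu x + g x) * cnj (\<psi> x))"
proof -
  have u: "H1 G u" using sol by (simp add: weak_sol_def)
  have ps: "sqi MG (grad G u l)" for l by (rule H1_grad_sqi[OF u])
  have hp: "H1 G \<psi>" by (rule weak_grad_smooth(3)[OF psi bounded_G G_lebesgue])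
  have psis: "sqi MG \<psi>" "sqi MG (pd \<psi> j)" "sqi MG (grad G \<psi> j)" for j
    using smooth_sqi_G[OF psi order_refl G_lebesgue] smooth_sqi_G[OF smooth_pd[OF psi] order_refl G_lebesgue] H1_grad_sqi[OF hp] by auto
  note fs = flux_sqi[OF ps] and ms = mu_sqi[OF H1_sqi[OF u]]
  have s: "(LINT x|MG. (\<Sum>j\<in>UNIV. (\<Sum>l\<in>UNIV. Acoef \<Omega> a x j l * grad G u l x) * cnj (grad G \<psi> j x))
            - complex_of_real (k\<^sup>2) * mucoef \<Omega> \<mu> x * u x * cnj (\<psi> x))
        - \<i> * complex_of_real k * bint vs (\<lambda>x. tu x * cnj (\<psi> x))
        = (LINT x|MG. f x * cnj (\<psi> x)) + bint vs (\<lambda>x. g x * cnj (\<psi> x))"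
    using sol tr hp smooth_trace[OF psi] unfolding weak_sol_def by blast
  have "(LINT x|MG. (\<Sum>j\<in>UNIV. (\<Sum>l\<in>UNIV. Acoef \<Omega> a x j l * grad G u l x) * cnj (grad G \<psi> j x))
            - complex_of_real (k\<^sup>2) * mucoef \<Omega> \<mu> x * u x * cnj (\<psi> x))
    = (LINT x|MG. (\<Sum>j\<in>UNIV. flux (grad G u) j x * cnj (grad G \<psi> j x)) - of_real (k\<^sup>2) * ((mucoef \<Omega> \<mu> x * u x) * cnj (\<psi> x)))"
    by (rule Bochner_Integration.integral_cong) (simp_all add: flux_def mult.assoc)
  also have "\<dots> = (\<Sum>j\<in>UNIV. ip (flux (grad G u) j) (grad G \<psi> j)) - of_real (k\<^sup>2) * ip (\<lambda>x. mucoef \<Omega> \<mu> x * u x) \<psi>"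
  proof -
    have i1: "integrable MG (\<lambda>x. flux (grad G u) j x * cnj (grad G \<psi> j x))" for j
      by (rule sqi_mult_cnj_integrable[OF fs psis(3)])
    have i2: "integrable MG (\<lambda>x. (mucoef \<Omega> \<mu> x * u x) * cnj (\<psi> x))" by (rule sqi_mult_cnj_integrable[OF ms psis(1)])
    show ?thesis unfolding ip_def
      by (subst Bochner_Integration.integral_diff[OF Bochner_Integration.integrable_sum[OF i1] integrable_mult_right[OF i2]],
          subst Bochner_Integration.integral_sum[OF i1]) (simp only: integral_mult_right_zero)
  qed
  also have "(\<Sum>j\<in>UNIV. ip (flux (grad G u) j) (grad G \<psi> j)) = (\<Sum>j\<in>UNIV. ip (flux (grad G u) j) (pd \<psi> j))"
    unfolding ip_def
  proof (rule sum.cong[OF refl], goal_cases)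
    case (1 j)
    show ?case
    proof (rule integral_cong_AE)
    show "AE x in MG. flux (grad G u) j x * cnj (grad G \<psi> j x) = flux (grad G u) j x * cnj (pd \<psi> j x)"
      using grad_smooth_AE[OF psi bounded_G open_G, of j] by eventually_elim simp
  qed (use sqi_mult_cnj_integrable[OF fs psis(3)] sqi_mult_cnj_integrable[OF fs psis(2)] in \<open>auto intro: borel_measurable_integrable\<close>)
  qed
  finally have l: "(LINT x|MG. (\<Sum>j\<in>UNIV. (\<Sum>l\<in>UNIV. Acoef \<Omega> a x j l * grad G u l x) * cnj (grad G \<psi> j x))
            - complex_of_real (k\<^sup>2) * mucoef \<Omega> \<mu> x * u x * cnj (\<psi> x))
     = (\<Sum>j\<in>UNIV. ip (flux (grad G u) j) (pd \<psi> j)) - of_real (k\<^sup>2) * ip (\<lambda>x. mucoef \<Omega> \<mu> x * u x) \<psi>" .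
  have bp: "bL2 vs \<psi>" by (rule bL2_continuous[OF smooth_continuous[OF psi]])
  have bt: "bL2 vs tu" using tr by (simp add: is_trace_def)
  have "bint vs (\<lambda>x. (\<i> * of_real k * tu x + g x) * cnj (\<psi> x))
    = bint vs (\<lambda>x. (\<i> * of_real k * tu x) * cnj (\<psi> x) + g x * cnj (\<psi> x))" by (simp add: distrib_right)
  also have "\<dots> = bint vs (\<lambda>x. (\<i> * of_real k * tu x) * cnj (\<psi> x)) + bint vs (\<lambda>x. g x * cnj (\<psi> x))"
    by (rule bint_add[OF bL2_mult_integrable[OF bL2_cmult[OF bt] bp] bL2_mult_integrable[OF g bp]])
  also have "bint vs (\<lambda>x. (\<i> * of_real k * tu x) * cnj (\<psi> x)) = \<i> * of_real k * bint vs (\<lambda>x. tu x * cnj (\<psi> x))"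
    using bint_cmult[of "\<i> * of_real k" "\<lambda>x. tu x * cnj (\<psi> x)"] by (simp add: mult.assoc)
  finally show ?thesis using s unfolding l ip_def by (simp add: algebra_simps)
qed

text \<open>The boundary term deliberately remains a sequence: for a limit \<open>v\<close> of
  dilation type it is enough to bound it along the approximants, and no trace of \<open>v\<close>
  has to be constructed.\<close>

lemma weak_form_limit:
  assumes sol: "weak_sol G vs \<Omega> a \<mu> k f g u" and tr: "is_trace G vs u tu" and g: "bL2 vs g" and f: "sqi MG f"
    and psi: "\<And>n. smooth (\<psi> n)" and v: "sqi MG v" "\<And>j. sqi MG (q j)"
    and l1: "(\<lambda>n. nrm2 MG (\<lambda>x. \<psi> n x - v x)) \<longlonglongrightarrow> 0" and l2: "\<And>j. (\<lambda>n. nrm2 MG (\<lambda>x. pd (\<psi> n) j x - q j x)) \<longlonglongrightarrow> 0"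
  shows "(\<lambda>n. bint vs (\<lambda>x. (\<i> * of_real k * tu x + g x) * cnj (\<psi> n x))) \<longlonglongrightarrow>
    (\<Sum>j\<in>UNIV. ip (flux (grad G u) j) (q j)) - of_real (k\<^sup>2) * ip (\<lambda>x. mucoef \<Omega> \<mu> x * u x) v - ip f v"
proof -
  have u: "H1 G u" using sol by (simp add: weak_sol_def)
  have ps: "sqi MG (grad G u l)" for l by (rule H1_grad_sqi[OF u])
  have psis: "sqi MG (\<psi> n)" "sqi MG (pd (\<psi> n) j)" for n j
    using smooth_sqi_G[OF psi order_refl G_lebesgue] smooth_sqi_G[OF smooth_pd[OF psi] order_refl G_lebesgue] by auto
  show ?thesis unfolding weak_form_smooth[OF sol tr g f psi, symmetric] unfolding ip_def
    by (intro tendsto_diff tendsto_sum tendsto_mult tendsto_const inner_tendsto[OF psis(1) v(1) f l1]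
        inner_tendsto[OF psis(2) v(2) flux_sqi[OF ps] l2] inner_tendsto[OF psis(1) v(1) mu_sqi[OF H1_sqi[OF u]] l1])
qed

lemma bint_self: assumes "bL2 vs h" shows "bint vs (\<lambda>x. h x * cnj (h x)) = of_real ((bL2norm vs h)\<^sup>2)"
  unfolding bint_def bL2norm_sq
  by (simp add: inner_self edge_nrm2_def scaleR_conv_of_real)

text \<open>\<open>\<bar>vD i\<bar> / elen vs i\<close> is the distance of the edge line from the
  origin, which is at least \<gamma>. So \<open>K1\<close> is a sum of reciprocal distances times
  \<open>rad\<^sup>2\<close>: a smaller \<gamma> allows a larger constant for the boundary
  differences.\<close>

definition K1 :: real where "K1 = (\<Sum>i<length vs. elen vs i * (rad\<^sup>2 / \<bar>vD i\<bar>))"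
definition K2 :: real where "K2 = (\<Sum>i<length vs. \<bar>vD i\<bar> / elen vs i)"
definition K3 :: real where "K3 = real (length vs) * rad\<^sup>2"

lemma elen_pos: "i < length vs \<Longrightarrow> elen vs i > 0"
  using vd_nonzero by (simp add: elen_eq)

lemma K_nonneg: "K1 \<ge> 0" "K2 \<ge> 0" "K3 \<ge> 0"
  by (auto simp: K1_def K2_def K3_def elen_def intro!: sum_nonneg mult_nonneg_nonneg divide_nonneg_nonneg)

lemma boundary_diff_le:
  assumes t: "0 < t" "t < 1" and v: "smooth v"
  shows "(bL2norm vs (\<lambda>x. v x - v (t *\<^sub>R x)))\<^sup>2 \<le> (1 - t) * K1 / t * dirichlet (annulus t) v"
proof -
  have "(bL2norm vs (\<lambda>x. v x - v (t *\<^sub>R x)))\<^sup>2 \<le> (\<Sum>i<length vs. elen vs i * ((1 - t) * rad\<^sup>2 / (t * \<bar>vD i\<bar>) * dirichlet (annulus t) v))"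
    unfolding bL2norm_sq by (intro sum_mono mult_left_mono edge_diff_le[OF _ t v]) (auto simp: elen_def)
  also have "\<dots> = (1 - t) * K1 / t * dirichlet (annulus t) v"
    by (simp add: K1_def sum_distrib_left sum_distrib_right sum_divide_distrib mult_ac)
  finally show ?thesis .
qed

lemma annulus_bound:
  assumes t: "0 < t" "t < 1" and v: "smooth v"
  shows "(nrm2 (lebesgue_on (annulus t)) v)\<^sup>2 \<le> 2 * (1 - t) * (K2 * (bL2norm vs v)\<^sup>2 + (1 - t) * K3 / t * dirichlet (annulus t) v)"
proof -
  have "(nrm2 (lebesgue_on (annulus t)) v)\<^sup>2 \<le>
    (\<Sum>i<length vs. \<bar>vD i\<bar> * (2 * (1 - t) * ((edge_nrm2 i v)\<^sup>2 + (1 - t) * rad\<^sup>2 / (t * \<bar>vD i\<bar>) * dirichlet (annulus t) v)))"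
    by (rule annulus_le[OF t v])
  also have "\<dots> \<le> (\<Sum>i<length vs. 2 * (1 - t) * (\<bar>vD i\<bar> / elen vs i * (bL2norm vs v)\<^sup>2 + (1 - t) * rad\<^sup>2 / t * dirichlet (annulus t) v))"
  proof (rule sum_mono)
    fix i assume "i \<in> {..<length vs}"
    then have i: "i < length vs" by simp
    have D: "\<bar>vD i\<bar> > 0" using vD_nonzero[OF i] by simp
    have "elen vs i * (edge_nrm2 i v)\<^sup>2 \<le> (bL2norm vs v)\<^sup>2" unfolding bL2norm_sq
      by (rule member_le_sum) (use i in \<open>auto simp: elen_def\<close>)
    then have "(edge_nrm2 i v)\<^sup>2 \<le> (bL2norm vs v)\<^sup>2 / elen vs i" using elen_pos[OF i] by (simp add: field_simps)
    then have "\<bar>vD i\<bar> * (edge_nrm2 i v)\<^sup>2 \<le> \<bar>vD i\<bar> / elen vs i * (bL2norm vs v)\<^sup>2"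
      using mult_left_mono[of "(edge_nrm2 i v)\<^sup>2" "(bL2norm vs v)\<^sup>2 / elen vs i" "\<bar>vD i\<bar>"] by simp
    then have le: "2 * (1 - t) * (\<bar>vD i\<bar> * (edge_nrm2 i v)\<^sup>2 + (1 - t) * rad\<^sup>2 / t * dirichlet (annulus t) v)
       \<le> 2 * (1 - t) * (\<bar>vD i\<bar> / elen vs i * (bL2norm vs v)\<^sup>2 + (1 - t) * rad\<^sup>2 / t * dirichlet (annulus t) v)"
      using t by (intro mult_left_mono add_right_mono) auto
    have eq: "\<bar>vD i\<bar> * (2 * (1 - t) * ((edge_nrm2 i v)\<^sup>2 + (1 - t) * rad\<^sup>2 / (t * \<bar>vD i\<bar>) * dirichlet (annulus t) v))
       = 2 * (1 - t) * (\<bar>vD i\<bar> * (edge_nrm2 i v)\<^sup>2 + (1 - t) * rad\<^sup>2 / t * dirichlet (annulus t) v)"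
    proof -
      have e1: "\<bar>vD i\<bar> * ((1 - t) * rad\<^sup>2 / (t * \<bar>vD i\<bar>) * dirichlet (annulus t) v) = (1 - t) * rad\<^sup>2 / t * dirichlet (annulus t) v"
        using D t by simp
      have e2: "\<bar>vD i\<bar> * (2 * (1 - t) * ((edge_nrm2 i v)\<^sup>2 + (1 - t) * rad\<^sup>2 / (t * \<bar>vD i\<bar>) * dirichlet (annulus t) v))
        = 2 * (1 - t) * (\<bar>vD i\<bar> * (edge_nrm2 i v)\<^sup>2 + \<bar>vD i\<bar> * ((1 - t) * rad\<^sup>2 / (t * \<bar>vD i\<bar>) * dirichlet (annulus t) v))"
        by (simp only: distrib_left mult_ac)
      show ?thesis unfolding e2 e1 ..
    qed
    show "\<bar>vD i\<bar> * (2 * (1 - t) * ((edge_nrm2 i v)\<^sup>2 + (1 - t) * rad\<^sup>2 / (t * \<bar>vD i\<bar>) * dirichlet (annulus t) v))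
       \<le> 2 * (1 - t) * (\<bar>vD i\<bar> / elen vs i * (bL2norm vs v)\<^sup>2 + (1 - t) * rad\<^sup>2 / t * dirichlet (annulus t) v)"
      by (rule ord_eq_le_trans[OF eq le])
  qed
  also have "\<dots> = 2 * (1 - t) * (K2 * (bL2norm vs v)\<^sup>2 + (1 - t) * K3 / t * dirichlet (annulus t) v)"
    by (simp add: K2_def K3_def sum.distrib sum_distrib_left[symmetric], simp add: sum_distrib_left mult_ac)
  finally show ?thesis .
qed

text \<open>The convexity of the energy density and the monotonicity of the coefficient along rays make the
  interface contribute with the favourable sign, without any regularity of the solution.\<close>

lemma flux_dilation:
  assumes p: "\<And>j. sqi MG (p j)" and t: "0 < t" "t < 1"
  shows "Re (\<Sum>j\<in>UNIV. ip (flux p j) (\<lambda>x. p j x - of_real t * p j (t *\<^sub>R x)))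
    \<ge> (\<Sum>j\<in>UNIV. (nrm2 (lebesgue_on (annulus t)) (p j))\<^sup>2) / 2"
proof -
  define h where "h x = Re (qf (Acoef \<Omega> a x) (\<lambda>j. p j x) (\<lambda>j. p j x))" for x
  have h0: "h x \<ge> 0" for x unfolding h_def by (rule qf_nonneg[OF coer_A])
  have pt: "sqi MG (\<lambda>x. of_real t * p j (t *\<^sub>R x))" for j by (rule sqi_cmult[OF sqi_dilation(1)[OF p t]])
  have int: "integrable MG (\<lambda>x. qf (Acoef \<Omega> a x) (\<lambda>j. p j x) (\<lambda>j. q j x))" if q: "\<And>j. sqi MG (q j)" for q
    unfolding qf_def using sqi_mult_cnj_integrable[OF flux_sqi[OF p] q]
    by (intro Bochner_Integration.integrable_sum) (simp add: flux_def)
  have ipq: "(\<Sum>j\<in>UNIV. ip (flux p j) (q j)) = (LINT x|MG. qf (Acoef \<Omega> a x) (\<lambda>j. p j x) (\<lambda>j. q j x))" if q: "\<And>j. sqi MG (q j)" for q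
    unfolding qf_def ip_def using sqi_mult_cnj_integrable[OF flux_sqi[OF p] q]
    by (subst Bochner_Integration.integral_sum) (auto simp: flux_def)
  have hi: "integrable MG h" unfolding h_def by (rule integrable_Re[OF int[OF p]])
  note di = dilation_integral[OF hi h0 t]
  have dq: "sqi MG (\<lambda>x. p j x - of_real t * p j (t *\<^sub>R x))" for j by (rule sqi_diff[OF p pt])
  \<comment> \<open>If \<open>x\<close> lies in \<Omega>, so does \<open>t x\<close>, and the
    coefficients agree; if it does not, the coefficient at \<open>x\<close> is the identity, the
    smaller of the two. Hence the density at \<open>t x\<close> may be formed with its own
    coefficient.\<close>
  have pw: "(h x - t\<^sup>2 * h (t *\<^sub>R x)) / 2 \<le> Re (qf (Acoef \<Omega> a x) (\<lambda>j. p j x) (\<lambda>j. p j x - of_real t * p j (t *\<^sub>R x)))" for x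
  proof -
    have "Re (qf (Acoef \<Omega> a x) (\<lambda>j. p j (t *\<^sub>R x)) (\<lambda>j. p j (t *\<^sub>R x))) \<le> h (t *\<^sub>R x)"
    proof (cases "x \<in> \<Omega>")
      case True
      then have "t *\<^sub>R x \<in> \<Omega>" using Om_star t by simp
      then show ?thesis using True by (simp add: h_def Acoef_def)
    next
      case False
      then show ?thesis unfolding h_def using qf_kd_le[OF coer_A] by (simp add: Acoef_def)
    qed
    then have le: "Re (qf (Acoef \<Omega> a x) (\<lambda>j. of_real t * p j (t *\<^sub>R x)) (\<lambda>j. of_real t * p j (t *\<^sub>R x))) \<le> t\<^sup>2 * h (t *\<^sub>R x)"
      unfolding qf_scale by (intro mult_left_mono) auto
    have aux: "(y - d) / 2 \<le> z" if "b \<le> d" "(y - b) / 2 \<le> z" for b d y z :: real using that by simp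
    show ?thesis
      using aux[OF le qf_convex[OF coer_A, of x "\<lambda>j. p j x" "\<lambda>j. of_real t * p j (t *\<^sub>R x)"]] unfolding h_def .
  qed
  have hann: "(\<Sum>j\<in>UNIV. (nrm2 (lebesgue_on (annulus t)) (p j))\<^sup>2) \<le> (LINT x|lebesgue_on (annulus t). h x)"
  proof -
    have s: "sqi (lebesgue_on (annulus t)) (p j)" for j
      by (rule sqi_subset(1)[OF p annulus_sub annulus_lebesgue G_lebesgue])
    have "(\<Sum>j\<in>UNIV. (nrm2 (lebesgue_on (annulus t)) (p j))\<^sup>2) = (LINT x|lebesgue_on (annulus t). (\<Sum>j\<in>UNIV. (cmod (p j x))\<^sup>2))"
      unfolding nrm2_sq using sqi_integrable_sq[OF s] by (subst Bochner_Integration.integral_sum) auto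
    also have "\<dots> \<le> (LINT x|lebesgue_on (annulus t). h x)"
      by (rule integral_mono) (use sqi_integrable_sq[OF s] di(3) in \<open>auto simp: h_def intro!: qf_coercive[OF coer_A]\<close>)
    finally show ?thesis .
  qed
  have "(LINT x|MG. (h x - t\<^sup>2 * h (t *\<^sub>R x)) / 2) \<le> (LINT x|MG. Re (qf (Acoef \<Omega> a x) (\<lambda>j. p j x) (\<lambda>j. p j x - of_real t * p j (t *\<^sub>R x))))"
    by (rule integral_mono) (use hi di(1) integrable_Re[OF int[OF dq]] pw in auto)
  also have "\<dots> = Re (\<Sum>j\<in>UNIV. ip (flux p j) (\<lambda>x. p j x - of_real t * p j (t *\<^sub>R x)))"
    unfolding ipq[OF dq] by (rule integral_Re[OF int[OF dq]])
  finally have "(LINT x|MG. (h x - t\<^sup>2 * h (t *\<^sub>R x)) / 2) \<le> Re (\<Sum>j\<in>UNIV. ip (flux p j) (\<lambda>x. p j x - of_real t * p j (t *\<^sub>R x)))" .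
  \<comment> \<open>In the plane the factor \<open>t\<^sup>2\<close> from the chain rule cancels the
    Jacobian \<open>1 / t\<^sup>2\<close>, so no gradient term remains in the interior and only the
    shell survives.\<close>
  moreover have "(LINT x|MG. (h x - t\<^sup>2 * h (t *\<^sub>R x)) / 2) = (LINT x|lebesgue_on (annulus t). h x) / 2"
    using hi di t by simp
  ultimately show ?thesis using hann by linarith
qed

lemma sqi_product_le:
  assumes "sqi MG f" "sqi MG v"
  shows "cmod (ip f v) \<le> nrm2 (lebesgue_on \<Omega>) f * nrm2 (lebesgue_on \<Omega>) v
    + nrm2 (lebesgue_on (G - \<Omega>)) f * nrm2 (lebesgue_on (G - \<Omega>)) v"
proof -
  note s = split_G(3)[OF sqi_mult_cnj_integrable[OF assms]]
  have "cmod (ip f v) \<le> cmod (LINT x|lebesgue_on \<Omega>. f x * cnj (v x)) + cmod (LINT x|lebesgue_on (G - \<Omega>). f x * cnj (v x))"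
    unfolding ip_def s by (rule norm_triangle_ineq)
  also have "\<dots> \<le> nrm2 (lebesgue_on \<Omega>) f * nrm2 (lebesgue_on \<Omega>) v
    + nrm2 (lebesgue_on (G - \<Omega>)) f * nrm2 (lebesgue_on (G - \<Omega>)) v"
    by (intro add_mono cauchy_schwarz_cnj sqi_parts(1)[OF assms(1)] sqi_parts(1)[OF assms(2)]
        sqi_parts(2)[OF assms(1)] sqi_parts(2)[OF assms(2)])
  finally show ?thesis .
qed

lemma ip_mu:
  assumes "sqi MG u" "sqi MG v"
  shows "ip (\<lambda>x. mucoef \<Omega> \<mu> x * u x) v
    = \<mu> * (LINT x|lebesgue_on \<Omega>. u x * cnj (v x)) + (LINT x|lebesgue_on (G - \<Omega>). u x * cnj (v x))"
proof -
  have "(LINT x|lebesgue_on \<Omega>. (mucoef \<Omega> \<mu> x * u x) * cnj (v x)) = (LINT x|lebesgue_on \<Omega>. \<mu> * (u x * cnj (v x)))"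
    by (rule Bochner_Integration.integral_cong) (auto simp: mucoef_def space_restrict_space)
  moreover have "(LINT x|lebesgue_on (G - \<Omega>). (mucoef \<Omega> \<mu> x * u x) * cnj (v x)) = (LINT x|lebesgue_on (G - \<Omega>). u x * cnj (v x))"
    by (rule Bochner_Integration.integral_cong) (auto simp: mucoef_def space_restrict_space)
  ultimately show ?thesis
    unfolding ip_def split_G(3)[OF sqi_mult_cnj_integrable[OF mu_sqi[OF assms(1)] assms(2)]] by simp
qed

lemma flux_self:
  assumes p: "\<And>j. sqi MG (p j)"
  shows "Im (\<Sum>j\<in>UNIV. ip (flux p j) (p j)) = 0"
    "Re (\<Sum>j\<in>UNIV. ip (flux p j) (p j)) \<ge> (\<Sum>j\<in>UNIV. (nrm2 MG (p j))\<^sup>2)"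
proof -
  have int: "integrable MG (\<lambda>x. qf (Acoef \<Omega> a x) (\<lambda>j. p j x) (\<lambda>j. p j x))"
    unfolding qf_def using sqi_mult_cnj_integrable[OF flux_sqi[OF p] p]
    by (intro Bochner_Integration.integrable_sum) (simp add: flux_def)
  have eq: "(\<Sum>j\<in>UNIV. ip (flux p j) (p j)) = (LINT x|MG. qf (Acoef \<Omega> a x) (\<lambda>j. p j x) (\<lambda>j. p j x))"
    unfolding qf_def ip_def using sqi_mult_cnj_integrable[OF flux_sqi[OF p] p]
    by (subst Bochner_Integration.integral_sum) (auto simp: flux_def)
  show "Im (\<Sum>j\<in>UNIV. ip (flux p j) (p j)) = 0"
    unfolding eq integral_Im[OF int, symmetric] by (simp add: qf_Im[OF coer_A])
  have "(\<Sum>j\<in>UNIV. (nrm2 MG (p j))\<^sup>2) = (LINT x|MG. (\<Sum>j\<in>UNIV. (cmod (p j x))\<^sup>2))"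
    unfolding nrm2_sq using sqi_integrable_sq[OF p] by (subst Bochner_Integration.integral_sum) auto
  also have "\<dots> \<le> (LINT x|MG. Re (qf (Acoef \<Omega> a x) (\<lambda>j. p j x) (\<lambda>j. p j x)))"
    by (rule integral_mono) (use sqi_integrable_sq[OF p] integrable_Re[OF int] in \<open>auto intro!: qf_coercive[OF coer_A]\<close>)
  finally show "Re (\<Sum>j\<in>UNIV. ip (flux p j) (p j)) \<ge> (\<Sum>j\<in>UNIV. (nrm2 MG (p j))\<^sup>2)"
    unfolding eq integral_Re[OF int] .
qed

text \<open>The factor \<open>c\<close> is \<open>1\<close> for the functions and \<open>t\<close>
  for their gradients.\<close>

lemma dilation_tendsto:
  assumes h: "\<And>n. sqi MG (hn n)" "sqi MG h" and l: "(\<lambda>n. nrm2 MG (\<lambda>x. hn n x - h x)) \<longlonglongrightarrow> 0" and t: "0 < t" "t < 1"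
  shows "(\<lambda>n. nrm2 MG (\<lambda>x. (hn n x - c * hn n (t *\<^sub>R x)) - (h x - c * h (t *\<^sub>R x)))) \<longlonglongrightarrow> 0"
proof (rule tendsto_sandwich[OF _ _ tendsto_const])
  have d: "sqi MG (\<lambda>x. hn n x - h x)" for n by (rule sqi_diff[OF h])
  have "nrm2 MG (\<lambda>x. (hn n x - c * hn n (t *\<^sub>R x)) - (h x - c * h (t *\<^sub>R x)))
    \<le> nrm2 MG (\<lambda>x. hn n x - h x) + cmod c * (1 / t * nrm2 MG (\<lambda>x. hn n x - h x))" for n
  proof -
    have "nrm2 MG (\<lambda>x. (hn n x - c * hn n (t *\<^sub>R x)) - (h x - c * h (t *\<^sub>R x)))
      = nrm2 MG (\<lambda>x. (hn n x - h x) - c * (hn n (t *\<^sub>R x) - h (t *\<^sub>R x)))" by (simp add: algebra_simps)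
    also have "\<dots> \<le> nrm2 MG (\<lambda>x. hn n x - h x) + nrm2 MG (\<lambda>x. c * (hn n (t *\<^sub>R x) - h (t *\<^sub>R x)))"
      by (rule nrm2_triangle_diff[OF d sqi_cmult[OF sqi_dilation(1)[OF d t]]])
    also have "\<dots> \<le> nrm2 MG (\<lambda>x. hn n x - h x) + cmod c * (1 / t * nrm2 MG (\<lambda>x. hn n x - h x))"
      unfolding nrm2_cmult by (intro add_left_mono mult_left_mono sqi_dilation(2)[OF d t]) simp
    finally show ?thesis .
  qed
  then show "\<forall>\<^sub>F n in sequentially. nrm2 MG (\<lambda>x. (hn n x - c * hn n (t *\<^sub>R x)) - (h x - c * h (t *\<^sub>R x)))
    \<le> nrm2 MG (\<lambda>x. hn n x - h x) + cmod c * (1 / t * nrm2 MG (\<lambda>x. hn n x - h x))" by simp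
  show "(\<lambda>n. nrm2 MG (\<lambda>x. hn n x - h x) + cmod c * (1 / t * nrm2 MG (\<lambda>x. hn n x - h x))) \<longlonglongrightarrow> 0"
    using tendsto_add[OF l tendsto_mult_left[OF tendsto_mult_left[OF l, of "1 / t"], of "cmod c"]] by simp
qed simp

text \<open>\<open>2 Re (z cnj (z - w)) = \<bar>z\<bar>\<^sup>2 + \<bar>z - w\<bar>\<^sup>2 - \<bar>w\<bar>\<^sup>2\<close>, and \<open>t x \<notin> \<Omega>\<close> implies \<open>x \<notin> \<Omega>\<close>.\<close>

lemma exterior_dilation:
  assumes u: "sqi MG u" and t: "0 < t" "t < 1"
  shows "Re (LINT x|lebesgue_on (G - \<Omega>). u x * cnj (u x - u (t *\<^sub>R x)))
    \<le> ((1 - 1 / t\<^sup>2) * (nrm2 (lebesgue_on (G - \<Omega>)) u)\<^sup>2 + 1 / t\<^sup>2 * (nrm2 (lebesgue_on (annulus t)) u)\<^sup>2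
        + (nrm2 MG (\<lambda>x. u x - u (t *\<^sub>R x)))\<^sup>2) / 2"
proof -
  define M where "M = lebesgue_on (G - \<Omega>)"
  \<comment> \<open>\<open>dilation_integral\<close> concerns all of \<open>G\<close>, so the
    exterior is selected in the integrand. After the dilation the integrand still vanishes on
    \<Omega>, because \<open>t x\<close> stays in \<Omega>.\<close>
  define h where "h x = indicator (- \<Omega>) x * (cmod (u x))\<^sup>2" for x
  have ut: "sqi MG (\<lambda>x. u (t *\<^sub>R x))" by (rule sqi_dilation(1)[OF u t])
  have v: "sqi MG (\<lambda>x. u x - u (t *\<^sub>R x))" by (rule sqi_diff[OF u ut])
  note su = sqi_parts[OF u, folded M_def] and sut = sqi_parts[OF ut, folded M_def] and sv = sqi_parts[OF v, folded M_def]
  have hm: "h \<in> borel_measurable MG"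
  proof -
    have "(\<lambda>x. if x \<in> \<Omega> then 0 else 1 :: real) \<in> borel_measurable MG" by (rule piecewise_measurable)
    moreover have "(\<lambda>x. if x \<in> \<Omega> then 0 else 1 :: real) = indicator (- \<Omega>)" by (auto simp: fun_eq_iff indicator_def)
    moreover have "(\<lambda>x. (cmod (u x))\<^sup>2) \<in> borel_measurable MG"
      by (rule borel_measurable_integrable[OF sqi_integrable_sq[OF u]])
    ultimately show ?thesis unfolding h_def[abs_def] by simp
  qed
  have hi: "integrable MG h"
    by (rule Bochner_Integration.integrable_bound[OF sqi_integrable_sq[OF u] hm]) (auto simp: h_def indicator_def)
  have h0: "h x \<ge> 0" for x by (simp add: h_def)
  note di = dilation_integral[OF hi h0 t]
  have hO: "(LINT x|MG. h x) = (nrm2 M u)\<^sup>2"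
  proof -
    have "(LINT x|lebesgue_on \<Omega>. h x) = (LINT x|lebesgue_on \<Omega>. 0)"
      by (rule Bochner_Integration.integral_cong) (auto simp: h_def space_restrict_space)
    moreover have "(LINT x|M. h x) = (LINT x|M. (cmod (u x))\<^sup>2)" unfolding M_def
      by (rule Bochner_Integration.integral_cong) (auto simp: h_def space_restrict_space)
    ultimately show ?thesis unfolding split_G(3)[OF hi] nrm2_sq M_def by simp
  qed
  have hA: "(LINT x|lebesgue_on (annulus t). h x) \<le> (nrm2 (lebesgue_on (annulus t)) u)\<^sup>2" unfolding nrm2_sq
    by (rule integral_mono[OF di(3) sqi_integrable_sq[OF sqi_subset(1)[OF u annulus_sub annulus_lebesgue G_lebesgue]]])
      (auto simp: h_def indicator_def)
  have "(LINT x|MG. h (t *\<^sub>R x)) \<le> (nrm2 M (\<lambda>x. u (t *\<^sub>R x)))\<^sup>2"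
  proof -
    have "(LINT x|lebesgue_on \<Omega>. h (t *\<^sub>R x)) = (LINT x|lebesgue_on \<Omega>. 0)"
      by (rule Bochner_Integration.integral_cong) (use Om_star t in \<open>auto simp: h_def space_restrict_space\<close>)
    then have "(LINT x|MG. h (t *\<^sub>R x)) = (LINT x|M. h (t *\<^sub>R x))" unfolding split_G(3)[OF di(1)] M_def by simp
    also have "\<dots> \<le> (LINT x|M. (cmod (u (t *\<^sub>R x)))\<^sup>2)"
      by (rule integral_mono) (use split_G(2)[OF di(1)] sqi_integrable_sq[OF sut(2)] in \<open>auto simp: h_def indicator_def M_def\<close>)
    finally show ?thesis unfolding nrm2_sq .
  qed
  then have lower: "1 / t\<^sup>2 * ((nrm2 M u)\<^sup>2 - (nrm2 (lebesgue_on (annulus t)) u)\<^sup>2) \<le> (nrm2 M (\<lambda>x. u (t *\<^sub>R x)))\<^sup>2"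
    using di(2) hO hA mult_left_mono[of "(nrm2 M u)\<^sup>2 - (nrm2 (lebesgue_on (annulus t)) u)\<^sup>2"
        "(nrm2 M u)\<^sup>2 - (LINT x|lebesgue_on (annulus t). h x)" "1 / t\<^sup>2"] by auto
  have pw: "Re (z * cnj (z - w)) = ((cmod z)\<^sup>2 + (cmod (z - w))\<^sup>2 - (cmod w)\<^sup>2) / 2" for z w
    unfolding cmod_power2 by (simp add: power2_eq_square algebra_simps)
  have "Re (LINT x|M. u x * cnj (u x - u (t *\<^sub>R x))) = (LINT x|M. Re (u x * cnj (u x - u (t *\<^sub>R x))))"
    by (rule integral_Re[symmetric, OF sqi_mult_cnj_integrable[OF su(2) sv(2)]])
  also have "\<dots> = (LINT x|M. ((cmod (u x))\<^sup>2 + (cmod (u x - u (t *\<^sub>R x)))\<^sup>2 - (cmod (u (t *\<^sub>R x)))\<^sup>2) / 2)" unfolding pw ..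
  also have "\<dots> = ((nrm2 M u)\<^sup>2 + (nrm2 M (\<lambda>x. u x - u (t *\<^sub>R x)))\<^sup>2 - (nrm2 M (\<lambda>x. u (t *\<^sub>R x)))\<^sup>2) / 2"
    unfolding nrm2_sq using sqi_integrable_sq[OF su(2)] sqi_integrable_sq[OF sv(2)] sqi_integrable_sq[OF sut(2)] by simp
  finally have e: "Re (LINT x|M. u x * cnj (u x - u (t *\<^sub>R x)))
    = ((nrm2 M u)\<^sup>2 + (nrm2 M (\<lambda>x. u x - u (t *\<^sub>R x)))\<^sup>2 - (nrm2 M (\<lambda>x. u (t *\<^sub>R x)))\<^sup>2) / 2" .
  have "(nrm2 M (\<lambda>x. u x - u (t *\<^sub>R x)))\<^sup>2 \<le> (nrm2 MG (\<lambda>x. u x - u (t *\<^sub>R x)))\<^sup>2"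
    using sv(3) zero_le_power2[of "nrm2 (lebesgue_on \<Omega>) (\<lambda>x. u x - u (t *\<^sub>R x))"] by linarith
  moreover have "(1 - 1 / t\<^sup>2) * (nrm2 M u)\<^sup>2 + 1 / t\<^sup>2 * (nrm2 (lebesgue_on (annulus t)) u)\<^sup>2
      = (nrm2 M u)\<^sup>2 - 1 / t\<^sup>2 * ((nrm2 M u)\<^sup>2 - (nrm2 (lebesgue_on (annulus t)) u)\<^sup>2)"
    by (simp only: left_diff_distrib right_diff_distrib mult_1)
  ultimately show ?thesis using lower unfolding M_def[symmetric] e by (intro divide_right_mono) linarith+
qed

lemma bL2norm_tendsto:
  assumes "\<And>n. bL2 vs (hn n)" "bL2 vs h" "(\<lambda>n. bL2norm vs (\<lambda>x. hn n x - h x)) \<longlonglongrightarrow> 0"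
  shows "(\<lambda>n. bL2norm vs (hn n)) \<longlonglongrightarrow> bL2norm vs h"
proof -
  have le: "\<bar>bL2norm vs (hn n) - bL2norm vs h\<bar> \<le> bL2norm vs (\<lambda>x. hn n x - h x)" for n
    using bL2norm_triangle[OF bL2_diff[OF assms(1)[of n] assms(2)] assms(2)]
      bL2norm_triangle[OF bL2_diff[OF assms(2) assms(1)[of n]] assms(1)[of n]] bL2norm_minus_commute[of "hn n" h] by simp
  have "(\<lambda>n. bL2norm vs (hn n) - bL2norm vs h) \<longlonglongrightarrow> 0"
    by (rule Lim_null_comparison[OF _ assms(3)]) (simp add: le)
  then show ?thesis by (rule LIM_zero_cancel)
qed

end

text \<open>The approximants are part of the locale, with boundary values tending to
  \<open>tu\<close>: each estimate for \<open>u\<close> is proved for smooth functions and passed to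
  the limit, and \<open>trace_exists\<close> supplies the sequence.\<close>

locale solution = inclusion G vs \<gamma> \<Omega> a for G vs \<gamma> \<Omega> a +
  fixes \<mu> :: complex and k :: real and f g u tu :: "R2 \<Rightarrow> complex" and un :: "nat \<Rightarrow> R2 \<Rightarrow> complex"
  assumes k: "k > 0" and sol: "weak_sol G vs \<Omega> a \<mu> k f g u" and f: "sqi (lebesgue_on G) f" and g: "bL2 vs g"
    and un: "\<And>n. smooth (un n)"
    and un_lim: "(\<lambda>n. nrm2 (lebesgue_on G) (\<lambda>x. un n x - u x)) \<longlonglongrightarrow> 0"
    and un_grad: "\<And>j. (\<lambda>n. nrm2 (lebesgue_on G) (\<lambda>x. pd (un n) j x - grad G u j x)) \<longlonglongrightarrow> 0"
    and tr: "is_trace G vs u tu"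
    and un_bd: "(\<lambda>n. bL2norm vs (\<lambda>x. un n x - tu x)) \<longlonglongrightarrow> 0"
begin

text \<open>The letters of \<open>combine_estimates\<close>, with \<open>B\<close> in place of its
  \<open>g\<close>. Inner norms (\<open>W\<close>, \<open>H\<close>) and outer norms
  (\<open>Ov\<close>, \<open>F\<close>) are kept apart because absorption acts only in \<Omega>, so
  the two parts of \<open>u\<close> obey different estimates.\<close>

definition P where "P = sqrt (\<Sum>j\<in>UNIV. (nrm2 MG (grad G u j))\<^sup>2)"
definition T where "T = bL2norm vs tu"
definition W where "W = nrm2 (lebesgue_on \<Omega>) u"
definition Ov where "Ov = nrm2 (lebesgue_on (G - \<Omega>)) u"
definition H where "H = nrm2 (lebesgue_on \<Omega>) f"
definition F where "F = nrm2 (lebesgue_on (G - \<Omega>)) f"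
definition B where "B = bL2norm vs g"

lemma norms_nonneg: "P \<ge> 0" "T \<ge> 0" "W \<ge> 0" "Ov \<ge> 0" "H \<ge> 0" "F \<ge> 0" "B \<ge> 0"
  by (simp_all add: P_def T_def W_def Ov_def H_def F_def B_def sum_nonneg)

lemma P_sq: "P\<^sup>2 = (\<Sum>j\<in>UNIV. (nrm2 MG (grad G u j))\<^sup>2)" by (simp add: P_def sum_nonneg)

lemma u_H1: "H1 G u" using sol by (simp add: weak_sol_def)

lemmas u_sqi = H1_sqi[OF u_H1] and p_sqi = H1_grad_sqi[OF u_H1]

lemma un_sqi: "sqi MG (un n)" "sqi MG (pd (un n) j)"
  using smooth_sqi_G[OF un order_refl G_lebesgue] smooth_sqi_G[OF smooth_pd[OF un] order_refl G_lebesgue] by auto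

lemma tu_bL2: "bL2 vs tu" using tr by (simp add: is_trace_def)

lemma un_bL2: "bL2 vs (un n)" by (rule bL2_continuous[OF smooth_continuous[OF un]])

definition X where "X x = \<i> * of_real k * tu x + g x"

lemma X_bL2: "bL2 vs X" unfolding X_def[abs_def] by (rule bL2_add[OF bL2_cmult[OF tu_bL2] g])

lemma X_norm: "bL2norm vs X \<le> k * T + B"
  using bL2norm_triangle[OF bL2_cmult[OF tu_bL2, of "\<i> * of_real k"] g] k
  unfolding bL2norm_cmult by (simp add: X_def[abs_def] T_def B_def norm_mult)

text \<open>The weak form is tested with \<open>un n\<close>, whose boundary values are explicit,
  and only the limit turns them into the trace \<open>tu\<close>.\<close>

lemma energy_identity:
  "(\<Sum>j\<in>UNIV. ip (flux (grad G u) j) (grad G u j)) - of_real (k\<^sup>2) * (\<mu> * of_real (W\<^sup>2) + of_real (Ov\<^sup>2)) - ip f u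
    = \<i> * of_real (k * T\<^sup>2) + bint vs (\<lambda>x. g x * cnj (tu x))"
proof -
  have split: "bint vs (\<lambda>x. X x * cnj (un n x)) = bint vs (\<lambda>x. X x * cnj (un n x - tu x)) + bint vs (\<lambda>x. X x * cnj (tu x))" for n
    using bint_add[OF bL2_mult_integrable[OF X_bL2 bL2_diff[OF un_bL2[of n] tu_bL2]] bL2_mult_integrable[OF X_bL2 tu_bL2]]
    by (simp add: algebra_simps)
  have "(\<lambda>n. bint vs (\<lambda>x. X x * cnj (un n x - tu x))) \<longlonglongrightarrow> 0"
  proof (rule Lim_null_comparison)
    show "\<forall>\<^sub>F n in sequentially. norm (bint vs (\<lambda>x. X x * cnj (un n x - tu x))) \<le> bL2norm vs X * bL2norm vs (\<lambda>x. un n x - tu x)"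
      using bint_cauchy_schwarz[OF X_bL2 bL2_diff[OF un_bL2 tu_bL2]] by simp
    show "(\<lambda>n. bL2norm vs X * bL2norm vs (\<lambda>x. un n x - tu x)) \<longlonglongrightarrow> 0"
      using tendsto_mult_left[OF un_bd] by simp
  qed
  then have "(\<lambda>n. bint vs (\<lambda>x. X x * cnj (un n x))) \<longlonglongrightarrow> bint vs (\<lambda>x. X x * cnj (tu x))"
    unfolding split by (rule tendsto_add[OF _ tendsto_const, where a = 0, unfolded add_0])
  moreover note weak_form_limit[OF sol tr g f un u_sqi p_sqi un_lim un_grad, folded X_def]
  ultimately have "(\<Sum>j\<in>UNIV. ip (flux (grad G u) j) (grad G u j)) - of_real (k\<^sup>2) * ip (\<lambda>x. mucoef \<Omega> \<mu> x * u x) u - ip f u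
     = bint vs (\<lambda>x. X x * cnj (tu x))" by (rule LIMSEQ_unique[rotated])
  also have "\<dots> = bint vs (\<lambda>x. (\<i> * of_real k) * (tu x * cnj (tu x))) + bint vs (\<lambda>x. g x * cnj (tu x))"
    using bint_add[OF bL2_mult_integrable[OF bL2_cmult[OF tu_bL2, of "\<i> * of_real k"] tu_bL2] bL2_mult_integrable[OF g tu_bL2]]
    by (simp add: X_def algebra_simps)
  also have "bint vs (\<lambda>x. (\<i> * of_real k) * (tu x * cnj (tu x))) = \<i> * of_real (k * T\<^sup>2)"
    unfolding bint_cmult bint_self[OF tu_bL2] T_def by simp
  finally show ?thesis unfolding ip_mu[OF u_sqi u_sqi] inner_self W_def Ov_def .
qed

text \<open>The flux term is real since the coefficient is real symmetric, so the imaginary part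
  shows the absorption, the impedance term and the data alone; in the real part the impedance term
  drops out.\<close>

lemma energy_estimates:
  "k\<^sup>2 * Im \<mu> * W\<^sup>2 + k * T\<^sup>2 \<le> H * W + F * Ov + B * T"
  "P\<^sup>2 \<le> k\<^sup>2 * (cmod \<mu> * W\<^sup>2 + Ov\<^sup>2) + (H * W + F * Ov + B * T)"
proof -
  define A where "A = (\<Sum>j\<in>UNIV. ip (flux (grad G u) j) (grad G u j))"
  define b where "b = bint vs (\<lambda>x. g x * cnj (tu x))"
  have A: "Im A = 0" "P\<^sup>2 \<le> Re A" using flux_self[of "grad G u", OF p_sqi] unfolding A_def P_sq by auto
  have b: "cmod b \<le> B * T" unfolding b_def B_def T_def by (rule bint_cauchy_schwarz[OF g tu_bL2])
  have fu: "cmod (ip f u) \<le> H * W + F * Ov" unfolding H_def W_def F_def Ov_def by (rule sqi_product_le[OF f u_sqi])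
  have id: "A - of_real (k\<^sup>2) * (\<mu> * of_real (W\<^sup>2) + of_real (Ov\<^sup>2)) - ip f u = \<i> * of_real (k * T\<^sup>2) + b"
    unfolding A_def b_def by (rule energy_identity)
  have "Im A - k\<^sup>2 * (Im \<mu> * W\<^sup>2) - Im (ip f u) = k * T\<^sup>2 + Im b" using arg_cong[OF id, of Im] by simp
  then show "k\<^sup>2 * Im \<mu> * W\<^sup>2 + k * T\<^sup>2 \<le> H * W + F * Ov + B * T"
    using A b fu abs_Im_le_cmod[of b] abs_Im_le_cmod[of "ip f u"] by (simp add: mult.assoc)
  have "Re A - k\<^sup>2 * (Re \<mu> * W\<^sup>2 + Ov\<^sup>2) - Re (ip f u) = Re b" using arg_cong[OF id, of Re] by simp
  moreover have "k\<^sup>2 * (Re \<mu> * W\<^sup>2 + Ov\<^sup>2) \<le> k\<^sup>2 * (cmod \<mu> * W\<^sup>2 + Ov\<^sup>2)"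
    by (intro mult_left_mono add_right_mono mult_right_mono complex_Re_le_cmod) auto
  ultimately show "P\<^sup>2 \<le> k\<^sup>2 * (cmod \<mu> * W\<^sup>2 + Ov\<^sup>2) + (H * W + F * Ov + B * T)"
    using A b fu abs_Re_le_cmod[of b] abs_Re_le_cmod[of "ip f u"] by linarith
qed

section \<open>The Rellich estimate for the solution\<close>

definition E where "E t = (\<Sum>j\<in>UNIV. (nrm2 (lebesgue_on (annulus t)) (grad G u j))\<^sup>2)"
definition V where "V t = nrm2 MG (\<lambda>x. u x - u (t *\<^sub>R x))"

lemma E_nonneg: "E t \<ge> 0" by (simp add: E_def sum_nonneg)

lemma annulus_tendsto:
  assumes "\<And>n. sqi MG (hn n)" "sqi MG h" "(\<lambda>n. nrm2 MG (\<lambda>x. hn n x - h x)) \<longlonglongrightarrow> 0"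
  shows "(\<lambda>n. nrm2 (lebesgue_on (annulus t)) (hn n)) \<longlonglongrightarrow> nrm2 (lebesgue_on (annulus t)) h"
proof (rule nrm2_tendsto)
  note s = sqi_subset[OF _ annulus_sub annulus_lebesgue G_lebesgue]
  show "sqi (lebesgue_on (annulus t)) (hn n)" "sqi (lebesgue_on (annulus t)) h" for n using s(1) assms by auto
  show "(\<lambda>n. nrm2 (lebesgue_on (annulus t)) (\<lambda>x. hn n x - h x)) \<longlonglongrightarrow> 0"
    by (rule tendsto_sandwich[OF _ _ tendsto_const assms(3)]) (use s(2)[OF sqi_diff[OF assms(1,2)]] in auto)
qed

lemma dirichlet_tendsto: "(\<lambda>n. dirichlet (annulus t) (un n)) \<longlonglongrightarrow> E t" "(\<lambda>n. dirichlet G (un n)) \<longlonglongrightarrow> P\<^sup>2"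
  unfolding dirichlet_def E_def P_sq
  by (intro tendsto_sum tendsto_power annulus_tendsto un_sqi p_sqi un_grad nrm2_tendsto)+

lemma dilation_tendsto_zero:
  assumes t: "0 < t" "t < 1"
  shows "(\<lambda>n. nrm2 MG (\<lambda>x. (un n x - un n (t *\<^sub>R x)) - (u x - u (t *\<^sub>R x)))) \<longlonglongrightarrow> 0"
  using dilation_tendsto[OF un_sqi(1) u_sqi un_lim t, of 1] by simp

lemma V_le:
  assumes t: "0 < t" "t < 1"
  shows "V t \<le> (1 - t) * rad / t * P"
proof -
  have "(\<lambda>n. nrm2 MG (\<lambda>x. un n x - un n (t *\<^sub>R x))) \<longlonglongrightarrow> V t" unfolding V_def
    by (rule nrm2_tendsto[OF _ _ dilation_tendsto_zero[OF t]])
      (intro sqi_diff un_sqi u_sqi sqi_dilation(1)[OF _ t])+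
  then have "(V t)\<^sup>2 \<le> (1 - t)\<^sup>2 * rad\<^sup>2 / t\<^sup>2 * P\<^sup>2"
    using dilation_ineq[OF t un] by (intro LIMSEQ_le[OF tendsto_power tendsto_mult_left[OF dirichlet_tendsto(2)]]) auto
  also have "\<dots> = ((1 - t) * rad / t * P)\<^sup>2" by (simp add: power_mult_distrib power_divide)
  finally show ?thesis by (rule power2_le_imp_le) (use t rad norms_nonneg in simp)
qed

lemma annulus_norm_le:
  assumes t: "0 < t" "t < 1"
  shows "(nrm2 (lebesgue_on (annulus t)) u)\<^sup>2 \<le> 2 * (1 - t) * (K2 * T\<^sup>2 + (1 - t) * K3 / t * E t)"
proof (rule LIMSEQ_le)
  show "(\<lambda>n. (nrm2 (lebesgue_on (annulus t)) (un n))\<^sup>2) \<longlonglongrightarrow> (nrm2 (lebesgue_on (annulus t)) u)\<^sup>2"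
    by (intro tendsto_power annulus_tendsto un_sqi u_sqi un_lim)
  show "(\<lambda>n. 2 * (1 - t) * (K2 * (bL2norm vs (un n))\<^sup>2 + (1 - t) * K3 / t * dirichlet (annulus t) (un n)))
    \<longlonglongrightarrow> 2 * (1 - t) * (K2 * T\<^sup>2 + (1 - t) * K3 / t * E t)"
    unfolding T_def by (intro tendsto_intros dirichlet_tendsto bL2norm_tendsto un_bL2 tu_bL2 un_bd)
qed (use annulus_bound[OF t un] in auto)

text \<open>The weak form tested with the dilation difference of \<open>u\<close>. By linearity the
  conormal derivative appears as \<open>X\<close>, and \<open>boundary_diff_le\<close> converts the
  boundary values of the test function into shell energy.\<close>

lemma rellich:
  assumes t: "0 < t" "t < 1"
  defines "q \<equiv> \<lambda>j x. grad G u j x - of_real t * grad G u j (t *\<^sub>R x)"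
  defines "v \<equiv> \<lambda>x. u x - u (t *\<^sub>R x)"
  shows "Re ((\<Sum>j\<in>UNIV. ip (flux (grad G u) j) (q j)) - of_real (k\<^sup>2) * ip (\<lambda>x. mucoef \<Omega> \<mu> x * u x) v - ip f v)
    \<le> (k * T + B) * sqrt ((1 - t) * K1 / t * E t)" (is "Re ?L \<le> _")
proof -
  define \<psi> where "\<psi> n x = un n x - un n (t *\<^sub>R x)" for n x
  have sm: "smooth (\<psi> n)" for n unfolding \<psi>_def[abs_def]
    using smooth_diff[OF un smooth_affine[OF un, of n 0 t]] by simp
  have pdp: "pd (\<psi> n) j x = pd (un n) j x - of_real t * pd (un n) j (t *\<^sub>R x)" for n j x
    unfolding \<psi>_def[abs_def] using pd_diff[OF un smooth_affine[OF un, of n 0 t]] pd_affine[OF un, of n 0 t] by simp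
  have "(\<lambda>n. bint vs (\<lambda>x. X x * cnj (\<psi> n x))) \<longlonglongrightarrow> ?L"
    unfolding X_def
  proof (rule weak_form_limit[OF sol tr g f sm])
    show "sqi MG v" unfolding v_def by (intro sqi_diff u_sqi sqi_dilation(1)[OF u_sqi t])
    show "sqi MG (q j)" for j unfolding q_def by (intro sqi_diff sqi_cmult p_sqi sqi_dilation(1)[OF p_sqi t])
    show "(\<lambda>n. nrm2 MG (\<lambda>x. \<psi> n x - v x)) \<longlonglongrightarrow> 0" unfolding \<psi>_def v_def by (rule dilation_tendsto_zero[OF t])
    show "(\<lambda>n. nrm2 MG (\<lambda>x. pd (\<psi> n) j x - q j x)) \<longlonglongrightarrow> 0" for j unfolding pdp q_def
      by (rule dilation_tendsto[OF un_sqi(2) p_sqi un_grad t])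
  qed
  then have "(\<lambda>n. cmod (bint vs (\<lambda>x. X x * cnj (\<psi> n x)))) \<longlonglongrightarrow> cmod ?L" by (rule tendsto_norm)
  moreover have "(\<lambda>n. bL2norm vs X * sqrt ((1 - t) * K1 / t * dirichlet (annulus t) (un n))) \<longlonglongrightarrow> bL2norm vs X * sqrt ((1 - t) * K1 / t * E t)"
    by (intro tendsto_intros dirichlet_tendsto)
  moreover have "cmod (bint vs (\<lambda>x. X x * cnj (\<psi> n x))) \<le> bL2norm vs X * sqrt ((1 - t) * K1 / t * dirichlet (annulus t) (un n))" for n
  proof -
    have "cmod (bint vs (\<lambda>x. X x * cnj (\<psi> n x))) \<le> bL2norm vs X * bL2norm vs (\<psi> n)"
      by (rule bint_cauchy_schwarz[OF X_bL2 bL2_continuous[OF smooth_continuous[OF sm]]])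
    also have "\<dots> \<le> bL2norm vs X * sqrt ((1 - t) * K1 / t * dirichlet (annulus t) (un n))"
      by (intro mult_left_mono real_le_rsqrt) (use boundary_diff_le[OF t un, of n] in \<open>simp_all add: \<psi>_def[abs_def]\<close>)
    finally show ?thesis .
  qed
  ultimately have "cmod ?L \<le> bL2norm vs X * sqrt ((1 - t) * K1 / t * E t)" by (intro LIMSEQ_le) auto
  also have "\<dots> \<le> (k * T + B) * sqrt ((1 - t) * K1 / t * E t)"
    using X_norm K_nonneg E_nonneg t by (intro mult_right_mono) auto
  finally show ?thesis using complex_Re_le_cmod order_trans by blast
qed

text \<open>With \<open>s = 1 - t\<close>, all terms are of order \<open>s\<close> except the shell
  energy \<open>E t\<close>, about which no rate is known. It stands with factor \<open>1/2\<close>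
  on the good side by \<open>flux_dilation\<close>; one quarter pays for the boundary flux, the
  other, thanks to \<open>small\<close>, for the mass of \<open>u\<close> in the shell.\<close>

lemma rellich_step:
  assumes t: "1 / 2 \<le> t" "t < 1" and small: "8 * k\<^sup>2 * (1 - t)\<^sup>2 * K3 \<le> 1 / 4"
  shows "k\<^sup>2 * Ov\<^sup>2 \<le> 4 * k\<^sup>2 * (K2 * T\<^sup>2) + 2 * rad * (P * (k\<^sup>2 * cmod \<mu> * W + F + H)) + 2 * K1 * (k * T + B)\<^sup>2
     + (1 - t) * (2 * k\<^sup>2 * rad\<^sup>2 * P\<^sup>2)"
proof -
  define s where "s = 1 - t"
  define v where "v x = u x - u (t *\<^sub>R x)" for x
  define A where "A = (nrm2 (lebesgue_on (annulus t)) u)\<^sup>2"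
  define Q where "Q = (LINT x|lebesgue_on (G - \<Omega>). u x * cnj (v x))"
  define R where "R = (LINT x|lebesgue_on \<Omega>. u x * cnj (v x))"
  have t': "0 < t" "t < 1" using t by auto
  have s: "s > 0" using t by (simp add: s_def)
  have v: "sqi MG v" unfolding v_def[abs_def] by (intro sqi_diff u_sqi sqi_dilation(1)[OF u_sqi t'])
  have t1: "1 / t \<le> 2" using t by (simp add: field_simps)
  have t2: "1 / t\<^sup>2 \<le> 4" using power_mono[OF t1, of 2] t by (simp add: power_divide)
  \<comment> \<open>This is where the exterior norm comes from: the Jacobian exceeds
    \<open>1\<close> by at least \<open>2 * s\<close>, the discrete form of the divergence
    \<open>2\<close> of the position field.\<close>
  have t3: "1 - 1 / t\<^sup>2 \<le> - (2 * s)"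
  proof -
    have "1 / t\<^sup>2 - 1 - 2 * s = s\<^sup>2 * (1 + 2 * t) / t\<^sup>2" using t' by (simp add: s_def field_simps power2_eq_square)
    also have "\<dots> \<ge> 0" using t' by simp
    finally show ?thesis by simp
  qed
  have Vn: "V t = nrm2 MG v" by (simp add: V_def v_def[abs_def])
  have V: "0 \<le> V t" "V t \<le> 2 * s * rad * P"
  proof -
    have "V t \<le> 1 / t * (s * rad * P)" using V_le[OF t'] by (simp add: s_def)
    also have "\<dots> \<le> 2 * (s * rad * P)" using s rad norms_nonneg by (intro mult_right_mono[OF t1]) auto
    finally show "V t \<le> 2 * s * rad * P" by (simp add: mult.assoc)
  qed (simp add: V_def)
  have parts: "nrm2 (lebesgue_on \<Omega>) v \<le> V t" "nrm2 (lebesgue_on (G - \<Omega>)) v \<le> V t"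
    unfolding Vn by (rule power2_le_imp_le; use sqi_parts(3)[OF v] in simp)+
  have fv: "Re (ip f v) \<le> (F + H) * V t"
  proof -
    have "Re (ip f v) \<le> H * nrm2 (lebesgue_on \<Omega>) v + F * nrm2 (lebesgue_on (G - \<Omega>)) v"
      using order_trans[OF complex_Re_le_cmod sqi_product_le[OF f v]] by (simp add: H_def F_def)
    also have "\<dots> \<le> H * V t + F * V t" by (intro add_mono mult_left_mono parts norms_nonneg)
    finally show ?thesis by (simp add: algebra_simps)
  qed
  have Rb: "cmod (\<mu> * R) \<le> cmod \<mu> * (W * V t)"
  proof -
    have "cmod R \<le> W * nrm2 (lebesgue_on \<Omega>) v" unfolding R_def W_def
      by (rule cauchy_schwarz_cnj[OF sqi_parts(1)[OF u_sqi] sqi_parts(1)[OF v]])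
    also have "\<dots> \<le> W * V t" by (intro mult_left_mono parts norms_nonneg)
    finally show ?thesis unfolding norm_mult by (intro mult_left_mono) auto
  qed
  have Qb: "Re Q \<le> - (s * Ov\<^sup>2) + 2 * A + (V t)\<^sup>2 / 2"
  proof -
    have "Re Q \<le> ((1 - 1 / t\<^sup>2) * Ov\<^sup>2 + 1 / t\<^sup>2 * A + (V t)\<^sup>2) / 2"
      using exterior_dilation[OF u_sqi t'] by (simp add: Q_def Ov_def A_def V_def v_def)
    moreover have "(1 - 1 / t\<^sup>2) * Ov\<^sup>2 \<le> - (2 * s) * Ov\<^sup>2" by (rule mult_right_mono[OF t3]) simp
    moreover have "1 / t\<^sup>2 * A \<le> 4 * A" by (rule mult_right_mono[OF t2]) (simp add: A_def)
    ultimately show ?thesis by simp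
  qed
  have Ab: "A \<le> 2 * s * (K2 * T\<^sup>2) + 4 * s\<^sup>2 * K3 * E t"
  proof -
    have "A \<le> 2 * s * (K2 * T\<^sup>2) + 1 / t * (2 * s\<^sup>2 * K3 * E t)"
      using annulus_norm_le[OF t', folded s_def A_def] by (simp add: power2_eq_square distrib_left mult_ac)
    also have "1 / t * (2 * s\<^sup>2 * K3 * E t) \<le> 2 * (2 * s\<^sup>2 * K3 * E t)"
      using K_nonneg E_nonneg by (intro mult_right_mono[OF t1]) auto
    finally show ?thesis by (simp add: mult_ac)
  qed
  \<comment> \<open>A bound for the boundary norm of \<open>X\<close>, that is, of the conormal
    derivative prescribed by the impedance condition.\<close>
  define y where "y = k * T + B"
  have bd: "y * sqrt ((1 - t) * K1 / t * E t) \<le> 2 * s * K1 * y\<^sup>2 + E t / 4"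
  proof -
    have y: "y \<ge> 0" using norms_nonneg k by (simp add: y_def)
    have "(1 - t) * K1 / t * E t = 1 / t * (s * K1 * E t)" by (simp add: s_def)
    also have "\<dots> \<le> 2 * (s * K1 * E t)" using K_nonneg E_nonneg s by (intro mult_right_mono[OF t1]) auto
    finally have "y * sqrt ((1 - t) * K1 / t * E t) \<le> y * sqrt (2 * s * K1 * E t)"
      using y by (intro mult_left_mono) (auto simp: mult_ac)
    also have "\<dots> = (y * sqrt (2 * s * K1)) * sqrt (E t)" by (simp add: real_sqrt_mult)
    also have "\<dots> \<le> (y * sqrt (2 * s * K1))\<^sup>2 + (sqrt (E t))\<^sup>2 / 4"
      using zero_le_power2[of "y * sqrt (2 * s * K1) - sqrt (E t) / 2"] by (simp add: power2_diff power_divide)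
    also have "(y * sqrt (2 * s * K1))\<^sup>2 = 2 * s * K1 * y\<^sup>2" using K_nonneg s by (simp add: power_mult_distrib)
    finally show ?thesis using E_nonneg by simp
  qed
  have "(\<Sum>j\<in>UNIV. (nrm2 (lebesgue_on (annulus t)) (grad G u j))\<^sup>2) / 2
     \<le> Re (\<Sum>j\<in>UNIV. ip (flux (grad G u) j) (\<lambda>x. grad G u j x - of_real t * grad G u j (t *\<^sub>R x)))"
    by (rule flux_dilation[OF p_sqi t'])
  moreover have "Re (\<Sum>j\<in>UNIV. ip (flux (grad G u) j) (\<lambda>x. grad G u j x - of_real t * grad G u j (t *\<^sub>R x)))
     - k\<^sup>2 * (Re (\<mu> * R) + Re Q) - Re (ip f v) \<le> y * sqrt ((1 - t) * K1 / t * E t)"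
    using rellich[OF t'] unfolding v_def[abs_def, symmetric] ip_mu[OF u_sqi v] y_def by (simp add: R_def Q_def)
  ultimately have m1: "E t / 2 \<le> k\<^sup>2 * Re (\<mu> * R) + k\<^sup>2 * Re Q + (F + H) * V t + (2 * s * K1 * y\<^sup>2 + E t / 4)"
    using fv bd unfolding E_def[symmetric] distrib_left by linarith
  have m2: "k\<^sup>2 * Re (\<mu> * R) \<le> k\<^sup>2 * (cmod \<mu> * (W * V t))"
    using order_trans[OF complex_Re_le_cmod Rb] by (intro mult_left_mono) auto
  have "k\<^sup>2 * Re Q \<le> k\<^sup>2 * (- (s * Ov\<^sup>2) + 2 * (2 * s * (K2 * T\<^sup>2) + 4 * s\<^sup>2 * K3 * E t) + (V t)\<^sup>2 / 2)"
    using Qb Ab by (intro mult_left_mono) auto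
  also have "\<dots> = - (k\<^sup>2 * s * Ov\<^sup>2) + 4 * k\<^sup>2 * s * (K2 * T\<^sup>2) + (8 * k\<^sup>2 * s\<^sup>2 * K3) * E t + k\<^sup>2 * ((V t)\<^sup>2 / 2)"
    by (simp add: algebra_simps)
  also have "(8 * k\<^sup>2 * s\<^sup>2 * K3) * E t \<le> 1 / 4 * E t" using small E_nonneg by (intro mult_right_mono) (auto simp: s_def)
  finally have m3: "k\<^sup>2 * Re Q \<le> - (k\<^sup>2 * s * Ov\<^sup>2) + 4 * k\<^sup>2 * s * (K2 * T\<^sup>2) + 1 / 4 * E t + k\<^sup>2 * ((V t)\<^sup>2 / 2)" by simp
  have m4: "(k\<^sup>2 * cmod \<mu> * W + F + H) * V t \<le> (k\<^sup>2 * cmod \<mu> * W + F + H) * (2 * s * rad * P)"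
    using V norms_nonneg by (intro mult_left_mono) auto
  have "(V t)\<^sup>2 / 2 \<le> 2 * s\<^sup>2 * rad\<^sup>2 * P\<^sup>2" using power_mono[OF V(2,1), of 2] by (simp add: power_mult_distrib)
  then have m5: "k\<^sup>2 * ((V t)\<^sup>2 / 2) \<le> k\<^sup>2 * (2 * s\<^sup>2 * rad\<^sup>2 * P\<^sup>2)" by (rule mult_left_mono) simp
  have "k\<^sup>2 * s * Ov\<^sup>2 \<le> 4 * k\<^sup>2 * s * (K2 * T\<^sup>2) + (k\<^sup>2 * cmod \<mu> * W + F + H) * (2 * s * rad * P)
     + 2 * s * K1 * y\<^sup>2 + k\<^sup>2 * (2 * s\<^sup>2 * rad\<^sup>2 * P\<^sup>2)"
    using m1 m2 m3 m4 m5 by (simp add: algebra_simps)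
  then have "s * (k\<^sup>2 * Ov\<^sup>2) \<le> s * (4 * k\<^sup>2 * (K2 * T\<^sup>2) + 2 * rad * (P * (k\<^sup>2 * cmod \<mu> * W + F + H)) + 2 * K1 * y\<^sup>2
     + s * (2 * k\<^sup>2 * rad\<^sup>2 * P\<^sup>2))"
    by (simp add: algebra_simps power2_eq_square)
  then show ?thesis using s unfolding y_def[symmetric] s_def[symmetric] by simp
qed

text \<open>The remainder in \<open>rellich_step\<close> comes from the square of the test function
  and still carries a factor \<open>1 - t\<close>. For fixed \<open>k\<close> the condition
  \<open>small\<close> holds near \<open>t = 1\<close>, so it leaves no trace in the
  constants.\<close>

lemma rellich_estimate:
  "k\<^sup>2 * Ov\<^sup>2 \<le> 4 * k\<^sup>2 * (K2 * T\<^sup>2) + 2 * rad * (P * (k\<^sup>2 * cmod \<mu> * W + F + H)) + 2 * K1 * (k * T + B)\<^sup>2"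
    (is "?l \<le> ?r")
proof (rule tendsto_lowerbound)
  show "((\<lambda>t. ?r + (1 - t) * (2 * k\<^sup>2 * rad\<^sup>2 * P\<^sup>2)) \<longlongrightarrow> ?r) (at_left 1)"
    by (auto intro!: tendsto_eq_intros)
  have "((\<lambda>t. 8 * k\<^sup>2 * (1 - t)\<^sup>2 * K3) \<longlongrightarrow> 0) (at_left 1)" by (auto intro!: tendsto_eq_intros)
  then have "\<forall>\<^sub>F t in at_left 1. 8 * k\<^sup>2 * (1 - t)\<^sup>2 * K3 < 1 / 4" by (rule order_tendstoD) simp
  moreover have "\<forall>\<^sub>F t in at_left 1. t \<in> {1 / 2 <..< 1 :: real}" by (rule eventually_at_left_real) simp
  ultimately show "\<forall>\<^sub>F t in at_left 1. ?l \<le> ?r + (1 - t) * (2 * k\<^sup>2 * rad\<^sup>2 * P\<^sup>2)"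
    by eventually_elim (rule rellich_step, auto)
qed simp

lemma norm1k_eq: "norm1k G k u = sqrt (P\<^sup>2 + k\<^sup>2 * (W\<^sup>2 + Ov\<^sup>2))"
  unfolding norm1k_def L2norm_nrm2 P_sq W_def Ov_def sqi_parts(3)[OF u_sqi] ..

text \<open>One constant for all terms, with the modulus of the permeability replaced by a bound
  that is uniform in \<open>k\<close>, as \<open>combine_estimates\<close> expects.\<close>

lemma exterior_estimate:
  assumes m: "cmod \<mu> \<le> m"
  shows "k\<^sup>2 * Ov\<^sup>2 \<le> (4 * K2 + 2 * K1 + 2 * rad * (m + 1)) * (k\<^sup>2 * T\<^sup>2 + (k * T + B)\<^sup>2 + P * (k\<^sup>2 * W + H + F))"
proof -
  define r where "r = 2 * rad * (m + 1)"
  have m0: "m \<ge> 0" using m norm_ge_zero order_trans by blast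
  have r: "r \<ge> 0" using rad m0 by (simp add: r_def)
  have n: "k\<^sup>2 * T\<^sup>2 \<ge> 0" "(k * T + B)\<^sup>2 \<ge> 0" "P * (k\<^sup>2 * W + H + F) \<ge> 0" using norms_nonneg by auto
  have "k\<^sup>2 * cmod \<mu> * W + F + H \<le> (m + 1) * (k\<^sup>2 * W + H + F)"
  proof -
    have "cmod \<mu> * (k\<^sup>2 * W) \<le> m * (k\<^sup>2 * W)" using norms_nonneg by (intro mult_right_mono[OF m]) auto
    moreover have "0 \<le> k\<^sup>2 * W" "0 \<le> m * (H + F)" using norms_nonneg m0 by auto
    ultimately show ?thesis by (simp add: algebra_simps)
  qed
  then have "2 * rad * (P * (k\<^sup>2 * cmod \<mu> * W + F + H)) \<le> 2 * rad * (P * ((m + 1) * (k\<^sup>2 * W + H + F)))"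
    using rad norms_nonneg by (intro mult_left_mono) auto
  also have "\<dots> = r * (P * (k\<^sup>2 * W + H + F))" unfolding r_def by (simp only: mult_ac)
  finally have "k\<^sup>2 * Ov\<^sup>2 \<le> 4 * K2 * (k\<^sup>2 * T\<^sup>2) + r * (P * (k\<^sup>2 * W + H + F)) + 2 * K1 * (k * T + B)\<^sup>2"
    using rellich_estimate by (simp add: mult_ac)
  moreover have "4 * K2 * (k\<^sup>2 * T\<^sup>2) \<le> (4 * K2 + 2 * K1 + r) * (k\<^sup>2 * T\<^sup>2)"
    "2 * K1 * (k * T + B)\<^sup>2 \<le> (4 * K2 + 2 * K1 + r) * (k * T + B)\<^sup>2"
    "r * (P * (k\<^sup>2 * W + H + F)) \<le> (4 * K2 + 2 * K1 + r) * (P * (k\<^sup>2 * W + H + F))"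
    using K_nonneg r n by (intro mult_right_mono; simp)+
  ultimately have "k\<^sup>2 * Ov\<^sup>2 \<le> (4 * K2 + 2 * K1 + r) * (k\<^sup>2 * T\<^sup>2) + (4 * K2 + 2 * K1 + r) * (k * T + B)\<^sup>2
      + (4 * K2 + 2 * K1 + r) * (P * (k\<^sup>2 * W + H + F))" by linarith
  also have "\<dots> = (4 * K2 + 2 * K1 + r) * (k\<^sup>2 * T\<^sup>2 + (k * T + B)\<^sup>2 + P * (k\<^sup>2 * W + H + F))"
    by (simp only: distrib_left)
  finally show ?thesis unfolding r_def .
qed

end

theorem theorem3p9:
  fixes \<Omega> G D :: "R2 set" and vs :: "R2 list" and \<epsilon>e k0 \<gamma> :: real and \<epsilon>i :: complex
    and wc :: "2 \<Rightarrow> R2 \<Rightarrow> complex"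
  assumes Omega: "open \<Omega>" "connected \<Omega>" "bounded \<Omega>" "\<Omega> \<noteq> {}" "C2_boundary \<Omega>" "closure \<Omega> \<subseteq> G"
    and Gpoly: "convex_polygon G vs"
    and Dcell: "open D" "connected D" "D \<noteq> {}" "closure D \<subseteq> interior Ycell" "C2_boundary D"
      "connected (Ystar D)"
    and params: "\<epsilon>e > 0" "Re \<epsilon>i > 0" "Im \<epsilon>i > 0" "k0 > 0"
    and gam: "\<gamma> > 0" "\<forall>p n. outer_normal G p n \<longrightarrow> p \<bullet> n \<ge> \<gamma>"
    and star: "\<forall>p n. outer_normal \<Omega> p n \<longrightarrow> p \<bullet> n \<ge> 0"
    and corr: "\<forall>j. cell_corrector D \<epsilon>e j (wc j)"
    and nsd: "neg_semidef (\<lambda>j l. kd j l - a_eff D \<epsilon>e wc j l)"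
  shows "\<exists>C>0. \<forall>k w f g u. k \<ge> k0 \<longrightarrow> cell_w D \<epsilon>i k w \<longrightarrow> L2 G f \<longrightarrow> H12 vs g \<longrightarrow>
            weak_sol G vs \<Omega> (a_eff D \<epsilon>e wc) (mu_eff D k w) k f g u \<longrightarrow>
            norm1k G k u \<le> C * (k ^ 3 * L2norm (G - closure \<Omega>) f + k\<^sup>2 * L2norm \<Omega> f
                                + k powr (3/2) * bL2norm vs g + (1 / k) * H12norm vs g)"
proof -
  interpret inclusion G vs \<gamma> \<Omega> "a_eff D \<epsilon>e wc"
  proof unfold_locales
    show "\<And>y t. y \<in> \<Omega> \<Longrightarrow> 0 < t \<Longrightarrow> t \<le> 1 \<Longrightarrow> t *\<^sub>R y \<in> \<Omega>" by (rule star_shaped[OF Omega(1,5) star])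
    show "coercive (a_eff D \<epsilon>e wc)"
      by (rule coercive_nsd[OF a_eff_real_symmetric[OF Dcell(1,4) corr params(1)] nsd])
    show "\<Omega> \<subseteq> G" using Omega(6) closure_subset by blast
  qed (use Gpoly gam Omega(1) C2_frontier_negligible[OF Omega(1,5)] in auto)
  obtain m c where m: "m > 0" and c: "c > 0" and mu: "\<And>k w. k \<ge> k0 \<Longrightarrow> cell_w D \<epsilon>i k w \<Longrightarrow>
      cmod (mu_eff D k w) \<le> m \<and> Im (mu_eff D k w) \<ge> c / k\<^sup>2"
    using mu_eff_bounds[OF Dcell(1,4,3) params(2-4)] by metis
  define K where "K = 4 * K2 + 2 * K1 + 2 * rad * (m + 1)"
  have K: "K > 0" using K_nonneg rad(1) m by (simp add: K_def add_nonneg_pos)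
  obtain C where C: "C > 0" and comb: "\<And>k T g P W Ov F H. k \<ge> k0 \<Longrightarrow> T \<ge> 0 \<Longrightarrow> g \<ge> 0 \<Longrightarrow> P \<ge> 0 \<Longrightarrow> W \<ge> 0 \<Longrightarrow> Ov \<ge> 0 \<Longrightarrow> F \<ge> 0 \<Longrightarrow> H \<ge> 0 \<Longrightarrow>
      c * W\<^sup>2 + k * T\<^sup>2 \<le> H * W + F * Ov + g * T \<Longrightarrow>
      P\<^sup>2 \<le> k\<^sup>2 * (m * W\<^sup>2 + Ov\<^sup>2) + (H * W + F * Ov + g * T) \<Longrightarrow>
      k\<^sup>2 * Ov\<^sup>2 \<le> K * (k\<^sup>2 * T\<^sup>2 + (k * T + g)\<^sup>2 + P * (k\<^sup>2 * W + H + F)) \<Longrightarrow>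
      P\<^sup>2 + k\<^sup>2 * (W\<^sup>2 + Ov\<^sup>2) \<le> C * (k ^ 4 * H\<^sup>2 + k ^ 3 * g\<^sup>2 + k ^ 6 * F\<^sup>2)"
    using combine_estimates[OF c less_imp_le[OF m] K params(4)] by blast
  show ?thesis
  \<comment> \<open>\<open>C\<close> was obtained before \<open>k\<close>, \<open>w\<close> and the
    data are introduced; it depends on the geometry, the parameters and \<open>k0\<close>
    alone.\<close>
  proof (intro exI[of _ "sqrt C"] conjI allI impI)
    fix k w f g u
    assume k: "k \<ge> k0" and w: "cell_w D \<epsilon>i k w" and f: "L2 G f" and g: "H12 vs g"
      and sol: "weak_sol G vs \<Omega> (a_eff D \<epsilon>e wc) (mu_eff D k w) k f g u"
    let ?X = "k ^ 3 * L2norm (G - closure \<Omega>) f + k\<^sup>2 * L2norm \<Omega> f + k powr (3/2) * bL2norm vs g"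
    have kp: "k > 0" using k params(4) by simp
    have u: "H1 G u" using sol by (simp add: weak_sol_def)
    have fs: "sqi (lebesgue_on G) f" using f by (simp add: L2_sqi)
    \<comment> \<open>Stated for any approximants with a trace, so that the locale can be
      instantiated; existence is supplied afterwards.\<close>
    have bound: "norm1k G k u \<le> sqrt C * ?X"
      if "\<forall>n. smooth (un n)" "(\<lambda>n. nrm2 MG (\<lambda>x. un n x - u x)) \<longlonglongrightarrow> 0"
        "\<forall>j. (\<lambda>n. nrm2 MG (\<lambda>x. pd (un n) j x - grad G u j x)) \<longlonglongrightarrow> 0"
        "is_trace G vs u tu" "(\<lambda>n. bL2norm vs (\<lambda>x. un n x - tu x)) \<longlonglongrightarrow> 0" for un tu
    proof -
      interpret s: solution G vs \<gamma> \<Omega> "a_eff D \<epsilon>e wc" "mu_eff D k w" k f g u tu un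
        by unfold_locales (use that kp sol fs g in \<open>auto simp: H12_def\<close>)
      note mu = mu[OF k w]
      \<comment> \<open>The lower bound \<open>c / k\<^sup>2\<close> for the absorption uses up the
        factor \<open>k\<^sup>2\<close> of the energy identity exactly.\<close>
      have "c * s.W\<^sup>2 \<le> k\<^sup>2 * Im (mu_eff D k w) * s.W\<^sup>2"
        using mu kp by (intro mult_right_mono) (auto simp: divide_le_eq mult.commute)
      then have e1: "c * s.W\<^sup>2 + k * s.T\<^sup>2 \<le> s.H * s.W + s.F * s.Ov + s.B * s.T"
        using s.energy_estimates(1) by linarith
      have "k\<^sup>2 * (cmod (mu_eff D k w) * s.W\<^sup>2 + s.Ov\<^sup>2) \<le> k\<^sup>2 * (m * s.W\<^sup>2 + s.Ov\<^sup>2)"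
        using mu by (intro mult_left_mono add_right_mono mult_right_mono) auto
      then have e2: "s.P\<^sup>2 \<le> k\<^sup>2 * (m * s.W\<^sup>2 + s.Ov\<^sup>2) + (s.H * s.W + s.F * s.Ov + s.B * s.T)"
        using s.energy_estimates(2) by linarith
      have e3: "k\<^sup>2 * s.Ov\<^sup>2 \<le> K * (k\<^sup>2 * s.T\<^sup>2 + (k * s.T + s.B)\<^sup>2 + s.P * (k\<^sup>2 * s.W + s.H + s.F))"
        using s.exterior_estimate[of m] mu by (simp add: K_def)
      \<comment> \<open>The summands of the claim; their squares are the three terms of
        \<open>combine_estimates\<close>, and for nonnegative numbers the sum of squares is at most
        the square of the sum.\<close>
      define a b d where "a = k ^ 3 * s.F" and "b = k\<^sup>2 * s.H" and "d = k powr (3/2) * s.B"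
      have nn: "a \<ge> 0" "b \<ge> 0" "d \<ge> 0" using s.norms_nonneg kp by (auto simp: a_def b_def d_def)
      have "k powr (3/2) * k powr (3/2) = k ^ 3" using kp by (simp add: powr_add[symmetric])
      then have "k ^ 4 * s.H\<^sup>2 + k ^ 3 * s.B\<^sup>2 + k ^ 6 * s.F\<^sup>2 = a\<^sup>2 + b\<^sup>2 + d\<^sup>2"
        by (simp add: a_def b_def d_def power_mult_distrib power2_eq_square[of "k powr (3/2)"])
      also have "\<dots> \<le> (a + b + d)\<^sup>2"
        using nn mult_nonneg_nonneg[OF nn(1,2)] mult_nonneg_nonneg[OF nn(1,3)] mult_nonneg_nonneg[OF nn(2,3)]
        by (simp add: power2_eq_square algebra_simps)
      finally have "C * (k ^ 4 * s.H\<^sup>2 + k ^ 3 * s.B\<^sup>2 + k ^ 6 * s.F\<^sup>2) \<le> C * (a + b + d)\<^sup>2"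
        using C by (intro mult_left_mono) auto
      then have "s.P\<^sup>2 + k\<^sup>2 * (s.W\<^sup>2 + s.Ov\<^sup>2) \<le> C * (a + b + d)\<^sup>2"
        using comb[OF k s.norms_nonneg(2,7,1,3,4,6,5) e1 e2 e3] by linarith
      then have "norm1k G k u \<le> sqrt C * (a + b + d)"
        unfolding s.norm1k_eq using nn by (metis add_nonneg_nonneg real_sqrt_abs real_sqrt_le_mono real_sqrt_mult abs_of_nonneg)
      then show ?thesis
        by (simp add: a_def b_def d_def s.F_def s.H_def s.B_def out_norm[OF fs] L2norm_nrm2)
    qed
    have "norm1k G k u \<le> sqrt C * ?X"
      using trace_exists[OF u] by (elim exE conjE) (rule bound)
    also have "\<dots> \<le> sqrt C * (?X + (1 / k) * H12norm vs g)"
      using C kp by (intro mult_left_mono) (auto simp: H12norm_def)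
    finally show "norm1k G k u \<le> sqrt C * (?X + (1 / k) * H12norm vs g)" .
  qed (use C in simp)
qed

end
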